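(* Let $k$ be an infinite field, let $d$ be a positive integer, and let $X\subseteq\mathbb P^n_k$ be a reduced and irreducible projective variety not contained in any hyperplane, with coordinate ring $R=k[x_0,\dots,x_n]/\mathcal I(X)$ and Hilbert function $\mathrm{HF}_R(t)=\dim_k R_t$. Let $H_d$, $\tilde H_d$ and $\operatorname{Bir}(X)_d$ be as defined in the context. Then: (i) $H_d$ and $\tilde H_d$ are quasi-projective varieties; (ii) $\operatorname{Bir}(X)_d$ has the structure of a constructible algebraic set; (iii) $\operatorname{edim}(\operatorname{Bir}(X)_d)\le (n+1)\,\mathrm{HF}_R(d)-1$.
   Context: Write $S=k[x_0,\dots,x_n]$, $\mathfrak p=\mathcal I(X)$, and let $M_1,\dots,M_N$, $N=\binom{n+d}{d}$, be the monomials of degree $d$ in $S$. For $\mathbf a\in k^N$ put $f_{\mathbf a}=\sum_j a_jM_j$. Rational maps. A rational map $h:X\dashrightarrow X$ is presented by an $(n+1)$-tuple $(h_0:\cdots:h_n)$ of forms of the same degree in $R$, not all zero; it is of polynomial degree $d$ if it is presented by forms of degree $d$ (presentations are not unique). The map $h$ has clear polynomial degree $d$ if it admits a presentation $(h_0:\cdots:h_n)$ with $\deg h_i=d$ such that the ideal $(h_0,\dots,h_n)\subseteq R$ has grade at least $2$ (grade = maximal length of a regular sequence in the ideal). $\operatorname{Bir}(X)_d$ is the set of birational maps $X\dashrightarrow X$ of clear polynomial degree $d$. Parameter spaces. $W_d$ is the set of non-zero $(n+1)$-tuples $(f_0,\dots,f_n)$ of homogeneous polynomials of degree $d$ in $S$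 modulo scaling by $k\setminus\{0\}$; it is identified with $\mathbb P^{(n+1)N-1}_k$ through $(\mathbf a_0,\dots,\mathbf a_n)\mapsto(f_{\mathbf a_0}:\cdots:f_{\mathbf a_n})$. For $f=(f_0:\cdots:f_n)\in W_d$ let $\psi_f:X\dashrightarrow X$, $x\mapsto(f_0(x):\cdots:f_n(x))$. $H_d\subseteq W_d$ is the set of $f$ such that $\psi_f$ is a well-defined birational map $X\dashrightarrow X$ (of polynomial degree $d$), and $\tilde H_d\subseteq H_d$ is the set of $f\in H_d$ such that $\psi_f$ is birational of clear polynomial degree $d$. A quasi-projective variety here is a locally closed subset of a projective space (in (i), of $W_d$), not required to be irreducible. Structure on $\operatorname{Bir}(X)_d$. A subset of a topological space is locally closed if it is the intersection of an open and a closed set, and constructible if it is a finite union of locally closed sets. Let $s=N-\dim_k\mathfrak p_d$ and let $l_1,\dots,l_s$ be linearly independent linear forms on $k^N$ whose common zero set is $\{\mathbf a\in k^N: f_{\mathbf a}\in\mathfrak p\}$. Let $\mathcal D':\tilde H_d\to\mathbb P^{(n+1)s-1}_k$ be given by $$(f_{\mathbf a_0}:\cdots:f_{\mathbf a_n})\mapsto(l_1(\mathbf a_0):\cdots:l_s(\mathbf a_0):\cdots:l_1(\mathbf a_n):\cdots:l_s(\mathbf a_n)).$$ That $\operatorname{Bir}(X)_d$ has the structure of a constructible algebraic set means that $\operatorname{Im}(\mathcal D')$ is a constructible subset of $\mathbb P^{(n+1)s-1}_k$ and that $\mathcal D'(f)\mapsto\psi_f$ is a well-defined bijection $\Phi:\operatorname{Im}(\mathcal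 D')\to\operatorname{Bir}(X)_d$, by which the structure is transported to $\operatorname{Bir}(X)_d$. For a constructible subset $\mathcal C$ of a projective space, the embedding dimension is $\operatorname{edim}(\mathcal C)=\min\{m:\mathcal C\subseteq\mathbb P^m\text{ as a closed embedding}\}$; $\operatorname{edim}(\operatorname{Bir}(X)_d)$ is that of $\operatorname{Im}(\mathcal D')$ under this identification.
   Formalization: In (iii), a non-closed constructible set (e.g. PGL_2 in P^3, for X=P^1, d=1) has no closed embedding into any P^m, so edim(C) is taken as the least m such that the Zariski closure of C has a closed embedding into P^m; for closed C this is the stated definition. *)

theory Defs
  imports
    "HOL-Analysis.Abstract_Topology"
    "HOL-Algebra.QuotRing"
    "HOL-Algebra.Embedded_Algebras"
    "HOL-Library.Poly_Mapping"
    "HOL-Library.Extended_Nat"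
begin

section \<open>Polynomials\<close>

text \<open>
  A monomial is its exponent vector and a polynomial is a finitely supported coefficient function on
  monomials. For a finite type of variables \<open>'v\<close> with \<open>n + 1\<close> elements, the type
  \<open>('v, 'k) mpoly\<close> is the polynomial ring \<open>S = k[x\<^sub>0, \<dots>, x\<^sub>n]\<close>.
\<close>

type_synonym 'v monom = "'v \<Rightarrow>\<^sub>0 nat"
type_synonym ('v, 'k) mpoly = "('v \<Rightarrow>\<^sub>0 nat) \<Rightarrow>\<^sub>0 'k"

definition const :: "'k::zero \<Rightarrow> ('v, 'k) mpoly" where
  "const c = Poly_Mapping.single 0 c"

definition var :: "'v \<Rightarrow> ('v, 'k::zero_neq_one) mpoly" where
  "var i = Poly_Mapping.single (Poly_Mapping.single i 1) 1"

definition mdeg :: "'v monom \<Rightarrow> nat" where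
  "mdeg m = (\<Sum>i\<in>Poly_Mapping.keys m. Poly_Mapping.lookup m i)"

definition monoms :: "nat \<Rightarrow> 'v monom set" where
  "monoms d = {m. mdeg m = d}"

text \<open>The zero polynomial is a form of every degree.\<close>

definition form :: "nat \<Rightarrow> ('v, 'k::zero) mpoly \<Rightarrow> bool" where
  "form d f \<longleftrightarrow> Poly_Mapping.keys f \<subseteq> monoms d"

definition peval :: "('k::zero \<Rightarrow> 'b::comm_semiring_1) \<Rightarrow> ('v \<Rightarrow> 'b) \<Rightarrow> ('v, 'k) mpoly \<Rightarrow> 'b" where
  "peval h v p = (\<Sum>m\<in>Poly_Mapping.keys p.
     h (Poly_Mapping.lookup p m) * (\<Prod>i\<in>Poly_Mapping.keys m. v i ^ Poly_Mapping.lookup m i))"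

abbreviation eval_at :: "('v \<Rightarrow> 'k::comm_semiring_1) \<Rightarrow> ('v, 'k) mpoly \<Rightarrow> 'k" where
  "eval_at \<equiv> peval (\<lambda>c. c)"

abbreviation subst :: "('v \<Rightarrow> ('w, 'k::comm_semiring_1) mpoly) \<Rightarrow> ('v, 'k) mpoly \<Rightarrow> ('w, 'k) mpoly" where
  "subst \<equiv> peval const"

lemma peval_superset:
  assumes "finite A" "Poly_Mapping.keys p \<subseteq> A" "h 0 = 0"
  shows "peval h v p = (\<Sum>m\<in>A. h (Poly_Mapping.lookup p m) *
           (\<Prod>i\<in>Poly_Mapping.keys m. v i ^ Poly_Mapping.lookup m i))"
  unfolding peval_def using assms
  by (intro sum.mono_neutral_left) (auto simp: in_keys_iff)

lemma prod_keys_superset: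
  fixes v :: "'v \<Rightarrow> 'b::comm_semiring_1"
  assumes "finite A" "Poly_Mapping.keys m \<subseteq> A"
  shows "(\<Prod>i\<in>Poly_Mapping.keys m. v i ^ Poly_Mapping.lookup m i)
       = (\<Prod>i\<in>A. v i ^ Poly_Mapping.lookup m i)"
  using assms by (intro prod.mono_neutral_left) (auto simp: in_keys_iff)

lemma prod_keys_add:
  fixes v :: "'v \<Rightarrow> 'b::comm_semiring_1" and m m' :: "'v monom"
  shows "(\<Prod>i\<in>Poly_Mapping.keys (m + m'). v i ^ Poly_Mapping.lookup (m + m') i)
       = (\<Prod>i\<in>Poly_Mapping.keys m. v i ^ Poly_Mapping.lookup m i)
         * (\<Prod>i\<in>Poly_Mapping.keys m'. v i ^ Poly_Mapping.lookup m' i)"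
proof -
  let ?A = "Poly_Mapping.keys m \<union> Poly_Mapping.keys m'"
  have "Poly_Mapping.keys (m + m') \<subseteq> ?A" by (rule Poly_Mapping.keys_add)
  then have "(\<Prod>i\<in>Poly_Mapping.keys (m + m'). v i ^ Poly_Mapping.lookup (m + m') i)
      = (\<Prod>i\<in>?A. v i ^ Poly_Mapping.lookup (m + m') i)"
    by (intro prod_keys_superset) auto
  also have "\<dots> = (\<Prod>i\<in>?A. v i ^ Poly_Mapping.lookup m i) * (\<Prod>i\<in>?A. v i ^ Poly_Mapping.lookup m' i)"
    by (simp add: lookup_add power_add prod.distrib)
  also have "\<dots> = (\<Prod>i\<in>Poly_Mapping.keys m. v i ^ Poly_Mapping.lookup m i)
         * (\<Prod>i\<in>Poly_Mapping.keys m'. v i ^ Poly_Mapping.lookup m' i)"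
    by (intro arg_cong2[where f = "(*)"] prod_keys_superset[symmetric]) auto
  finally show ?thesis .
qed

lemma mdeg_superset:
  assumes "finite A" "Poly_Mapping.keys m \<subseteq> A"
  shows "mdeg m = (\<Sum>i\<in>A. Poly_Mapping.lookup m i)"
  unfolding mdeg_def using assms by (intro sum.mono_neutral_left) (auto simp: in_keys_iff)

lemma mdeg_add: "mdeg (m + m') = mdeg m + mdeg m'"
proof -
  let ?A = "Poly_Mapping.keys m \<union> Poly_Mapping.keys m'"
  have "Poly_Mapping.keys (m + m') \<subseteq> ?A" by (rule Poly_Mapping.keys_add)
  then show ?thesis by (simp add: mdeg_superset[of ?A] lookup_add sum.distrib)
qed

lemma form_mult: "form d p \<Longrightarrow> form e q \<Longrightarrow> form (d + e) (p * q)"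
  using keys_mult[of p q] unfolding form_def monoms_def by (fastforce simp: mdeg_add)

lemma peval_add:
  fixes p q :: "('v, 'k::semiring_0) mpoly"
  assumes "h 0 = 0" "\<And>a b. h (a + b) = h a + h b"
  shows "peval h v (p + q) = peval h v p + peval h v q"
proof -
  let ?A = "Poly_Mapping.keys p \<union> Poly_Mapping.keys q"
  have "Poly_Mapping.keys (p + q) \<subseteq> ?A" by (rule Poly_Mapping.keys_add)
  then show ?thesis using assms
    by (simp add: peval_superset[of ?A _ h] lookup_add distrib_right sum.distrib)
qed

lemma peval_zero [simp]: "peval h v 0 = 0"
  by (simp add: peval_def)

lemma peval_sum:
  fixes p :: "'i \<Rightarrow> ('v, 'k::semiring_0) mpoly"
  assumes "h 0 = 0" "\<And>a b. h (a + b) = h a + h b"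
  shows "peval h v (\<Sum>i\<in>A. p i) = (\<Sum>i\<in>A. peval h v (p i))"
  by (induction A rule: infinite_finite_induct) (simp_all add: peval_add[OF assms])

lemma peval_single:
  assumes "h 0 = 0"
  shows "peval h v (Poly_Mapping.single m c)
       = h c * (\<Prod>i\<in>Poly_Mapping.keys m. v i ^ Poly_Mapping.lookup m i)"
  using assms by (simp add: peval_def)

lemma mpoly_sum_single:
  "p = (\<Sum>m\<in>Poly_Mapping.keys p. Poly_Mapping.single m (Poly_Mapping.lookup p m))"
  by (rule poly_mapping_eqI)
     (auto simp: lookup_sum lookup_single when_def in_keys_iff)

lemma peval_mult:
  fixes p q :: "('v, 'k::comm_semiring_1) mpoly"
  assumes h: "h 0 = 0" "\<And>a b. h (a + b) = h a + h b" "\<And>a b. h (a * b) = h a * h b"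
  shows "peval h v (p * q) = peval h v p * peval h v q"
proof -
  let ?s = "\<lambda>p::('v, 'k) mpoly. \<lambda>m. Poly_Mapping.single m (Poly_Mapping.lookup p m)"
  have "p * q = (\<Sum>m\<in>Poly_Mapping.keys p. ?s p m) * (\<Sum>m\<in>Poly_Mapping.keys q. ?s q m)"
    using mpoly_sum_single[of p] mpoly_sum_single[of q] by simp
  also have "\<dots> = (\<Sum>m\<in>Poly_Mapping.keys p. \<Sum>m'\<in>Poly_Mapping.keys q. ?s p m * ?s q m')"
    by (rule sum_product)
  finally have "peval h v (p * q)
      = (\<Sum>m\<in>Poly_Mapping.keys p. \<Sum>m'\<in>Poly_Mapping.keys q. peval h v (?s p m * ?s q m'))"
    by (simp add: peval_sum[OF h(1,2)])
  also have "\<dots> = (\<Sum>m\<in>Poly_Mapping.keys p. \<Sum>m'\<in>Poly_Mapping.keys q.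
                     peval h v (?s p m) * peval h v (?s q m'))"
    by (simp add: mult_single peval_single[of h, OF h(1)] h(3) prod_keys_add mult_ac)
  also have "\<dots> = peval h v p * peval h v q"
    unfolding sum_product[symmetric] peval_single[of h, OF h(1)] by (simp only: peval_def)
  finally show ?thesis .
qed

section \<open>Projective spaces and the Zariski topology\<close>

text \<open>
  The coordinates are indexed by an arbitrary finite set \<open>I\<close>, so that \<open>proj_space I\<close> is the projective
  space of dimension \<open>card I - 1\<close>; in particular \<open>\<P>\<^sup>m\<close> is \<open>proj_space {..m}\<close>. A point
  is the set of all its vectors of homogeneous coordinates, and coordinates outside \<open>I\<close> are \<open>0\<close>.
\<close>

definition vecs :: "'i set \<Rightarrow> ('i \<Rightarrow> 'k::zero) set" where
  "vecs I = {v. v \<noteq> (\<lambda>_. 0) \<and> (\<forall>i. i \<notin> I \<longrightarrow> v i = 0)}"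

definition pt :: "('i \<Rightarrow> 'k::field) \<Rightarrow> ('i \<Rightarrow> 'k) set" where
  "pt v = {(\<lambda>i. c * v i) | c. c \<noteq> 0}"

definition proj_space :: "'i set \<Rightarrow> ('i \<Rightarrow> 'k::field) set set" where
  "proj_space I = pt ` vecs I"

definition zero_locus :: "'i set \<Rightarrow> ('i, 'k::field) mpoly set \<Rightarrow> ('i \<Rightarrow> 'k) set set" where
  "zero_locus I F = {x \<in> proj_space I. \<forall>q\<in>F. \<forall>v\<in>x. eval_at v q = 0}"

definition zariski :: "'i set \<Rightarrow> ('i \<Rightarrow> 'k::field) set topology" where
  "zariski I = topology (\<lambda>U. \<exists>F. (\<forall>q\<in>F. \<exists>e. form e q) \<and> U = proj_space I - zero_locus I F)"

lemma eval_at_scale: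
  fixes v :: "'v \<Rightarrow> 'k::field"
  assumes "form e q"
  shows "eval_at (\<lambda>i. c * v i) q = c ^ e * eval_at v q"
proof -
  have "(\<Prod>i\<in>Poly_Mapping.keys m. (c * v i) ^ Poly_Mapping.lookup m i)
      = c ^ e * (\<Prod>i\<in>Poly_Mapping.keys m. v i ^ Poly_Mapping.lookup m i)"
    if "m \<in> Poly_Mapping.keys q" for m
    using that assms
    by (auto simp: form_def monoms_def mdeg_def power_mult_distrib prod.distrib power_sum[symmetric])
  then show ?thesis
    unfolding peval_def sum_distrib_left by (intro sum.cong) (simp_all add: mult_ac)
qed

lemma zero_locus_Un:
  assumes F: "\<forall>q\<in>F. \<exists>e. form e q" and G: "\<forall>q\<in>G. \<exists>e. form e q"
  shows "zero_locus I F \<union> zero_locus I G = zero_locus I {p * q | p q. p \<in> F \<and> q \<in> G}"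
proof
  have mult: "eval_at v (p * q) = eval_at v p * eval_at v q" for v and p q :: "('a, 'b) mpoly"
    by (rule peval_mult) auto
  show "zero_locus I F \<union> zero_locus I G \<subseteq> zero_locus I {p * q | p q. p \<in> F \<and> q \<in> G}"
    by (auto simp: zero_locus_def mult)
  show "zero_locus I {p * q | p q. p \<in> F \<and> q \<in> G} \<subseteq> zero_locus I F \<union> zero_locus I G"
  proof
    fix x assume x: "x \<in> zero_locus I {p * q | p q. p \<in> F \<and> q \<in> G}"
    show "x \<in> zero_locus I F \<union> zero_locus I G"
    proof (cases "x \<in> zero_locus I F")
      case False
      then obtain p v where p: "p \<in> F" "v \<in> x" "eval_at v p \<noteq> 0"
        using x by (auto simp: zero_locus_def)
      have "eval_at w q = 0" if qw: "q \<in> G" "w \<in> x" for q w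
      proof -
        obtain u where u: "x = pt u"
          using x by (auto simp: zero_locus_def proj_space_def)
        obtain a b where ab: "a \<noteq> 0" "b \<noteq> 0" "v = (\<lambda>i. a * u i)" "w = (\<lambda>i. b * u i)"
          using p(2) qw(2) unfolding u pt_def by auto
        obtain e where "form e q" using G qw(1) by auto
        have "p * q \<in> {p * q | p q. p \<in> F \<and> q \<in> G}" using p(1) qw(1) by blast
        then have "eval_at v (p * q) = 0" using x p(2) unfolding zero_locus_def by blast
        then have "eval_at v q = 0" using p(3) by (simp add: mult)
        then show ?thesis
          using ab \<open>form e q\<close> by (simp add: eval_at_scale)
      qed
      then show ?thesis using x by (auto simp: zero_locus_def)
    qed simp
  qed
qed

lemma istopology_zariski:
  "istopology (\<lambda>U. \<exists>F. (\<forall>q\<in>F. \<exists>e. form e q) \<and>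
     U = (proj_space I :: ('i \<Rightarrow> 'k::field) set set) - zero_locus I F)"
  unfolding istopology_def
proof (intro conjI allI impI)
  fix S T :: "('i \<Rightarrow> 'k) set set"
  assume "\<exists>F. (\<forall>q\<in>F. \<exists>e. form e q) \<and> S = proj_space I - zero_locus I F"
  then obtain F where F: "\<forall>q\<in>F. \<exists>e. form e q" "S = proj_space I - zero_locus I F" by blast
  assume "\<exists>F. (\<forall>q\<in>F. \<exists>e. form e q) \<and> T = proj_space I - zero_locus I F"
  then obtain G where G: "\<forall>q\<in>G. \<exists>e. form e q" "T = proj_space I - zero_locus I G" by blast
  show "\<exists>F. (\<forall>q\<in>F. \<exists>e. form e q) \<and> S \<inter> T = proj_space I - zero_locus I F"
  proof (intro exI conjI)
    show "\<forall>q\<in>{p * q | p q. p \<in> F \<and> q \<in> G}. \<exists>e. form e q"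
      using F(1) G(1) form_mult by blast
    show "S \<inter> T = proj_space I - zero_locus I {p * q | p q. p \<in> F \<and> q \<in> G}"
      unfolding zero_locus_Un[OF F(1) G(1), symmetric] F(2) G(2) by blast
  qed
next
  fix K :: "('i \<Rightarrow> 'k) set set set"
  assume "\<forall>S\<in>K. \<exists>F. (\<forall>q\<in>F. \<exists>e. form e q) \<and> S = proj_space I - zero_locus I F"
  then obtain F where F: "\<And>S. S \<in> K \<Longrightarrow> \<forall>q\<in>F S. \<exists>e. form e q"
    "\<And>S. S \<in> K \<Longrightarrow> S = proj_space I - zero_locus I (F S)" by metis
  show "\<exists>F. (\<forall>q\<in>F. \<exists>e. form e q) \<and> \<Union>K = proj_space I - zero_locus I F"
  proof (intro exI conjI)
    show "\<forall>q\<in>(\<Union>S\<in>K. F S). \<exists>e. form e q" using F(1) by blast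
    have "\<Union>K = (\<Union>S\<in>K. proj_space I - zero_locus I (F S))" using F(2) by auto
    also have "\<dots> = proj_space I - zero_locus I (\<Union>S\<in>K. F S)"
      unfolding zero_locus_def by blast
    finally show "\<Union>K = proj_space I - zero_locus I (\<Union>S\<in>K. F S)" .
  qed
qed

lemma openin_zariski:
  "openin (zariski I) U \<longleftrightarrow>
     (\<exists>F. (\<forall>q\<in>F. \<exists>e. form e q) \<and> U = proj_space I - zero_locus I F)"
  unfolding zariski_def topology_inverse'[OF istopology_zariski] ..

lemma topspace_zariski: "topspace (zariski I) = (proj_space I :: ('i \<Rightarrow> 'k::field) set set)"
proof
  show "topspace (zariski I) \<subseteq> (proj_space I :: ('i \<Rightarrow> 'k) set set)"
    using openin_topspace[of "zariski I"] unfolding openin_zariski by blast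
  have "form 0 (const 1 :: ('i, 'k) mpoly)"
    by (simp add: form_def const_def monoms_def mdeg_def)
  moreover have "zero_locus I {const 1 :: ('i, 'k) mpoly} = {}"
  proof -
    have "eval_at v (const 1 :: ('i, 'k) mpoly) = 1" for v
      by (simp add: const_def peval_single del: single_one)
    moreover have "v \<in> pt v" for v :: "'i \<Rightarrow> 'k"
      by (auto simp: pt_def intro!: exI[of _ 1])
    ultimately show ?thesis by (force simp: zero_locus_def proj_space_def)
  qed
  ultimately have "openin (zariski I) (proj_space I :: ('i \<Rightarrow> 'k) set set)"
    unfolding openin_zariski by (intro exI[of _ "{const 1}"]) auto
  then show "(proj_space I :: ('i \<Rightarrow> 'k) set set) \<subseteq> topspace (zariski I)"
    by (rule openin_subset)
qed

lemma closedin_zariski: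
  "closedin (zariski I) C \<longleftrightarrow> (\<exists>F. (\<forall>q\<in>F. \<exists>e. form e q) \<and> C = zero_locus I F)"
proof -
  have "zero_locus I F \<subseteq> proj_space I" for F :: "('a, 'b) mpoly set"
    by (auto simp: zero_locus_def)
  then show ?thesis
    unfolding closedin_def topspace_zariski openin_zariski by blast
qed

definition locally_closed_in :: "'a topology \<Rightarrow> 'a set \<Rightarrow> bool" where
  "locally_closed_in T A \<longleftrightarrow> (\<exists>U C. openin T U \<and> closedin T C \<and> A = U \<inter> C)"

definition constructible_in :: "'a topology \<Rightarrow> 'a set \<Rightarrow> bool" where
  "constructible_in T A \<longleftrightarrow> (\<exists>\<A>. finite \<A> \<and> (\<forall>B\<in>\<A>. locally_closed_in T B) \<and> A = \<Union>\<A>)"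

subsection \<open>Regular maps and embedding dimension\<close>

definition regular_map_on ::
  "'i set \<Rightarrow> ('i \<Rightarrow> 'k::field) set set \<Rightarrow> 'j set \<Rightarrow> (('i \<Rightarrow> 'k) set \<Rightarrow> ('j \<Rightarrow> 'k) set) \<Rightarrow> bool" where
  "regular_map_on I A J \<phi> \<longleftrightarrow> A \<subseteq> proj_space I \<and>
     (\<forall>x\<in>A. \<exists>U e q. openin (zariski I) U \<and> x \<in> U \<and> (\<forall>j. form e (q j)) \<and>
        (\<forall>y\<in>A \<inter> U. \<forall>v\<in>y. (\<lambda>j. eval_at v (q j)) \<in> vecs J \<and> \<phi> y = pt (\<lambda>j. eval_at v (q j))))"

definition closed_embedding ::
  "'i set \<Rightarrow> ('i \<Rightarrow> 'k::field) set set \<Rightarrow> 'j set \<Rightarrow> (('i \<Rightarrow> 'k) set \<Rightarrow> ('j \<Rightarrow> 'k) set) \<Rightarrow> bool" where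
  "closed_embedding I A J \<phi> \<longleftrightarrow>
     regular_map_on I A J \<phi> \<and> inj_on \<phi> A \<and> closedin (zariski J) (\<phi> ` A) \<and>
     regular_map_on J (\<phi> ` A) I (inv_into A \<phi>)"

text \<open>
  A constructible set that is not closed has no closed embedding into a projective space in the literal
  sense (for instance the open subset \<open>PGL\<^sub>2\<close> of \<open>\<P>\<^sup>3\<close>, which is affine); a closed embedding
  of \<open>C\<close> into \<open>\<P>\<^sup>m\<close> is read as the restriction to \<open>C\<close> of a closed embedding of the
  Zariski closure of \<open>C\<close>. The value is \<open>\<infinity>\<close> if there is none.
\<close>

definition edim :: "'i set \<Rightarrow> ('i \<Rightarrow> 'k::field) set set \<Rightarrow> enat" where
  "edim I C = (INF m \<in> {m. \<exists>\<phi>. closed_embedding I (Abstract_Topology.closure_of (zariski I) C) {..m} \<phi>}. enat m)"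

section \<open>Projective varieties and their coordinate rings\<close>

definition S_ring :: "('v, 'k::field) mpoly ring" where
  "S_ring = \<lparr>carrier = UNIV, monoid.mult = (*), one = 1, zero = 0, add = (+)\<rparr>"

lemma cring_S_ring: "cring S_ring"
  unfolding S_ring_def
  by (unfold_locales) (auto simp: algebra_simps Units_def intro: exI[of _ "- _"])

definition homogeneous_ideal :: "('v, 'k::field) mpoly set \<Rightarrow> bool" where
  "homogeneous_ideal P \<longleftrightarrow> ideal P S_ring \<and> P = Idl\<^bsub>S_ring\<^esub> {f \<in> P. \<exists>d. form d f}"

text \<open>
  A reduced and irreducible closed subscheme \<open>X\<close> of \<open>\<P>\<^sup>n\<close> over an arbitrary field is given by
  its homogeneous ideal \<open>P = \<I>(X)\<close>, a homogeneous prime that does not contain all the variables.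
  All notions depending on \<open>X\<close> below take \<open>P\<close> as their argument.
\<close>

definition projective_variety :: "('v, 'k::field) mpoly set \<Rightarrow> bool" where
  "projective_variety P \<longleftrightarrow> primeideal P S_ring \<and> homogeneous_ideal P \<and> \<not> range var \<subseteq> P"

definition in_no_hyperplane :: "('v, 'k::field) mpoly set \<Rightarrow> bool" where
  "in_no_hyperplane P \<longleftrightarrow> (\<forall>f\<in>P. form 1 f \<longrightarrow> f = 0)"

definition coord_ring :: "('v, 'k::field) mpoly set \<Rightarrow> ('v, 'k) mpoly set ring" where
  "coord_ring P = S_ring Quot P"

abbreviation cls :: "('v, 'k::field) mpoly set \<Rightarrow> ('v, 'k) mpoly \<Rightarrow> ('v, 'k) mpoly set" where
  "cls P f \<equiv> P +>\<^bsub>S_ring\<^esub> f"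

definition HF :: "('v, 'k::field) mpoly set \<Rightarrow> nat \<Rightarrow> nat" where
  "HF P t = ring.dim (coord_ring P) (cls P ` range const) (cls P ` {f. form t f})"

section \<open>Grade\<close>

definition regular_sequence :: "('a, 'b) ring_scheme \<Rightarrow> 'a list \<Rightarrow> bool" where
  "regular_sequence R rs \<longleftrightarrow> set rs \<subseteq> carrier R \<and>
     (\<forall>i < length rs. \<forall>y\<in>carrier R.
        rs ! i \<otimes>\<^bsub>R\<^esub> y \<in> Idl\<^bsub>R\<^esub> (set (take i rs)) \<longrightarrow> y \<in> Idl\<^bsub>R\<^esub> (set (take i rs))) \<and>
     Idl\<^bsub>R\<^esub> (set rs) \<noteq> carrier R"

definition grade :: "('a, 'b) ring_scheme \<Rightarrow> 'a set \<Rightarrow> enat" where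
  "grade R J = (SUP rs \<in> {rs. regular_sequence R rs \<and> set rs \<subseteq> J}. enat (length rs))"

section \<open>Rational and birational maps\<close>

text \<open>
  A form of degree \<open>e\<close> in the coordinate ring is the class of a form of degree \<open>e\<close> in \<open>S\<close>, so
  presentations are written as tuples of forms in \<open>S\<close>, and everything is required modulo \<open>P\<close>.
\<close>

definition presentation :: "('v, 'k::field) mpoly set \<Rightarrow> nat \<Rightarrow> ('v \<Rightarrow> ('v, 'k) mpoly) \<Rightarrow> bool" where
  "presentation P e h \<longleftrightarrow> (\<forall>i. form e (h i)) \<and> (\<exists>i. h i \<notin> P) \<and> (\<forall>g\<in>P. subst h g \<in> P)"

definition same_map ::
  "('v, 'k::field) mpoly set \<Rightarrow> ('v \<Rightarrow> ('v, 'k) mpoly) \<Rightarrow> ('v \<Rightarrow> ('v, 'k) mpoly) \<Rightarrow> bool" where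
  "same_map P h h' \<longleftrightarrow> (\<forall>i j. h i * h' j - h j * h' i \<in> P)"

text \<open>A rational map from \<open>X\<close> to \<open>X\<close> is the set of all its presentations.\<close>

definition rat_map ::
  "('v, 'k::field) mpoly set \<Rightarrow> ('v \<Rightarrow> ('v, 'k) mpoly) \<Rightarrow> ('v \<Rightarrow> ('v, 'k) mpoly) set" where
  "rat_map P h = {h'. (\<exists>e. presentation P e h') \<and> same_map P h h'}"

definition inverse_maps ::
  "('v, 'k::field) mpoly set \<Rightarrow> ('v \<Rightarrow> ('v, 'k) mpoly) \<Rightarrow> ('v \<Rightarrow> ('v, 'k) mpoly) \<Rightarrow> bool" where
  "inverse_maps P h g \<longleftrightarrow>
     (\<exists>i. subst h (g i) \<notin> P) \<and> same_map P (\<lambda>i. subst h (g i)) var \<and>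
     (\<exists>i. subst g (h i) \<notin> P) \<and> same_map P (\<lambda>i. subst g (h i)) var"

definition birational :: "('v, 'k::field) mpoly set \<Rightarrow> nat \<Rightarrow> ('v \<Rightarrow> ('v, 'k) mpoly) \<Rightarrow> bool" where
  "birational P d h \<longleftrightarrow> presentation P d h \<and> (\<exists>e g. presentation P e g \<and> inverse_maps P h g)"

definition clear_degree :: "('v, 'k::field) mpoly set \<Rightarrow> nat \<Rightarrow> ('v \<Rightarrow> ('v, 'k) mpoly) set \<Rightarrow> bool" where
  "clear_degree P d \<Psi> \<longleftrightarrow> (\<exists>h\<in>\<Psi>. (\<forall>i. form d (h i)) \<and>
     grade (coord_ring P) (Idl\<^bsub>coord_ring P\<^esub> (range (\<lambda>i. cls P (h i)))) \<ge> 2)"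

definition Bir :: "('v, 'k::field) mpoly set \<Rightarrow> nat \<Rightarrow> ('v \<Rightarrow> ('v, 'k) mpoly) set set" where
  "Bir P d = {rat_map P h | h e. birational P e h \<and> clear_degree P d (rat_map P h)}"

section \<open>Parameter spaces\<close>

text \<open>
  \<open>W\<^sub>d\<close> is \<open>proj_space (W_index d)\<close>: the coordinate \<open>(i, m)\<close> is the coefficient of the
  monomial \<open>m\<close> in the \<open>i\<close>-th form.
\<close>

definition W_index :: "nat \<Rightarrow> ('v \<times> 'v monom) set" where
  "W_index d = UNIV \<times> monoms d"

definition forms_of :: "nat \<Rightarrow> ('v \<times> 'v monom \<Rightarrow> 'k::field) \<Rightarrow> 'v \<Rightarrow> ('v, 'k) mpoly" where
  "forms_of d a i = (\<Sum>m\<in>monoms d. Poly_Mapping.single m (a (i, m)))"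

text \<open>All representatives of a point of \<open>Hd P d\<close> give the same rational map.\<close>

definition psi :: "('v, 'k::field) mpoly set \<Rightarrow> nat \<Rightarrow> ('v \<times> 'v monom \<Rightarrow> 'k) set \<Rightarrow> ('v \<Rightarrow> ('v, 'k) mpoly) set" where
  "psi P d w = the_elem ((\<lambda>a. rat_map P (forms_of d a)) ` w)"

definition Hd :: "('v, 'k::field) mpoly set \<Rightarrow> nat \<Rightarrow> ('v \<times> 'v monom \<Rightarrow> 'k) set set" where
  "Hd P d = {w \<in> proj_space (W_index d). \<forall>a\<in>w. birational P d (forms_of d a)}"

definition Hd_clear :: "('v, 'k::field) mpoly set \<Rightarrow> nat \<Rightarrow> ('v \<times> 'v monom \<Rightarrow> 'k) set set" where
  "Hd_clear P d = {w \<in> Hd P d. clear_degree P d (psi P d w)}"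

section \<open>The algebraic structure on the set of birational maps of clear degree\<close>

definition s_dim :: "('v, 'k::field) mpoly set \<Rightarrow> nat \<Rightarrow> nat" where
  "s_dim P d = card (monoms d :: 'v monom set)
     - ring.dim (S_ring :: ('v, 'k) mpoly ring) (range const) {f \<in> P. form d f}"

text \<open>
  A linear form on \<open>k\<^sup>N\<close> (coordinates indexed by \<open>monoms d\<close>) is given by its coefficients.
\<close>

definition lin :: "nat \<Rightarrow> ('v monom \<Rightarrow> 'k::field) \<Rightarrow> ('v monom \<Rightarrow> 'k) \<Rightarrow> 'k" where
  "lin d l a = (\<Sum>m\<in>monoms d. l m * a m)"

definition defining_forms :: "('v, 'k::field) mpoly set \<Rightarrow> nat \<Rightarrow> (nat \<Rightarrow> 'v monom \<Rightarrow> 'k) \<Rightarrow> bool" where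
  "defining_forms P d l \<longleftrightarrow>
     (\<forall>c. (\<forall>m\<in>monoms d. (\<Sum>j<s_dim P d. c j * l j m) = 0) \<longrightarrow> (\<forall>j<s_dim P d. c j = 0)) \<and>
     (\<forall>a. (\<forall>j<s_dim P d. lin d (l j) a = 0) \<longleftrightarrow> (\<Sum>m\<in>monoms d. Poly_Mapping.single m (a m)) \<in> P)"

definition D_index :: "('v, 'k::field) mpoly set \<Rightarrow> nat \<Rightarrow> ('v \<times> nat) set" where
  "D_index P d = UNIV \<times> {..<s_dim P d}"

text \<open>
  As the map on coordinate vectors is linear, the image of a point of \<open>Hd_clear P d\<close>, taken as a set of
  vectors, is again a point.
\<close>

definition D' ::
  "('v, 'k::field) mpoly set \<Rightarrow> nat \<Rightarrow> (nat \<Rightarrow> 'v monom \<Rightarrow> 'k) \<Rightarrow>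
     ('v \<times> 'v monom \<Rightarrow> 'k) set \<Rightarrow> ('v \<times> nat \<Rightarrow> 'k) set" where
  "D' P d l w =
     (\<lambda>a (i, j). if j < s_dim P d then lin d (l j) (\<lambda>m. a (i, m)) else 0) ` w"

end

theory Submission imports Defs "HOL-Computational_Algebra.Polynomial" begin

text \<open>
  Everything is expressed by tuples \<open>h\<close> of forms modulo the homogeneous prime \<open>P\<close>.

  \<^bold>\<open>Birational maps.\<close> A tuple \<open>h\<close> that maps \<open>X\<close> to itself is birational as soon as it has a left inverse, that is
  a tuple \<open>g\<close> with \<open>g(h)\<close> non-zero and proportional to the coordinates (\<open>left_inverse_birational\<close>): comparing
  Hilbert functions, \<open>h\<close> must be dominant, and then the rest can be tested after substituting \<open>h\<close>. If the degree
  of \<open>g\<close> is fixed, a left inverse is a non-trivial solution of a linear system whose coefficients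
  are forms in the coefficients of \<open>h\<close>; solvability is a closed condition, and an open condition on \<open>h\<close>
  guarantees that \<open>g(h)\<close> is not zero (\<open>birational_conditions\<close>). So the birational tuples form a locally closed
  set, provided that the degree of the inverse is bounded on the whole parameter space.

  The bound (\<open>left_inverse_degree_bound\<close>) comes from noetherian induction and a theorem on families of ideals:
  on a dense open subset of an irreducible parameter space the ideal of leading monomials is constant, hence
  generated in bounded degrees (\<open>generic_leading_monomials\<close>). Applied to the ideal of the graph of \<open>h\<close>, it bounds
  the degrees of the relations that are linear in the source coordinates and generate all such relations. The
  inverse solves this linear system over the coordinate ring, a solution of bounded degree exists by
  elimination, and every solution is proportional to the inverse.

  \<^bold>\<open>Clear degree.\<close> The ideal of \<open>h\<close> has grade at least two if and only if every tuple of forms proportional to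
  \<open>h\<close> is a multiple of \<open>h\<close> (\<open>grade_saturated\<close>, \<open>saturated_grade\<close>; for the converse a non-zero-divisor modulo a
  component of \<open>h\<close> is found on a moment curve over the infinite field). In each degree this says that some
  vectors depending linearly on \<open>h\<close> have the largest possible rank, which is an open condition
  (\<open>saturated_full_rank\<close>). The theorem on families of ideals shows that finitely many degrees suffice
  (\<open>saturation_bound\<close>), so the clear birational tuples form a locally closed set, too. Moreover a tuple of
  clear degree is determined by its rational map up to a scalar (\<open>proportional_of_saturated\<close>).

  \<^bold>\<open>The structure on the set of maps.\<close> All conditions depend on the classes of the forms modulo \<open>P\<close> only. The map \<open>D'\<close>
  takes the coordinates of these classes and has a linear section, along which the conditions
  are pulled back; so its image is locally closed (\<open>constructible_image\<close>). Two tuples have the same image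
  if and only if their classes agree up to a scalar, that is, if they define the same map (\<open>D'_eq_iff\<close>). Finally
  the number \<open>s\<close> of coordinates of a class is the value of the Hilbert function (\<open>HF_eq\<close>), so the closure of the
  image is a closed subset of a projective space of dimension \<open>(n + 1) HF\<^sub>R(d) - 1\<close>.
\<close>


section \<open>Linear algebra with families of vectors\<close>

definition indep :: "('x \<Rightarrow> 'c \<Rightarrow> 'k::field) \<Rightarrow> 'x set \<Rightarrow> bool" where
  "indep v A \<longleftrightarrow> (\<forall>t. (\<forall>c. (\<Sum>x\<in>A. t x * v x c) = 0) \<longrightarrow> (\<forall>x\<in>A. t x = 0))"

definition inspan :: "('x \<Rightarrow> 'c \<Rightarrow> 'k::field) \<Rightarrow> 'x set \<Rightarrow> ('c \<Rightarrow> 'k) \<Rightarrow> bool" where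
  "inspan v A y \<longleftrightarrow> (\<exists>t. \<forall>c. y c = (\<Sum>x\<in>A. t x * v x c))"

lemma indepD: "indep v A \<Longrightarrow> (\<And>c. (\<Sum>x\<in>A. t x * v x c) = 0) \<Longrightarrow> x \<in> A \<Longrightarrow> t x = 0"
  unfolding indep_def by blast

lemma inspan_mem: "finite A \<Longrightarrow> x \<in> A \<Longrightarrow> inspan v A (v x)"
  unfolding inspan_def
proof (intro exI allI)
  fix c assume "finite A" "x \<in> A"
  then show "v x c = (\<Sum>y\<in>A. (if y = x then 1 else 0) * v y c)"
    by (simp add: if_distrib[of "\<lambda>z. z * _"] cong: if_cong)
qed

lemma inspan_mono:
  assumes "finite B" "A \<subseteq> B" "inspan v A y"
  shows "inspan v B y"
proof -
  obtain t where t: "\<And>c. y c = (\<Sum>x\<in>A. t x * v x c)" using assms(3) unfolding inspan_def by blast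
  have "y c = (\<Sum>x\<in>B. (if x \<in> A then t x else 0) * v x c)" for c
    unfolding t using assms by (intro sum.mono_neutral_cong_left) auto
  then show ?thesis unfolding inspan_def by (intro exI allI)
qed

lemma inspan_trans:
  assumes "\<And>x. x \<in> A \<Longrightarrow> inspan w B (v x)" "inspan v A y"
  shows "inspan w B y"
proof -
  obtain t where t: "\<And>c. y c = (\<Sum>x\<in>A. t x * v x c)" using assms(2) unfolding inspan_def by blast
  obtain s where s: "\<And>x c. x \<in> A \<Longrightarrow> v x c = (\<Sum>b\<in>B. s x b * w b c)"
    using assms(1) unfolding inspan_def by metis
  have "y c = (\<Sum>b\<in>B. (\<Sum>x\<in>A. t x * s x b) * w b c)" for c
  proof -
    have "y c = (\<Sum>x\<in>A. \<Sum>b\<in>B. t x * s x b * w b c)"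
      unfolding t by (intro sum.cong) (simp_all add: s sum_distrib_left mult_ac)
    then show ?thesis by (subst (asm) sum.swap) (simp add: sum_distrib_right)
  qed
  then show ?thesis unfolding inspan_def by (intro exI allI)
qed

lemma indep_subset:
  assumes "indep v B" "A \<subseteq> B" "finite B"
  shows "indep v A"
  unfolding indep_def
proof (intro allI impI ballI)
  fix t x assume t: "\<forall>c. (\<Sum>x\<in>A. t x * v x c) = 0" and "x \<in> A"
  have "(\<Sum>x\<in>B. (if x \<in> A then t x else 0) * v x c) = 0" for c
    using t assms by (subst sum.mono_neutral_cong_right[of B A _ "\<lambda>x. t x * v x c"]) auto
  from indepD[OF assms(1) this, of x] show "t x = 0" using \<open>x \<in> A\<close> assms(2) by auto
qed

lemma indep_insert:
  assumes "finite T" "x \<notin> T" "indep v T"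
  shows "indep v (insert x T) \<longleftrightarrow> \<not> inspan v T (v x)"
proof
  assume i: "indep v (insert x T)"
  show "\<not> inspan v T (v x)"
  proof
    assume "inspan v T (v x)"
    then obtain t where t: "\<And>c. v x c = (\<Sum>y\<in>T. t y * v y c)" unfolding inspan_def by blast
    let ?t = "t(x := -1)"
    have "(\<Sum>y\<in>insert x T. ?t y * v y c) = 0" for c
    proof -
      have "(\<Sum>y\<in>T. ?t y * v y c) = (\<Sum>y\<in>T. t y * v y c)"
        using assms(2) by (intro sum.cong) auto
      then show ?thesis using assms(1,2) t[of c] by simp
    qed
    from indepD[OF i this, of x] show False by simp
  qed
next
  assume n: "\<not> inspan v T (v x)"
  show "indep v (insert x T)"
    unfolding indep_def
  proof (intro allI impI)
    fix t assume t: "\<forall>c. (\<Sum>y\<in>insert x T. t y * v y c) = 0"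
    have eq: "t x * v x c + (\<Sum>y\<in>T. t y * v y c) = 0" for c
      using t assms(1,2) by simp
    have "t x = 0"
    proof (rule ccontr)
      assume nz: "t x \<noteq> 0"
      have "v x c = (\<Sum>y\<in>T. (- t y / t x) * v y c)" for c
      proof -
        have "t x * v x c = - (\<Sum>y\<in>T. t y * v y c)" using eq[of c] by (simp add: eq_neg_iff_add_eq_0)
        then have "v x c = - (\<Sum>y\<in>T. t y * v y c) / t x"
          using nz by (metis nonzero_mult_div_cancel_left)
        then show ?thesis by (simp add: sum_divide_distrib sum_negf)
      qed
      then have "inspan v T (v x)" unfolding inspan_def by (intro exI allI)
      then show False using n by contradiction
    qed
    moreover have "t y = 0" if "y \<in> T" for y
      using indepD[OF assms(3) _ that, of t] eq \<open>t x = 0\<close> by simp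
    ultimately show "\<forall>y\<in>insert x T. t y = 0" by blast
  qed
qed

lemma homogeneous_system:
  fixes M :: "'x \<Rightarrow> 'b \<Rightarrow> 'k::field"
  assumes "finite B" "finite A" "card B < card A"
  shows "\<exists>t. (\<exists>x\<in>A. t x \<noteq> 0) \<and> (\<forall>b\<in>B. (\<Sum>x\<in>A. t x * M x b) = 0)"
  using assms
proof (induction B arbitrary: A M rule: finite_induct)
  case empty
  then have "A \<noteq> {}" by auto
  then show ?case by (intro exI[of _ "\<lambda>_. 1"]) auto
next
  case (insert b B)
  show ?case
  proof (cases "\<forall>x\<in>A. M x b = 0")
    case True
    have "card B < card A" using insert by simp
    from insert.IH[OF insert.prems(1) this, of M] obtain t where
      "\<exists>x\<in>A. t x \<noteq> 0" "\<forall>b\<in>B. (\<Sum>x\<in>A. t x * M x b) = 0" by blast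
    then show ?thesis using True by (intro exI[of _ t]) simp
  next
    case False
    then obtain x0 where x0: "x0 \<in> A" "M x0 b \<noteq> 0" by blast
    let ?A = "A - {x0}" and ?M = "\<lambda>x b'. M x b' - M x b / M x0 b * M x0 b'"
    have "finite ?A" "card B < card ?A" using insert x0 by auto
    from insert.IH[OF this, of ?M] obtain t where
      t: "\<exists>x\<in>?A. t x \<noteq> 0" "\<And>b'. b' \<in> B \<Longrightarrow> (\<Sum>x\<in>?A. t x * ?M x b') = 0" by blast
    define s where "s = t(x0 := - (\<Sum>x\<in>?A. t x * (M x b / M x0 b)))"
    have sum: "(\<Sum>x\<in>A. s x * M x b') = (\<Sum>x\<in>?A. t x * ?M x b')" for b'
    proof -
      have "(\<Sum>x\<in>A. s x * M x b') = s x0 * M x0 b' + (\<Sum>x\<in>?A. s x * M x b')"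
        using insert.prems(1) x0(1) by (rule sum.remove)
      also have "(\<Sum>x\<in>?A. s x * M x b') = (\<Sum>x\<in>?A. t x * M x b')"
        by (intro sum.cong) (auto simp: s_def)
      also have "s x0 * M x0 b' = - (\<Sum>x\<in>?A. t x * (M x b / M x0 b * M x0 b'))"
        by (simp add: s_def sum_distrib_right mult.assoc)
      finally show ?thesis by (simp add: right_diff_distrib sum_subtractf)
    qed
    have "(\<Sum>x\<in>A. s x * M x b) = 0" unfolding sum using x0(2) by simp
    moreover have "\<exists>x\<in>A. s x \<noteq> 0" using t(1) by (auto simp: s_def)
    ultimately show ?thesis using t(2) sum by (intro exI[of _ s]) auto
  qed
qed

lemma indep_card_le:
  assumes "indep v A" "finite A" "finite B" "\<And>x. x \<in> A \<Longrightarrow> inspan w B (v x)"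
  shows "card A \<le> card B"
proof (rule ccontr)
  assume "\<not> card A \<le> card B"
  obtain s where s: "\<And>x c. x \<in> A \<Longrightarrow> v x c = (\<Sum>b\<in>B. s x b * w b c)"
    using assms(4) unfolding inspan_def by metis
  obtain t where t: "\<exists>x\<in>A. t x \<noteq> 0" "\<forall>b\<in>B. (\<Sum>x\<in>A. t x * s x b) = 0"
    using homogeneous_system[OF assms(3,2), of s] \<open>\<not> card A \<le> card B\<close> by auto
  have "(\<Sum>x\<in>A. t x * v x c) = 0" for c
  proof -
    have "(\<Sum>x\<in>A. t x * v x c) = (\<Sum>x\<in>A. \<Sum>b\<in>B. t x * s x b * w b c)"
      by (intro sum.cong) (simp_all add: s sum_distrib_left mult_ac)
    also have "\<dots> = (\<Sum>b\<in>B. (\<Sum>x\<in>A. t x * s x b) * w b c)"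
      by (subst sum.swap) (simp add: sum_distrib_right)
    finally show ?thesis using t(2) by simp
  qed
  from indepD[OF assms(1) this] t(1) show False by blast
qed

lemma maximal_indep:
  assumes "finite A"
  shows "\<exists>T\<subseteq>A. indep v T \<and> (\<forall>x\<in>A. inspan v T (v x))"
  using assms
proof (induction A rule: finite_induct)
  case empty
  then show ?case by (auto simp: indep_def)
next
  case (insert x A)
  then obtain T where T: "T \<subseteq> A" "indep v T" "\<forall>x\<in>A. inspan v T (v x)" by blast
  have fT: "finite T" "x \<notin> T" using T(1) insert.hyps finite_subset by auto
  show ?case
  proof (cases "inspan v T (v x)")
    case True
    then show ?thesis using T by (intro exI[of _ T]) auto
  next
    case False
    have "\<forall>y\<in>insert x A. inspan v (insert x T) (v y)"
      using T(3) inspan_mono[of "insert x T" T v] inspan_mem[of "insert x T" x v] fT by auto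
    then show ?thesis using indep_insert[OF fT T(2)] False T(1)
      by (intro exI[of _ "insert x T"]) auto
  qed
qed

section \<open>Functions given by forms, and openness of linear independence\<close>

text \<open>
  Homogeneous polynomial functions on the space of parameter vectors, with the number of coordinates
  left open.
\<close>

definition hfun :: "nat \<Rightarrow> (('i \<Rightarrow> 'k::field) \<Rightarrow> 'k) \<Rightarrow> bool" where
  "hfun e f \<longleftrightarrow> (\<exists>p. form e p \<and> f = (\<lambda>a. eval_at a p))"

lemma eval_at_add: "eval_at v (p + q) = eval_at v p + eval_at v (q :: ('i, 'k::field) mpoly)"
  by (rule peval_add) auto

lemma eval_at_mult: "eval_at v (p * q) = eval_at v p * eval_at v (q :: ('i, 'k::field) mpoly)"
  by (rule peval_mult) auto

lemma form_zero [simp]: "form e 0"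
  by (simp add: form_def)

lemma form_add: "form e p \<Longrightarrow> form e q \<Longrightarrow> form e (p + q)"
  unfolding form_def using Poly_Mapping.keys_add[of p q] by blast

lemma form_uminus: "form e p \<Longrightarrow> form e (- p :: ('v, 'k::field) mpoly)"
  unfolding form_def by (auto simp: in_keys_iff)

lemma form_diff: "form e p \<Longrightarrow> form e q \<Longrightarrow> form e (p - q :: ('v, 'k::field) mpoly)"
  using form_add[of e p "- q"] form_uminus[of e q] by simp

lemma mdeg_0 [simp]: "mdeg 0 = 0" by (simp add: mdeg_def)

lemma mdeg_single [simp]: "mdeg (Poly_Mapping.single i c) = c"
  by (cases "c = 0") (simp_all add: mdeg_def)

lemma form_const: "form 0 (const c)"
  by (simp add: form_def const_def monoms_def)

lemma form_var: "form 1 (var i :: ('v, 'k::zero_neq_one) mpoly)"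
  by (simp add: form_def var_def monoms_def)

lemma form_sum: "(\<And>x. x \<in> A \<Longrightarrow> form e (f x)) \<Longrightarrow> form e (\<Sum>x\<in>A. f x)"
  by (induction A rule: infinite_finite_induct) (auto intro: form_add)

lemma form_single: "mdeg m = e \<Longrightarrow> form e (Poly_Mapping.single m c)"
  by (simp add: form_def monoms_def)

lemma hfun_add: "hfun e f \<Longrightarrow> hfun e g \<Longrightarrow> hfun e (\<lambda>a. f a + g a)"
proof -
  assume "hfun e f" "hfun e g"
  then obtain p q where "form e p" "f = (\<lambda>a. eval_at a p)" "form e q" "g = (\<lambda>a. eval_at a q)"
    unfolding hfun_def by (elim exE conjE)
  then show ?thesis unfolding hfun_def
    by (intro exI[of _ "p + q"]) (simp add: form_add eval_at_add)
qed

lemma hfun_mult: "hfun e f \<Longrightarrow> hfun e' g \<Longrightarrow> hfun (e + e') (\<lambda>a. f a * g a)"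
proof -
  assume "hfun e f" "hfun e' g"
  then obtain p q where "form e p" "f = (\<lambda>a. eval_at a p)" "form e' q" "g = (\<lambda>a. eval_at a q)"
    unfolding hfun_def by (elim exE conjE)
  then show ?thesis unfolding hfun_def
    by (intro exI[of _ "p * q"]) (simp add: form_mult eval_at_mult)
qed

lemma hfun_const: "hfun 0 (\<lambda>a :: 'i \<Rightarrow> 'k::field. c)"
proof -
  have "(\<lambda>a :: 'i \<Rightarrow> 'k. c) = (\<lambda>a. eval_at a (const c))"
    by (simp add: const_def peval_single)
  then show ?thesis unfolding hfun_def using form_const by blast
qed

lemma hfun_zero: "hfun e (\<lambda>a. 0)"
  unfolding hfun_def by (intro exI[of _ 0]) simp

lemma hfun_coord: "hfun 1 (\<lambda>a :: 'i \<Rightarrow> 'k::field. a i)"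
proof -
  have "(\<lambda>a :: 'i \<Rightarrow> 'k. a i) = (\<lambda>a. eval_at a (var i))"
    by (simp add: var_def peval_single)
  then show ?thesis unfolding hfun_def by (intro exI[of _ "var i"] conjI form_var)
qed

lemma hfun_cmult: "hfun e f \<Longrightarrow> hfun e (\<lambda>a. c * f a)"
  using hfun_mult[OF hfun_const[of c], of e f] by simp

lemma hfun_diff: "hfun e f \<Longrightarrow> hfun e g \<Longrightarrow> hfun e (\<lambda>a. f a - g a)"
proof -
  assume "hfun e f" "hfun e g"
  then have "hfun e (\<lambda>a. f a + (-1) * g a)" by (intro hfun_add hfun_cmult)
  then show ?thesis by simp
qed

lemma hfun_sum: "(\<And>x. x \<in> A \<Longrightarrow> hfun e (f x)) \<Longrightarrow> hfun e (\<lambda>a. \<Sum>x\<in>A. f x a)"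
proof (induction A rule: infinite_finite_induct)
  case (insert x A)
  then have "hfun e (\<lambda>a. f x a + (\<Sum>x\<in>A. f x a))" by (intro hfun_add) simp_all
  then show ?case using insert.hyps by simp
qed (simp_all add: hfun_zero)

lemma hfun_scale: "hfun e f \<Longrightarrow> f (\<lambda>i. c * a i) = c ^ e * f a"
  unfolding hfun_def by (auto simp: eval_at_scale)

text \<open>
  Fraction-free Gaussian elimination: clearing one coordinate with a pivot that does not vanish at
  \<open>a0\<close> keeps all coordinates homogeneous, and the product of the pivots witnesses independence
  in a neighbourhood of \<open>a0\<close>.
\<close>

lemma indep_open:
  assumes "finite A" "\<And>x c. x \<in> A \<Longrightarrow> hfun (e x) (\<lambda>a. v a x c)" "indep (v a0) A"
  shows "\<exists>e' q. hfun e' q \<and> q a0 \<noteq> 0 \<and> (\<forall>a. q a \<noteq> 0 \<longrightarrow> indep (v a) A)"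
  using assms
proof (induction A arbitrary: v e rule: finite_induct)
  case empty
  then show ?case by (intro exI[of _ 0] exI[of _ "\<lambda>_. 1"]) (auto simp: hfun_const indep_def)
next
  case (insert x A)
  have "\<exists>c. v a0 x c \<noteq> 0"
  proof (rule ccontr)
    assume n: "\<not> ?thesis"
    have "(\<Sum>y\<in>insert x A. (if y = x then 1 else 0) * v a0 y c) = 0" for c
      using n insert.hyps by (intro sum.neutral) auto
    from indepD[OF insert.prems(2) this, of x] show False by simp
  qed
  then obtain c0 where c0: "v a0 x c0 \<noteq> 0" by blast
  define w where "w a y c = v a x c0 * v a y c - v a y c0 * v a x c" for a y c
  have hw: "hfun (e x + e y) (\<lambda>a. w a y c)" if "y \<in> A" for y c
  proof -
    have "hfun (e x + e y) (\<lambda>a. v a x c0 * v a y c)" "hfun (e y + e x) (\<lambda>a. v a y c0 * v a x c)"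
      using that by (auto intro!: hfun_mult insert.prems(1))
    then show ?thesis unfolding w_def by (intro hfun_diff) (simp_all add: add.commute)
  qed
  have expand: "(\<Sum>y\<in>A. t y * w a y c)
      = v a x c0 * (\<Sum>y\<in>A. t y * v a y c) - (\<Sum>y\<in>A. t y * v a y c0) * v a x c" for t a c
    by (simp add: w_def sum_distrib_left sum_distrib_right sum_subtractf[symmetric] algebra_simps)
  have iw: "indep (w a0) A"
    unfolding indep_def
  proof (intro allI impI ballI)
    fix t y assume t: "\<forall>c. (\<Sum>y\<in>A. t y * w a0 y c) = 0" and y: "y \<in> A"
    define s where "s z = (if z = x then - (\<Sum>y\<in>A. t y * v a0 y c0) else v a0 x c0 * t z)" for z
    have "(\<Sum>z\<in>insert x A. s z * v a0 z c) = 0" for c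
    proof -
      have "(\<Sum>z\<in>A. s z * v a0 z c) = v a0 x c0 * (\<Sum>y\<in>A. t y * v a0 y c)"
        unfolding sum_distrib_left using insert.hyps by (intro sum.cong) (auto simp: s_def)
      then show ?thesis using insert.hyps t expand[of t a0 c] by (simp add: s_def)
    qed
    from indepD[OF insert.prems(2) this, of y] y insert.hyps(2) c0
    show "t y = 0" by (auto simp: s_def split: if_splits)
  qed
  obtain e' q where q: "hfun e' q" "q a0 \<noteq> 0" "\<And>a. q a \<noteq> 0 \<Longrightarrow> indep (w a) A"
    using insert.IH[of "\<lambda>y. e x + e y" w] hw iw by blast
  have "indep (v a) (insert x A)" if "q a * v a x c0 \<noteq> 0" for a
    unfolding indep_def
  proof (intro allI impI)
    fix t assume "\<forall>c. (\<Sum>y\<in>insert x A. t y * v a y c) = 0"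
    then have t: "t x * v a x c + (\<Sum>y\<in>A. t y * v a y c) = 0" for c
      using insert.hyps by simp
    then have t': "(\<Sum>y\<in>A. t y * v a y c) = - (t x * v a x c)" for c
      by (simp add: eq_neg_iff_add_eq_0 add.commute)
    have "(\<Sum>y\<in>A. t y * w a y c) = 0" for c
      unfolding expand t' by (simp add: algebra_simps)
    then have A: "\<forall>y\<in>A. t y = 0" using q(3)[of a] that indepD by fastforce
    then have "t x * v a x c0 = 0" using t[of c0] by simp
    then show "\<forall>y\<in>insert x A. t y = 0" using A that by auto
  qed
  moreover have "hfun (e' + e x) (\<lambda>a. q a * v a x c0)"
    using q(1) insert.prems(1)[of x c0] by (intro hfun_mult) auto
  ultimately show ?case using q(2) c0 by (intro exI[of _ "e' + e x"] exI[of _ "\<lambda>a. q a * v a x c0"]) auto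
qed

abbreviation keys :: "('a \<Rightarrow>\<^sub>0 'b::zero) \<Rightarrow> 'a set" where "keys \<equiv> Poly_Mapping.keys"
abbreviation lookup :: "('a \<Rightarrow>\<^sub>0 'b::zero) \<Rightarrow> 'a \<Rightarrow> 'b" where "lookup \<equiv> Poly_Mapping.lookup"
abbreviation single :: "'a \<Rightarrow> 'b \<Rightarrow> ('a \<Rightarrow>\<^sub>0 'b::zero)" where "single \<equiv> Poly_Mapping.single"

section \<open>Monomial orders, Dickson's lemma and the ascending chain condition\<close>

definition mdvd :: "'w monom \<Rightarrow> 'w monom \<Rightarrow> bool" where
  "mdvd m m' \<longleftrightarrow> (\<exists>n. m' = m + n)"

text \<open>
  The degree-lexicographic order with respect to a numbering \<open>r\<close> of the variables.
\<close>

definition mless :: "('w \<Rightarrow> nat) \<Rightarrow> 'w monom \<Rightarrow> 'w monom \<Rightarrow> bool" where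
  "mless r m m' \<longleftrightarrow> mdeg m < mdeg m' \<or> (mdeg m = mdeg m' \<and>
     (\<exists>w. lookup m w < lookup m' w \<and>
          (\<forall>w'. r w' < r w \<longrightarrow> lookup m w' = lookup m' w')))"

lemma mless_add: "mless r m m' \<Longrightarrow> mless r (n + m) (n + m')"
  unfolding mless_def by (auto simp: mdeg_add lookup_add)

lemma mdvdI:
  assumes "\<And>w. lookup m w \<le> lookup m' w"
  shows "mdvd m m'"
  unfolding mdvd_def
  by (intro exI[of _ "m' - m"] poly_mapping_eqI) (simp add: lookup_add lookup_minus assms)

lemma mdvd_refl: "mdvd m m"
  unfolding mdvd_def by (intro exI[of _ 0]) simp

locale monomial_order =
  fixes r :: "'w \<Rightarrow> nat" and A :: "'w set"
  assumes inj: "inj_on r A" and fin: "finite A"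
begin

lemma mless_irrefl: "\<not> mless r m m"
  by (simp add: mless_def)

lemma mless_trans:
  assumes "keys m2 \<subseteq> A" "keys m3 \<subseteq> A" "mless r m1 m2" "mless r m2 m3"
  shows "mless r m1 m3"
proof (cases "mdeg m1 < mdeg m2 \<or> mdeg m2 < mdeg m3")
  case True
  then show ?thesis using assms unfolding mless_def by auto
next
  case False
  then obtain u v where
    u: "lookup m1 u < lookup m2 u"
       "\<And>w'. r w' < r u \<Longrightarrow> lookup m1 w' = lookup m2 w'" and
    v: "lookup m2 v < lookup m3 v"
       "\<And>w'. r w' < r v \<Longrightarrow> lookup m2 w' = lookup m3 w'" and
    d: "mdeg m1 = mdeg m2" "mdeg m2 = mdeg m3"
    using assms(3,4) unfolding mless_def by auto
  have "u \<in> A" "v \<in> A" using u(1) v(1) assms(1,2) by (auto simp: in_keys_iff subset_iff)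
  then consider "u = v" | "r u < r v" | "r v < r u"
    using inj unfolding inj_on_def by (meson linorder_neqE_nat)
  then have "\<exists>w. lookup m1 w < lookup m3 w \<and>
          (\<forall>w'. r w' < r w \<longrightarrow> lookup m1 w' = lookup m3 w')"
  proof cases
    case 1 then show ?thesis using u v by (intro exI[of _ u]) auto
  next
    case 2 then show ?thesis using u v(2)[of u] v(2) by (intro exI[of _ u]) auto
  next
    case 3 then show ?thesis using v u(2)[of v] u(2) by (intro exI[of _ v]) auto
  qed
  then show ?thesis using d unfolding mless_def by auto
qed

lemma mless_total:
  assumes "keys m \<subseteq> A" "keys m' \<subseteq> A" "m \<noteq> m'"
  shows "mless r m m' \<or> mless r m' m"
proof (cases "mdeg m = mdeg m'")
  case True
  let ?D = "{w \<in> A. lookup m w \<noteq> lookup m' w}"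
  obtain w0 where w0: "lookup m w0 \<noteq> lookup m' w0"
    using assms(3) poly_mapping_eqI[of m m'] by blast
  then have "w0 \<in> keys m \<or> w0 \<in> keys m'" by (auto simp: in_keys_iff)
  then have "w0 \<in> ?D" using w0 assms(1,2) by blast
  then obtain w where w: "w \<in> ?D" "\<And>w'. w' \<in> ?D \<Longrightarrow> r w \<le> r w'"
    using ex_has_least_nat[of "\<lambda>w. w \<in> ?D" w0 r] by blast
  have "lookup m w' = lookup m' w'" if "r w' < r w" for w'
  proof (rule ccontr)
    assume n: "lookup m w' \<noteq> lookup m' w'"
    then have "w' \<in> keys m \<or> w' \<in> keys m'" by (auto simp: in_keys_iff)
    then have "w' \<in> ?D" using n assms(1,2) by blast
    then show False using w(2) that by fastforce
  qed
  then show ?thesis using w(1) True unfolding mless_def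
    by (cases "lookup m w < lookup m' w") (auto simp: not_less_iff_gr_or_eq)
qed (auto simp: mless_def)

lemma finite_monomials: "finite {m. keys m \<subseteq> A \<and> mdeg m \<le> N}"
proof -
  have "lookup ` {m. keys m \<subseteq> A \<and> mdeg m \<le> N}
      \<subseteq> {f. \<forall>x. (x \<in> A \<longrightarrow> f x \<in> {..N}) \<and> (x \<notin> A \<longrightarrow> f x = 0)}"
  proof clarsimp
    fix m :: "'w monom" and x
    assume k: "keys m \<subseteq> A" "mdeg m \<le> N"
    have "lookup m x \<le> mdeg m" if "x \<in> A"
      unfolding mdeg_superset[OF fin k(1)] using that fin
      by (intro member_le_sum) auto
    then show "(x \<in> A \<longrightarrow> lookup m x \<le> N) \<and> (x \<notin> A \<longrightarrow> lookup m x = 0)"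
      using k by (auto simp: in_keys_iff subset_iff)
  qed
  then have "finite (lookup ` {m. keys m \<subseteq> A \<and> mdeg m \<le> N})"
    using finite_set_of_finite_funs[OF fin finite_atMost[of N], of 0] finite_subset by blast
  then show ?thesis by (rule finite_imageD) (auto intro: inj_onI poly_mapping_eqI)
qed

lemma wf_mless: "wf {(m, m'). keys m \<subseteq> A \<and> keys m' \<subseteq> A \<and> mless r m m'}"
proof (rule wf_finite_segments)
  show "irrefl {(m, m'). keys m \<subseteq> A \<and> keys m' \<subseteq> A \<and> mless r m m'}"
    by (auto simp: irrefl_def mless_irrefl)
  show "trans {(m, m'). keys m \<subseteq> A \<and> keys m' \<subseteq> A \<and> mless r m m'}"
    by (auto intro!: transI intro: mless_trans)
  fix m'
  show "finite {m. (m, m') \<in> {(m, m'). keys m \<subseteq> A \<and> keys m' \<subseteq> A \<and> mless r m m'}}"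
    by (rule finite_subset[OF _ finite_monomials[of "mdeg m'"]]) (auto simp: mless_def)
qed

lemma leading_monomial:
  assumes "finite M" "M \<noteq> {}" "\<And>m. m \<in> M \<Longrightarrow> keys m \<subseteq> A"
  shows "\<exists>m\<in>M. \<forall>m'\<in>M. m' \<noteq> m \<longrightarrow> mless r m' m"
  using assms
proof (induction M rule: finite_ne_induct)
  case (insert x M)
  then obtain m where m: "m \<in> M" "\<And>m'. m' \<in> M \<Longrightarrow> m' \<noteq> m \<Longrightarrow> mless r m' m" by blast
  have "x \<noteq> m" using m(1) insert.hyps by blast
  then consider "mless r x m" | "mless r m x" using mless_total[of x m] insert.prems m(1) by auto
  then show ?case
  proof cases
    case 1
    then show ?thesis using m by (intro bexI[of _ m]) auto
  next
    case 2
    have "mless r m' x" if "m' \<in> M" for m'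
      using mless_trans[of m x m'] m insert.prems 2 that by (cases "m' = m") auto
    then show ?thesis by (intro bexI[of _ x]) auto
  qed
qed auto

end

lemma nondecreasing_subsequence:
  fixes g :: "nat \<Rightarrow> nat"
  shows "\<exists>s :: nat \<Rightarrow> nat. strict_mono s \<and> (\<forall>i j. i \<le> j \<longrightarrow> g (s i) \<le> g (s j))"
proof -
  obtain s where "strict_mono s \<and> monoseq (\<lambda>n. g (s n))" using seq_monosub[of g] by (elim exE)
  then have s: "strict_mono s" "monoseq (\<lambda>n. g (s n))" by simp_all
  from s(2) consider "\<forall>m. \<forall>n\<ge>m. g (s m) \<le> g (s n)" | "\<forall>m. \<forall>n\<ge>m. g (s n) \<le> g (s m)"
    unfolding monoseq_def by blast
  then show ?thesis
  proof cases
    case 1 then show ?thesis using s(1) by blast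
  next
    case 2
    obtain k where k: "\<And>n. g (s k) \<le> g (s n)"
      using ex_has_least_nat[of "\<lambda>_. True" 0 "\<lambda>n. g (s n)"] by auto
    have "g (s (k + i)) = g (s k)" for i using k[of "k + i"] 2 by (simp add: le_antisym)
    moreover have "strict_mono (\<lambda>i. s (k + i))" using s(1) by (simp add: strict_mono_def)
    ultimately show ?thesis by (intro exI[of _ "\<lambda>i. s (k + i)"]) auto
  qed
qed

lemma dickson_subsequence:
  fixes f :: "nat \<Rightarrow> 'w \<Rightarrow> nat"
  assumes "finite A"
  shows "\<exists>s :: nat \<Rightarrow> nat. strict_mono s \<and> (\<forall>w\<in>A. \<forall>i j. i \<le> j \<longrightarrow> f (s i) w \<le> f (s j) w)"
  using assms
proof (induction A rule: finite_induct)
  case empty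
  show ?case by (intro exI[of _ "\<lambda>n. n"]) (auto simp: strict_mono_def)
next
  case (insert x A)
  then obtain s :: "nat \<Rightarrow> nat" where s: "strict_mono s" "\<forall>w\<in>A. \<forall>i j. i \<le> j \<longrightarrow> f (s i) w \<le> f (s j) w"
    by (elim exE conjE) (rule that)
  obtain t :: "nat \<Rightarrow> nat" where t: "strict_mono t" "\<forall>i j. i \<le> j \<longrightarrow> f (s (t i)) x \<le> f (s (t j)) x"
    using nondecreasing_subsequence[of "\<lambda>n. f (s n) x"] by (elim exE conjE) (rule that)
  have "strict_mono (\<lambda>n. s (t n))" using s(1) t(1) by (simp add: strict_mono_def)
  then show ?case using s(2) t
    by (intro exI[of _ "\<lambda>n. s (t n)"]) (auto simp: strict_mono_less_eq)
qed

lemma dickson: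
  fixes m :: "nat \<Rightarrow> 'w monom"
  assumes "finite A" "\<And>n. keys (m n) \<subseteq> A"
  shows "\<exists>i j. i < j \<and> mdvd (m i) (m j)"
proof -
  obtain s :: "nat \<Rightarrow> nat" where s: "strict_mono s" and
    le: "\<forall>w\<in>A. \<forall>i j. i \<le> j \<longrightarrow> lookup (m (s i)) w \<le> lookup (m (s j)) w"
    using dickson_subsequence[OF assms(1), of "\<lambda>n. lookup (m n)"] by (elim exE conjE) (rule that)
  have "mdvd (m (s 0)) (m (s 1))"
  proof (rule mdvdI)
    fix w
    show "lookup (m (s 0)) w \<le> lookup (m (s 1)) w"
    proof (cases "w \<in> A")
      case False
      then have "w \<notin> keys (m (s 0))" using assms(2)[of "s 0"] by blast
      then show ?thesis by (simp add: in_keys_iff)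
    qed (use le in simp)
  qed
  moreover have "s 0 < s 1" using s by (simp add: strict_mono_def)
  ultimately show ?thesis by blast
qed

lemma dickson_generators:
  fixes T :: "'w monom set"
  assumes "finite A" "\<And>m. m \<in> T \<Longrightarrow> keys m \<subseteq> A"
  shows "\<exists>F\<subseteq>T. finite F \<and> (\<forall>m\<in>T. \<exists>\<mu>\<in>F. mdvd \<mu> m)"
proof (intro exI[of _ "{m \<in> T. \<forall>\<mu>\<in>T. mdvd \<mu> m \<longrightarrow> \<mu> = m}"] conjI ballI)
  let ?F = "{m \<in> T. \<forall>\<mu>\<in>T. mdvd \<mu> m \<longrightarrow> \<mu> = m}"
  show "finite ?F"
  proof (rule ccontr)
    assume "infinite ?F"
    then obtain f :: "nat \<Rightarrow> 'w monom" where f: "inj f" "range f \<subseteq> ?F"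
      using infinite_countable_subset by blast
    have fF: "f n \<in> ?F" for n using f(2) by blast
    then have fA: "keys (f n) \<subseteq> A" for n using assms(2) by blast
    obtain i j where ij: "i < j" "mdvd (f i) (f j)"
      using dickson[OF assms(1), of f, OF fA] by (elim exE conjE) (rule that)
    then have "f i = f j" using fF[of i] fF[of j] by simp
    then show False using f(1) ij(1) by (simp add: inj_eq)
  qed
  fix m assume "m \<in> T"
  then show "\<exists>\<mu>\<in>?F. mdvd \<mu> m"
  proof (induction "mdeg m" arbitrary: m rule: less_induct)
    case (less m)
    show ?case
    proof (cases "m \<in> ?F")
      case True
      then show ?thesis using mdvd_refl by (rule_tac x = m in bexI)
    next
      case False
      then obtain \<nu> where \<nu>: "\<nu> \<in> T" "mdvd \<nu> m" "\<nu> \<noteq> m" using less.prems by auto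
      obtain n where n: "m = \<nu> + n" using \<nu>(2) unfolding mdvd_def by (elim exE) (rule that)
      have "mdeg n \<noteq> 0"
      proof
        assume "mdeg n = 0"
        then have "n = 0" by (intro poly_mapping_eqI) (auto simp: mdeg_def not_in_keys_iff_lookup_eq_zero)
        then show False using \<nu>(3) n by simp
      qed
      then have "mdeg \<nu> < mdeg m" by (simp add: n mdeg_add)
      from less.hyps[OF this \<nu>(1)] obtain \<mu> where \<mu>: "\<mu> \<in> ?F" "mdvd \<mu> \<nu>" by (elim bexE) (rule that)
      obtain n' where "\<nu> = \<mu> + n'" using \<mu>(2) unfolding mdvd_def by (elim exE) (rule that)
      then have "mdvd \<mu> m" unfolding mdvd_def n by (intro exI[of _ "n' + n"]) (simp add: add.assoc)
      then show ?thesis using \<mu>(1) by (rule_tac x = \<mu> in bexI)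
    qed
  qed
qed auto

lemma lookup_single_mult:
  "lookup (single n c * (f :: ('w, 'k::field) mpoly)) (n + m)
     = c * lookup f m"
proof -
  have "single n c * f
      = (\<Sum>m\<in>keys f. single (n + m) (c * lookup f m))"
    by (subst (1) mpoly_sum_single[of f]) (simp add: sum_distrib_left mult_single)
  then show ?thesis
    by (auto simp: lookup_sum lookup_single when_def in_keys_iff)
qed

lemma keys_single_mult:
  "keys (single n c * (f :: ('w, 'k::field) mpoly)) \<subseteq> (+) n ` keys f"
  using keys_mult[of "single n c" f] by (auto split: if_splits)

lemma keys_diff_subset: "keys (f - g :: ('w, 'k::field) mpoly) \<subseteq> keys f \<union> keys g"
  by (auto simp: in_keys_iff lookup_minus)

text \<open>
  Hilbert's basis theorem, in the form that no infinite sequence of polynomials in finitely many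
  variables has every member outside the ideal generated by the earlier ones. From a counterexample,
  pick in each step of the chain of ideals a new element with minimal leading monomial: by
  minimality no earlier leading monomial divides it, contradicting Dickson's lemma.
\<close>

lemma hilbert_chain:
  fixes q :: "nat \<Rightarrow> ('w, 'k::field) mpoly"
  assumes "finite A" "\<And>j m. m \<in> keys (q j) \<Longrightarrow> keys m \<subseteq> A"
  shows "\<exists>N c. q N = (\<Sum>j<N. c j * q j)"
proof (rule ccontr)
  assume contr: "\<not> ?thesis"
  obtain r :: "'w \<Rightarrow> nat" where r: "inj_on r A"
    using finite_imp_inj_to_nat_seg[OF assms(1)] by auto
  interpret monomial_order r A using r assms(1) by unfold_locales
  define PA :: "('w, 'k) mpoly set" where "PA = {p. \<forall>m\<in>keys p. keys m \<subseteq> A}"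
  have PA_add: "p \<in> PA \<Longrightarrow> p' \<in> PA \<Longrightarrow> p + p' \<in> PA" for p p'
    unfolding PA_def using Poly_Mapping.keys_add[of p p'] by blast
  have PA_mult: "p * p' \<in> PA" if p: "p \<in> PA" "p' \<in> PA" for p p'
  proof -
    have "keys m \<subseteq> A" if m: "m \<in> keys (p * p')" for m
    proof -
      obtain a b where ab: "m = a + b" "a \<in> keys p" "b \<in> keys p'"
        using m keys_mult[of p p'] by blast
      then show ?thesis using p Poly_Mapping.keys_add[of a b] unfolding PA_def by blast
    qed
    then show ?thesis unfolding PA_def by blast
  qed
  have PA0: "0 \<in> PA" by (simp add: PA_def)
  have qPA: "q j \<in> PA" for j using assms(2) unfolding PA_def by blast
  define I where "I n = {\<Sum>j<n. c j * q j | c. \<forall>j. c j \<in> PA}" for n :: nat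
  have I0: "0 \<in> I n" for n
    unfolding I_def by (intro CollectI exI[of _ "\<lambda>_. 0"]) (simp add: PA0)
  have I_add: "f + g \<in> I n" if fg: "f \<in> I n" "g \<in> I n" for f g n
  proof -
    obtain c c' where "f = (\<Sum>j<n. c j * q j)" "g = (\<Sum>j<n. c' j * q j)" "\<forall>j. c j \<in> PA" "\<forall>j. c' j \<in> PA"
      using fg unfolding I_def by blast
    then show ?thesis unfolding I_def
      by (intro CollectI exI[of _ "\<lambda>j. c j + c' j"]) (simp add: PA_add distrib_right sum.distrib)
  qed
  have I_mult: "p * f \<in> I n" if f: "f \<in> I n" "p \<in> PA" for f p n
  proof -
    obtain c where "f = (\<Sum>j<n. c j * q j)" "\<forall>j. c j \<in> PA" using f(1) unfolding I_def by blast
    then show ?thesis unfolding I_def using f(2)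
      by (intro CollectI exI[of _ "\<lambda>j. p * c j"]) (simp add: PA_mult sum_distrib_left mult.assoc)
  qed
  have I_Suc: "f \<in> I (Suc n)" if f: "f \<in> I n" for f n
  proof -
    obtain c where "f = (\<Sum>j<n. c j * q j)" "\<forall>j. c j \<in> PA" using f unfolding I_def by blast
    then show ?thesis unfolding I_def
      by (intro CollectI exI[of _ "\<lambda>j. if j < n then c j else 0"]) (simp add: PA0)
  qed
  have I_mono: "f \<in> I i \<Longrightarrow> i \<le> j \<Longrightarrow> f \<in> I j" for f i j
    by (induction j) (auto simp: le_Suc_eq I_Suc)
  have one: "1 \<in> PA" by (auto simp: PA_def)
  have I_new: "q n \<in> I (Suc n) - I n" for n
  proof
    show "q n \<in> I (Suc n)" unfolding I_def
      by (intro CollectI exI[of _ "\<lambda>j. if j = n then 1 else 0"]) (simp add: one PA0)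
    show "q n \<notin> I n" using contr unfolding I_def by blast
  qed
  have I_PA: "f \<in> PA" if f: "f \<in> I n" for f n
  proof -
    obtain c where c: "f = (\<Sum>j<n. c j * q j)" "\<forall>j. c j \<in> PA" using f unfolding I_def by blast
    have "(\<Sum>j<n. c j * q j) \<in> PA" by (induction n) (auto intro!: PA_add PA_mult simp: PA0 c qPA)
    then show ?thesis using c by simp
  qed
  define lm where "lm f m \<longleftrightarrow> m \<in> keys f \<and> (\<forall>m'\<in>keys f. m' \<noteq> m \<longrightarrow> mless r m' m)"
    for f :: "('w, 'k) mpoly" and m
  have ex_lm: "\<exists>m. lm f m" if "f \<in> PA" "f \<noteq> 0" for f
    using leading_monomial[of "keys f"] that unfolding lm_def PA_def by auto
  have "\<exists>m. (\<exists>f\<in>I (Suc n) - I n. lm f m) \<and>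
       (\<forall>m'. mless r m' m \<longrightarrow> \<not> (\<exists>f\<in>I (Suc n) - I n. lm f m'))" for n
  proof -
    let ?Q = "{m. \<exists>f\<in>I (Suc n) - I n. lm f m}"
    have keysA: "keys m \<subseteq> A" if "m \<in> ?Q" for m
      using that I_PA unfolding lm_def PA_def by blast
    have "q n \<in> PA" "q n \<noteq> 0" using qPA I_new[of n] I0[of n] by auto
    then obtain m0 where m0: "m0 \<in> ?Q" using ex_lm[of "q n"] I_new[of n] by blast
    obtain m where m: "m \<in> ?Q"
      "\<forall>m'. (m', m) \<in> {(m, m'). keys m \<subseteq> A \<and> keys m' \<subseteq> A \<and> mless r m m'} \<longrightarrow> m' \<notin> ?Q"
      using wf_mless[unfolded wf_eq_minimal, rule_format, of m0 ?Q, OF m0] by (elim bexE) (rule that)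
    have "\<not> (\<exists>f\<in>I (Suc n) - I n. lm f m')" if "mless r m' m" for m'
      using m(2) keysA[OF m(1)] keysA[of m'] that by blast
    then show ?thesis using m(1) by blast
  qed
  then obtain m where m: "\<And>n. \<exists>f\<in>I (Suc n) - I n. lm f (m n)"
    "\<And>n m'. mless r m' (m n) \<Longrightarrow> \<not> (\<exists>f\<in>I (Suc n) - I n. lm f m')" by metis
  obtain f where "\<forall>n. f n \<in> I (Suc n) - I n \<and> lm (f n) (m n)"
    using choice[of "\<lambda>n g. g \<in> I (Suc n) - I n \<and> lm g (m n)"] m(1) by blast
  then have f: "\<And>n. f n \<in> I (Suc n) - I n" "\<And>n. lm (f n) (m n)" by simp_all
  have mA: "keys (m n) \<subseteq> A" for n using f I_PA[of "f n" "Suc n"] unfolding lm_def PA_def by blast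
  obtain i j where ij: "i < j" "mdvd (m i) (m j)"
    using dickson[OF assms(1), of m, OF mA] by (elim exE conjE) (rule that)
  then obtain n where n: "m j = n + m i" unfolding mdvd_def by (metis add.commute)
  define c where "c = lookup (f j) (m j) / lookup (f i) (m i)"
  define g where "g = single n c * f i"
  have nz: "lookup (f i) (m i) \<noteq> 0" using f(2)[of i] unfolding lm_def by (simp add: in_keys_iff)
  have "keys n \<subseteq> keys (m j)" unfolding n by (auto simp: in_keys_iff lookup_add)
  then have "single n c \<in> PA" using mA[of j] by (auto simp: PA_def)
  moreover have "f i \<in> I j" using f(1)[of i] I_mono[of "f i" "Suc i" j] ij(1) by auto
  ultimately have gI: "g \<in> I j" unfolding g_def by (rule I_mult[rotated])
  have m1: "-1 \<in> PA" by (auto simp: PA_def in_keys_iff lookup_one when_def split: if_splits)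
  have "f j - g \<in> I (Suc j)"
    using I_add[of "f j" "Suc j" "(-1) * g"] f(1)[of j] I_mult[OF I_Suc[OF gI] m1] by simp
  moreover have "f j - g \<notin> I j"
  proof
    assume "f j - g \<in> I j"
    from I_add[OF this gI] f(1)[of j] show False by simp
  qed
  ultimately have new: "f j - g \<in> I (Suc j) - I j" by blast
  have "f j - g \<noteq> 0"
  proof
    assume "f j - g = 0"
    then show False using new I0[of j] by simp
  qed
  then obtain m' where m': "lm (f j - g) m'" using ex_lm[of "f j - g"] new I_PA by blast
  have "lookup (f j - g) (m j) = 0"
    unfolding lookup_minus g_def n lookup_single_mult using nz by (simp add: c_def n)
  then have ne: "m' \<noteq> m j" using m' unfolding lm_def by (auto simp: in_keys_iff)
  have "m' \<in> keys (f j) \<union> keys g" using m' keys_diff_subset[of "f j" g] unfolding lm_def by blast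
  then have "mless r m' (m j)"
  proof
    assume "m' \<in> keys (f j)"
    then show ?thesis using f(2)[of j] ne unfolding lm_def by blast
  next
    assume "m' \<in> keys g"
    then obtain b where b: "m' = n + b" "b \<in> keys (f i)" using keys_single_mult unfolding g_def by blast
    then have "b \<noteq> m i" using ne n by auto
    then show ?thesis using f(2)[of i] b unfolding lm_def n by (auto intro: mless_add)
  qed
  then show False using m(2) new m' by blast
qed

section \<open>Noetherian induction on closed cones\<close>

text \<open>
  Zariski closed cones in the affine space with coordinates \<open>I\<close>. The second predicate is irreducibility,
  in the form that two non-empty basic open subsets meet.
\<close>

definition hclosed :: "'i set \<Rightarrow> ('i \<Rightarrow> 'k::field) set \<Rightarrow> bool" where
  "hclosed I Z \<longleftrightarrow> (\<exists>\<F>. (\<forall>f\<in>\<F>. \<exists>e. hfun e f) \<and> Z = {a. (\<forall>i. i \<notin> I \<longrightarrow> a i = 0) \<and> (\<forall>f\<in>\<F>. f a = 0)})"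

definition irred :: "('i \<Rightarrow> 'k::field) set \<Rightarrow> bool" where
  "irred Z \<longleftrightarrow> Z \<noteq> {} \<and> (\<forall>e f e' g. hfun e f \<longrightarrow> hfun e' g \<longrightarrow> (\<exists>a\<in>Z. f a \<noteq> 0) \<longrightarrow> (\<exists>a\<in>Z. g a \<noteq> 0)
     \<longrightarrow> (\<exists>a\<in>Z. f a \<noteq> 0 \<and> g a \<noteq> 0))"

lemma hclosed_Int:
  assumes "hclosed I Z" "hfun e f"
  shows "hclosed I {a \<in> Z. f a = 0}"
proof -
  obtain \<F> where "\<forall>f\<in>\<F>. \<exists>e. hfun e f" "Z = {a. (\<forall>i. i \<notin> I \<longrightarrow> a i = 0) \<and> (\<forall>f\<in>\<F>. f a = 0)}"
    using assms(1) unfolding hclosed_def by blast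
  then show ?thesis unfolding hclosed_def using assms(2) by (intro exI[of _ "insert f \<F>"]) auto
qed

lemma hclosed_space: "hclosed I {a. \<forall>i. i \<notin> I \<longrightarrow> a i = 0}"
  unfolding hclosed_def by (intro exI[of _ "{}"]) auto

text \<open>
  A properly decreasing sequence of closed cones provides, in each step, a form that vanishes on the next
  cone and not on the present one; no such form is a combination of the earlier ones, against the
  ascending chain condition.
\<close>

lemma wf_hclosed:
  assumes "finite (I :: 'i set)"
  shows "wf {(Z', Z :: ('i \<Rightarrow> 'k::field) set). hclosed I Z' \<and> hclosed I Z \<and> Z' \<subset> Z}"
  unfolding wf_iff_no_infinite_down_chain
proof
  assume "\<exists>Z. \<forall>n. (Z (Suc n), Z n) \<in> {(Z', Z :: ('i \<Rightarrow> 'k) set). hclosed I Z' \<and> hclosed I Z \<and> Z' \<subset> Z}"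
  then obtain Z :: "nat \<Rightarrow> ('i \<Rightarrow> 'k) set" where Z: "\<And>n. hclosed I (Z n)" "\<And>n. Z (Suc n) \<subset> Z n" by blast
  have "\<exists>a p. a \<in> Z n \<and> eval_at a p \<noteq> 0 \<and> (\<forall>b\<in>Z (Suc n). eval_at b p = 0)" for n
  proof -
    obtain a where a: "a \<in> Z n" "a \<notin> Z (Suc n)" using Z(2)[of n] by blast
    obtain \<F> where F: "\<forall>f\<in>\<F>. \<exists>e. hfun e f"
      "Z (Suc n) = {a. (\<forall>i. i \<notin> I \<longrightarrow> a i = 0) \<and> (\<forall>f\<in>\<F>. f a = 0)}"
      using Z(1)[of "Suc n"] unfolding hclosed_def by blast
    have "\<forall>i. i \<notin> I \<longrightarrow> a i = 0" using a(1) Z(1)[of n] unfolding hclosed_def by blast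
    then obtain f where f: "f \<in> \<F>" "f a \<noteq> 0" using a(2) F(2) by blast
    then obtain p where "f = (\<lambda>a. eval_at a p)" using F(1) unfolding hfun_def by blast
    then show ?thesis using f a(1) F(2) by (intro exI[of _ a] exI[of _ p]) auto
  qed
  then obtain a p where ap: "\<And>n. a n \<in> Z n" "\<And>n. eval_at (a n) (p n) \<noteq> 0"
    "\<And>n b. b \<in> Z (Suc n) \<Longrightarrow> eval_at b (p n) = 0" by metis
  have sub: "Z (Suc n) \<subseteq> Z n" for n using Z(2)[of n] by (rule psubset_imp_subset)
  have mono: "Z j \<subseteq> Z i" if "i \<le> j" for i j
    using sub that by (rule lift_Suc_antimono_le)
  have supp: "b i = 0" if "b \<in> Z n" "i \<notin> I" for b n i
    using that Z(1)[of n] unfolding hclosed_def by blast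
  define q where "q n = (\<Sum>m\<in>{m\<in>keys (p n). keys m \<subseteq> I}. single m (lookup (p n) m))" for n
  have ev: "eval_at b (q n) = eval_at b (p n)" if b: "\<And>i. i \<notin> I \<Longrightarrow> b i = 0" for b n
  proof -
    have "eval_at b (q n) = (\<Sum>m\<in>{m\<in>keys (p n). keys m \<subseteq> I}.
        lookup (p n) m * (\<Prod>i\<in>keys m. b i ^ lookup m i))"
      unfolding q_def by (simp add: peval_sum peval_single)
    also have "\<dots> = (\<Sum>m\<in>keys (p n). lookup (p n) m * (\<Prod>i\<in>keys m. b i ^ lookup m i))"
    proof (rule sum.mono_neutral_left)
      show "\<forall>m\<in>keys (p n) - {m \<in> keys (p n). keys m \<subseteq> I}.
          lookup (p n) m * (\<Prod>i\<in>keys m. b i ^ lookup m i) = 0"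
      proof
        fix m assume "m \<in> keys (p n) - {m \<in> keys (p n). keys m \<subseteq> I}"
        then obtain i where "i \<in> keys m" "i \<notin> I" by blast
        then have "b i ^ lookup m i = 0" using b by (simp add: in_keys_iff)
        then have "(\<Prod>i\<in>keys m. b i ^ lookup m i) = 0" using \<open>i \<in> keys m\<close> by (intro prod_zero) auto
        then show "lookup (p n) m * (\<Prod>i\<in>keys m. b i ^ lookup m i) = 0" by simp
      qed
    qed auto
    finally show ?thesis by (simp add: peval_def)
  qed
  have "keys (q n) \<subseteq> {m. keys m \<subseteq> I}" for n
    unfolding q_def by (rule subset_trans[OF keys_sum]) (auto split: if_splits)
  then obtain N c where "q N = (\<Sum>j<N. c j * q j)"
    using hilbert_chain[OF assms, of q] by blast
  then have "eval_at (a N) (q N) = (\<Sum>j<N. eval_at (a N) (c j) * eval_at (a N) (q j))"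
    by (simp add: peval_sum eval_at_mult)
  also have "\<dots> = 0"
  proof (intro sum.neutral ballI)
    fix j assume "j \<in> {..<N}"
    then have "a N \<in> Z (Suc j)" using mono[of "Suc j" N] ap(1)[of N] by auto
    then have "eval_at (a N) (q j) = 0" using ap(3) ev[of "a N" j] supp by metis
    then show "eval_at (a N) (c j) * eval_at (a N) (q j) = 0" by simp
  qed
  finally show False using ap(2)[of N] ev[of "a N" N] supp[OF ap(1)] by simp
qed

text \<open>
  A property that is stable under unions holds for a closed cone if every irreducible one has it on a
  dense open subset: the complement, or the two parts of a reducible cone, are smaller.
\<close>

lemma noetherian_induct:
  fixes Z :: "('i \<Rightarrow> 'k::field) set"
  assumes fin: "finite I" and Z: "hclosed I Z"
    and empty: "Q {}" and un: "\<And>A B. Q A \<Longrightarrow> Q B \<Longrightarrow> Q (A \<union> B)"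
    and gen: "\<And>Z. hclosed I Z \<Longrightarrow> irred Z \<Longrightarrow> \<exists>e q. hfun e q \<and> (\<exists>a\<in>Z. q a \<noteq> 0) \<and> Q {a\<in>Z. q a \<noteq> 0}"
  shows "Q Z"
  using wf_hclosed[OF fin] Z
proof (induction Z rule: wf_induct_rule)
  case (less Z)
  have IH: "Q {a\<in>Z. f a = 0}" if "hfun e f" "\<exists>a\<in>Z. f a \<noteq> 0" for e and f
    using that hclosed_Int[OF less.prems, of e f] less.prems by (intro less.IH) auto
  show ?case
  proof (cases "Z = {}")
    case False
    show ?thesis
    proof (cases "irred Z")
      case True
      then obtain e q where q: "hfun e q" "\<exists>a\<in>Z. q a \<noteq> 0" "Q {a\<in>Z. q a \<noteq> 0}"
        using gen less.prems by blast
      have "Z = {a\<in>Z. q a = 0} \<union> {a\<in>Z. q a \<noteq> 0}" by blast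
      then show ?thesis using un[OF IH[OF q(1,2)] q(3)] by simp
    next
      case n: False
      then obtain e f e' g where fg: "hfun e f" "hfun e' g" "\<exists>a\<in>Z. f a \<noteq> 0" "\<exists>a\<in>Z. g a \<noteq> 0"
        "\<And>a. a \<in> Z \<Longrightarrow> f a = 0 \<or> g a = 0" using False unfolding irred_def by blast
      have "Z = {a\<in>Z. f a = 0} \<union> {a\<in>Z. g a = 0}" using fg(5) by blast
      then show ?thesis using un[OF IH[OF fg(1,3)] IH[OF fg(2,4)]] by simp
    qed
  qed (simp add: empty)
qed

section \<open>Families of monomial ideals\<close>

lemma irred_finite:
  assumes Z: "irred Z" and fin: "finite E"
    and q: "\<And>e. e \<in> E \<Longrightarrow> \<exists>d. hfun d (q e)" "\<And>e. e \<in> E \<Longrightarrow> \<exists>a\<in>Z. q e a \<noteq> 0"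
  shows "\<exists>d Q. hfun d Q \<and> (\<exists>a\<in>Z. Q a \<noteq> 0) \<and> (\<forall>a. Q a \<noteq> 0 \<longrightarrow> (\<forall>e\<in>E. q e a \<noteq> 0))"
  using fin q
proof (induction E rule: finite_induct)
  case empty
  have "\<exists>a. a \<in> Z" using Z unfolding irred_def by blast
  then show ?case by (intro exI[of _ 0] exI[of _ "\<lambda>_. 1"]) (auto simp: hfun_const)
next
  case (insert e E)
  have "\<exists>d Q. hfun d Q \<and> (\<exists>a\<in>Z. Q a \<noteq> 0) \<and> (\<forall>a. Q a \<noteq> 0 \<longrightarrow> (\<forall>e\<in>E. q e a \<noteq> 0))"
    by (rule insert.IH) (use insert.prems in auto)
  then obtain d Q where Q: "hfun d Q" "\<exists>a\<in>Z. Q a \<noteq> 0" "\<forall>a. Q a \<noteq> 0 \<longrightarrow> (\<forall>e\<in>E. q e a \<noteq> 0)"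
    by (elim exE conjE) (rule that)
  obtain d' where d': "hfun d' (q e)" using insert.prems(1)[of e] by blast
  have "\<exists>a\<in>Z. Q a \<noteq> 0 \<and> q e a \<noteq> 0"
    using Z Q(1,2) d' insert.prems(2)[of e] unfolding irred_def by blast
  then show ?case using hfun_mult[OF Q(1) d'] Q(3)
    by (intro exI[of _ "d + d'"] exI[of _ "\<lambda>a. Q a * q e a"]) auto
qed

text \<open>
  A family, depending on a parameter \<open>a\<close>, of vectors \<open>b a m\<close> indexed by the monomials \<open>m\<close>. Think of
  \<open>b a m\<close> as the class of \<open>m\<close> in the graded quotient of a polynomial ring by an ideal \<open>I\<^sub>a\<close>;
  then \<open>lead a m\<close> says that \<open>m\<close> is the leading monomial of an element of \<open>I\<^sub>a\<close>. The last assumption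
  makes the Hilbert function of the quotient independent of \<open>a\<close>.
\<close>

locale monomial_family = monomial_order r "UNIV :: 'w set" for r :: "'w::finite \<Rightarrow> nat" +
  fixes dg :: "'w monom \<Rightarrow> nat \<times> nat" and \<D> :: "(nat \<times> nat) set"
    and b :: "('i \<Rightarrow> 'k::field) \<Rightarrow> 'w monom \<Rightarrow> 'c \<Rightarrow> 'k"
  assumes finite_piece: "e \<in> \<D> \<Longrightarrow> finite {m. dg m = e}"
    and hom: "dg m \<in> \<D> \<Longrightarrow> \<exists>e. \<forall>c. hfun e (\<lambda>a. b a m c)"
    and shift: "dg m \<in> \<D> \<Longrightarrow> dg (n + m) \<in> \<D> \<Longrightarrow>
      inspan (b a) {m'. dg m' = dg m \<and> mless r m' m} (b a m) \<Longrightarrow>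
      inspan (b a) {m'. dg m' = dg (n + m) \<and> mless r m' (n + m)} (b a (n + m))"
    and fixed_span: "e \<in> \<D> \<Longrightarrow> \<exists>B\<subseteq>{m. dg m = e}. \<forall>a a'.
      (\<forall>m\<in>B. b a m = b a' m) \<and> (\<forall>m. dg m = e \<longrightarrow> inspan (b a) B (b a m))"
begin

definition lead :: "('i \<Rightarrow> 'k) \<Rightarrow> 'w monom \<Rightarrow> bool" where
  "lead a m \<longleftrightarrow> inspan (b a) {m'. dg m' = dg m \<and> mless r m' m} (b a m)"

definition std :: "('i \<Rightarrow> 'k) \<Rightarrow> nat \<times> nat \<Rightarrow> 'w monom set" where
  "std a e = {m. dg m = e \<and> \<not> lead a m}"

lemma finite_std: "e \<in> \<D> \<Longrightarrow> finite (std a e)"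
  using finite_piece by (rule finite_subset[rotated]) (auto simp: std_def)

lemma indep_std:
  assumes "e \<in> \<D>" "D \<subseteq> std a e"
  shows "indep (b a) D"
proof (rule ccontr)
  assume "\<not> indep (b a) D"
  then obtain t x where t: "\<forall>c. (\<Sum>m\<in>D. t m * b a m c) = 0" "x \<in> D" "t x \<noteq> 0"
    unfolding indep_def by blast
  have finD: "finite D" using finite_std[OF assms(1)] assms(2) finite_subset by blast
  let ?M = "{m\<in>D. t m \<noteq> 0}"
  have "finite ?M" "?M \<noteq> {}" using finD t by auto
  then obtain m where m: "m \<in> ?M" "\<forall>m'\<in>?M. m' \<noteq> m \<longrightarrow> mless r m' m"
    using leading_monomial[of ?M] by blast
  have "b a m c = (\<Sum>m'\<in>?M - {m}. (- t m' / t m) * b a m' c)" for c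
  proof -
    have "0 = (\<Sum>m\<in>?M. t m * b a m c)"
      using t(1) finD by (subst sum.mono_neutral_left[of D]) auto
    also have "\<dots> = t m * b a m c + (\<Sum>m'\<in>?M - {m}. t m' * b a m' c)"
      using m(1) \<open>finite ?M\<close> by (intro sum.remove) auto
    finally have "t m * b a m c = - (\<Sum>m'\<in>?M - {m}. t m' * b a m' c)"
      by (simp add: eq_neg_iff_add_eq_0)
    moreover have "b a m c = t m * b a m c / t m" using m(1) by simp
    ultimately have "b a m c = - (\<Sum>m'\<in>?M - {m}. t m' * b a m' c) / t m" by simp
    then show ?thesis by (simp add: sum_divide_distrib sum_negf)
  qed
  then have "inspan (b a) (?M - {m}) (b a m)" unfolding inspan_def by (intro exI allI)
  moreover have "finite {m'. dg m' = dg m \<and> mless r m' m}"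
    using finite_piece[OF assms(1)] m(1) assms(2)
    by (intro finite_subset[OF _ finite_piece[OF assms(1)]]) (auto simp: std_def)
  moreover have "?M - {m} \<subseteq> {m'. dg m' = dg m \<and> mless r m' m}"
    using m assms(2) by (auto simp: std_def)
  ultimately have "lead a m" unfolding lead_def by (metis (no_types, lifting) inspan_mono)
  then show False using m(1) assms(2) by (auto simp: std_def)
qed

text \<open>
  Leading monomials are rewritten in terms of smaller ones until only standard monomials are left.
\<close>

lemma std_spans:
  assumes "dg m \<in> \<D>"
  shows "inspan (b a) {m' \<in> std a (dg m). m' = m \<or> mless r m' m} (b a m)"
  using assms
proof (induction m rule: wf_induct_rule[OF wf_mless])
  case (1 m)
  let ?S = "{m' \<in> std a (dg m). m' = m \<or> mless r m' m}"
  have fin: "finite ?S" using finite_std[OF "1.prems"] by simp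
  show ?case
  proof (cases "lead a m")
    case True
    show ?thesis
    proof (rule inspan_trans[OF _ True[unfolded lead_def]])
      fix x assume x: "x \<in> {m'. dg m' = dg m \<and> mless r m' m}"
      then have "inspan (b a) {m' \<in> std a (dg x). m' = x \<or> mless r m' x} (b a x)"
        using "1.prems" by (intro "1.IH") auto
      moreover have "{m' \<in> std a (dg x). m' = x \<or> mless r m' x} \<subseteq> ?S"
        using x mless_trans[of x m] by auto
      ultimately show "inspan (b a) ?S (b a x)" by (rule inspan_mono[OF fin, rotated])
    qed
  next
    case False
    then show ?thesis using fin by (intro inspan_mem) (auto simp: std_def)
  qed
qed

text \<open>
  The piece is spanned by vectors that do not depend on the parameter, so its dimension does not either,
  and the standard monomials are a basis of it.
\<close>

lemma std_card:
  assumes e: "e \<in> \<D>"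
  shows "card (std a e) \<le> card (std a' e)"
proof -
  obtain B where B: "B \<subseteq> {m. dg m = e}" "\<And>a a' m. m \<in> B \<Longrightarrow> b a m = b a' m"
    "\<And>a m. dg m = e \<Longrightarrow> inspan (b a) B (b a m)"
    using fixed_span[OF e] by blast
  have finB: "finite B" using B(1) finite_piece[OF e] finite_subset by blast
  obtain T where T: "T \<subseteq> B" "indep (b a) T" "\<forall>x\<in>B. inspan (b a) T (b a x)"
    using maximal_indep[OF finB] by blast
  have finT: "finite T" using T(1) finB finite_subset by blast
  have "card (std a e) \<le> card T"
  proof (rule indep_card_le[OF indep_std[OF e order_refl] finite_std[OF e] finT])
    fix x assume "x \<in> std a e"
    then have "inspan (b a) B (b a x)" using B(3) by (auto simp: std_def)
    then show "inspan (b a) T (b a x)" using T(3) inspan_trans[of B "b a" T "b a"] by blast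
  qed
  also have "card T \<le> card (std a' e)"
  proof (rule indep_card_le[OF T(2) finT finite_std[OF e]])
    fix x assume x: "x \<in> T"
    then have d: "dg x = e" using T(1) B(1) by blast
    have "inspan (b a') (std a' e) (b a' x)"
      using std_spans[of x a'] e d finite_std[OF e] by (intro inspan_mono[of "std a' e"]) auto
    then show "inspan (b a') (std a' e) (b a x)" using B(2)[of x a a'] x T(1) by auto
  qed
  finally show ?thesis .
qed

text \<open>
  Going up in the order, whether the next monomial is a leading one depends only on its relation to the
  standard monomials found so far. It is standard on an open set; if that set is empty, it is a
  leading monomial everywhere.
\<close>

lemma std_generic_piece:
  assumes e: "e \<in> \<D>" and Z: "Z \<noteq> {}" and "finite D" "D \<subseteq> {m. dg m = e}"
    "\<And>m m'. m \<in> D \<Longrightarrow> dg m' = e \<Longrightarrow> mless r m' m \<Longrightarrow> m' \<in> D"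
  shows "\<exists>d q T. hfun d q \<and> (\<exists>a\<in>Z. q a \<noteq> 0) \<and> (\<forall>a\<in>Z. q a \<noteq> 0 \<longrightarrow> std a e \<inter> D = T)"
  using assms(3-)
proof (induction "card D" arbitrary: D)
  case 0
  then have "D = {}" by simp
  then show ?case using Z
    by (intro exI[of _ 0] exI[of _ "\<lambda>_. 1"] exI[of _ "{}"]) (auto simp: hfun_const)
next
  case (Suc k D)
  then have "D \<noteq> {}" by auto
  then obtain m where m: "m \<in> D" "\<And>m'. m' \<in> D \<Longrightarrow> m' \<noteq> m \<Longrightarrow> mless r m' m"
    using leading_monomial[of D] Suc.prems(1) by blast
  let ?D = "D - {m}"
  have dm: "dg m = e" using m(1) Suc.prems(2) by blast
  have below: "{m'. dg m' = dg m \<and> mless r m' m} = ?D"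
    using m Suc.prems(2,3) dm mless_irrefl by blast
  have below_D: "m' \<in> ?D" if "x \<in> ?D" "dg m' = e" "mless r m' x" for x m'
  proof -
    have "mless r m' m" using that m(2)[of x] mless_trans[of x m m'] by auto
    then show ?thesis using that Suc.prems(3)[of x m'] mless_irrefl by blast
  qed
  have "\<exists>d q T. hfun d q \<and> (\<exists>a\<in>Z. q a \<noteq> 0) \<and> (\<forall>a\<in>Z. q a \<noteq> 0 \<longrightarrow> std a e \<inter> ?D = T)"
  proof (rule Suc.hyps(1))
    show "k = card ?D" using Suc.hyps(2) m(1) Suc.prems(1) by simp
    show "finite ?D" "?D \<subseteq> {m. dg m = e}" using Suc.prems(1,2) by auto
  qed (rule below_D)
  then obtain d q T where q: "hfun d q" "\<exists>a\<in>Z. q a \<noteq> 0"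
    and q': "\<forall>a\<in>Z. q a \<noteq> 0 \<longrightarrow> std a e \<inter> ?D = T"
    by (elim exE conjE) (rule that)
  have q3: "std a e \<inter> ?D = T" if "a \<in> Z" "q a \<noteq> 0" for a using q' that by blast
  obtain a1 where a1: "a1 \<in> Z" "q a1 \<noteq> 0" using q(2) by blast
  have T: "finite T" "m \<notin> T" using q3[OF a1] Suc.prems(1) finite_subset[of T D] by auto
  have lead: "lead a m \<longleftrightarrow> inspan (b a) T (b a m)" if a: "a \<in> Z" "q a \<noteq> 0" for a
  proof
    assume "lead a m"
    then have D: "inspan (b a) ?D (b a m)" unfolding lead_def below .
    have TD: "inspan (b a) T (b a x)" if x: "x \<in> ?D" for x
    proof -
      have dx: "dg x = e" using x Suc.prems(2) by blast
      have sub: "{m' \<in> std a (dg x). m' = x \<or> mless r m' x} \<subseteq> T"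
        unfolding q3[OF a, symmetric] dx
      proof
        fix y assume y: "y \<in> {m' \<in> std a e. m' = x \<or> mless r m' x}"
        then have "y = x \<or> mless r y m" using m(2)[of x] x mless_trans[of x m y] by auto
        then show "y \<in> std a e \<inter> ?D" using y x below dm by (auto simp: std_def)
      qed
      show ?thesis by (rule inspan_mono[OF T(1) sub std_spans]) (simp add: dx e)
    qed
    show "inspan (b a) T (b a m)" by (rule inspan_trans[OF TD D])
  next
    assume "inspan (b a) T (b a m)"
    then have "inspan (b a) ?D (b a m)"
      using q3[OF a] Suc.prems(1) inspan_mono[of ?D T "b a" "b a m"] by blast
    then show "lead a m" unfolding lead_def below .
  qed
  have split: "std a e \<inter> D = (if lead a m then T else insert m T)" if "a \<in> Z" "q a \<noteq> 0" for a
    using q3[OF that] m(1) dm by (auto simp: std_def)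
  show ?case
  proof (cases "\<exists>a\<in>Z. q a \<noteq> 0 \<and> \<not> lead a m")
    case True
    then obtain a0 where a0: "a0 \<in> Z" "q a0 \<noteq> 0" "\<not> lead a0 m" by blast
    have "indep (b a0) T"
      using q3[OF a0(1,2)] by (intro indep_std[OF e]) auto
    then have i0: "indep (b a0) (insert m T)" using indep_insert[OF T] lead[OF a0(1,2)] a0(3) by blast
    have "\<exists>ee. \<forall>x\<in>insert m T. \<forall>c. hfun (ee x) (\<lambda>a. b a x c)"
    proof (rule bchoice, rule ballI)
      fix x assume "x \<in> insert m T"
      then have "dg x = e" using q3[OF a0(1,2)] dm by (auto simp: std_def)
      then show "\<exists>y. \<forall>c. hfun y (\<lambda>a. b a x c)" using hom[of x] e by simp
    qed
    then obtain ee where ee: "\<And>x c. x \<in> insert m T \<Longrightarrow> hfun (ee x) (\<lambda>a. b a x c)" by blast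
    have fi: "finite (insert m T)" using T(1) by simp
    obtain d' q' where q': "hfun d' q'" "q' a0 \<noteq> 0" "\<And>a. q' a \<noteq> 0 \<Longrightarrow> indep (b a) (insert m T)"
      using indep_open[OF fi ee i0] by blast
    have "std a e \<inter> D = insert m T" if "a \<in> Z" "q a * q' a \<noteq> 0" for a
    proof -
      have a: "q a \<noteq> 0" "q' a \<noteq> 0" using that by auto
      have "indep (b a) T" using indep_subset[OF q'(3)[OF a(2)] _ fi] by blast
      then have "\<not> lead a m" using q'(3)[OF a(2)] indep_insert[OF T] lead[OF that(1) a(1)] by blast
      then show ?thesis using split[OF that(1) a(1)] by simp
    qed
    then show ?thesis using hfun_mult[OF q(1) q'(1)] a0 q'(2)
      by (intro exI[of _ "d + d'"] exI[of _ "\<lambda>a. q a * q' a"] exI[of _ "insert m T"]) auto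
  next
    case False
    then have "std a e \<inter> D = T" if "a \<in> Z" "q a \<noteq> 0" for a using split[OF that] that by auto
    then show ?thesis using q(1,2) by (intro exI[of _ d] exI[of _ q] exI[of _ T]) auto
  qed
qed

text \<open>
  The generic monomial ideal. Each graded piece is constant on a dense open set. By Dickson's lemma finitely many
  pieces contain generators of the generic ideal, so on one dense open set the ideal of leading
  monomials contains the generic one; as both have the same Hilbert function, they agree.
\<close>

theorem generic_leading_monomials:
  assumes Z: "irred Z"
  shows "\<exists>d q T F. hfun d q \<and> (\<exists>a\<in>Z. q a \<noteq> 0) \<and>
    (\<forall>a\<in>Z. q a \<noteq> 0 \<longrightarrow> {m. dg m \<in> \<D> \<and> lead a m} = T) \<and>
    finite F \<and> F \<subseteq> T \<and> (\<forall>m\<in>T. \<exists>\<mu>\<in>F. mdvd \<mu> m)"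
proof -
  have Z0: "Z \<noteq> {}" using Z unfolding irred_def by blast
  have "\<exists>d q S. hfun d q \<and> (\<exists>a\<in>Z. q a \<noteq> 0) \<and> (\<forall>a\<in>Z. q a \<noteq> 0 \<longrightarrow> std a e = S)"
    if e: "e \<in> \<D>" for e
  proof -
    have "std a e \<inter> {m. dg m = e} = std a e" for a by (auto simp: std_def)
    then show ?thesis
      using std_generic_piece[OF e Z0 finite_piece[OF e]] by simp
  qed
  then have "\<exists>z. hfun (fst z) (fst (snd z)) \<and> (\<exists>a\<in>Z. fst (snd z) a \<noteq> 0) \<and>
      (\<forall>a\<in>Z. fst (snd z) a \<noteq> 0 \<longrightarrow> std a e = snd (snd z))" if "e \<in> \<D>" for e
    using that by simp
  then have "\<exists>z. \<forall>e\<in>\<D>. hfun (fst (z e)) (fst (snd (z e))) \<and> (\<exists>a\<in>Z. fst (snd (z e)) a \<noteq> 0) \<and>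
      (\<forall>a\<in>Z. fst (snd (z e)) a \<noteq> 0 \<longrightarrow> std a e = snd (snd (z e)))"
    by (intro bchoice ballI)
  then obtain z where z: "\<forall>e\<in>\<D>. hfun (fst (z e)) (fst (snd (z e))) \<and> (\<exists>a\<in>Z. fst (snd (z e)) a \<noteq> 0) \<and>
      (\<forall>a\<in>Z. fst (snd (z e)) a \<noteq> 0 \<longrightarrow> std a e = snd (snd (z e)))" by (elim exE) (rule that)
  define d q S where "d e = fst (z e)" and "q e = fst (snd (z e))" and "S e = snd (snd (z e))" for e
  have q: "\<And>e. e \<in> \<D> \<Longrightarrow> hfun (d e) (q e)" "\<And>e. e \<in> \<D> \<Longrightarrow> \<exists>a\<in>Z. q e a \<noteq> 0"
    "\<And>e a. e \<in> \<D> \<Longrightarrow> a \<in> Z \<Longrightarrow> q e a \<noteq> 0 \<Longrightarrow> std a e = S e"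
    using z unfolding d_def q_def S_def by simp_all
  define T where "T = {m. dg m \<in> \<D> \<and> m \<notin> S (dg m)}"
  have "\<exists>F\<subseteq>T. finite F \<and> (\<forall>m\<in>T. \<exists>\<mu>\<in>F. mdvd \<mu> m)"
    by (rule dickson_generators[OF fin]) simp
  then obtain F where F: "F \<subseteq> T" "finite F" "\<forall>m\<in>T. \<exists>\<mu>\<in>F. mdvd \<mu> m" by (elim exE conjE) (rule that)
  have FD: "e \<in> \<D>" if "e \<in> dg ` F" for e using that F(1) unfolding T_def by blast
  have "\<exists>d' Q. hfun d' Q \<and> (\<exists>a\<in>Z. Q a \<noteq> 0) \<and> (\<forall>a. Q a \<noteq> 0 \<longrightarrow> (\<forall>e\<in>dg ` F. q e a \<noteq> 0))"
  proof (rule irred_finite[OF Z])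
    show "finite (dg ` F)" using F(2) by simp
    show "\<exists>d. hfun d (q e)" "\<exists>a\<in>Z. q e a \<noteq> 0" if "e \<in> dg ` F" for e
      using q(1,2)[OF FD[OF that]] by auto
  qed
  then obtain d' Q where Q: "hfun d' Q" "\<exists>a\<in>Z. Q a \<noteq> 0" and
    Q': "\<forall>a. Q a \<noteq> 0 \<longrightarrow> (\<forall>e\<in>dg ` F. q e a \<noteq> 0)" by (elim exE conjE) (rule that)
  have "{m. dg m \<in> \<D> \<and> lead a m} = T" if a: "a \<in> Z" "Q a \<noteq> 0" for a
  proof -
    have TF: "lead a m" if m: "m \<in> T" for m
    proof -
      obtain \<mu> where \<mu>: "\<mu> \<in> F" "mdvd \<mu> m" using F(3) m by blast
      obtain n where n: "m = n + \<mu>" using \<mu>(2) unfolding mdvd_def by (metis add.commute)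
      have \<mu>T: "dg \<mu> \<in> \<D>" "\<mu> \<notin> S (dg \<mu>)" using \<mu>(1) F(1) unfolding T_def by auto
      have "std a (dg \<mu>) = S (dg \<mu>)" using q(3)[OF \<mu>T(1) a(1)] Q' a(2) \<mu>(1) by blast
      then have "lead a \<mu>" using \<mu>T(2) by (auto simp: std_def)
      then show ?thesis unfolding n lead_def
        using shift[of \<mu> n a] \<mu>T(1) m by (simp add: T_def n)
    qed
    have std_eq: "std a e = S e" if e: "e \<in> \<D>" for e
    proof -
      obtain a' where a': "a' \<in> Z" "q e a' \<noteq> 0" using q(2)[OF e] by blast
      have "S e = std a' e" using q(3)[OF e a'] by simp
      then have S: "finite (S e)" "card (S e) \<le> card (std a e)" "\<And>m. m \<in> S e \<Longrightarrow> dg m = e"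
        using finite_std[OF e] std_card[OF e] by (auto simp: std_def)
      have "std a e \<subseteq> S e"
      proof
        fix m assume "m \<in> std a e"
        then show "m \<in> S e" using TF[of m] e by (auto simp: std_def T_def)
      qed
      then show ?thesis using S by (simp add: card_seteq)
    qed
    show ?thesis
    proof (rule Set.set_eqI)
      fix m show "m \<in> {m. dg m \<in> \<D> \<and> lead a m} \<longleftrightarrow> m \<in> T"
        using std_eq[of "dg m"] unfolding T_def std_def by blast
    qed
  qed
  then show ?thesis using Q(1,2) F by (intro exI[of _ d'] exI[of _ Q] exI[of _ T] exI[of _ F]) simp
qed

end

section \<open>Polynomials: constants, substitution, homogeneous components\<close>

lemma const_0 [simp]: "const 0 = 0" by (simp add: const_def)
lemma const_1 [simp]: "const 1 = 1" by (simp add: const_def)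
lemma const_add: "const (a + b) = const a + const (b :: 'k::field)" by (simp add: const_def single_add)
lemma const_mult: "const (a * b) = const a * const (b :: 'k::field)" by (simp add: const_def mult_single)
lemma const_uminus: "const (- a) = - const (a :: 'k::field)" by (simp add: const_def single_uminus)
lemma const_mult_single: "const a * single m b = single m (a * b :: 'k::field)"
  by (simp add: const_def mult_single)

lemma lookup_const_mult [simp]: "lookup (const c * f) m = c * lookup (f :: ('w, 'k::field) mpoly) m"
  using lookup_single_mult[of 0 c f m] by (simp add: const_def)

lemma subst_add: "subst h (p + q) = subst h p + subst h (q :: ('v, 'k::field) mpoly)"
  by (rule peval_add) (simp_all add: const_add)

lemma subst_mult: "subst h (p * q) = subst h p * subst h (q :: ('v, 'k::field) mpoly)"
  by (rule peval_mult) (simp_all add: const_add const_mult)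

lemma subst_sum: "subst h (\<Sum>i\<in>A. p i) = (\<Sum>i\<in>A. subst h (p i :: ('v, 'k::field) mpoly))"
  by (rule peval_sum) (simp_all add: const_add)

lemma subst_single: "subst h (single m c) = const (c :: 'k::field) * (\<Prod>i\<in>keys m. h i ^ lookup m i)"
  by (rule peval_single) simp

lemma subst_const [simp]: "subst h (const c) = const (c :: 'k::field)"
proof -
  have "subst h (single 0 c) = const c" using subst_single[of h 0 c] by simp
  then show ?thesis by (simp only: const_def)
qed

lemma subst_1 [simp]: "subst h 1 = (1 :: ('w, 'k::field) mpoly)"
  using subst_const[of h 1] by simp

lemma subst_var [simp]: "subst h (var i) = (h i :: ('w, 'k::field) mpoly)"
  by (simp add: var_def subst_single)

lemma subst_uminus: "subst h (- p) = - subst h (p :: ('v, 'k::field) mpoly)"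
  using subst_add[of h p "- p"] by (simp add: eq_neg_iff_add_eq_0 add.commute)

lemma subst_diff: "subst h (p - q) = subst h p - subst h (q :: ('v, 'k::field) mpoly)"
  using subst_add[of h p "- q"] subst_uminus[of h q] by simp

lemma subst_power: "subst h (p ^ n) = subst h (p :: ('v, 'k::field) mpoly) ^ n"
  by (induction n) (simp_all add: subst_mult)

lemma subst_prod: "subst h (\<Prod>i\<in>A. p i) = (\<Prod>i\<in>A. subst h (p i :: ('v, 'k::field) mpoly))"
  by (induction A rule: infinite_finite_induct) (simp_all add: subst_mult)

lemma subst_expand:
  "subst h p = (\<Sum>m\<in>keys p. const (lookup p m) * (\<Prod>i\<in>keys m. h i ^ lookup m i))"
  by (simp add: peval_def)

lemma subst_subst:
  "subst f (subst g p) = subst (\<lambda>i. subst f (g i)) (p :: ('v, 'k::field) mpoly)"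
  unfolding subst_expand[of g p] subst_expand[of "\<lambda>i. subst f (g i)" p]
  by (simp add: subst_sum subst_mult subst_prod subst_power)

lemma subst_ident [simp]: "subst var p = (p :: ('v, 'k::field) mpoly)"
proof -
  have "(\<Prod>i\<in>A. var i ^ f i) = (single (\<Sum>i\<in>A. single i (f i)) 1 :: ('v, 'k) mpoly)" for A f
  proof (induction A rule: infinite_finite_induct)
    case (insert x A)
    have "var x ^ n = (single (single x n) 1 :: ('v, 'k) mpoly)" for n
      by (induction n) (simp_all add: var_def mult_single single_add[symmetric])
    then show ?case using insert by (simp add: mult_single)
  qed simp_all
  then have "subst var p = (\<Sum>m\<in>keys p. single (\<Sum>i\<in>keys m. single i (lookup m i)) (lookup p m))"
    unfolding subst_expand by (simp add: const_mult_single)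
  also have "\<dots> = p"
  proof -
    have "(\<Sum>i\<in>keys m. single i (lookup m i)) = m" for m :: "'v monom"
      by (rule poly_mapping_eqI) (auto simp: lookup_sum lookup_single when_def in_keys_iff)
    then show ?thesis using mpoly_sum_single[of p] by simp
  qed
  finally show ?thesis .
qed

lemma form_one: "form 0 (1 :: ('v, 'k::field) mpoly)"
  using form_const[of "1 :: 'k"] by simp

lemma form_power: "form d p \<Longrightarrow> form (n * d) (p ^ n :: ('v, 'k::field) mpoly)"
proof (induction n)
  case 0 then show ?case by (simp add: form_one)
next
  case (Suc n) then show ?case using form_mult[of d p "n * d" "p ^ n"] by simp
qed

lemma form_prod:
  "(\<And>i. i \<in> A \<Longrightarrow> form (d i) (p i)) \<Longrightarrow> form (\<Sum>i\<in>A. d i) (\<Prod>i\<in>A. p i :: ('v, 'k::field) mpoly)"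
proof (induction A rule: infinite_finite_induct)
  case (insert x A) then show ?case by (simp add: form_mult)
qed (simp_all add: form_one)

lemma form_const_mult: "form d p \<Longrightarrow> form d (const c * p :: ('v, 'k::field) mpoly)"
  using form_mult[OF form_const, of d p c] by simp

lemma form_subst_weighted:
  assumes "\<And>i. form (w i) (h i)" "\<And>m. m \<in> keys p \<Longrightarrow> (\<Sum>i\<in>keys m. lookup m i * w i) = e"
  shows "form e (subst h p :: ('w, 'k::field) mpoly)"
  unfolding subst_expand
proof (rule form_sum)
  fix m assume "m \<in> keys p"
  have "form (\<Sum>i\<in>keys m. lookup m i * w i) (\<Prod>i\<in>keys m. h i ^ lookup m i)"
    using assms(1) by (intro form_prod form_power)
  then show "form e (const (lookup p m) * (\<Prod>i\<in>keys m. h i ^ lookup m i))"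
    using assms(2)[OF \<open>m \<in> keys p\<close>] by (intro form_const_mult) simp
qed

lemma form_subst:
  assumes "\<And>i. form d (h i)" "form e p"
  shows "form (e * d) (subst h p :: ('w, 'k::field) mpoly)"
proof (rule form_subst_weighted[of "\<lambda>_. d"])
  fix m assume "m \<in> keys p"
  then have "mdeg m = e" using assms(2) by (auto simp: form_def monoms_def)
  then show "(\<Sum>i\<in>keys m. lookup m i * d) = e * d"
    unfolding mdeg_def sum_distrib_right[symmetric] by simp
qed (rule assms(1))

lemma subst_scale:
  assumes "form e p"
  shows "subst (\<lambda>i. q * h i) p = q ^ e * subst h (p :: ('v, 'k::field) mpoly)"
  unfolding subst_expand sum_distrib_left
proof (rule sum.cong[OF refl])
  fix m assume "m \<in> keys p"
  then have "mdeg m = e" using assms by (auto simp: form_def monoms_def)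
  then show "const (lookup p m) * (\<Prod>i\<in>keys m. (q * h i) ^ lookup m i)
      = q ^ e * (const (lookup p m) * (\<Prod>i\<in>keys m. h i ^ lookup m i))"
    by (simp add: power_mult_distrib prod.distrib power_sum[symmetric] mdeg_def mult_ac)
qed

definition hcomp :: "nat \<Rightarrow> ('v, 'k::field) mpoly \<Rightarrow> ('v, 'k) mpoly" where
  "hcomp e f = (\<Sum>m\<in>{m \<in> keys f. mdeg m = e}. single m (lookup f m))"

lemma lookup_hcomp: "lookup (hcomp e f) m = (if mdeg m = e then lookup f m else 0)"
  by (auto simp: hcomp_def lookup_sum lookup_single when_def in_keys_iff)

lemma form_hcomp: "form e (hcomp e f)"
  by (auto simp: form_def monoms_def in_keys_iff lookup_hcomp split: if_splits)

lemma hcomp_add: "hcomp e (f + g) = hcomp e f + hcomp e g"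
  by (rule poly_mapping_eqI) (simp add: lookup_hcomp lookup_add)

lemma hcomp_zero [simp]: "hcomp e 0 = 0"
  by (rule poly_mapping_eqI) (simp add: lookup_hcomp)

lemma hcomp_diff: "hcomp e (f - g) = hcomp e f - hcomp e g"
  by (rule poly_mapping_eqI) (simp add: lookup_hcomp lookup_minus)

lemma hcomp_sum: "hcomp e (\<Sum>i\<in>A. f i) = (\<Sum>i\<in>A. hcomp e (f i))"
  by (induction A rule: infinite_finite_induct) (simp_all add: hcomp_add)

lemma hcomp_form: "form d f \<Longrightarrow> hcomp e f = (if e = d then f else 0)"
  by (rule poly_mapping_eqI)
     (auto simp: lookup_hcomp form_def monoms_def in_keys_iff subset_iff)

lemma sum_hcomp: "f = (\<Sum>e\<in>mdeg ` keys f. hcomp e f)"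
  by (rule poly_mapping_eqI) (auto simp: lookup_sum lookup_hcomp in_keys_iff)

lemma hcomp_mult:
  assumes "form d g"
  shows "hcomp e (g * f) = (if d \<le> e then g * hcomp (e - d) f else 0)"
proof -
  let ?E = "mdeg ` keys f"
  have "g * f = (\<Sum>i\<in>?E. g * hcomp i f)"
    unfolding sum_distrib_left[symmetric] using sum_hcomp[of f] by simp
  then have "hcomp e (g * f) = (\<Sum>i\<in>?E. hcomp e (g * hcomp i f))" by (simp add: hcomp_sum)
  also have "\<dots> = (\<Sum>i\<in>?E. if e = d + i then g * hcomp i f else 0)"
    by (intro sum.cong refl hcomp_form form_mult assms form_hcomp)
  also have "\<dots> = (\<Sum>i\<in>?E. if i = e - d \<and> d \<le> e then g * hcomp i f else 0)"
    by (intro sum.cong) auto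
  also have "\<dots> = (if d \<le> e then g * hcomp (e - d) f else 0)"
  proof (cases "e - d \<in> ?E")
    case False
    then have "hcomp (e - d) f = 0"
      by (intro poly_mapping_eqI) (force simp: lookup_hcomp in_keys_iff)
    then show ?thesis using False by (auto intro!: sum.neutral)
  next
    case True
    then show ?thesis by (cases "d \<le> e") simp_all
  qed
  finally show ?thesis .
qed

lemma lookup_0_form: "form d f \<Longrightarrow> d > 0 \<Longrightarrow> lookup f 0 = 0"
  by (auto simp: form_def monoms_def in_keys_iff subset_iff)

section \<open>Polynomials whose coefficients are forms in a parameter\<close>

text \<open>
  Polynomials whose coefficients are forms of one degree in the parameter. The uniform finite support is
  what makes their coordinates modulo \<open>P\<close> forms in the parameter.
\<close>

definition pfam :: "nat \<Rightarrow> (('i \<Rightarrow> 'k::field) \<Rightarrow> ('w, 'k) mpoly) \<Rightarrow> bool" where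
  "pfam e F \<longleftrightarrow> (\<forall>m. hfun e (\<lambda>a. lookup (F a) m)) \<and> (\<exists>M. finite M \<and> (\<forall>a. keys (F a) \<subseteq> M))"

lemma pfam_add:
  assumes "pfam e F" "pfam e G" shows "pfam e (\<lambda>a. F a + G a)"
proof -
  obtain M N where "finite M" "\<forall>a. keys (F a) \<subseteq> M" "finite N" "\<forall>a. keys (G a) \<subseteq> N"
    using assms unfolding pfam_def by (elim exE conjE) (rule that)
  moreover have "keys (F a + G a) \<subseteq> keys (F a) \<union> keys (G a)" for a by (rule Poly_Mapping.keys_add)
  ultimately have "finite (M \<union> N)" "\<forall>a. keys (F a + G a) \<subseteq> M \<union> N"
    by (simp, meson Un_mono subset_trans)
  then show ?thesis using assms unfolding pfam_def
    by (intro conjI exI[of _ "M \<union> N"]) (auto simp: lookup_add intro: hfun_add)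
qed

lemma pfam_fixed: "pfam 0 (\<lambda>a. p)"
  unfolding pfam_def by (intro conjI exI[of _ "keys p"]) (simp_all add: hfun_const)

lemma pfam_zero: "pfam e (\<lambda>a. 0)"
  unfolding pfam_def by (intro conjI exI[of _ "{}"]) (simp_all add: hfun_zero)

lemma pfam_mult:
  assumes "pfam e F" "pfam e' G" shows "pfam (e + e') (\<lambda>a. F a * G a)"
proof -
  obtain M N where M: "finite M" "\<forall>a. keys (F a) \<subseteq> M" and N: "finite N" "\<forall>a. keys (G a) \<subseteq> N"
    using assms unfolding pfam_def by (elim exE conjE) (rule that)
  have expand: "f = (\<Sum>m\<in>M. single m (lookup f m))" if "finite M" "keys f \<subseteq> M"
    for f :: "('z, 'k::field) mpoly" and M
    using mpoly_sum_single[of f] that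
    by (subst sum.mono_neutral_right[of M "keys f"]) (auto simp: in_keys_iff)
  have prod: "F a * G a = (\<Sum>m\<in>M. \<Sum>n\<in>N. single (m + n) (lookup (F a) m * lookup (G a) n))" for a
  proof -
    have "F a * G a = (\<Sum>m\<in>M. single m (lookup (F a) m)) * (\<Sum>n\<in>N. single n (lookup (G a) n))"
      using expand[OF M(1) M(2)[rule_format, of a]] expand[OF N(1) N(2)[rule_format, of a]] by simp
    then show ?thesis by (simp add: sum_product mult_single)
  qed
  have "hfun (e + e') (\<lambda>a. lookup (F a * G a) k)" for k
  proof -
    have "hfun (e + e') (\<lambda>a. if m + n = k then lookup (F a) m * lookup (G a) n else 0)" for m n
      using assms unfolding pfam_def by (cases "m + n = k") (simp_all add: hfun_mult hfun_zero)
    then show ?thesis unfolding prod lookup_sum lookup_single when_def by (intro hfun_sum)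
  qed
  moreover have "keys (F a * G a) \<subseteq> (\<lambda>(m, n). m + n) ` (M \<times> N)" for a
      proof
    fix k assume "k \<in> keys (F a * G a)"
    then obtain m n where "k = m + n" "m \<in> keys (F a)" "n \<in> keys (G a)"
      using keys_mult[of "F a" "G a"] by blast
    then show "k \<in> (\<lambda>(m, n). m + n) ` (M \<times> N)" using M(2) N(2) by blast
  qed
  ultimately show ?thesis unfolding pfam_def using M(1) N(1)
    by (intro conjI allI exI[of _ "(\<lambda>(m, n). m + n) ` (M \<times> N)"]) auto
qed

lemma pfam_sum: "(\<And>x. x \<in> A \<Longrightarrow> pfam e (F x)) \<Longrightarrow> pfam e (\<lambda>a. \<Sum>x\<in>A. F x a)"
proof (induction A rule: infinite_finite_induct)
  case (insert x A)
  then have "pfam e (\<lambda>a. F x a + (\<Sum>x\<in>A. F x a))" by (intro pfam_add) simp_all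
  then show ?case using insert.hyps by simp
qed (simp_all add: pfam_zero)

lemma pfam_power: "pfam e F \<Longrightarrow> pfam (n * e) (\<lambda>a. F a ^ n)"
proof (induction n)
  case 0 then show ?case using pfam_fixed[of 1] by simp
next
  case (Suc n) then show ?case using pfam_mult[of e F "n * e" "\<lambda>a. F a ^ n"] by simp
qed

lemma pfam_prod: "(\<And>x. x \<in> A \<Longrightarrow> pfam (e x) (F x)) \<Longrightarrow> pfam (\<Sum>x\<in>A. e x) (\<lambda>a. \<Prod>x\<in>A. F x a)"
proof (induction A rule: infinite_finite_induct)
  case (insert x A)
  then have "pfam (e x + (\<Sum>x\<in>A. e x)) (\<lambda>a. F x a * (\<Prod>x\<in>A. F x a))" by (intro pfam_mult) simp_all
  then show ?case using insert.hyps by simp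
qed (use pfam_fixed[of 1] in simp_all)

lemma pfam_mult_fixed: "pfam e F \<Longrightarrow> pfam e (\<lambda>a. p * F a)"
  using pfam_mult[OF pfam_fixed[of p], of e F] by simp

lemma pfam_diff: "pfam e F \<Longrightarrow> pfam e G \<Longrightarrow> pfam e (\<lambda>a. F a - G a)"
  using pfam_add[of e F "\<lambda>a. (-1) * G a"] pfam_mult_fixed[of e G "-1"] by simp

lemma pfam_subst_single:
  assumes "\<And>i. pfam (d i) (\<lambda>a. h a i)"
  shows "pfam (\<Sum>i\<in>keys m. lookup m i * d i) (\<lambda>a. subst (h a) (single m c))"
  unfolding subst_single using assms by (intro pfam_mult_fixed pfam_prod pfam_power)

lemma pfam_subst:
  assumes "\<And>i. pfam d (\<lambda>a. h a i)" "form e p"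
  shows "pfam (e * d) (\<lambda>a. subst (h a) p)"
proof -
  have "pfam (e * d) (\<lambda>a. \<Sum>m\<in>keys p. subst (h a) (single m (lookup p m)))"
  proof (rule pfam_sum)
    fix m assume "m \<in> keys p"
    then have "mdeg m = e" using assms(2) by (auto simp: form_def monoms_def)
    then show "pfam (e * d) (\<lambda>a. subst (h a) (single m (lookup p m)))"
      using pfam_subst_single[of "\<lambda>_. d" h m "lookup p m", OF assms(1)]
      unfolding sum_distrib_right[symmetric] mdeg_def[symmetric] by simp
  qed
  then show ?thesis unfolding subst_sum[symmetric] using mpoly_sum_single[of p] by simp
qed

section \<open>Coordinates modulo a subspace\<close>

text \<open>
  A subspace of the polynomial ring is the kernel of a family of coordinate functions. With these,
  congruences modulo a prime become equations between vectors with entries in the field.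
\<close>

lemma ex_coordinates:
  fixes P :: "('v, 'k::field) mpoly set"
  assumes zero: "0 \<in> P" and add: "\<And>f g. f \<in> P \<Longrightarrow> g \<in> P \<Longrightarrow> f + g \<in> P"
    and scale: "\<And>c f. f \<in> P \<Longrightarrow> const c * f \<in> P"
  shows "\<exists>pr :: ('v, 'k) mpoly \<Rightarrow> ('v, 'k) mpoly \<Rightarrow> 'k. (\<forall>f g c. pr (f + g) c = pr f c + pr g c) \<and>
     (\<forall>t f c. pr (const t * f) c = t * pr f c) \<and> (\<forall>f. f \<in> P \<longleftrightarrow> (\<forall>c. pr f c = 0))"
proof -
  interpret vs: vector_space "\<lambda>(c::'k) (f :: ('v, 'k) mpoly). const c * f"
  proof
    fix a b :: 'k and x y :: "('v, 'k) mpoly"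
    show "const a * (x + y) = const a * x + const a * y" by (rule distrib_left)
    show "const (a + b) * x = const a * x + const b * x" unfolding const_add by (rule distrib_right)
    show "const a * (const b * x) = const (a * b) * x" unfolding const_mult by (rule mult.assoc[symmetric])
    show "const 1 * x = x" by simp
  qed
  have sum_mem: "(\<Sum>x\<in>A. f x) \<in> P" if "\<And>x. x \<in> A \<Longrightarrow> f x \<in> P"
    for A :: "'y set" and f :: "'y \<Rightarrow> ('v, 'k) mpoly"
    using that by (induction A rule: infinite_finite_induct) (auto intro: zero add)
  obtain B where B: "B \<subseteq> P" "\<not> vs.dependent B" "P \<subseteq> vs.span B"
    by (rule vs.maximal_independent_subset[of P]) (rule that)
  obtain C where C: "B \<subseteq> C" "\<not> vs.dependent C" "UNIV \<subseteq> vs.span C"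
    by (rule vs.maximal_independent_subset_extend[OF subset_UNIV B(2)]) (rule that)
  have inC: "f \<in> vs.span C" for f using C(3) by blast
  define pr where "pr f c = (if c \<in> C - B then vs.representation C f c else 0)" for f c
  have "f \<in> P \<longleftrightarrow> (\<forall>c. pr f c = 0)" for f
  proof
    assume "f \<in> P"
    then have f: "f \<in> vs.span B" using B(3) by blast
    have "vs.representation C f = vs.representation B f"
      by (rule vs.representation_extend[OF C(2) f C(1)])
    then have rep: "vs.representation C f c = vs.representation B f c" for c by simp
    show "\<forall>c. pr f c = 0"
    proof
      fix c show "pr f c = 0"
      proof (cases "c \<in> C - B")
        case True
        then have "vs.representation B f c = 0" using vs.representation_ne_zero[of B f c] by blast
        then show ?thesis by (simp add: pr_def rep)
      next
        case False
        then show ?thesis by (auto simp: pr_def)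
      qed
    qed
  next
    assume z: "\<forall>c. pr f c = 0"
    have "(\<Sum>c | vs.representation C f c \<noteq> 0. const (vs.representation C f c) * c) = f"
      by (rule vs.sum_nonzero_representation_eq[OF C(2) inC])
    moreover have "(\<Sum>c | vs.representation C f c \<noteq> 0. const (vs.representation C f c) * c) \<in> P"
    proof (rule sum_mem)
      fix c assume c: "c \<in> {c. vs.representation C f c \<noteq> 0}"
      then have "c \<in> C" using vs.representation_ne_zero[of C f c] by simp
      moreover have "\<not> (c \<in> C - B)"
      proof
        assume "c \<in> C - B"
        then have "pr f c = vs.representation C f c" by (simp add: pr_def)
        then show False using z c by simp
      qed
      ultimately have "c \<in> B" by blast
      then show "const (vs.representation C f c) * c \<in> P" using B(1) scale by blast
    qed
    ultimately show "f \<in> P" by simp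
  qed
  moreover have "pr (f + g) c = pr f c + pr g c" for f g c
    unfolding pr_def vs.representation_add[OF C(2) inC inC] by simp
  moreover have "pr (const t * f) c = t * pr f c" for t f c
    unfolding pr_def vs.representation_scale[OF C(2) inC] by simp
  ultimately show ?thesis by (intro exI[of _ pr] conjI allI) assumption+
qed

section \<open>Homogeneous primes\<close>

text \<open>
  The closure properties of a homogeneous prime that does not contain all variables, on sets of
  polynomials and with homogeneity expressed by components.
\<close>

locale hprime =
  fixes P :: "('v::finite, 'k::field) mpoly set"
  assumes P_zero: "0 \<in> P"
    and P_add: "f \<in> P \<Longrightarrow> g \<in> P \<Longrightarrow> f + g \<in> P"
    and P_mult: "f \<in> P \<Longrightarrow> g * f \<in> P"
    and P_prime: "f * g \<in> P \<Longrightarrow> f \<in> P \<or> g \<in> P"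
    and P_one: "1 \<notin> P"
    and P_hcomp: "f \<in> P \<Longrightarrow> hcomp e f \<in> P"
    and P_var: "\<exists>i. var i \<notin> P"

lemma projective_variety_hprime:
  fixes P :: "('v::finite, 'k::field) mpoly set"
  assumes "projective_variety P"
  shows "hprime P"
proof -
  interpret S: cring S_ring by (rule cring_S_ring)
  interpret primeideal P S_ring using assms by (simp add: projective_variety_def)
  have sr: "carrier S_ring = (UNIV :: ('v, 'k) mpoly set)"
    "\<And>a b :: ('v, 'k) mpoly. a \<otimes>\<^bsub>S_ring\<^esub> b = a * b"
    "\<And>a b :: ('v, 'k) mpoly. a \<oplus>\<^bsub>S_ring\<^esub> b = a + b"
    "\<one>\<^bsub>S_ring\<^esub> = (1 :: ('v, 'k) mpoly)" "\<zero>\<^bsub>S_ring\<^esub> = (0 :: ('v, 'k) mpoly)" by (simp_all add: S_ring_def)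
  have 1: "0 \<in> P" using zero_closed sr by simp
  have 2: "f + g \<in> P" if "f \<in> P" "g \<in> P" for f g using a_closed[OF that] sr by simp
  have 3: "g * f \<in> P" if "f \<in> P" for f g using I_l_closed[OF that, of g] sr by simp
  have 4: "f \<in> P \<or> g \<in> P" if "f * g \<in> P" for f g using I_prime[of f g] that sr by simp
  have 5: "1 \<notin> P"
  proof
    assume "1 \<in> P"
    then have "P = carrier S_ring" using one_imp_carrier sr by simp
    then show False using I_notcarr by simp
  qed
  let ?I = "{f. \<forall>e. hcomp e f \<in> P}"
  have sum2: "(\<Sum>x\<in>A. f x) \<in> P" if "\<And>x. x \<in> A \<Longrightarrow> f x \<in> P"
    for A :: "'c set" and f :: "'c \<Rightarrow> ('v, 'k) mpoly"
    using that by (induction A rule: infinite_finite_induct) (auto intro: 1 2)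
  have I_mult: "g * f \<in> ?I" if f: "f \<in> ?I" for f g
  proof
    show "\<forall>e. hcomp e (g * f) \<in> P"
    proof
      fix e
      have "g * f = (\<Sum>i\<in>mdeg ` keys g. hcomp i g * f)"
        unfolding sum_distrib_right[symmetric] using sum_hcomp[of g] by simp
      then have "hcomp e (g * f)
          = (\<Sum>i\<in>mdeg ` keys g. if i \<le> e then hcomp i g * hcomp (e - i) f else 0)"
        by (simp add: hcomp_sum hcomp_mult[OF form_hcomp])
      also have "\<dots> \<in> P" using f by (intro sum2) (auto intro: 1 3)
      finally show "hcomp e (g * f) \<in> P" .
    qed
  qed
  have "ideal ?I S_ring"
  proof (rule idealI)
    show "ring S_ring" by (rule S.ring_axioms)
    show "subgroup ?I (add_monoid S_ring)"
    proof (rule S.add.subgroupI)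
      show "?I \<subseteq> carrier S_ring" by (simp add: sr)
      show "?I \<noteq> {}" using 1 by (auto intro!: exI[of _ 0])
      fix a assume a: "a \<in> ?I"
      have "(-1) * a \<in> ?I" using I_mult[OF a, of "-1"] .
      moreover have "\<ominus>\<^bsub>S_ring\<^esub> a = - a"
        by (rule S.minus_equality) (simp_all add: sr)
      ultimately show "\<ominus>\<^bsub>S_ring\<^esub> a \<in> ?I" by simp
    next
      fix a b assume "a \<in> ?I" "b \<in> ?I"
      then show "a \<oplus>\<^bsub>S_ring\<^esub> b \<in> ?I" by (auto simp: sr hcomp_add intro: 2)
    qed
    fix a x assume "a \<in> ?I"
    then show "x \<otimes>\<^bsub>S_ring\<^esub> a \<in> ?I" "a \<otimes>\<^bsub>S_ring\<^esub> x \<in> ?I"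
      unfolding sr using I_mult[of a x] by (simp_all add: mult.commute)
  qed
  moreover have "{f \<in> P. \<exists>d. form d f} \<subseteq> ?I" by (auto simp: hcomp_form 1)
  ultimately have "Idl\<^bsub>S_ring\<^esub> {f \<in> P. \<exists>d. form d f} \<subseteq> ?I" by (rule S.genideal_minimal)
  then have 6: "hcomp e f \<in> P" if "f \<in> P" for e f
    using assms that unfolding projective_variety_def homogeneous_ideal_def by blast
  have 7: "\<exists>i. var i \<notin> P" using assms unfolding projective_variety_def by blast
  show ?thesis by unfold_locales (use 1 2 3 4 5 6 7 in auto)
qed

context hprime
begin

lemma P_mult_right: "f \<in> P \<Longrightarrow> f * g \<in> P" using P_mult[of f g] by (simp add: mult.commute)
lemma P_uminus: "f \<in> P \<Longrightarrow> - f \<in> P" using P_mult[of f "-1"] by simp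
lemma P_diff: "f \<in> P \<Longrightarrow> g \<in> P \<Longrightarrow> f - g \<in> P" using P_add[of f "- g"] P_uminus by simp
lemma P_sum: "(\<And>x. x \<in> A \<Longrightarrow> f x \<in> P) \<Longrightarrow> (\<Sum>x\<in>A. f x) \<in> P"
  by (induction A rule: infinite_finite_induct) (auto intro: P_zero P_add)
lemma P_cancel: "f * g \<in> P \<Longrightarrow> f \<notin> P \<Longrightarrow> g \<in> P" using P_prime by blast
lemma P_power: "f ^ n \<in> P \<Longrightarrow> f \<in> P"
  by (induction n) (use P_one P_prime in auto)
lemma P_sub_mem: "f - g \<in> P \<Longrightarrow> f \<in> P \<longleftrightarrow> g \<in> P"
  using P_add[of "f - g" g] P_diff[of f "f - g"] by auto
lemma P_sub_sym: "f - g \<in> P \<Longrightarrow> g - f \<in> P" using P_uminus[of "f - g"] by simp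
lemma P_sub_mult: "f - g \<in> P \<Longrightarrow> f' - g' \<in> P \<Longrightarrow> f * f' - g * g' \<in> P"
proof -
  assume "f - g \<in> P" "f' - g' \<in> P"
  then have "f' * (f - g) + g * (f' - g') \<in> P" by (intro P_add P_mult)
  then show ?thesis by (simp add: algebra_simps)
qed
lemma P_sub_power: "f - g \<in> P \<Longrightarrow> f ^ n - g ^ n \<in> P"
  by (induction n) (auto simp: P_zero intro: P_sub_mult)
lemma P_sub_prod: "(\<And>x. x \<in> A \<Longrightarrow> f x - g x \<in> P) \<Longrightarrow> (\<Prod>x\<in>A. f x) - (\<Prod>x\<in>A. g x) \<in> P"
  by (induction A rule: infinite_finite_induct) (auto simp: P_zero intro: P_sub_mult)
lemma P_sub_sum: "(\<And>x. x \<in> A \<Longrightarrow> f x - g x \<in> P) \<Longrightarrow> (\<Sum>x\<in>A. f x) - (\<Sum>x\<in>A. g x) \<in> P"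
  unfolding sum_subtractf[symmetric] by (rule P_sum)

lemma const_in_P: "const c \<in> P \<longleftrightarrow> c = 0"
proof
  assume c: "const c \<in> P"
  show "c = 0"
  proof (rule ccontr)
    assume "c \<noteq> 0"
    then have "const (inverse c) * const c = (1 :: ('v, 'k) mpoly)" by (simp add: const_mult[symmetric])
    then show False using P_mult[OF c, of "const (inverse c)"] P_one by simp
  qed
qed (simp add: P_zero)

lemma subst_cong_P:
  assumes "\<And>i. G i - H i \<in> P"
  shows "subst G p - subst H (p :: ('w, 'k) mpoly) \<in> P"
  unfolding subst_expand using assms
  by (intro P_sub_sum P_sub_mult P_sub_prod P_sub_power) (simp_all add: P_zero)

lemma form_proportional:
  assumes "form e p" "\<And>i j. G i * H j - G j * H i \<in> P"
  shows "H j ^ e * subst G p - G j ^ e * subst H p \<in> P"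
proof -
  have "subst (\<lambda>i. H j * G i) p - subst (\<lambda>i. G j * H i) p \<in> P"
    using assms(2) by (intro subst_cong_P) (simp add: mult.commute)
  then show ?thesis using assms(1) by (simp add: subst_scale)
qed

subsection \<open>Coordinates modulo the prime\<close>

definition pr :: "('v, 'k) mpoly \<Rightarrow> ('v, 'k) mpoly \<Rightarrow> 'k" where
  "pr = (SOME pr. (\<forall>f g c. pr (f + g) c = pr f c + pr g c) \<and>
     (\<forall>t f c. pr (const t * f) c = t * pr f c) \<and> (\<forall>f. f \<in> P \<longleftrightarrow> (\<forall>c. pr f c = 0)))"

lemma pr_add: "pr (f + g) c = pr f c + pr g c"
  and pr_scale: "pr (const t * f) c = t * pr f c"
  and pr_P: "f \<in> P \<longleftrightarrow> (\<forall>c. pr f c = 0)"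
  using someI_ex[OF ex_coordinates[OF P_zero P_add P_mult]] unfolding pr_def[symmetric] by blast+

lemma pr_zero: "pr 0 c = 0" using pr_P[of 0] P_zero by simp

lemma pr_uminus: "pr (- f) c = - pr f c"
  using pr_scale[of "-1" f c] by (simp add: const_uminus)

lemma pr_diff: "pr (f - g) c = pr f c - pr g c"
  using pr_add[of f "- g" c] by (simp add: pr_uminus)

lemma pr_sum: "pr (\<Sum>x\<in>A. f x) c = (\<Sum>x\<in>A. pr (f x) c)"
  by (induction A rule: infinite_finite_induct) (simp_all add: pr_zero pr_add)

lemma pr_lincomb: "pr (\<Sum>x\<in>A. const (t x) * f x) c = (\<Sum>x\<in>A. t x * pr (f x) c)"
  by (simp add: pr_sum pr_scale)

lemma indep_pr: "indep (\<lambda>x. pr (v x)) A \<longleftrightarrow>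
    (\<forall>t. (\<Sum>x\<in>A. const (t x) * v x) \<in> P \<longrightarrow> (\<forall>x\<in>A. t x = 0))"
  unfolding indep_def pr_P pr_lincomb ..

lemma inspan_pr: "inspan (\<lambda>x. pr (v x)) A (pr f) \<longleftrightarrow> (\<exists>t. f - (\<Sum>x\<in>A. const (t x) * v x) \<in> P)"
  unfolding inspan_def pr_P pr_diff pr_lincomb by simp

lemma pr_hfun:
  assumes "pfam e F"
  shows "hfun e (\<lambda>a. pr (F a) c)"
proof -
  obtain M where M: "finite M" "\<And>a. keys (F a) \<subseteq> M" using assms unfolding pfam_def by blast
  have "pr (F a) c = (\<Sum>m\<in>M. pr (single m 1) c * lookup (F a) m)" for a
  proof -
    have "F a = (\<Sum>m\<in>keys (F a). const (lookup (F a) m) * single m 1)"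
      using mpoly_sum_single[of "F a"] by (simp add: const_mult_single)
    also have "\<dots> = (\<Sum>m\<in>M. const (lookup (F a) m) * single m 1)"
      using M by (intro sum.mono_neutral_left) (auto simp: in_keys_iff)
    finally have "pr (F a) c = pr (\<Sum>m\<in>M. const (lookup (F a) m) * single m 1) c" by simp
    then show ?thesis unfolding pr_lincomb by (simp add: mult.commute)
  qed
  moreover have "hfun e (\<lambda>a. \<Sum>m\<in>M. pr (single m 1) c * lookup (F a) m)"
    using assms unfolding pfam_def by (intro hfun_sum hfun_cmult) blast
  ultimately show ?thesis by simp
qed

subsection \<open>Standard monomials and the Hilbert function\<close>

lemma finite_monoms: "finite (monoms t :: 'v monom set)"
proof -
  obtain r :: "'v \<Rightarrow> nat" where "inj_on r UNIV" using finite_imp_inj_to_nat_seg[of "UNIV :: 'v set"] by auto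
  then interpret monomial_order r "UNIV :: 'v set" by unfold_locales simp_all
  show ?thesis by (rule finite_subset[OF _ finite_monomials[of t]]) (auto simp: monoms_def)
qed

text \<open>
  Monomials of degree \<open>t\<close> whose classes form a basis of the degree \<open>t\<close> part of the coordinate ring.
\<close>

definition Std :: "nat \<Rightarrow> 'v monom set" where
  "Std t = (SOME T. T \<subseteq> monoms t \<and> indep (\<lambda>m. pr (single m 1)) T \<and>
     (\<forall>m\<in>monoms t. inspan (\<lambda>m. pr (single m 1)) T (pr (single m 1))))"

lemma Std_props: "Std t \<subseteq> monoms t \<and> indep (\<lambda>m. pr (single m 1)) (Std t) \<and>
     (\<forall>m\<in>monoms t. inspan (\<lambda>m. pr (single m 1)) (Std t) (pr (single m 1)))"
  unfolding Std_def
  by (rule someI_ex) (use maximal_indep[OF finite_monoms[of t], of "\<lambda>m. pr (single m 1)"] in blast)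

lemma Std_monoms: "m \<in> Std t \<Longrightarrow> mdeg m = t" using Std_props by (auto simp: monoms_def)
lemma finite_Std: "finite (Std t)" using Std_props finite_monoms finite_subset by blast
lemma indep_Std: "indep (\<lambda>m. pr (single m 1)) (Std t)" using Std_props by blast

lemma Std_span:
  assumes "form t f"
  shows "inspan (\<lambda>m. pr (single m 1)) (Std t) (pr f)"
proof (rule inspan_trans[of "keys f" _ _ "\<lambda>m. pr (single m 1)"])
  fix m assume "m \<in> keys f"
  then have "m \<in> monoms t" using assms by (auto simp: form_def)
  then show "inspan (\<lambda>m. pr (single m 1)) (Std t) (pr (single m 1))" using Std_props by blast
next
  have "pr f c = (\<Sum>m\<in>keys f. lookup f m * pr (single m 1) c)" for c
  proof -
    have "f = (\<Sum>m\<in>keys f. const (lookup f m) * single m 1)"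
      using mpoly_sum_single[of f] by (simp add: const_mult_single)
    from arg_cong[OF this, of "\<lambda>g. pr g c"] show ?thesis unfolding pr_lincomb .
  qed
  then show "inspan (\<lambda>m. pr (single m 1)) (keys f) (pr f)" unfolding inspan_def by (intro exI allI)
qed

end

section \<open>Birational maps and left inverses\<close>

lemma mdeg_eq_0: "mdeg m = 0 \<longleftrightarrow> m = 0"
  by (auto simp: mdeg_def in_keys_iff intro!: poly_mapping_eqI)

text \<open>
  Summing the growth condition along multiples of \<open>c\<close> gives \<open>s F(s) \<le> F(K s)\<close> with \<open>K = 2 e c\<close>, hence
  \<open>F(K\<^sup>i)\<close> is at least \<open>K\<close> to the power \<open>i (i - 1) / 2\<close>, which outgrows every polynomial in \<open>K\<^sup>i\<close>.
\<close>

lemma growth_contradiction: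
  fixes F :: "nat \<Rightarrow> nat"
  assumes pos: "\<And>t. F t \<ge> 1" and step: "\<And>t. F t \<le> F (Suc t)" and bound: "\<And>t. F t \<le> (t + 1) ^ N"
    and e: "e \<ge> 1" and c: "c \<ge> 1" and grow: "\<And>t. c \<le> e * t \<Longrightarrow> F (e * t - c) + F t \<le> F (e * t)"
  shows False
proof -
  have mono: "F s \<le> F t" if "s \<le> t" for s t
    using step that by (rule lift_Suc_mono_le)
  have grow2: "F (e * (c * t)) + F (c * Suc t) \<le> F (e * (c * Suc t))" for t
  proof -
    have "c \<le> e * c" using e by (cases e) simp_all
    moreover have "e * (c * Suc t) = e * c + e * (c * t)" by (simp add: algebra_simps)
    ultimately have "c \<le> e * (c * Suc t)" "e * (c * t) \<le> e * (c * Suc t) - c" by linarith+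
    then show ?thesis using grow[of "c * Suc t"] mono[of "e * (c * t)" "e * (c * Suc t) - c"] by linarith
  qed
  have sum: "j * F s \<le> F (e * (c * (s + j)))" for s j
  proof (induction j)
    case (Suc j)
    have "s \<le> c * Suc (s + j)" using c by (cases c) auto
    then have "F s \<le> F (c * Suc (s + j))" by (rule mono)
    then have "Suc j * F s \<le> F (e * (c * Suc (s + j)))" using Suc grow2[of "s + j"] by simp
    then show ?case by simp
  qed simp
  define K where "K = 2 * (e * c)"
  have K: "K \<ge> 2" using e c by (simp add: K_def)
  have iter: "s * F s \<le> F (K * s)" for s
  proof -
    have "K * s = e * (c * (s + s))" by (simp add: K_def algebra_simps)
    then show ?thesis using sum[of s s] by (simp only:)
  qed
  have low: "K ^ (\<Sum>j<i. j) \<le> F (K ^ i)" for i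
  proof (induction i)
    case (Suc i)
    have "K ^ (\<Sum>j<Suc i. j) = K ^ i * K ^ (\<Sum>j<i. j)" by (simp add: power_add mult.commute)
    also have "\<dots> \<le> K ^ i * F (K ^ i)" using Suc by simp
    also have "\<dots> \<le> F (K ^ Suc i)" using iter[of "K ^ i"] by simp
    finally show ?case .
  qed (use pos[of 1] in simp)
  have tri: "2 * (\<Sum>j<i. j) = i * (i - 1)" for i :: nat
  proof (induction i)
    case (Suc i)
    then show ?case by (cases i) simp_all
  qed simp
  have up: "F (K ^ i) \<le> K ^ (Suc i * N)" for i
  proof -
    have "K ^ i + 1 \<le> K ^ Suc i" using K by (simp add: Suc_leI less_le_trans[of "K ^ i" "2 * K ^ i"])
    then have "(K ^ i + 1) ^ N \<le> (K ^ Suc i) ^ N" by (rule power_mono) simp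
    then have "F (K ^ i) \<le> (K ^ Suc i) ^ N" using bound[of "K ^ i"] by (rule order_trans[rotated])
    then show ?thesis by (simp only: power_mult)
  qed
  define i where "i = 2 * N + 4"
  have "2 * (\<Sum>j<i. j) = 2 * ((N + 2) * (2 * N + 3))" unfolding tri by (simp add: i_def algebra_simps)
  then have "Suc i * N < (\<Sum>j<i. j)" by (simp add: i_def algebra_simps)
  then have "K ^ (Suc i * N) < K ^ (\<Sum>j<i. j)" using K by (intro power_strict_increasing) auto
  then show False using low[of i] up[of i] by linarith
qed

context hprime
begin

text \<open>
  One half of the definition of mutually inverse maps. For fixed \<open>h\<close> and \<open>e\<close> it is, apart from the condition that
  \<open>g(h)\<close> is not zero, linear in the coefficients of \<open>g\<close>.
\<close>

definition left_inverse where
  "left_inverse h e g \<longleftrightarrow> (\<forall>i. form e (g i)) \<and> (\<exists>i. subst h (g i) \<notin> P) \<and>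
     same_map P (\<lambda>i. subst h (g i)) var"

definition dominant where
  "dominant h \<longleftrightarrow> (\<forall>e p. form e p \<longrightarrow> subst h p \<in> P \<longrightarrow> p \<in> P)"

lemma same_mapD: "same_map P h h' \<Longrightarrow> h i * h' j - h j * h' i \<in> P"
  unfolding same_map_def by blast

lemma form_at_left_inverse:
  assumes "same_map P G var" "form t p"
  shows "var j ^ t * subst G p - G j ^ t * p \<in> P"
  using form_proportional[where H = var and G = G and j = j, OF assms(2)] same_mapD[OF assms(1)] by simp

lemma left_inverse_var:
  assumes "left_inverse h e g" "h k \<notin> P"
  shows "left_inverse h (Suc e) (\<lambda>i. var k * g i)"
  unfolding left_inverse_def
proof (intro conjI allI)
  show "form (Suc e) (var k * g i)" for i
    using form_mult[OF form_var, of e "g i" k] assms(1) unfolding left_inverse_def by simp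
  show "\<exists>i. subst h (var k * g i) \<notin> P"
    using assms P_prime unfolding left_inverse_def by (metis subst_mult subst_var)
  show "same_map P (\<lambda>i. subst h (var k * g i)) var"
    unfolding same_map_def
  proof (intro allI)
    fix i j
    have "h k * (subst h (g i) * var j - subst h (g j) * var i) \<in> P"
      using assms(1) unfolding left_inverse_def same_map_def by (intro P_mult) blast
    then show "subst h (var k * g i) * var j - subst h (var k * g j) * var i \<in> P"
      by (simp add: subst_mult algebra_simps)
  qed
qed

abbreviation hilb :: "nat \<Rightarrow> nat" where "hilb t \<equiv> card (Std t)"

lemma hilb_indep:
  assumes "finite A" "\<And>x. x \<in> A \<Longrightarrow> form t (v x)" "indep (\<lambda>x. pr (v x)) A"
  shows "card A \<le> hilb t"
  by (rule indep_card_le[OF assms(3,1) finite_Std]) (use Std_span assms(2) in blast)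

lemma Std_zero:
  assumes "(\<Sum>m\<in>Std t. const (s m) * single m 1) \<in> P" "m \<in> Std t"
  shows "s m = 0"
  using indep_Std[of t] assms unfolding indep_pr by blast

lemma form_Std_sum: "form t (\<Sum>m\<in>Std t. const (s m :: 'k) * single m 1)"
  by (intro form_sum form_const_mult form_single Std_monoms)

lemma hilb_pos: "hilb t \<ge> 1"
proof (rule ccontr)
  assume "\<not> ?thesis"
  then have S: "Std t = {}" using finite_Std[of t] by (cases "Std t = {}") (auto simp: card_eq_0_iff not_le)
  obtain k where k: "var k \<notin> P" using P_var by blast
  have "form t (var k ^ t :: ('v, 'k) mpoly)" using form_power[OF form_var, of t k] by simp
  from Std_span[OF this] have "var k ^ t \<in> P" unfolding S inspan_pr by simp
  then show False using P_power k by blast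
qed

lemma hilb_Suc: "hilb t \<le> hilb (Suc t)"
proof -
  obtain k where k: "var k \<notin> P" using P_var by blast
  show ?thesis
  proof (rule hilb_indep[OF finite_Std])
    show "form (Suc t) (var k * single m 1)" if "m \<in> Std t" for m
      using form_mult[OF form_var form_single[OF Std_monoms[OF that]], of k] by simp
    show "indep (\<lambda>m. pr (var k * single m 1)) (Std t)"
      unfolding indep_pr
    proof (intro allI impI ballI)
      fix s m assume "(\<Sum>m\<in>Std t. const (s m) * (var k * single m 1)) \<in> P" and m: "m \<in> Std t"
      then have "var k * (\<Sum>m\<in>Std t. const (s m) * single m 1) \<in> P"
        by (simp add: sum_distrib_left mult_ac)
      then show "s m = 0" using P_cancel[OF _ k] Std_zero m by blast
    qed
  qed
qed

lemma hilb_bound: "hilb t \<le> (t + 1) ^ card (UNIV :: 'v set)"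
proof -
  have "hilb t \<le> card (monoms t :: 'v monom set)"
    using Std_props by (intro card_mono finite_monoms) blast
  also have "\<dots> = card (lookup ` (monoms t :: 'v monom set))"
    by (rule card_image[symmetric]) (auto intro: inj_onI poly_mapping_eqI)
  also have "\<dots> \<le> card (PiE (UNIV :: 'v set) (\<lambda>_. {..t}))"
  proof (rule card_mono)
    show "lookup ` (monoms t :: 'v monom set) \<subseteq> PiE UNIV (\<lambda>_. {..t})"
    proof
      fix f assume "f \<in> lookup ` (monoms t :: 'v monom set)"
      then obtain m :: "'v monom" where m: "f = lookup m" "mdeg m = t" by (auto simp: monoms_def)
      have "lookup m x \<le> t" for x
        using mdeg_superset[of UNIV m] m(2) member_le_sum[of x UNIV "lookup m"] by simp
      then show "f \<in> PiE UNIV (\<lambda>_. {..t})" using m(1) by (simp add: PiE_def extensional_def)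
    qed
  qed (simp add: finite_PiE)
  also have "\<dots> = (t + 1) ^ card (UNIV :: 'v set)" by (simp add: card_PiE)
  finally show ?thesis .
qed

text \<open>
  Let \<open>Q\<close> be the kernel of \<open>p \<mapsto> p(h)\<close>. A left inverse \<open>g\<close> of degree \<open>e\<close> embeds the
  forms of degree \<open>t\<close> modulo \<open>P\<close> into the forms of degree \<open>e t\<close> modulo \<open>Q\<close>. If \<open>Q\<close> contained
  a form of degree \<open>c\<close> outside \<open>P\<close>, then the Hilbert function of \<open>P\<close> would satisfy
  \<open>hilb (e t - c) + hilb t \<le> hilb (e t)\<close>, so it would grow faster than every polynomial.
\<close>

lemma left_inverse_dominant:
  assumes pres: "presentation P d h" and inv: "left_inverse h e g"
  shows "dominant h"
proof (rule ccontr)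
  assume "\<not> ?thesis"
  then obtain c q where q: "form c q" "subst h q \<in> P" "q \<notin> P" unfolding dominant_def by blast
  obtain k where k: "h k \<notin> P" using pres unfolding presentation_def by blast
  define g' where "g' i = var k * g i" for i
  \<comment> \<open>the degree is raised by one because it has to be positive\<close>
  have inv': "left_inverse h (Suc e) g'"
    using left_inverse_var[OF inv k] unfolding g'_def .
  define G where "G = (\<lambda>i. subst h (g' i))"
  have G: "\<And>i. form (Suc e) (g' i)" "same_map P G var"
    using inv' unfolding left_inverse_def G_def by auto
  obtain j where j: "G j \<notin> P" using inv' unfolding left_inverse_def G_def by blast
  have hP: "subst h f \<in> P" if "f \<in> P" for f using pres that unfolding presentation_def by blast
  have c1: "c \<ge> 1"
  proof (rule ccontr)
    assume "\<not> c \<ge> 1"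
    then have "c = 0" by simp
    then have "keys q \<subseteq> {0}" using q(1) by (auto simp: form_def monoms_def mdeg_eq_0)
    then have "q = const (lookup q 0)"
      by (intro poly_mapping_eqI) (auto simp: const_def lookup_single when_def in_keys_iff)
    then have "subst h q = q" by (metis subst_const)
    then show False using q(2,3) by simp
  qed
  have grow: "hilb (Suc e * t - c) + hilb t \<le> hilb (Suc e * t)" if ct: "c \<le> Suc e * t" for t
  proof -
    define v where "v x = (case x of Inl m \<Rightarrow> q * single m 1 | Inr m \<Rightarrow> subst g' (single m 1))"
      for x :: "'v monom + 'v monom"
    let ?A = "Std (Suc e * t - c) <+> Std t"
    have "card ?A \<le> hilb (Suc e * t)"
    proof (rule hilb_indep)
      show "finite ?A" by (intro finite_Plus finite_Std)
      fix x assume x: "x \<in> ?A"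
      then show "form (Suc e * t) (v x)"
      proof
        fix m assume m: "m \<in> Std (Suc e * t - c)" "x = Inl m"
        have "form (c + (Suc e * t - c)) (q * single m 1)"
          using q(1) form_single[OF Std_monoms[OF m(1)]] by (rule form_mult)
        then show ?thesis using m(2) ct by (simp add: v_def)
      next
        fix m assume m: "m \<in> Std t" "x = Inr m"
        then show ?thesis using form_subst[OF G(1) form_single[where c = 1, OF Std_monoms[OF m(1)]]]
          by (simp add: v_def mult.commute)
      qed
    next
      show "indep (\<lambda>x. pr (v x)) ?A"
        unfolding indep_pr
      proof (intro allI impI)
        fix s assume s: "(\<Sum>x\<in>?A. const (s x) * v x) \<in> P"
        define a where "a = (\<Sum>m\<in>Std (Suc e * t - c). const (s (Inl m)) * single m 1)"
        define b where "b = (\<Sum>m\<in>Std t. const (s (Inr m)) * single m 1)"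
        have fb: "form t b" unfolding b_def by (rule form_Std_sum)
        have "(\<Sum>x\<in>?A. const (s x) * v x) = q * a + subst g' b"
          using finite_Std by (simp add: sum.Plus a_def b_def v_def sum_distrib_left subst_sum subst_mult mult_ac)
        then have qa: "q * a + subst g' b \<in> P" using s by simp
        from hP[OF this] have "subst h q * subst h a + subst G b \<in> P"
          by (simp add: subst_add subst_mult subst_subst G_def)
        then have "subst G b \<in> P"
          using P_diff[of _ "subst h q * subst h a"] P_mult_right[OF q(2)] by fastforce
        then have "G j ^ t * b \<in> P"
          using P_sub_mem[OF form_at_left_inverse[OF G(2) fb, of j]] P_mult by simp
        then have b: "b \<in> P" using P_cancel P_power j by metis
        have b0: "s (Inr m) = 0" if "m \<in> Std t" for m
          using Std_zero[of "\<lambda>m. s (Inr m)" t m] b that unfolding b_def by simp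
        then have "b = 0" unfolding b_def by simp
        then have "a \<in> P" using qa q(3) P_cancel by simp
        then have "s (Inl m) = 0" if "m \<in> Std (Suc e * t - c)" for m
          using Std_zero[of "\<lambda>m. s (Inl m)" "Suc e * t - c" m] that unfolding a_def by simp
        then show "\<forall>x\<in>?A. s x = 0" using b0 by blast
      qed
    qed
    then show ?thesis using finite_Std by (simp add: card_Plus)
  qed
  show False by (rule growth_contradiction[OF hilb_pos hilb_Suc hilb_bound _ c1 grow]) simp_all
qed

lemma dominantD: "dominant h \<Longrightarrow> form e p \<Longrightarrow> subst h p \<in> P \<Longrightarrow> p \<in> P"
  unfolding dominant_def by blast

text \<open>
  As \<open>h\<close> is dominant, all that is required of \<open>g\<close> can be tested after substituting \<open>h\<close>, and there
  \<open>g(h)\<close> is proportional to the coordinates.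
\<close>

lemma left_inverse_birational:
  assumes pres: "presentation P d h" and inv: "left_inverse h e g"
  shows "birational P d h"
proof -
  have dom: "dominant h" by (rule left_inverse_dominant[OF assms])
  define G where "G = (\<lambda>i. subst h (g i))"
  have G: "\<And>i. form e (g i)" "same_map P G var"
    using inv unfolding left_inverse_def G_def by auto
  obtain j where j: "G j \<notin> P" using inv unfolding left_inverse_def G_def by blast
  obtain k where k: "var k \<notin> P" using P_var by blast
  have hf: "\<And>i. form d (h i)" and hP: "\<And>f. f \<in> P \<Longrightarrow> subst h f \<in> P"
    using pres unfolding presentation_def by auto
  obtain l where l: "h l \<notin> P" using pres unfolding presentation_def by blast
  have "presentation P e g"
    unfolding presentation_def
  proof (intro conjI allI ballI)
    show "\<exists>i. g i \<notin> P" using j hP unfolding G_def by blast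
    fix f assume f: "f \<in> P"
    have "subst g (hcomp t f) \<in> P" for t
    proof (rule dominantD[OF dom])
      show "form (t * e) (subst g (hcomp t f))" by (rule form_subst[OF G(1) form_hcomp])
      have "G k ^ t * hcomp t f \<in> P" by (intro P_mult P_hcomp f)
      then have "var k ^ t * subst G (hcomp t f) \<in> P"
        using P_sub_mem[OF form_at_left_inverse[OF G(2) form_hcomp, of k t f]] by blast
      then have "subst G (hcomp t f) \<in> P" using P_cancel P_power k by blast
      then show "subst h (subst g (hcomp t f)) \<in> P" by (simp add: subst_subst G_def)
    qed
    then have "(\<Sum>t\<in>mdeg ` keys f. subst g (hcomp t f)) \<in> P" by (rule P_sum)
    then show "subst g f \<in> P" unfolding subst_sum[symmetric] using sum_hcomp[of f] by simp
  qed (rule G(1))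
  moreover have "\<exists>i. subst g (h i) \<notin> P"
  proof
    show "subst g (h l) \<notin> P"
    proof
      assume "subst g (h l) \<in> P"
      then have "subst G (h l) \<in> P" using hP by (fastforce simp: subst_subst G_def)
      then have "G j ^ d * h l \<in> P"
        using P_sub_mem[OF form_at_left_inverse[OF G(2) hf, of j l]] P_mult by blast
      then show False using P_prime P_power j l by blast
    qed
  qed
  moreover have "same_map P (\<lambda>i. subst g (h i)) var"
    unfolding same_map_def
  proof (intro allI)
    fix i i'
    let ?z = "subst g (h i) * var i' - subst g (h i') * var i"
    show "?z \<in> P"
    proof (rule dominantD[OF dom])
      show "form (d * e + 1) ?z" by (intro form_diff form_mult form_subst G(1) hf form_var)
      have "var k ^ d * subst h ?z =
          (var k ^ d * subst G (h i) - G k ^ d * h i) * h i' - (var k ^ d * subst G (h i') - G k ^ d * h i') * h i"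
        by (simp add: subst_diff subst_mult subst_subst G_def algebra_simps)
      also have "\<dots> \<in> P" by (intro P_diff P_mult_right form_at_left_inverse G(2) hf)
      finally show "subst h ?z \<in> P" using P_cancel P_power k by blast
    qed
  qed
  ultimately show ?thesis
    unfolding birational_def inverse_maps_def using pres inv
    unfolding left_inverse_def by blast
qed

lemma birational_iff:
  "birational P d h \<longleftrightarrow> presentation P d h \<and> (\<exists>e g. left_inverse h e g)"
proof
  assume "birational P d h"
  then obtain e g where "presentation P d h" "presentation P e g" "inverse_maps P h g"
    unfolding birational_def by blast
  then have "left_inverse h e g"
    unfolding left_inverse_def inverse_maps_def presentation_def by blast
  then show "presentation P d h \<and> (\<exists>e g. left_inverse h e g)" using \<open>presentation P d h\<close> by blast
qed (use left_inverse_birational in blast)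

section \<open>Presentations of the same rational map\<close>

lemma same_map_refl: "same_map P h h"
  unfolding same_map_def by (simp add: mult.commute P_zero)

lemma same_map_sym: "same_map P h h' \<Longrightarrow> same_map P h' h"
  unfolding same_map_def
proof (intro allI)
  fix i j assume "\<forall>i j. h i * h' j - h j * h' i \<in> P"
  then have "h j * h' i - h i * h' j \<in> P" by blast
  then show "h' i * h j - h' j * h i \<in> P" by (simp add: mult.commute)
qed

lemma same_map_trans:
  assumes "same_map P h h'" "same_map P h' h''" "h' k \<notin> P"
  shows "same_map P h h''"
  unfolding same_map_def
proof (intro allI)
  fix i j
  have "h' k * (h i * h'' j - h j * h'' i)
      = h'' j * (h i * h' k - h k * h' i) - h'' i * (h j * h' k - h k * h' j)
        + h k * (h' i * h'' j - h' j * h'' i)"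
    by (simp add: algebra_simps)
  also have "\<dots> \<in> P" using assms(1,2) by (intro P_add P_diff P_mult same_mapD)
  finally show "h i * h'' j - h j * h'' i \<in> P" using P_cancel assms(3) by blast
qed

lemma same_map_nonzero:
  assumes "same_map P h h'" "h j \<notin> P" "h' i \<notin> P"
  shows "h' j \<notin> P"
proof
  assume "h' j \<in> P"
  then have "h i * h' j \<in> P" by (rule P_mult)
  then have "h j * h' i \<in> P" using P_sub_mem[OF same_mapD[OF assms(1)]] by blast
  then show False using P_prime assms(2,3) by blast
qed

lemma same_map_cong: "(\<And>i. h i - h' i \<in> P) \<Longrightarrow> same_map P h h'"
  unfolding same_map_def
proof (intro allI)
  fix i j assume a: "\<And>i. h i - h' i \<in> P"
  have "h i * h' j - h j * h' i = h' j * (h i - h' i) - h' i * (h j - h' j)" by (simp add: algebra_simps)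
  also have "\<dots> \<in> P" by (intro P_diff P_mult a)
  finally show "h i * h' j - h j * h' i \<in> P" .
qed

lemma rat_map_eq:
  assumes "presentation P d h" "presentation P d' h'" "same_map P h h'"
  shows "rat_map P h = rat_map P h'"
proof -
  obtain i j where "h i \<notin> P" "h' j \<notin> P" using assms(1,2) unfolding presentation_def by blast
  then show ?thesis unfolding rat_map_def
    using same_map_trans[of h h' _ j] same_map_trans[of h' h _ i] same_map_sym assms(3) by blast
qed

text \<open>
  Proportional tuples \<open>h\<close> and \<open>h'\<close> have proportional values \<open>g(h)\<close> and \<open>g(h')\<close>, so they share the left inverse.
\<close>

lemma birational_same_map:
  assumes "birational P d h" "presentation P d' h'" "same_map P h h'"
  shows "birational P d' h'"
proof -
  obtain e g where pres: "presentation P d h" and inv: "left_inverse h e g"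
    using assms(1) unfolding birational_iff by blast
  obtain j i where j: "h j \<notin> P" and i: "h' i \<notin> P"
    using pres assms(2) unfolding presentation_def by blast
  have j': "h' j \<notin> P" by (rule same_map_nonzero[OF assms(3) j i])
  have gf: "\<And>i. form e (g i)" using inv unfolding left_inverse_def by blast
  have hg: "h' j ^ e * subst h (g i) - h j ^ e * subst h' (g i) \<in> P" for i
    using form_proportional[where G = h and H = h' and j = j, OF gf] same_mapD[OF assms(3)] .
  obtain k where k: "subst h (g k) \<notin> P" using inv unfolding left_inverse_def by blast
  have "subst h' (g k) \<notin> P"
  proof
    assume "subst h' (g k) \<in> P"
    then have "h' j ^ e * subst h (g k) \<in> P" using P_sub_mem[OF hg] P_mult by blast
    then show False using P_prime P_power j' k by blast
  qed
  moreover have "same_map P (\<lambda>i. subst h' (g i)) var"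
    unfolding same_map_def
  proof (intro allI)
    fix a b
    have "h j ^ e * (subst h' (g a) * var b - subst h' (g b) * var a)
      = h' j ^ e * (subst h (g a) * var b - subst h (g b) * var a)
        - var b * (h' j ^ e * subst h (g a) - h j ^ e * subst h' (g a))
        + var a * (h' j ^ e * subst h (g b) - h j ^ e * subst h' (g b))"
      by (simp add: algebra_simps)
    also have "\<dots> \<in> P"
    proof -
      have "subst h (g a) * var b - subst h (g b) * var a \<in> P"
        using inv unfolding left_inverse_def same_map_def by blast
      then show ?thesis using P_add[OF P_diff[OF P_mult P_mult[OF hg]] P_mult[OF hg]] by blast
    qed
    finally show "subst h' (g a) * var b - subst h' (g b) * var a \<in> P"
      using P_cancel P_power j by blast
  qed
  ultimately have "left_inverse h' e g" using gf unfolding left_inverse_def by blast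
  then show ?thesis using assms(2) unfolding birational_iff by blast
qed

lemma presentation_cong:
  assumes "presentation P d h" "\<And>i. form d (h' i)" "\<And>i. h i - h' i \<in> P"
  shows "presentation P d h'"
  using assms P_sub_mem[OF assms(3)] P_sub_mem[OF subst_cong_P[of h h', OF assms(3)]]
  unfolding presentation_def by blast

end

section \<open>Homogeneous linear systems over the coordinate ring\<close>

context hprime
begin

text \<open>
  Elimination of one unknown with a pivot at most doubles the degrees of the coefficients, so the degree
  of some non-trivial solution is bounded in terms of the number of unknowns and these degrees,
  however many equations there are.
\<close>

lemma bounded_solution_card:
  "\<exists>B. \<forall>A (r :: 'r \<Rightarrow> 'v \<Rightarrow> ('v, 'k) mpoly) Rw X. card A = n \<longrightarrow>
     (\<forall>\<rho>\<in>Rw. \<exists>e\<le>E. \<forall>i\<in>A. form e (r \<rho> i)) \<longrightarrow> (\<forall>\<rho>\<in>Rw. (\<Sum>i\<in>A. r \<rho> i * X i) \<in> P) \<longrightarrow>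
     (\<exists>i\<in>A. X i \<notin> P) \<longrightarrow>
     (\<exists>D\<le>B. \<exists>Y. (\<forall>i\<in>A. form D (Y i)) \<and> (\<exists>i\<in>A. Y i \<notin> P) \<and>
        (\<forall>\<rho>\<in>Rw. (\<Sum>i\<in>A. r \<rho> i * Y i) \<in> P))"
proof (induction n arbitrary: E)
  case 0
  have "A = {}" if "card A = 0" for A :: "'v set" using that by (simp add: card_eq_0_iff)
  then show ?case by auto
next
  case (Suc n)
  from Suc.IH[of "2 * E"] obtain B where B: "\<forall>A (r :: 'r \<Rightarrow> 'v \<Rightarrow> ('v, 'k) mpoly) Rw X. card A = n \<longrightarrow>
     (\<forall>\<rho>\<in>Rw. \<exists>e\<le>2 * E. \<forall>i\<in>A. form e (r \<rho> i)) \<longrightarrow> (\<forall>\<rho>\<in>Rw. (\<Sum>i\<in>A. r \<rho> i * X i) \<in> P) \<longrightarrow>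
     (\<exists>i\<in>A. X i \<notin> P) \<longrightarrow>
     (\<exists>D\<le>B. \<exists>Y. (\<forall>i\<in>A. form D (Y i)) \<and> (\<exists>i\<in>A. Y i \<notin> P) \<and>
        (\<forall>\<rho>\<in>Rw. (\<Sum>i\<in>A. r \<rho> i * Y i) \<in> P))"
    by (elim exE) (rule that)
  show ?case
  proof (rule exI[of _ "E + B"], intro allI impI)
    fix A and r :: "'r \<Rightarrow> 'v \<Rightarrow> ('v, 'k) mpoly" and Rw X
    assume A: "card A = Suc n" and r: "\<forall>\<rho>\<in>Rw. \<exists>e\<le>E. \<forall>i\<in>A. form e (r \<rho> i)"
      and X: "\<forall>\<rho>\<in>Rw. (\<Sum>i\<in>A. r \<rho> i * X i) \<in> P" and nz: "\<exists>i\<in>A. X i \<notin> P"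
    show "\<exists>D\<le>E + B. \<exists>Y. (\<forall>i\<in>A. form D (Y i)) \<and> (\<exists>i\<in>A. Y i \<notin> P) \<and>
        (\<forall>\<rho>\<in>Rw. (\<Sum>i\<in>A. r \<rho> i * Y i) \<in> P)"
    proof (cases "\<forall>\<rho>\<in>Rw. \<forall>i\<in>A. r \<rho> i \<in> P")
      case True
      have "A \<noteq> {}" using A by auto
      then obtain i0 where i0: "i0 \<in> A" by blast
      show ?thesis
      proof (intro exI[of _ 0] conjI exI[of _ "\<lambda>_. 1"] ballI)
        show "\<exists>i\<in>A. 1 \<notin> P" using i0 P_one by blast
        show "(\<Sum>i\<in>A. r \<rho> i * 1) \<in> P" if "\<rho> \<in> Rw" for \<rho>
          using True that by (intro P_sum) simp
      qed (simp_all add: form_one)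
    next
      case False
      then obtain \<rho>0 j where p: "\<rho>0 \<in> Rw" "j \<in> A" "r \<rho>0 j \<notin> P" by blast
      obtain e0 where e0: "e0 \<le> E" "\<And>i. i \<in> A \<Longrightarrow> form e0 (r \<rho>0 i)" using r p(1) by blast
      let ?A = "A - {j}"
      define r' where "r' \<rho> i = r \<rho>0 j * r \<rho> i - r \<rho> j * r \<rho>0 i" for \<rho> i
      have split: "(\<Sum>i\<in>A. f i) = f j + (\<Sum>i\<in>?A. f i)" for f :: "'v \<Rightarrow> ('v, 'k) mpoly"
        using p(2) by (intro sum.remove) auto
      have elim: "(\<Sum>i\<in>?A. r' \<rho> i * Z i)
          = r \<rho>0 j * (\<Sum>i\<in>?A. r \<rho> i * Z i) - r \<rho> j * (\<Sum>i\<in>?A. r \<rho>0 i * Z i)" for \<rho> Z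
        by (simp add: r'_def sum_distrib_left sum_subtractf[symmetric] algebra_simps)
      have "\<exists>D\<le>B. \<exists>Y. (\<forall>i\<in>?A. form D (Y i)) \<and> (\<exists>i\<in>?A. Y i \<notin> P) \<and>
          (\<forall>\<rho>\<in>Rw. (\<Sum>i\<in>?A. r' \<rho> i * Y i) \<in> P)"
      proof (rule B[THEN spec, THEN spec, THEN spec, THEN spec, THEN mp, THEN mp, THEN mp, THEN mp])
        show "card ?A = n" using A p(2) by simp
        show "\<forall>\<rho>\<in>Rw. \<exists>e\<le>2 * E. \<forall>i\<in>?A. form e (r' \<rho> i)"
        proof
          fix \<rho> assume "\<rho> \<in> Rw"
          then obtain e where e: "e \<le> E" "\<And>i. i \<in> A \<Longrightarrow> form e (r \<rho> i)" using r by blast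
          have "form (e0 + e) (r' \<rho> i)" if "i \<in> ?A" for i
          proof -
            have "form (e0 + e) (r \<rho>0 j * r \<rho> i)" "form (e + e0) (r \<rho> j * r \<rho>0 i)"
              using that p(2) by (auto intro!: form_mult e(2) e0(2))
            then show ?thesis unfolding r'_def by (intro form_diff) (simp_all add: add.commute)
          qed
          moreover have "e0 + e \<le> 2 * E" using e0(1) e(1) by simp
          ultimately show "\<exists>e\<le>2 * E. \<forall>i\<in>?A. form e (r' \<rho> i)" by blast
        qed
        show "\<forall>\<rho>\<in>Rw. (\<Sum>i\<in>?A. r' \<rho> i * X i) \<in> P"
        proof
          fix \<rho> assume \<rho>: "\<rho> \<in> Rw"
          have "(\<Sum>i\<in>?A. r' \<rho> i * X i)
              = r \<rho>0 j * (\<Sum>i\<in>A. r \<rho> i * X i) - r \<rho> j * (\<Sum>i\<in>A. r \<rho>0 i * X i)"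
            unfolding elim split[of "\<lambda>i. r \<rho> i * X i"] split[of "\<lambda>i. r \<rho>0 i * X i"]
            by (simp add: algebra_simps)
          also have "\<dots> \<in> P" using X \<rho> p(1) by (intro P_diff P_mult) auto
          finally show "(\<Sum>i\<in>?A. r' \<rho> i * X i) \<in> P" .
        qed
        show "\<exists>i\<in>?A. X i \<notin> P"
        proof (rule ccontr)
          assume n: "\<not> ?thesis"
          then have "(\<Sum>i\<in>?A. r \<rho>0 i * X i) \<in> P" by (intro P_sum P_mult) auto
          moreover have "r \<rho>0 j * X j = (\<Sum>i\<in>A. r \<rho>0 i * X i) - (\<Sum>i\<in>?A. r \<rho>0 i * X i)"
            unfolding split[of "\<lambda>i. r \<rho>0 i * X i"] by simp
          ultimately have "r \<rho>0 j * X j \<in> P" using X p(1) P_diff by simp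
          then have "X j \<in> P" using P_cancel p(3) by blast
          then show False using n nz by blast
        qed
      qed
      then obtain D Y where D: "D \<le> B" and Y: "\<And>i. i \<in> ?A \<Longrightarrow> form D (Y i)" "\<exists>i\<in>?A. Y i \<notin> P"
        "\<And>\<rho>. \<rho> \<in> Rw \<Longrightarrow> (\<Sum>i\<in>?A. r' \<rho> i * Y i) \<in> P" by blast
      define Y' where "Y' i = (if i = j then - (\<Sum>l\<in>?A. r \<rho>0 l * Y l) else r \<rho>0 j * Y i)" for i
      have "form (e0 + D) (Y' i)" if "i \<in> A" for i
        unfolding Y'_def using that p(2)
        by (cases "i = j") (auto intro!: form_uminus form_sum form_mult e0(2) Y(1))
      moreover have "\<exists>i\<in>A. Y' i \<notin> P"
      proof -
        obtain i where i: "i \<in> ?A" "Y i \<notin> P" using Y(2) by blast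
        then have "Y' i \<notin> P" using P_prime[of "r \<rho>0 j" "Y i"] p(3) by (auto simp: Y'_def)
        then show ?thesis using i(1) by blast
      qed
      moreover have "(\<Sum>i\<in>A. r \<rho> i * Y' i) \<in> P" if "\<rho> \<in> Rw" for \<rho>
      proof -
        have "(\<Sum>i\<in>?A. r \<rho> i * Y' i) = r \<rho>0 j * (\<Sum>i\<in>?A. r \<rho> i * Y i)"
          unfolding sum_distrib_left by (intro sum.cong) (auto simp: Y'_def mult_ac)
        then have "(\<Sum>i\<in>A. r \<rho> i * Y' i) = (\<Sum>i\<in>?A. r' \<rho> i * Y i)"
          unfolding split[of "\<lambda>i. r \<rho> i * Y' i"] elim by (simp add: Y'_def)
        then show ?thesis using Y(3)[OF that] by simp
      qed
      moreover have "e0 + D \<le> E + B" using e0(1) D by simp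
      ultimately show ?thesis by blast
    qed
  qed
qed

end

section \<open>Families of substitutions\<close>

definition emb :: "('v \<Rightarrow> 'w) \<Rightarrow> 'v monom \<Rightarrow> 'w monom" where
  "emb \<iota> m = (\<Sum>i\<in>keys m. single (\<iota> i) (lookup m i))"

lemma lookup_emb:
  assumes "inj \<iota>"
  shows "lookup (emb \<iota> m) (\<iota> i) = lookup m i"
proof -
  have "lookup (emb \<iota> m) (\<iota> i) = (\<Sum>j\<in>keys m. if j = i then lookup m j else 0)"
    unfolding emb_def lookup_sum lookup_single when_def using assms
    by (intro sum.cong) (auto simp: inj_eq)
  then show ?thesis by (auto simp: in_keys_iff)
qed

lemma lookup_emb_other: "w \<notin> range \<iota> \<Longrightarrow> lookup (emb \<iota> m) w = 0"
  unfolding emb_def by (auto simp: lookup_sum lookup_single when_def intro!: sum.neutral)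

lemma subst_single_UNIV:
  "subst v (single m (c :: 'k::field)) = const c * (\<Prod>w\<in>(UNIV :: 'w::finite set). v w ^ lookup m w)"
  unfolding subst_single by (subst prod_keys_superset[of UNIV]) simp_all

lemma subst_emb:
  assumes "inj \<iota>"
  shows "subst v (single (emb \<iota> m) (c :: 'k::field)) = subst (\<lambda>i. v (\<iota> i)) (single m c)"
proof -
  have keys_emb: "keys (emb \<iota> m) = \<iota> ` keys m"
  proof (intro equalityI subsetI)
    fix w assume w: "w \<in> keys (emb \<iota> m)"
    then obtain i where "w = \<iota> i" using lookup_emb_other[of w \<iota> m] by (auto simp: in_keys_iff)
    then show "w \<in> \<iota> ` keys m" using w lookup_emb[OF assms, of m i] by (auto simp: in_keys_iff)
  qed (use lookup_emb[OF assms, of m] in \<open>auto simp: in_keys_iff\<close>)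
  have "inj_on \<iota> (keys m)" using assms by (rule inj_on_subset) simp
  then show ?thesis unfolding subst_single keys_emb
    by (subst prod.reindex) (simp_all add: lookup_emb[OF assms])
qed

lemma subst_cong_keys:
  assumes "\<And>m w. m \<in> keys f \<Longrightarrow> w \<in> keys m \<Longrightarrow> v w = v' w"
  shows "subst v f = subst v' f"
  unfolding peval_def using assms by (intro sum.cong prod.cong refl arg_cong2[of _ _ _ _ "(*)"] ) auto

definition wdeg :: "('w::finite \<Rightarrow> nat) \<Rightarrow> 'w monom \<Rightarrow> nat" where
  "wdeg \<omega> m = (\<Sum>w\<in>UNIV. lookup m w * \<omega> w)"

lemma wdeg_add: "wdeg \<omega> (m + n) = wdeg \<omega> m + wdeg \<omega> n"
  by (simp add: wdeg_def lookup_add distrib_right sum.distrib)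

lemma wdeg_keys: "wdeg \<omega> m = (\<Sum>w\<in>keys m. lookup m w * \<omega> w)"
  unfolding wdeg_def by (intro sum.mono_neutral_right) (auto simp: in_keys_iff)

lemma mdeg_wdeg: "mdeg m = wdeg (\<lambda>_. 1) m"
  unfolding wdeg_def using mdeg_superset[of UNIV m] by simp

lemma wdeg_add_weights: "wdeg (\<lambda>w. \<omega> w + \<omega>' w) m = wdeg \<omega> m + wdeg \<omega>' m"
  by (simp add: wdeg_def distrib_left sum.distrib)

lemma wdeg_mono: "(\<And>w. \<omega> w \<le> \<omega>' w) \<Longrightarrow> wdeg \<omega> m \<le> wdeg \<omega>' m"
  unfolding wdeg_def by (intro sum_mono) simp

context hprime
begin

text \<open>
  The joint image of a monomial under several substitutions, in coordinates modulo \<open>P\<close>. A linear relation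
  between such vectors is a polynomial that all substitutions map into \<open>P\<close>.
\<close>

definition svec :: "('q \<Rightarrow> 'w \<Rightarrow> ('v, 'k) mpoly) \<Rightarrow> 'w monom \<Rightarrow> 'q \<times> ('v, 'k) mpoly \<Rightarrow> 'k" where
  "svec v m = (\<lambda>(q, c). pr (subst (v q) (single m 1)) c)"

lemma inspan_svec:
  "inspan (svec v) M (svec v m) \<longleftrightarrow>
     (\<exists>t. \<forall>q. subst (v q) (single m 1 - (\<Sum>x\<in>M. const (t x) * single x 1)) \<in> P)"
  unfolding inspan_def svec_def pr_P split_paired_All
  by (simp add: subst_diff subst_sum subst_mult pr_diff pr_lincomb)

text \<open>
  Multiplying a relation by a monomial gives a relation, which is the shift property; the grading by two
  weights of positive sum makes the pieces finite.
\<close>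

lemma monomial_family_svec:
  fixes r :: "'w::finite \<Rightarrow> nat" and v :: "('i \<Rightarrow> 'k) \<Rightarrow> 'q \<Rightarrow> 'w \<Rightarrow> ('v, 'k) mpoly"
  assumes r: "inj r" and pos: "\<And>w. 1 \<le> \<omega> w + \<omega>' w"
    and fam: "\<And>q w. pfam (\<delta> w) (\<lambda>a. v a q w)"
    and span: "\<And>e. e \<in> \<D> \<Longrightarrow> \<exists>B\<subseteq>{m. (wdeg \<omega> m, wdeg \<omega>' m) = e}. \<forall>a a'.
      (\<forall>m\<in>B. \<forall>q. subst (v a q) (single m 1) = subst (v a' q) (single m 1)) \<and>
      (\<forall>m. (wdeg \<omega> m, wdeg \<omega>' m) = e \<longrightarrow> inspan (svec (v a)) B (svec (v a) m))"
  shows "monomial_family r (\<lambda>m. (wdeg \<omega> m, wdeg \<omega>' m)) \<D> (\<lambda>a. svec (v a))"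
proof -
  interpret monomial_order r "UNIV :: 'w set" using r by unfold_locales simp_all
  have fin: "finite {m. (wdeg \<omega> m, wdeg \<omega>' m) = e}" for e
  proof (rule finite_subset[OF _ finite_monomials[of "fst e + snd e"]], rule subsetI)
    fix m assume m: "m \<in> {m. (wdeg \<omega> m, wdeg \<omega>' m) = e}"
    have "mdeg m \<le> wdeg (\<lambda>w. \<omega> w + \<omega>' w) m" unfolding mdeg_wdeg by (rule wdeg_mono) (rule pos)
    then show "m \<in> {m. keys m \<subseteq> UNIV \<and> mdeg m \<le> fst e + snd e}"
      using m by (auto simp: wdeg_add_weights)
  qed
  show ?thesis
  proof unfold_locales
    fix e assume "e \<in> \<D>"
    show "finite {m. (wdeg \<omega> m, wdeg \<omega>' m) = e}" by (rule fin)
    show "\<exists>B\<subseteq>{m. (wdeg \<omega> m, wdeg \<omega>' m) = e}. \<forall>a a'. (\<forall>m\<in>B. svec (v a) m = svec (v a') m) \<and>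
       (\<forall>m. (wdeg \<omega> m, wdeg \<omega>' m) = e \<longrightarrow> inspan (svec (v a)) B (svec (v a) m))"
      using span[OF \<open>e \<in> \<D>\<close>]
    proof (elim exE conjE, intro exI conjI allI)
      fix B a a' assume B: "\<forall>a a'. (\<forall>m\<in>B. \<forall>q. subst (v a q) (single m 1) = subst (v a' q) (single m 1)) \<and>
        (\<forall>m. (wdeg \<omega> m, wdeg \<omega>' m) = e \<longrightarrow> inspan (svec (v a)) B (svec (v a) m))"
      show "\<forall>m\<in>B. svec (v a) m = svec (v a') m"
      proof
        fix m assume "m \<in> B"
        then have "\<forall>q. subst (v a q) (single m 1) = subst (v a' q) (single m 1)" using B by blast
        then show "svec (v a) m = svec (v a') m" unfolding svec_def by simp
      qed
      show "(wdeg \<omega> m, wdeg \<omega>' m) = e \<longrightarrow> inspan (svec (v a)) B (svec (v a) m)" for m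
        using B by blast
    qed
  next
    fix m :: "'w monom"
    have "hfun (\<Sum>w\<in>keys m. lookup m w * \<delta> w) (\<lambda>a. svec (v a) m c)" for c
      unfolding svec_def case_prod_unfold by (intro pr_hfun pfam_subst_single fam)
    then show "\<exists>e. \<forall>c. hfun e (\<lambda>a. svec (v a) m c)" by blast
  next
    fix m n :: "'w monom" and a
    let ?dg = "\<lambda>m. (wdeg \<omega> m, wdeg \<omega>' m)"
    let ?M = "{m'. ?dg m' = ?dg m \<and> mless r m' m}" and ?N = "{m'. ?dg m' = ?dg (n + m) \<and> mless r m' (n + m)}"
    assume "inspan (svec (v a)) ?M (svec (v a) m)"
    then obtain t where t: "\<And>q. subst (v a q) (single m 1 - (\<Sum>x\<in>?M. const (t x) * single x 1)) \<in> P"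
      unfolding inspan_svec by blast
    have sub: "(+) n ` ?M \<subseteq> ?N" by (auto simp: wdeg_add intro: mless_add)
    have fN: "finite ?N" by (rule finite_subset[OF _ fin[of "?dg (n + m)"]]) auto
    have "inspan (svec (v a)) ((+) n ` ?M) (svec (v a) (n + m))"
      unfolding inspan_svec
    proof (intro exI[of _ "\<lambda>x. t (x - n)"] allI)
      fix q
      have "(\<Sum>x\<in>(+) n ` ?M. const (t (x - n)) * single x 1)
          = (\<Sum>x\<in>?M. single n 1 * (const (t x) * single x (1 :: 'k)))"
        by (subst sum.reindex) (auto simp: inj_on_def mult_single const_def intro!: sum.cong)
      then have "single (n + m) 1 - (\<Sum>x\<in>(+) n ` ?M. const (t (x - n)) * single x (1 :: 'k))
          = single n 1 * (single m 1 - (\<Sum>x\<in>?M. const (t x) * single x 1))"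
        by (simp add: right_diff_distrib sum_distrib_left mult_single)
      then show "subst (v a q) (single (n + m) 1 - (\<Sum>x\<in>(+) n ` ?M. const (t (x - n)) * single x 1)) \<in> P"
        using P_mult[OF t[of q]] by (simp add: subst_mult)
    qed
    then show "inspan (svec (v a)) ?N (svec (v a) (n + m))" by (rule inspan_mono[OF fN sub])
  qed
qed

text \<open>
  Membership in a span becomes a polynomial relation with leading monomial \<open>m\<close>, to which the division
  algorithm applies.
\<close>

lemma inspan_svec_relation:
  fixes v :: "'q \<Rightarrow> 'w \<Rightarrow> ('v, 'k) mpoly"
  assumes "finite M" "m \<notin> M"
  shows "inspan (svec v) M (svec v m) \<longleftrightarrow>
    (\<exists>f. lookup f m = 1 \<and> keys f \<subseteq> insert m M \<and> (\<forall>q. subst (v q) f \<in> P))"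
proof
  assume "inspan (svec v) M (svec v m)"
  then obtain t where t: "\<And>q. subst (v q) (single m 1 - (\<Sum>x\<in>M. const (t x) * single x 1)) \<in> P"
    unfolding inspan_svec by blast
  let ?f = "single m 1 - (\<Sum>x\<in>M. const (t x) * single x 1)"
  have lk: "lookup ?f k = (if k = m then 1 else 0) - (if k \<in> M then t k else 0)" for k
    using assms(1) by (simp add: lookup_minus lookup_sum lookup_single when_def if_distrib[of "(*) _"] cong: if_cong)
  have "lookup ?f m = 1" using lk assms(2) by simp
  moreover have "keys ?f \<subseteq> insert m M" by (auto simp: in_keys_iff lk split: if_splits)
  ultimately show "\<exists>f. lookup f m = 1 \<and> keys f \<subseteq> insert m M \<and> (\<forall>q. subst (v q) f \<in> P)"
    using t by (intro exI[of _ ?f]) simp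
next
  assume "\<exists>f. lookup f m = 1 \<and> keys f \<subseteq> insert m M \<and> (\<forall>q. subst (v q) f \<in> P)"
  then obtain f where f: "lookup f m = 1" "keys f \<subseteq> insert m M" "\<And>q. subst (v q) f \<in> P" by blast
  have feq: "f = single m 1 - (\<Sum>x\<in>M. const (- lookup f x) * single x 1)"
  proof (rule poly_mapping_eqI)
    fix k
    have "lookup (single m 1 - (\<Sum>x\<in>M. const (- lookup f x) * single x 1)) k
        = (if k = m then 1 else 0) + (if k \<in> M then lookup f k else 0)"
      using assms(1) by (simp add: lookup_minus lookup_sum lookup_single when_def if_distrib[of "(*) _"] sum_negf cong: if_cong)
    also have "\<dots> = lookup f k" using f(1,2) assms(2) by (auto simp: in_keys_iff subset_iff)
    finally show "lookup f k = lookup (single m 1 - (\<Sum>x\<in>M. const (- lookup f x) * single x 1)) k" by simp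
  qed
  show "inspan (svec v) M (svec v m)" unfolding inspan_svec
    by (intro exI[of _ "\<lambda>x. - lookup f x"] allI) (simp only: feq[symmetric] f(3))
qed

end

section \<open>The degree of the inverse is bounded on the parameter space\<close>

lemma lookup_forms_of:
  "lookup (forms_of d a i :: ('v::finite, 'k::field) mpoly) m = (if mdeg m = d then a (i, m) else 0)"
proof -
  obtain r :: "'v \<Rightarrow> nat" where "inj_on r UNIV" using finite_imp_inj_to_nat_seg[of "UNIV :: 'v set"] by auto
  then interpret monomial_order r "UNIV :: 'v set" by unfold_locales simp_all
  have "finite (monoms d :: 'v monom set)"
    by (rule finite_subset[OF _ finite_monomials[of d]]) (auto simp: monoms_def)
  then show ?thesis
    by (simp add: forms_of_def lookup_sum lookup_single when_def monoms_def)
qed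

lemma form_forms_of: "form d (forms_of d a i :: ('v::finite, 'k::field) mpoly)"
  by (auto simp: form_def monoms_def in_keys_iff lookup_forms_of split: if_splits)

text \<open>
  The variables of the polynomial ring of the graph of a rational map: \<open>x\<^sub>i\<close>, \<open>y\<^sub>i\<close> and
  one further variable \<open>u\<close>, with \<open>y\<^sub>i \<mapsto> h\<^sub>i u\<close>; below \<open>u\<close> is specialized to \<open>1\<close>, which
  loses nothing because of the bigrading. The degree-lexicographic order eliminates
  \<open>u\<close> within each bidegree.
\<close>

type_synonym 'v graph_var = "'v + 'v option"

abbreviation X :: "'v \<Rightarrow> 'v graph_var" where "X i \<equiv> Inl i"
abbreviation Y :: "'v \<Rightarrow> 'v graph_var" where "Y i \<equiv> Inr (Some i)"
abbreviation U :: "'v graph_var" where "U \<equiv> Inr None"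

definition gval :: "('v \<Rightarrow> 'b) \<Rightarrow> ('v \<Rightarrow> 'b) \<Rightarrow> 'b \<Rightarrow> 'v graph_var \<Rightarrow> 'b" where
  "gval x y u w = (case w of Inl i \<Rightarrow> x i | Inr None \<Rightarrow> u | Inr (Some i) \<Rightarrow> y i)"

lemma gval_simps [simp]: "gval x y u (X i) = x i" "gval x y u (Y i) = y i" "gval x y u U = u"
  by (simp_all add: gval_def)

lemma graph_var_cases: obtains i where "w = X i" | i where "w = Y i" | "w = U"
  by (metis option.exhaust sum.exhaust)

abbreviation xdeg :: "'v::finite graph_var monom \<Rightarrow> nat" where "xdeg \<equiv> wdeg (gval (\<lambda>_. 1) (\<lambda>_. 0) 0)"
abbreviation ydeg :: "'v::finite graph_var monom \<Rightarrow> nat" where "ydeg \<equiv> wdeg (gval (\<lambda>_. 0) (\<lambda>_. 1) 0)"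
abbreviation udeg :: "'v::finite graph_var monom \<Rightarrow> nat" where "udeg \<equiv> wdeg (gval (\<lambda>_. 0) (\<lambda>_. 0) 1)"

lemma UNIV_graph_var: "(UNIV :: 'v graph_var set) = range X \<union> (range Y \<union> {U})"
proof -
  have "w \<in> range X \<union> (range Y \<union> {U})" for w :: "'v graph_var"
    by (cases w rule: graph_var_cases) auto
  then show ?thesis by blast
qed

lemma prod_graph_var:
  fixes f :: "'v::finite graph_var \<Rightarrow> 'b::comm_monoid_mult"
  shows "(\<Prod>w\<in>UNIV. f w) = (\<Prod>i\<in>UNIV. f (X i)) * ((\<Prod>i\<in>UNIV. f (Y i)) * f U)"
proof -
  have "(\<Prod>w\<in>range X. f w) = (\<Prod>i\<in>UNIV. f (X i))" by (subst prod.reindex) (simp_all add: inj_on_def)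
  moreover have "(\<Prod>w\<in>range Y. f w) = (\<Prod>i\<in>UNIV. f (Y i))" by (subst prod.reindex) (simp_all add: inj_on_def)
  moreover have "(\<Prod>w\<in>range X \<union> (range Y \<union> {U}). f w)
      = (\<Prod>w\<in>range X. f w) * ((\<Prod>w\<in>range Y. f w) * (\<Prod>w\<in>{U}. f w))"
    by (subst prod.union_disjoint, simp, simp, force, subst prod.union_disjoint) auto
  ultimately show ?thesis unfolding UNIV_graph_var by simp
qed

lemma sum_graph_var:
  fixes f :: "'v::finite graph_var \<Rightarrow> 'b::comm_monoid_add"
  shows "(\<Sum>w\<in>UNIV. f w) = (\<Sum>i\<in>UNIV. f (X i)) + ((\<Sum>i\<in>UNIV. f (Y i)) + f U)"
proof -
  have "(\<Sum>w\<in>range X. f w) = (\<Sum>i\<in>UNIV. f (X i))" by (subst sum.reindex) (simp_all add: inj_on_def)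
  moreover have "(\<Sum>w\<in>range Y. f w) = (\<Sum>i\<in>UNIV. f (Y i))" by (subst sum.reindex) (simp_all add: inj_on_def)
  moreover have "(\<Sum>w\<in>range X \<union> (range Y \<union> {U}). f w)
      = (\<Sum>w\<in>range X. f w) + ((\<Sum>w\<in>range Y. f w) + (\<Sum>w\<in>{U}. f w))"
    by (subst sum.union_disjoint, simp, simp, force, subst sum.union_disjoint) auto
  ultimately show ?thesis unfolding UNIV_graph_var by simp
qed

lemma wdeg_graph_var: "wdeg (gval (\<lambda>_. a) (\<lambda>_. b) c) m = a * xdeg m + b * ydeg m + c * udeg m"
  unfolding wdeg_def sum_graph_var by (simp add: sum_distrib_left mult.commute)

lemma xdeg_simp: "xdeg m = (\<Sum>i\<in>UNIV. lookup m (X i))"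
  unfolding wdeg_def sum_graph_var by simp

lemma mdeg_graph_var: "mdeg m = xdeg m + ydeg m + udeg m"
proof -
  have "(\<lambda>_. 1) = gval (\<lambda>_ :: 'a. 1 :: nat) (\<lambda>_. 1) 1"
  proof
    fix w show "1 = gval (\<lambda>_ :: 'a. 1 :: nat) (\<lambda>_. 1) 1 w" by (cases w rule: graph_var_cases) simp_all
  qed
  from trans[OF mdeg_wdeg[of m] arg_cong[OF this, of "\<lambda>\<omega>. wdeg \<omega> m"]] wdeg_graph_var[of 1 1 1 m]
  show ?thesis by linarith
qed

text \<open>
  The coefficients of a polynomial that is linear in the \<open>x\<^sub>i\<close> are its values at the unit vectors.
\<close>

lemma subst_linear_x:
  fixes x y :: "'v::finite \<Rightarrow> ('z, 'k::field) mpoly"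
  assumes "\<And>m. m \<in> keys f \<Longrightarrow> xdeg m = 1"
  shows "subst (gval x y u) f
    = (\<Sum>i\<in>UNIV. subst (gval (\<lambda>j. if j = i then 1 else 0) y u) f * x i)"
proof -
  have mono: "(\<Prod>i\<in>UNIV. z i ^ lookup m (X i)) = (\<Sum>i\<in>UNIV. (\<Prod>j\<in>UNIV. (if j = i then 1 else 0) ^ lookup m (X j)) * z i)"
    if m: "xdeg m = 1" for m and z :: "'v \<Rightarrow> ('z, 'k) mpoly"
  proof -
    from m have s: "(\<Sum>i\<in>UNIV. lookup m (X i)) = 1" unfolding xdeg_simp .
    then obtain k where k: "lookup m (X k) \<noteq> 0" by fastforce
    have "(\<Sum>i\<in>UNIV. lookup m (X i)) = lookup m (X k) + (\<Sum>i\<in>UNIV - {k}. lookup m (X i))"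
      by (rule sum.remove) simp_all
    then have "lookup m (X k) = 1" "(\<Sum>i\<in>UNIV - {k}. lookup m (X i)) = 0" using s k by linarith+
    then have lk: "lookup m (X i) = (if i = k then 1 else 0)" for i by auto
    have p1: "(\<Prod>i\<in>UNIV. z i ^ lookup m (X i)) = z k" for z :: "'v \<Rightarrow> ('z, 'k) mpoly"
    proof -
      have "(\<Prod>i\<in>UNIV. z i ^ lookup m (X i)) = (\<Prod>i\<in>UNIV. if i = k then z i else 1)"
        by (intro prod.cong refl) (simp add: lk)
      then show ?thesis by simp
    qed
    show ?thesis unfolding p1 by (simp add: if_distrib[of "\<lambda>t. t * _"] cong: if_cong)
  qed
  have "subst (gval x y u) f = (\<Sum>m\<in>keys f. subst (gval x y u) (single m (lookup f m)))"
    unfolding subst_sum[symmetric] using mpoly_sum_single[of f] by simp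
  also have "\<dots> = (\<Sum>m\<in>keys f. \<Sum>i\<in>UNIV.
      subst (gval (\<lambda>j. if j = i then 1 else 0) y u) (single m (lookup f m)) * x i)"
  proof (intro sum.cong refl)
    fix m assume "m \<in> keys f"
    from mono[OF assms[OF this], of x]
    show "subst (gval x y u) (single m (lookup f m)) = (\<Sum>i\<in>UNIV.
      subst (gval (\<lambda>j. if j = i then 1 else 0) y u) (single m (lookup f m)) * x i)"
      unfolding subst_single_UNIV prod_graph_var gval_simps by (simp add: sum_distrib_left mult_ac)
  qed
  also have "\<dots> = (\<Sum>i\<in>UNIV. subst (gval (\<lambda>j. if j = i then 1 else 0) y u) f * x i)"
    by (subst sum.swap, subst sum_distrib_right[symmetric], subst subst_sum[symmetric])
       (use mpoly_sum_single[of f] in simp)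
  finally show ?thesis .
qed

lemma keys_subst_var:
  assumes "inj \<iota>"
  shows "keys (subst (\<lambda>v. var (\<iota> v)) p) \<subseteq> emb \<iota> ` keys (p :: ('v, 'k::field) mpoly)"
proof -
  have "subst (\<lambda>v. var (\<iota> v)) p = (\<Sum>m\<in>keys p. subst (\<lambda>v. var (\<iota> v)) (single m (lookup p m)))"
    unfolding subst_sum[symmetric] using mpoly_sum_single[of p] by simp
  also have "\<dots> = (\<Sum>m\<in>keys p. single (emb \<iota> m) (lookup p m))"
    unfolding subst_emb[OF assms, symmetric] by simp
  finally show ?thesis using keys_sum[of "\<lambda>m. single (emb \<iota> m) (lookup p m)" "keys p"]
    by (auto split: if_splits)
qed

context hprime
begin

lemma pfam_forms_of: "pfam 1 (\<lambda>a. forms_of d a i :: ('v, 'k) mpoly)"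
  unfolding pfam_def lookup_forms_of
proof (intro conjI allI exI[of _ "monoms d"])
  show "hfun 1 (\<lambda>a. if mdeg m = d then a (i, m) else 0)" for m :: "'v monom"
    using hfun_coord[of "(i, m)"] hfun_zero by (cases "mdeg m = d") simp_all
  show "keys (forms_of d a i :: ('v, 'k) mpoly) \<subseteq> monoms d" for a
    using form_forms_of[of d a i] by (simp add: form_def)
qed (rule finite_monoms)

definition graph_val :: "nat \<Rightarrow> ('v \<times> 'v monom \<Rightarrow> 'k) \<Rightarrow> unit \<Rightarrow> 'v graph_var \<Rightarrow> ('v, 'k) mpoly" where
  "graph_val d a = (\<lambda>_. gval var (forms_of d a) 1)"

lemma form_gval_subst:
  assumes "\<And>i. form a (x i)" "\<And>i. form b (y i)" "form c u"
    and "\<And>m. m \<in> keys f \<Longrightarrow> a * xdeg m + b * ydeg m + c * udeg m = e"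
  shows "form e (subst (gval x y u) f :: ('v, 'k) mpoly)"
proof (rule form_subst_weighted[of "gval (\<lambda>_. a) (\<lambda>_. b) c"])
  show "form (gval (\<lambda>_. a) (\<lambda>_. b) c w) (gval x y u w)" for w
    using assms(1-3) by (cases w rule: graph_var_cases) simp_all
  fix m assume "m \<in> keys f"
  then show "(\<Sum>i\<in>keys m. lookup m i * gval (\<lambda>_. a) (\<lambda>_. b) c i) = e"
    unfolding wdeg_keys[symmetric] wdeg_graph_var[of a b c] by (rule assms(4))
qed

text \<open>
  The family belonging to the ideal of the graph. A piece of bidegree \<open>(s, t)\<close> is spanned by
  the monomials of degree \<open>s\<close> in the \<open>x\<^sub>i\<close> times \<open>u\<^sup>t\<close>, whose images do not involve \<open>h\<close>.
\<close>

lemma graph_family: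
  assumes r: "inj (r :: 'v graph_var \<Rightarrow> nat)"
  shows "monomial_family r (\<lambda>m. (wdeg (gval (\<lambda>_. 1) (\<lambda>_. d) 0) m, wdeg (gval (\<lambda>_. 0) (\<lambda>_. 1) 1) m)) UNIV
    (\<lambda>a. svec (graph_val d a))"
proof (rule monomial_family_svec[where \<delta> = "gval (\<lambda>_. 0) (\<lambda>_. 1) 0", OF r])
  show "1 \<le> gval (\<lambda>_. 1) (\<lambda>_. d) 0 w + gval (\<lambda>_. 0) (\<lambda>_. 1) 1 w" for w :: "'v graph_var"
    by (cases w rule: graph_var_cases) simp_all
  show "pfam (gval (\<lambda>_. 0) (\<lambda>_. 1) 0 w) (\<lambda>a. graph_val d a q w)" for q w
    unfolding graph_val_def using pfam_forms_of by (cases w rule: graph_var_cases) (simp_all add: pfam_fixed)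
  fix e :: "nat \<times> nat"
  obtain s t where e: "e = (s, t)" by force
  let ?dg = "\<lambda>m :: 'v graph_var monom. (wdeg (gval (\<lambda>_. 1) (\<lambda>_. d) 0) m, wdeg (gval (\<lambda>_. 0) (\<lambda>_. 1) 1) m)"
  define \<mu> where "\<mu> \<alpha> = emb X \<alpha> + single U t" for \<alpha> :: "'v monom"
  have lX: "lookup (\<mu> \<alpha>) (X i) = lookup \<alpha> i" and lY: "lookup (\<mu> \<alpha>) (Y i) = 0" and lU: "lookup (\<mu> \<alpha>) U = t" for \<alpha> i
  proof -
    have "Y i \<notin> range X" "(U :: 'v graph_var) \<notin> range X" by auto
    then show "lookup (\<mu> \<alpha>) (X i) = lookup \<alpha> i" "lookup (\<mu> \<alpha>) (Y i) = 0" "lookup (\<mu> \<alpha>) U = t"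
      unfolding \<mu>_def by (simp_all add: lookup_add lookup_single lookup_emb lookup_emb_other)
  qed
  have \<mu>_inj: "inj \<mu>"
  proof (rule injI, rule poly_mapping_eqI)
    fix \<alpha> \<beta> i assume "\<mu> \<alpha> = \<mu> \<beta>"
    then have "lookup (\<mu> \<alpha>) (X i) = lookup (\<mu> \<beta>) (X i)" by simp
    then show "lookup \<alpha> i = lookup \<beta> i" by (simp add: lX)
  qed
  have \<mu>_subst: "subst (graph_val d a q) (single (\<mu> \<alpha>) 1) = single \<alpha> 1" for a q \<alpha>
  proof -
    have "subst (graph_val d a q) (single (\<mu> \<alpha>) 1)
        = subst (graph_val d a q) (single (emb X \<alpha>) 1) * subst (graph_val d a q) (single (single U t) 1)"
      unfolding subst_mult[symmetric] by (simp add: mult_single \<mu>_def)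
    also have "\<dots> = subst var (single \<alpha> 1)"
      by (simp add: subst_emb graph_val_def subst_single[of _ "single U t"] inj_def)
    finally show ?thesis by simp
  qed
  have dg\<mu>: "?dg (\<mu> \<alpha>) = (mdeg \<alpha>, t)" for \<alpha>
    unfolding wdeg_def sum_graph_var by (simp add: lX lY lU mdeg_superset[of UNIV \<alpha>])
  show "\<exists>B\<subseteq>{m. ?dg m = e}. \<forall>a a'.
      (\<forall>m\<in>B. \<forall>q. subst (graph_val d a q) (single m 1) = subst (graph_val d a' q) (single m 1)) \<and>
      (\<forall>m. ?dg m = e \<longrightarrow> inspan (svec (graph_val d a)) B (svec (graph_val d a) m))"
  proof (intro exI[of _ "\<mu> ` monoms s"] conjI allI ballI impI)
    show "\<mu> ` monoms s \<subseteq> {m. ?dg m = e}" using dg\<mu> by (auto simp: e monoms_def)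
    show "subst (graph_val d a q) (single m 1) = subst (graph_val d a' q) (single m 1)"
      if "m \<in> \<mu> ` monoms s" for a a' m q
      using that \<mu>_subst by auto
    fix a and m :: "'v graph_var monom" assume m: "?dg m = e"
    define f where "f = subst (graph_val d a ()) (single m 1)"
    have "form s f" unfolding f_def graph_val_def
    proof (rule form_gval_subst[OF form_var form_forms_of form_one])
      fix m' assume "m' \<in> keys (single m (1 :: 'k))"
      then have "m' = m" by simp
      then show "1 * xdeg m' + d * ydeg m' + 0 * udeg m' = s"
        using m wdeg_graph_var[of 1 d 0 m] by (simp add: e)
    qed
    then have "f = (\<Sum>\<alpha>\<in>monoms s. single \<alpha> (lookup f \<alpha>))"
      using mpoly_sum_single[of f] finite_monoms
      by (subst sum.mono_neutral_right[of "monoms s" "keys f"]) (auto simp: form_def in_keys_iff)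
    also have "\<dots> = (\<Sum>x\<in>\<mu> ` monoms s. const (lookup f (inv_into UNIV \<mu> x)) * subst (graph_val d a ()) (single x 1))"
      by (subst sum.reindex) (simp_all add: \<mu>_inj inj_on_subset[OF \<mu>_inj] \<mu>_subst const_mult_single)
    finally have "subst (graph_val d a ()) (single m 1 -
        (\<Sum>x\<in>\<mu> ` monoms s. const (lookup f (inv_into UNIV \<mu> x)) * single x 1)) = 0"
      by (simp add: subst_diff subst_sum subst_mult f_def[symmetric])
    then show "inspan (svec (graph_val d a)) (\<mu> ` monoms s) (svec (graph_val d a) m)"
      unfolding inspan_svec by (intro exI[of _ "\<lambda>x. lookup f (inv_into UNIV \<mu> x)"]) (simp add: P_zero)
  qed
qed

lemma left_inverse_raise:
  assumes "left_inverse h e g" "h k \<notin> P" "e \<le> D"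
  shows "\<exists>g. left_inverse h D g"
  using assms(3)
proof (induction D rule: dec_induct)
  case base then show ?case using assms(1) by blast
next
  case (step n)
  then obtain g' where "left_inverse h n g'" by blast
  from left_inverse_var[of h n g' k, OF this assms(2)] show ?case by (rule exI[of "left_inverse h (Suc n)"])
qed

text \<open>
  Where the leading monomials of the graph ideal are generic, it has a Groebner basis of bounded degree.
  Its elements that are linear in the \<open>x\<^sub>i\<close> and free of \<open>u\<close> form a linear system over the coordinate ring in \<open>y\<close>,
  which the inverse solves; so it has a solution of bounded degree. Division by the basis shows that
  every solution satisfies all relations of the graph that are linear in the \<open>x\<^sub>i\<close>, among them
  \<open>g\<^sub>i(y) x\<^sub>j = g\<^sub>j(y) x\<^sub>i\<close>, so it is proportional to the inverse.
\<close>

lemma left_inverse_degree_generic: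
  assumes d: "d > 0" and Z: "irred (Z :: ('v \<times> 'v monom \<Rightarrow> 'k) set)"
  shows "\<exists>e q. hfun e q \<and> (\<exists>a\<in>Z. q a \<noteq> 0) \<and>
    (\<exists>D. \<forall>a\<in>{a\<in>Z. q a \<noteq> 0}. birational P d (forms_of d a) \<longrightarrow> (\<exists>g. left_inverse (forms_of d a) D g))"
proof -
  obtain r :: "'v graph_var \<Rightarrow> nat" where r: "inj r"
    using finite_imp_inj_to_nat_seg[of "UNIV :: 'v graph_var set"] by auto
  let ?dg = "\<lambda>m :: 'v graph_var monom. (wdeg (gval (\<lambda>_. 1) (\<lambda>_. d) 0) m, wdeg (gval (\<lambda>_. 0) (\<lambda>_. 1) 1) m)"
  interpret fam: monomial_family r ?dg UNIV "\<lambda>a. svec (graph_val d a)" by (rule graph_family[OF r])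
  obtain e q T F where q: "hfun e q" "\<exists>a\<in>Z. q a \<noteq> 0"
    and T: "\<forall>a\<in>Z. q a \<noteq> 0 \<longrightarrow> {m. ?dg m \<in> UNIV \<and> fam.lead a m} = T"
    and F: "finite F" "F \<subseteq> T" "\<forall>m\<in>T. \<exists>\<mu>\<in>F. mdvd \<mu> m"
    using fam.generic_leading_monomials[OF Z] by (elim exE conjE) (rule that)
  define E where "E = (\<Sum>\<mu>\<in>F. ydeg \<mu>)"
  have E: "ydeg \<mu> \<le> E" if "\<mu> \<in> F" for \<mu> unfolding E_def using that F(1) by (intro member_le_sum) auto
  obtain B where B: "\<forall>A (r :: 'v graph_var monom \<Rightarrow> 'v \<Rightarrow> ('v, 'k) mpoly) Rw X. card A = card (UNIV :: 'v set) \<longrightarrow>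
     (\<forall>\<rho>\<in>Rw. \<exists>e\<le>E. \<forall>i\<in>A. form e (r \<rho> i)) \<longrightarrow> (\<forall>\<rho>\<in>Rw. (\<Sum>i\<in>A. r \<rho> i * X i) \<in> P) \<longrightarrow>
     (\<exists>i\<in>A. X i \<notin> P) \<longrightarrow>
     (\<exists>D\<le>B. \<exists>Y. (\<forall>i\<in>A. form D (Y i)) \<and> (\<exists>i\<in>A. Y i \<notin> P) \<and>
        (\<forall>\<rho>\<in>Rw. (\<Sum>i\<in>A. r \<rho> i * Y i) \<in> P))"
    using bounded_solution_card[where n = "card (UNIV :: 'v set)" and E = E] by (elim exE) (rule that)
  have "\<exists>g. left_inverse (forms_of d a) B g"
    if a: "a \<in> Z" "q a \<noteq> 0" and bir: "birational P d (forms_of d a)" for a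
  proof -
    define h where "h = forms_of d a"
    have Ta: "fam.lead a m \<longleftrightarrow> m \<in> T" for m using T a by auto
    obtain e0 g where pres: "presentation P d h" and g: "left_inverse h e0 g"
      using bir unfolding birational_iff h_def by blast
    have dom: "dominant h" by (rule left_inverse_dominant[OF pres g])
    have hP: "subst h f \<in> P" if "f \<in> P" for f using pres that unfolding presentation_def by blast
    have hf: "form d (h i)" for i using pres unfolding presentation_def by blast
    have gf: "form e0 (g i)" for i using g unfolding left_inverse_def by blast
    have gG: "same_map P (\<lambda>i. subst h (g i)) var" using g unfolding left_inverse_def by blast
    obtain l where l: "subst h (g l) \<notin> P" using g unfolding left_inverse_def by blast
    obtain k where k: "var k \<notin> P" using P_var by blast
    define \<sigma> where "\<sigma> = gval var h 1"
    have \<sigma>: "graph_val d a q = \<sigma>" for q by (simp add: graph_val_def \<sigma>_def h_def)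
    have lead: "fam.lead a m \<longleftrightarrow> (\<exists>f. lookup f m = 1 \<and>
        keys f \<subseteq> insert m {m'. ?dg m' = ?dg m \<and> mless r m' m} \<and> subst \<sigma> f \<in> P)" for m
    proof -
      have "finite {m'. ?dg m' = ?dg m \<and> mless r m' m}"
        by (rule finite_subset[OF _ fam.finite_piece[of "?dg m"]]) auto
      moreover have "m \<notin> {m'. ?dg m' = ?dg m \<and> mless r m' m}" using fam.mless_irrefl by blast
      ultimately show ?thesis unfolding fam.lead_def by (subst inspan_svec_relation) (simp_all add: \<sigma>)
    qed
    define f where "f \<mu> = (SOME f. lookup f \<mu> = 1 \<and>
        keys f \<subseteq> insert \<mu> {m'. ?dg m' = ?dg \<mu> \<and> mless r m' \<mu>} \<and> subst \<sigma> f \<in> P)" for \<mu>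
    have f: "lookup (f \<mu>) \<mu> = 1" "keys (f \<mu>) \<subseteq> insert \<mu> {m'. ?dg m' = ?dg \<mu> \<and> mless r m' \<mu>}"
      "subst \<sigma> (f \<mu>) \<in> P" if "\<mu> \<in> F" for \<mu>
      using someI_ex[of "\<lambda>f. lookup f \<mu> = 1 \<and>
        keys f \<subseteq> insert \<mu> {m'. ?dg m' = ?dg \<mu> \<and> mless r m' \<mu>} \<and> subst \<sigma> f \<in> P"] that F(2) Ta lead
      unfolding f_def[symmetric] by blast+
    \<comment> \<open>the order eliminates \<open>u\<close>\<close>
    have elim: "udeg m = 0 \<and> xdeg m = xdeg \<mu> \<and> ydeg m = ydeg \<mu>"
      if \<mu>: "\<mu> \<in> F" "udeg \<mu> = 0" and m: "m \<in> keys (f \<mu>)" for m \<mu>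
    proof (cases "m = \<mu>")
      case False
      then have dm: "?dg m = ?dg \<mu>" "mless r m \<mu>" using f(2)[OF \<mu>(1)] m by auto
      have 1: "xdeg m + d * ydeg m = xdeg \<mu> + d * ydeg \<mu>" "ydeg m + udeg m = ydeg \<mu>"
        using dm(1) \<mu>(2) wdeg_graph_var[of 1 d 0 m] wdeg_graph_var[of 1 d 0 \<mu>]
          wdeg_graph_var[of 0 1 1 m] wdeg_graph_var[of 0 1 1 \<mu>] by auto
      have "mdeg m \<le> mdeg \<mu>" using dm(2) unfolding mless_def by auto
      then have 2: "xdeg m \<le> xdeg \<mu>" using 1(2) \<mu>(2) unfolding mdeg_graph_var by linarith
      have "d * ydeg \<mu> = d * ydeg m + d * udeg m" unfolding 1(2)[symmetric] by (simp add: distrib_left)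
      then have "xdeg m = xdeg \<mu> + d * udeg m" using 1(1) by linarith
      then have "udeg m = 0" using 2 d by simp
      then show ?thesis using 1 2 \<open>xdeg m = xdeg \<mu> + d * udeg m\<close> by simp
    qed (use \<mu> in simp)
    define Rw where "Rw = {\<mu> \<in> F. udeg \<mu> = 0 \<and> xdeg \<mu> = 1}"
    define \<rho> where "\<rho> \<mu> i = subst (gval (\<lambda>j. if j = i then 1 else 0) var 1) (f \<mu>)" for \<mu> i
    have \<rho>f: "form (ydeg \<mu>) (\<rho> \<mu> i)" if "\<mu> \<in> Rw" for \<mu> i
      unfolding \<rho>_def
    proof (rule form_gval_subst[OF _ form_var form_one])
      show "form 0 (if j = i then 1 else 0 :: ('v, 'k) mpoly)" for j by (simp add: form_one)
      fix m assume "m \<in> keys (f \<mu>)"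
      then show "0 * xdeg m + 1 * ydeg m + 0 * udeg m = ydeg \<mu>" using elim that unfolding Rw_def by simp
    qed
    have \<rho>_sum: "subst (gval x var 1) (f \<mu>) = (\<Sum>i\<in>UNIV. \<rho> \<mu> i * x i)" if "\<mu> \<in> Rw" for \<mu> x
      unfolding \<rho>_def using elim that by (intro subst_linear_x) (auto simp: Rw_def)
    \<comment> \<open>the inverse solves the linear system given by the generators that are linear in the \<open>x\<^sub>i\<close>\<close>
    have g_sol: "(\<Sum>i\<in>UNIV. \<rho> \<mu> i * g i) \<in> P" if \<mu>: "\<mu> \<in> Rw" for \<mu>
    proof (rule dominantD[OF dom])
      show "form (ydeg \<mu> + e0) (\<Sum>i\<in>UNIV. \<rho> \<mu> i * g i)"
        by (intro form_sum form_mult \<rho>f[OF \<mu>] gf)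
      have "(\<Sum>i\<in>UNIV. subst h (\<rho> \<mu> i) * var i) = subst \<sigma> (f \<mu>)"
      proof -
        have "subst h (\<rho> \<mu> i) = subst (gval (\<lambda>j. if j = i then 1 else 0) h 1) (f \<mu>)" for i
        proof -
          have "(\<lambda>w. subst h (gval (\<lambda>j. if j = i then 1 else 0) var 1 w)) = gval (\<lambda>j. if j = i then 1 else 0) h 1"
          proof
            fix w show "subst h (gval (\<lambda>j. if j = i then 1 else 0) var 1 w) = gval (\<lambda>j. if j = i then 1 else 0) h 1 w"
              by (cases w rule: graph_var_cases) simp_all
          qed
          then show ?thesis unfolding \<rho>_def subst_subst by simp
        qed
        then show ?thesis unfolding \<sigma>_def using elim \<mu>
          by (subst subst_linear_x) (auto simp: Rw_def)
      qed
      then have R: "(\<Sum>i\<in>UNIV. subst h (\<rho> \<mu> i) * var i) \<in> P" using f(3) \<mu> unfolding Rw_def by simp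
      have "var k * subst h (\<Sum>i\<in>UNIV. \<rho> \<mu> i * g i)
          = (\<Sum>i\<in>UNIV. subst h (\<rho> \<mu> i) * (subst h (g i) * var k - subst h (g k) * var i))
            + subst h (g k) * (\<Sum>i\<in>UNIV. subst h (\<rho> \<mu> i) * var i)"
        unfolding sum_distrib_left subst_sum subst_mult sum.distrib[symmetric]
        by (intro sum.cong refl) (simp add: algebra_simps)
      also have "\<dots> \<in> P" by (intro P_add P_sum P_mult R same_mapD[OF gG])
      finally show "subst h (\<Sum>i\<in>UNIV. \<rho> \<mu> i * g i) \<in> P" using P_cancel k by blast
    qed
    have gnz: "g l \<notin> P" using l hP by blast
    have "\<exists>D\<le>B. \<exists>Y. (\<forall>i\<in>UNIV. form D (Y i)) \<and> (\<exists>i\<in>UNIV. Y i \<notin> P) \<and>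
        (\<forall>\<mu>\<in>Rw. (\<Sum>i\<in>UNIV. \<rho> \<mu> i * Y i) \<in> P)"
    proof (rule B[THEN spec, THEN spec, THEN spec, THEN spec, THEN mp, THEN mp, THEN mp, THEN mp])
      show "\<forall>\<mu>\<in>Rw. \<exists>e\<le>E. \<forall>i\<in>UNIV. form e (\<rho> \<mu> i)"
        using \<rho>f E unfolding Rw_def by blast
      show "\<forall>\<mu>\<in>Rw. (\<Sum>i\<in>UNIV. \<rho> \<mu> i * g i) \<in> P" using g_sol by blast
      show "\<exists>i\<in>UNIV. g i \<notin> P" using gnz by blast
    qed simp
    then obtain D z where D: "D \<le> B" and zf: "\<And>i. form D (z i)" and znz: "\<exists>i. z i \<notin> P"
      and z_sol: "\<And>\<mu>. \<mu> \<in> Rw \<Longrightarrow> (\<Sum>i\<in>UNIV. \<rho> \<mu> i * z i) \<in> P" by auto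
    \<comment> \<open>every solution kills all relations that are free of \<open>u\<close> and linear in the \<open>x\<^sub>i\<close>\<close>
    define \<tau> where "\<tau> = gval z var 1"
    have gen: "subst \<tau> (f \<mu>) \<in> P" if \<mu>: "\<mu> \<in> F" "udeg \<mu> = 0" "xdeg \<mu> \<le> 1" for \<mu>
    proof (cases "xdeg \<mu> = 1")
      case True
      then have "\<mu> \<in> Rw" using \<mu> by (simp add: Rw_def)
      then show ?thesis unfolding \<tau>_def using \<rho>_sum z_sol by simp
    next
      case False
      then have x0: "xdeg m = 0" if "m \<in> keys (f \<mu>)" for m using elim[OF \<mu>(1,2) that] \<mu>(3) by simp
      define p where "p = subst (gval (\<lambda>_. 1) var 1) (f \<mu>)"
      have noX: "w \<noteq> X i" if "m \<in> keys (f \<mu>)" "w \<in> keys m" for m w i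
        using x0[OF that(1)] that(2) unfolding xdeg_simp by (auto simp: in_keys_iff)
      have "subst \<tau> (f \<mu>) = p" unfolding p_def \<tau>_def
      proof (rule subst_cong_keys)
        fix m w assume "m \<in> keys (f \<mu>)" "w \<in> keys m"
        from noX[OF this] show "gval z var 1 w = gval (\<lambda>_. 1) var 1 w"
          by (cases w rule: graph_var_cases) auto
      qed
      moreover have "p \<in> P"
      proof (rule dominantD[OF dom])
        show "form (ydeg \<mu>) p" unfolding p_def
        proof (rule form_gval_subst[OF form_one form_var form_one])
          fix m assume "m \<in> keys (f \<mu>)"
          then show "0 * xdeg m + 1 * ydeg m + 0 * udeg m = ydeg \<mu>" using elim \<mu> by simp
        qed
        have "subst h p = subst \<sigma> (f \<mu>)" unfolding p_def subst_subst \<sigma>_def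
        proof (rule subst_cong_keys)
          fix m w assume "m \<in> keys (f \<mu>)" "w \<in> keys m"
          from noX[OF this] show "subst h (gval (\<lambda>_. 1) var 1 w) = gval var h 1 w"
            by (cases w rule: graph_var_cases) auto
        qed
        then show "subst h p \<in> P" using f(3)[OF \<mu>(1)] by simp
      qed
      ultimately show ?thesis by simp
    qed
    have kill: "subst \<tau> p \<in> P"
      if "subst \<sigma> p \<in> P" "\<forall>m'\<in>keys p. udeg m' = 0 \<and> xdeg m' = 1 \<and> ydeg m' = t"
        "\<forall>m'\<in>keys p. m' = m \<or> mless r m' m" for p m t
      using that
    proof (induction m arbitrary: p rule: wf_induct_rule[OF fam.wf_mless])
      case (1 m)
      have smaller: "subst \<tau> p' \<in> P" if p': "subst \<sigma> p' \<in> P"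
        "\<forall>m'\<in>keys p'. udeg m' = 0 \<and> xdeg m' = 1 \<and> ydeg m' = t" "\<forall>m'\<in>keys p'. mless r m' m" for p'
      proof (cases "p' = 0")
        case False
        then obtain m1 where "m1 \<in> keys p'" "\<forall>m'\<in>keys p'. m' \<noteq> m1 \<longrightarrow> mless r m' m1"
          using fam.leading_monomial[of "keys p'"] by auto
        then show ?thesis using p' by (intro "1.IH"[of m1 p']) auto
      qed (simp add: P_zero)
      show ?case
      proof (cases "m \<in> keys p")
        case False
        then show ?thesis using "1.prems" by (intro smaller) auto
      next
        case True
        have mt: "udeg m = 0" "xdeg m = 1" "ydeg m = t" using "1.prems"(2) True by auto
        have dgt: "?dg m' = ?dg m" if "m' \<in> keys p" for m'
          using "1.prems"(2) that mt wdeg_graph_var[of 1 d 0 m] wdeg_graph_var[of 1 d 0 m']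
            wdeg_graph_var[of 0 1 1 m] wdeg_graph_var[of 0 1 1 m'] by simp
        let ?c = "lookup p m"
        have c: "?c \<noteq> 0" using True by (simp add: in_keys_iff)
        have "fam.lead a m"
          unfolding lead
        proof (intro exI[of _ "const (1 / ?c) * p"] conjI)
          show "lookup (const (1 / ?c) * p) m = 1" using c by simp
          have "keys (const (1 / ?c) * p) \<subseteq> keys p" by (auto simp: in_keys_iff)
          then show "keys (const (1 / ?c) * p) \<subseteq> insert m {m'. ?dg m' = ?dg m \<and> mless r m' m}"
            using "1.prems"(3) dgt by blast
          show "subst \<sigma> (const (1 / ?c) * p) \<in> P" unfolding subst_mult by (rule P_mult[OF "1.prems"(1)])
        qed
        then have "m \<in> T" unfolding Ta .
        then obtain \<mu> where \<mu>1: "\<mu> \<in> F" "mdvd \<mu> m" using F(3) by blast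
        then obtain n where \<mu>2: "m = \<mu> + n" unfolding mdvd_def by blast
        have \<mu>: "\<mu> \<in> F" "m = n + \<mu>" using \<mu>1(1) \<mu>2 by (simp_all add: add.commute)
        have \<mu>d: "udeg \<mu> = 0" "xdeg \<mu> \<le> 1" using mt unfolding \<mu>(2) wdeg_add by auto
        define s where "s = single n ?c * f \<mu>"
        have ks: "keys s \<subseteq> (+) n ` keys (f \<mu>)" unfolding s_def by (rule keys_single_mult)
        have sm: "lookup s m = ?c" unfolding s_def \<mu>(2) lookup_single_mult f(1)[OF \<mu>(1)] by simp
        have "subst \<tau> (p - s) \<in> P"
        proof (rule smaller)
          show "subst \<sigma> (p - s) \<in> P" unfolding subst_diff s_def subst_mult
            by (intro P_diff "1.prems"(1) P_mult f(3)[OF \<mu>(1)])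
          show "\<forall>m'\<in>keys (p - s). udeg m' = 0 \<and> xdeg m' = 1 \<and> ydeg m' = t"
          proof
            fix m' assume "m' \<in> keys (p - s)"
            then have "m' \<in> keys p \<union> keys s" using keys_diff_subset by blast
            then show "udeg m' = 0 \<and> xdeg m' = 1 \<and> ydeg m' = t"
            proof
              assume "m' \<in> keys s"
              then obtain b where b: "m' = n + b" "b \<in> keys (f \<mu>)" using ks by blast
              then show ?thesis using elim[OF \<mu>(1) \<mu>d(1) b(2)] mt unfolding b(1) \<mu>(2) wdeg_add by simp
            qed (use "1.prems"(2) in blast)
          qed
          show "\<forall>m'\<in>keys (p - s). mless r m' m"
          proof
            fix m' assume m': "m' \<in> keys (p - s)"
            have ne: "m' \<noteq> m" using m' sm by (auto simp: in_keys_iff lookup_minus)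
            have "m' \<in> keys p \<union> keys s" using m' keys_diff_subset by blast
            then show "mless r m' m"
            proof
              assume "m' \<in> keys s"
              then obtain b where b: "m' = n + b" "b \<in> keys (f \<mu>)" using ks by blast
              then have "mless r b \<mu>" using f(2)[OF \<mu>(1)] ne \<mu>(2) by auto
              then show ?thesis unfolding b(1) \<mu>(2) by (rule mless_add)
            qed (use "1.prems"(3) ne in blast)
          qed
        qed
        moreover have "subst \<tau> s \<in> P" unfolding s_def subst_mult by (intro P_mult gen \<mu>(1) \<mu>d)
        ultimately have "subst \<tau> (p - s) + subst \<tau> s \<in> P" by (rule P_add)
        then show ?thesis by (simp add: subst_diff)
      qed
    qed
    have gz: "same_map P g z"
      unfolding same_map_def
    proof (intro allI)
      fix i j
      define p where "p = subst (\<lambda>v. var (Y v)) (g i) * var (X j) - subst (\<lambda>v. var (Y v)) (g j) * var (X i)"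
      have keys_g: "udeg m = 0 \<and> xdeg m = 1 \<and> ydeg m = e0"
        if m: "m \<in> keys (subst (\<lambda>v. var (Y v)) (g i) * var (X j))" for i j m
      proof -
        obtain m1 where m1: "m1 \<in> keys (subst (\<lambda>v. var (Y v) :: ('v graph_var, 'k) mpoly) (g i))" "m = m1 + single (X j) 1"
          using m keys_mult[of "subst (\<lambda>v. var (Y v)) (g i)" "var (X j)"] by (auto simp: var_def)
        have "keys (subst (\<lambda>v. var (Y v) :: ('v graph_var, 'k) mpoly) (g i)) \<subseteq> emb Y ` keys (g i)"
          by (rule keys_subst_var) (simp add: inj_def)
        then obtain \<beta> where \<beta>: "\<beta> \<in> keys (g i)" "m1 = emb Y \<beta>" using m1(1) by blast
        have "mdeg \<beta> = e0" using \<beta>(1) gf[of i] by (auto simp: form_def monoms_def)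
        moreover have "(X a :: 'v graph_var) \<notin> range Y" "(U :: 'v graph_var) \<notin> range Y" for a by auto
        then have "lookup (emb Y \<beta>) (X a) = 0" "lookup (emb Y \<beta>) U = 0" for a
          by (simp_all add: lookup_emb_other)
        moreover have "lookup (emb Y \<beta>) (Y a) = lookup \<beta> a" for a
          by (rule lookup_emb) (simp add: inj_def)
        ultimately show ?thesis unfolding m1(2) \<beta>(2)
          unfolding wdeg_def sum_graph_var
          by (simp add: lookup_add lookup_single when_def mdeg_superset[of UNIV \<beta>])
      qed
      have kp: "\<forall>m\<in>keys p. udeg m = 0 \<and> xdeg m = 1 \<and> ydeg m = e0"
        using keys_diff_subset[of "subst (\<lambda>v. var (Y v)) (g i) * var (X j)" "subst (\<lambda>v. var (Y v)) (g j) * var (X i)"]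
          keys_g unfolding p_def by blast
      have "subst \<sigma> p \<in> P" using same_mapD[OF gG, of i j]
        by (simp add: p_def subst_diff subst_mult subst_subst \<sigma>_def)
      moreover have "subst \<tau> p = g i * z j - g j * z i"
        by (simp add: p_def subst_diff subst_mult subst_subst \<tau>_def)
      moreover have "subst \<tau> p \<in> P"
      proof (cases "p = 0")
        case False
        then obtain m1 where "m1 \<in> keys p" "\<forall>m'\<in>keys p. m' \<noteq> m1 \<longrightarrow> mless r m' m1"
          using fam.leading_monomial[of "keys p"] by auto
        then show ?thesis using kill[OF \<open>subst \<sigma> p \<in> P\<close> kp, of m1] by blast
      qed (simp add: P_zero)
      ultimately show "g i * z j - g j * z i \<in> P" by simp
    qed
    obtain i where i: "z i \<notin> P" using znz by blast
    have zl: "z l \<notin> P" by (rule same_map_nonzero[OF gz gnz i])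
    have "left_inverse h D z"
      unfolding left_inverse_def
    proof (intro conjI allI)
      show "\<exists>i. subst h (z i) \<notin> P" using dominantD[OF dom zf] zl by blast
      have "same_map P (\<lambda>i. subst h (z i)) (\<lambda>i. subst h (g i))"
        unfolding same_map_def
      proof (intro allI)
        fix i j
        have "subst h (g j * z i - g i * z j) \<in> P" by (rule hP[OF same_mapD[OF gz]])
        then show "subst h (z i) * subst h (g j) - subst h (z j) * subst h (g i) \<in> P"
          by (simp add: subst_diff subst_mult mult.commute)
      qed
      then show "same_map P (\<lambda>i. subst h (z i)) var" using gG l by (rule same_map_trans)
    qed (rule zf)
    moreover obtain k' where "h k' \<notin> P" using pres unfolding presentation_def by blast
    ultimately show ?thesis using left_inverse_raise[of h D z k' B] D unfolding h_def by blast
  qed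
  then show ?thesis using q by (intro exI[of _ e] exI[of _ q] conjI exI[of _ B]) auto
qed

lemma finite_W_index: "finite (W_index d :: ('v \<times> 'v monom) set)"
  unfolding W_index_def by (intro finite_cartesian_product finite_monoms) simp

text \<open>
  Noetherian induction spreads the bound from dense open subsets to the whole parameter space; on a union
  the larger bound works, as the degree of a left inverse can be raised.
\<close>

theorem left_inverse_degree_bound:
  assumes d: "d > 0"
  shows "\<exists>D. \<forall>a. (\<forall>i. i \<notin> W_index d \<longrightarrow> a i = 0) \<longrightarrow> birational P d (forms_of d a) \<longrightarrow>
    (\<exists>g. left_inverse (forms_of d a) D g)"
proof -
  define Q where "Q A \<longleftrightarrow> (\<exists>D. \<forall>a\<in>A. birational P d (forms_of d a) \<longrightarrow> (\<exists>g. left_inverse (forms_of d a) D g))" for A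
  have "Q {a. \<forall>i. i \<notin> W_index d \<longrightarrow> a i = 0}"
  proof (rule noetherian_induct[OF finite_W_index hclosed_space])
    show "Q {}" by (simp add: Q_def)
    fix A B assume "Q A" "Q B"
    then obtain D D' where D: "\<And>a. a \<in> A \<Longrightarrow> birational P d (forms_of d a) \<Longrightarrow> \<exists>g. left_inverse (forms_of d a) D g"
      "\<And>a. a \<in> B \<Longrightarrow> birational P d (forms_of d a) \<Longrightarrow> \<exists>g. left_inverse (forms_of d a) D' g"
      unfolding Q_def by blast
    have "\<exists>g. left_inverse (forms_of d a) (max D D') g" if a: "a \<in> A \<union> B" "birational P d (forms_of d a)" for a
    proof -
      obtain k where k: "forms_of d a k \<notin> P" using a(2) unfolding birational_def presentation_def by blast
      obtain g where "left_inverse (forms_of d a) D g \<or> left_inverse (forms_of d a) D' g"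
        using D a by blast
      then show ?thesis
        using left_inverse_raise[of "forms_of d a" D g k "max D D'"]
          left_inverse_raise[of "forms_of d a" D' g k "max D D'"] k by auto
    qed
    then show "Q (A \<union> B)" unfolding Q_def by blast
  next
    fix Z :: "('v \<times> 'v monom \<Rightarrow> 'k) set" assume "irred Z"
    from left_inverse_degree_generic[OF d this]
    show "\<exists>e q. hfun e q \<and> (\<exists>a\<in>Z. q a \<noteq> 0) \<and> Q {a \<in> Z. q a \<noteq> 0}" unfolding Q_def .
  qed
  then show ?thesis unfolding Q_def by simp
qed

end

section \<open>Open and closed conditions on the parameter space\<close>

text \<open>
  Conditions that hold where at least one form of a family does not vanish. Their truth only depends on
  the point of projective space, and they are closed under arbitrary disjunctions.
\<close>

definition hopen :: "(('i \<Rightarrow> 'k::field) \<Rightarrow> bool) \<Rightarrow> bool" where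
  "hopen \<psi> \<longleftrightarrow> (\<exists>\<F>. (\<forall>f\<in>\<F>. \<exists>e. hfun e f) \<and> (\<forall>a. \<psi> a \<longleftrightarrow> (\<exists>f\<in>\<F>. f a \<noteq> 0)))"

lemma hopen_hfun: "hfun e f \<Longrightarrow> hopen (\<lambda>a. f a \<noteq> 0)"
  unfolding hopen_def by (intro exI[of _ "{f}"]) auto

lemma hopen_ex: "(\<And>x. hopen (\<psi> x)) \<Longrightarrow> hopen (\<lambda>a. \<exists>x. \<psi> x a)"
proof -
  assume "\<And>x. hopen (\<psi> x)"
  then have "\<forall>x. \<exists>\<F>. (\<forall>f\<in>\<F>. \<exists>e. hfun e f) \<and> (\<forall>a. \<psi> x a \<longleftrightarrow> (\<exists>f\<in>\<F>. f a \<noteq> 0))"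
    unfolding hopen_def by blast
  from choice[OF this] obtain \<F> where "\<forall>x. (\<forall>f\<in>\<F> x. \<exists>e. hfun e f) \<and> (\<forall>a. \<psi> x a \<longleftrightarrow> (\<exists>f\<in>\<F> x. f a \<noteq> 0))"
    by (elim exE) (rule that)
  then show ?thesis unfolding hopen_def by (intro exI[of _ "\<Union>x. \<F> x"]) auto
qed

lemma hopen_const: "hopen (\<lambda>a. b)"
proof (cases b)
  case True
  then show ?thesis using hopen_hfun[OF hfun_const[of 1]] by simp
next
  case False
  then show ?thesis unfolding hopen_def by (intro exI[of _ "{}"]) simp
qed

lemma hopen_conj:
  assumes "hopen \<psi>" "hopen \<psi>'"
  shows "hopen (\<lambda>a. \<psi> a \<and> \<psi>' a)"
proof -
  obtain \<F> \<F>' where F: "\<forall>f\<in>\<F>. \<exists>e. hfun e f" "\<forall>a. \<psi> a \<longleftrightarrow> (\<exists>f\<in>\<F>. f a \<noteq> 0)"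
    "\<forall>f\<in>\<F>'. \<exists>e. hfun e f" "\<forall>a. \<psi>' a \<longleftrightarrow> (\<exists>f\<in>\<F>'. f a \<noteq> 0)"
    using assms unfolding hopen_def by (elim exE conjE) (rule that)
  show ?thesis unfolding hopen_def
  proof (intro exI[of _ "{\<lambda>a. f a * g a | f g. f \<in> \<F> \<and> g \<in> \<F>'}"] conjI ballI allI)
    fix f assume "f \<in> {\<lambda>a. f a * g a | f g. f \<in> \<F> \<and> g \<in> \<F>'}"
    then obtain g g' where "f = (\<lambda>a. g a * g' a)" "g \<in> \<F>" "g' \<in> \<F>'" by blast
    then show "\<exists>e. hfun e f" using F(1,3) hfun_mult by metis
  next
    fix a
    show "\<psi> a \<and> \<psi>' a \<longleftrightarrow> (\<exists>f\<in>{\<lambda>a. f a * g a | f g. f \<in> \<F> \<and> g \<in> \<F>'}. f a \<noteq> 0)"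
    proof
      assume "\<psi> a \<and> \<psi>' a"
      then obtain f g where "f \<in> \<F>" "g \<in> \<F>'" "f a \<noteq> 0" "g a \<noteq> 0" using F(2,4) by blast
      then show "\<exists>f\<in>{\<lambda>a. f a * g a | f g. f \<in> \<F> \<and> g \<in> \<F>'}. f a \<noteq> 0"
        by (intro bexI[of _ "\<lambda>a. f a * g a"]) auto
    qed (use F(2,4) in auto)
  qed
qed

lemma hopen_cong: "hopen \<psi> \<Longrightarrow> (\<And>a. \<psi> a \<longleftrightarrow> \<psi>' a) \<Longrightarrow> hopen \<psi>'"
  unfolding hopen_def by simp

lemma hopen_all_le: "(\<And>e. hopen (\<psi> e)) \<Longrightarrow> hopen (\<lambda>a. \<forall>e\<le>(n::nat). \<psi> e a)"
proof (induction n)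
  case (Suc n)
  then have "hopen (\<lambda>a. (\<forall>e\<le>n. \<psi> e a) \<and> \<psi> (Suc n) a)" by (intro hopen_conj) auto
  then show ?case by (rule hopen_cong) (auto simp: le_Suc_eq)
qed simp

lemma hopen_indep:
  assumes "finite A" "\<And>x c. x \<in> A \<Longrightarrow> hfun (e x) (\<lambda>a. v a x c)"
  shows "hopen (\<lambda>a. indep (v a) A)"
  unfolding hopen_def
proof (intro exI[of _ "{q. (\<exists>e. hfun e q) \<and> (\<forall>a. q a \<noteq> 0 \<longrightarrow> indep (v a) A)}"] conjI allI)
  fix a0
  show "indep (v a0) A \<longleftrightarrow> (\<exists>f\<in>{q. (\<exists>e. hfun e q) \<and> (\<forall>a. q a \<noteq> 0 \<longrightarrow> indep (v a) A)}. f a0 \<noteq> 0)"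
    using indep_open[where A = A and e = e and v = v and ?a0.0 = a0, OF assms] by blast
qed auto

lemma hfun_nonzero_pt: "hfun e f \<Longrightarrow> a \<in> pt v \<Longrightarrow> f a \<noteq> 0 \<longleftrightarrow> f v \<noteq> 0"
  unfolding pt_def using hfun_scale[of e f _ v] by auto

lemma hopen_pt: "hopen \<psi> \<Longrightarrow> a \<in> pt v \<Longrightarrow> \<psi> a \<longleftrightarrow> \<psi> v"
  unfolding hopen_def using hfun_nonzero_pt by (metis (no_types, lifting))

lemma pt_self: "v \<in> pt v" unfolding pt_def by (auto intro: exI[of _ 1])

lemma closedin_hopen:
  assumes "hopen (\<lambda>a. \<not> \<phi> a)"
  shows "closedin (zariski I) {w \<in> proj_space I. \<forall>a\<in>w. \<phi> a}"
proof -
  obtain \<F> where F: "\<forall>f\<in>\<F>. \<exists>e. hfun e f" "\<forall>a. \<not> \<phi> a \<longleftrightarrow> (\<exists>f\<in>\<F>. f a \<noteq> 0)"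
    using assms unfolding hopen_def by (elim exE conjE) (rule that)
  let ?G = "{q. (\<exists>e. form e q) \<and> (\<lambda>a. eval_at a q) \<in> \<F>}"
  have "\<phi> a \<longleftrightarrow> (\<forall>q\<in>?G. eval_at a q = 0)" for a
  proof
    assume "\<phi> a"
    then have z: "f a = 0" if "f \<in> \<F>" for f using F(2) that by blast
    show "\<forall>q\<in>?G. eval_at a q = 0"
    proof
      fix q assume "q \<in> ?G"
      then have "(\<lambda>a. eval_at a q) \<in> \<F>" by simp
      from z[OF this] show "eval_at a q = 0" .
    qed
  next
    assume q: "\<forall>q\<in>?G. eval_at a q = 0"
    show "\<phi> a"
    proof (rule ccontr)
      assume "\<not> \<phi> a"
      then obtain f where f: "f \<in> \<F>" "f a \<noteq> 0" using F(2) by blast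
      then obtain e p where "form e p" "f = (\<lambda>a. eval_at a p)" using F(1) unfolding hfun_def by blast
      then show False using f q by blast
    qed
  qed
  then have "{w \<in> proj_space I. \<forall>a\<in>w. \<phi> a} = zero_locus I ?G"
    unfolding zero_locus_def by blast
  then show ?thesis unfolding closedin_zariski by (intro exI[of _ ?G]) auto
qed

lemma openin_hopen:
  assumes "hopen \<psi>"
  shows "openin (zariski I) {w \<in> proj_space I. \<forall>a\<in>w. \<psi> a}"
proof -
  have "closedin (zariski I) {w \<in> proj_space I. \<forall>a\<in>w. \<not> \<psi> a}"
    using closedin_hopen[of "\<lambda>a. \<not> \<psi> a"] assms by simp
  moreover have "{w \<in> proj_space I. \<forall>a\<in>w. \<psi> a} = topspace (zariski I) - {w \<in> proj_space I. \<forall>a\<in>w. \<not> \<psi> a}"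
  proof -
    have "(\<forall>a\<in>w. \<psi> a) \<longleftrightarrow> \<not> (\<forall>a\<in>w. \<not> \<psi> a)" if "w \<in> proj_space I" for w
    proof -
      obtain v where "w = pt v" using \<open>w \<in> proj_space I\<close> unfolding proj_space_def by blast
      then show ?thesis using hopen_pt[OF assms] pt_self by blast
    qed
    then show ?thesis unfolding topspace_zariski by blast
  qed
  ultimately show ?thesis by (simp add: openin_diff)
qed

lemma locally_closed_hopen:
  assumes "hopen \<psi>" "hopen (\<lambda>a. \<not> \<phi> a)"
  shows "locally_closed_in (zariski I) {w \<in> proj_space I. \<forall>a\<in>w. \<psi> a \<and> \<phi> a}"
  unfolding locally_closed_in_def
  using openin_hopen[OF assms(1), of I] closedin_hopen[OF assms(2), of I]
  by (intro exI[of _ "{w \<in> proj_space I. \<forall>a\<in>w. \<psi> a}"] exI[of _ "{w \<in> proj_space I. \<forall>a\<in>w. \<phi> a}"]) auto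

lemma proj_space_vecs: "w \<in> proj_space I \<Longrightarrow> v \<in> w \<Longrightarrow> v \<in> vecs I"
proof -
  assume "w \<in> proj_space I" "v \<in> w"
  then obtain u c where u: "u \<in> vecs I" "v = (\<lambda>i. c * u i)" "c \<noteq> 0" unfolding proj_space_def pt_def by blast
  obtain i where "u i \<noteq> 0" using u(1) unfolding vecs_def by blast
  then have "v i \<noteq> 0" using u(2,3) by simp
  then have "v \<noteq> (\<lambda>_. 0)" by auto
  then show "v \<in> vecs I" using u(1) unfolding vecs_def u(2) by simp
qed

lemma proj_space_support: "w \<in> proj_space I \<Longrightarrow> a \<in> w \<Longrightarrow> i \<notin> I \<Longrightarrow> a i = 0"
  using proj_space_vecs[of w I a] unfolding vecs_def by blast

section \<open>The locus of birational maps is locally closed\<close>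

context hprime
begin

definition maps_into :: "nat \<Rightarrow> ('v \<times> 'v monom \<Rightarrow> 'k) \<Rightarrow> bool" where
  "maps_into d a \<longleftrightarrow> (\<forall>p\<in>P. subst (forms_of d a) p \<in> P)"

definition not_all_zero :: "nat \<Rightarrow> ('v \<times> 'v monom \<Rightarrow> 'k) \<Rightarrow> bool" where
  "not_all_zero d a \<longleftrightarrow> (\<exists>i. forms_of d a i \<notin> P)"

text \<open>
  Substitution of the forms is injective modulo \<open>P\<close> in degree \<open>D\<close>.
\<close>

definition inj_degree :: "nat \<Rightarrow> nat \<Rightarrow> ('v \<times> 'v monom \<Rightarrow> 'k) \<Rightarrow> bool" where
  "inj_degree d D a \<longleftrightarrow> indep (\<lambda>m. pr (subst (forms_of d a) (single m 1))) (Std D)"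

text \<open>
  The contribution of the coefficient of the monomial \<open>snd x\<close> in the component \<open>fst x\<close> of a tuple \<open>g\<close> to the
  element \<open>g\<^sub>i(h) x\<^sub>j - g\<^sub>j(h) x\<^sub>i\<close>, which has to vanish for a left inverse.
\<close>

definition lin_cond :: "nat \<Rightarrow> ('v \<times> 'v monom \<Rightarrow> 'k) \<Rightarrow> 'v \<times> 'v monom \<Rightarrow> 'v \<Rightarrow> 'v \<Rightarrow> ('v, 'k) mpoly" where
  "lin_cond d a x i j = (if fst x = i then subst (forms_of d a) (single (snd x) 1) * var j else 0)
     - (if fst x = j then subst (forms_of d a) (single (snd x) 1) * var i else 0)"

definition lin_vec :: "nat \<Rightarrow> ('v \<times> 'v monom \<Rightarrow> 'k) \<Rightarrow> 'v \<times> 'v monom \<Rightarrow> ('v \<times> 'v) \<times> ('v, 'k) mpoly \<Rightarrow> 'k" where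
  "lin_vec d a x = (\<lambda>((i, j), c). pr (lin_cond d a x i j) c)"

lemma presentation_forms_of: "presentation P d (forms_of d a) \<longleftrightarrow> maps_into d a \<and> not_all_zero d a"
  unfolding presentation_def maps_into_def not_all_zero_def by (auto simp: form_forms_of)

lemma hopen_not_all_zero: "hopen (not_all_zero d)"
proof -
  have "hopen (\<lambda>a. \<exists>i c. pr (forms_of d a i) c \<noteq> 0)"
    by (intro hopen_ex hopen_hfun[OF pr_hfun[OF pfam_forms_of]])
  then show ?thesis by (rule hopen_cong) (simp add: not_all_zero_def pr_P)
qed

lemma hopen_not_maps_into: "hopen (\<lambda>a. \<not> maps_into d a)"
proof -
  have "hopen (\<lambda>a. \<exists>p e c. p \<in> P \<and> pr (subst (forms_of d a) (hcomp e p)) c \<noteq> 0)"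
    by (intro hopen_ex hopen_conj hopen_const hopen_hfun[OF pr_hfun[OF pfam_subst[OF pfam_forms_of form_hcomp]]])
  then show ?thesis
  proof (rule hopen_cong)
    fix a
    have "maps_into d a \<longleftrightarrow> (\<forall>p\<in>P. \<forall>e. subst (forms_of d a) (hcomp e p) \<in> P)"
    proof
      assume "maps_into d a"
      then show "\<forall>p\<in>P. \<forall>e. subst (forms_of d a) (hcomp e p) \<in> P" using P_hcomp unfolding maps_into_def by blast
    next
      assume e: "\<forall>p\<in>P. \<forall>e. subst (forms_of d a) (hcomp e p) \<in> P"
      show "maps_into d a" unfolding maps_into_def
      proof
        fix p assume "p \<in> P"
        then have "(\<Sum>e\<in>mdeg ` keys p. subst (forms_of d a) (hcomp e p)) \<in> P" using e by (intro P_sum) blast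
        then show "subst (forms_of d a) p \<in> P" unfolding subst_sum[symmetric] using sum_hcomp[of p] by simp
      qed
    qed
    then show "(\<exists>p e c. p \<in> P \<and> pr (subst (forms_of d a) (hcomp e p)) c \<noteq> 0) \<longleftrightarrow> \<not> maps_into d a"
      unfolding pr_P[of "subst (forms_of d a) _"] by blast
  qed
qed

lemma hopen_inj_degree: "hopen (inj_degree d D)"
  unfolding inj_degree_def
  by (rule hopen_indep[OF finite_Std pr_hfun[OF pfam_subst[OF pfam_forms_of form_single[OF refl]]]])

lemma hopen_lin_vec: "hopen (\<lambda>a. indep (lin_vec d a) (UNIV \<times> Std D))"
proof (rule hopen_indep)
  show "finite ((UNIV :: 'v set) \<times> Std D)" by (intro finite_cartesian_product finite_Std) simp
  fix x :: "'v \<times> 'v monom" and c :: "('v \<times> 'v) \<times> ('v, 'k) mpoly"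
  have *: "pfam (mdeg (snd x) * 1) (\<lambda>a. if b then subst (forms_of d a) (single (snd x) 1) * (var j :: ('v, 'k) mpoly) else 0)" for b j
  proof -
    have "pfam (mdeg (snd x) * 1) (\<lambda>a. subst (forms_of d a) (single (snd x) 1) :: ('v, 'k) mpoly)"
      by (rule pfam_subst[OF pfam_forms_of form_single[OF refl]])
    from pfam_mult_fixed[OF this, of "var j"] show ?thesis
      by (cases b) (simp_all add: mult.commute pfam_zero)
  qed
  show "hfun (mdeg (snd x) * 1) (\<lambda>a. lin_vec d a x c)"
    unfolding lin_vec_def lin_cond_def case_prod_unfold by (intro pr_hfun pfam_diff *)
qed

lemma lin_cond_sum:
  "(\<Sum>x\<in>UNIV \<times> Std D. const (t x) * lin_cond d a x i j)
    = subst (forms_of d a) (\<Sum>m\<in>Std D. const (t (i, m)) * single m 1) * var j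
      - subst (forms_of d a) (\<Sum>m\<in>Std D. const (t (j, m)) * single m 1) * var i"
proof -
  let ?h = "forms_of d a"
  have *: "(\<Sum>l\<in>UNIV. \<Sum>m\<in>Std D. const (t (l, m)) * (if l = i then subst ?h (single m 1) * z else 0))
      = subst ?h (\<Sum>m\<in>Std D. const (t (i, m)) * single m 1) * z" for i z
  proof -
    have "(\<Sum>l\<in>UNIV. \<Sum>m\<in>Std D. const (t (l, m)) * (if l = i then subst ?h (single m 1) * z else 0))
        = (\<Sum>l\<in>UNIV. if l = i then \<Sum>m\<in>Std D. const (t (l, m)) * (subst ?h (single m 1) * z) else 0)"
      by (intro sum.cong) auto
    then show ?thesis by (simp add: subst_sum subst_mult sum_distrib_right mult.assoc)
  qed
  have split: "(\<Sum>x\<in>UNIV \<times> Std D. f x) = (\<Sum>l\<in>UNIV. \<Sum>m\<in>Std D. f (l, m))"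
    for f :: "'v \<times> 'v monom \<Rightarrow> ('v, 'k) mpoly"
    by (simp add: sum.cartesian_product)
  show ?thesis
    unfolding split lin_cond_def
    by (simp only: fst_conv snd_conv right_diff_distrib sum_subtractf *)
qed

lemma lin_vec_sum:
  "(\<forall>c. (\<Sum>x\<in>UNIV \<times> Std D. t x * lin_vec d a x c) = 0) \<longleftrightarrow>
   same_map P (\<lambda>i. subst (forms_of d a) (\<Sum>m\<in>Std D. const (t (i, m)) * single m 1)) var"
  unfolding same_map_def lin_cond_sum[symmetric] pr_P lin_vec_def split_paired_All
  by (simp add: pr_lincomb)

text \<open>
  With the degree \<open>D\<close> of the inverse fixed, a left inverse is a non-trivial relation between the vectors
  \<open>lin_vec\<close>; injectivity of the substitution in degree \<open>D\<close>, which holds for a birational map, excludes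
  relations with \<open>g(h) = 0\<close>. Two of the four conditions are open and two are closed.
\<close>

lemma birational_conditions:
  assumes D: "birational P d (forms_of d a) \<Longrightarrow> \<exists>g. left_inverse (forms_of d a) D g"
  shows "birational P d (forms_of d a) \<longleftrightarrow>
    (not_all_zero d a \<and> inj_degree d D a) \<and> (maps_into d a \<and> \<not> indep (lin_vec d a) (UNIV \<times> Std D))"
proof
  let ?h = "forms_of d a"
  assume bir: "birational P d ?h"
  then obtain g where g: "left_inverse ?h D g" using D by blast
  have pres: "presentation P d ?h" using bir unfolding birational_def by blast
  have dom: "dominant ?h" by (rule left_inverse_dominant[OF pres g])
  have "inj_degree d D a" unfolding inj_degree_def indep_pr
  proof (intro allI impI)
    fix t assume "(\<Sum>m\<in>Std D. const (t m) * subst ?h (single m 1)) \<in> P"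
    then have "subst ?h (\<Sum>m\<in>Std D. const (t m) * single m 1) \<in> P" by (simp add: subst_sum subst_mult)
    from dominantD[OF dom form_Std_sum this] show "\<forall>m\<in>Std D. t m = 0" using Std_zero by blast
  qed
  moreover have "\<not> indep (lin_vec d a) (UNIV \<times> Std D)"
  proof
    assume ind: "indep (lin_vec d a) (UNIV \<times> Std D)"
    have "\<exists>s. g i - (\<Sum>m\<in>Std D. const (s m) * single m 1) \<in> P" for i
      using Std_span[of D "g i"] g unfolding left_inverse_def inspan_pr by blast
    then obtain s where s: "\<And>i. g i - (\<Sum>m\<in>Std D. const (s i m) * single m 1) \<in> P" by metis
    define t where "t x = s (fst x) (snd x)" for x
    define g' where "g' i = (\<Sum>m\<in>Std D. const (t (i, m)) * single m 1)" for i
    have gg: "g i - g' i \<in> P" for i using s by (simp add: g'_def t_def)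
    have hgg: "subst ?h (g i) - subst ?h (g' i) \<in> P" for i
      using pres gg unfolding presentation_def subst_diff[symmetric] by blast
    obtain l where l: "subst ?h (g l) \<notin> P" using g unfolding left_inverse_def by blast
    have "same_map P (\<lambda>i. subst ?h (g' i)) (\<lambda>i. subst ?h (g i))"
      by (rule same_map_sym, rule same_map_cong, rule hgg)
    moreover have "same_map P (\<lambda>i. subst ?h (g i)) var" using g unfolding left_inverse_def by blast
    ultimately have "same_map P (\<lambda>i. subst ?h (g' i)) var"
      using same_map_trans[of "\<lambda>i. subst ?h (g' i)" "\<lambda>i. subst ?h (g i)" var l] l by blast
    then have "\<forall>c. (\<Sum>x\<in>UNIV \<times> Std D. t x * lin_vec d a x c) = 0" unfolding lin_vec_sum g'_def .
    then have "t x = 0" if "x \<in> UNIV \<times> Std D" for x using indepD[OF ind _ that] by blast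
    then have "g' l = 0" unfolding g'_def by simp
    then show False using l hgg[of l] by simp
  qed
  ultimately show "(not_all_zero d a \<and> inj_degree d D a) \<and> (maps_into d a \<and> \<not> indep (lin_vec d a) (UNIV \<times> Std D))"
    using pres unfolding presentation_forms_of by blast
next
  let ?h = "forms_of d a"
  assume c: "(not_all_zero d a \<and> inj_degree d D a) \<and> (maps_into d a \<and> \<not> indep (lin_vec d a) (UNIV \<times> Std D))"
  then have pres: "presentation P d ?h" unfolding presentation_forms_of by blast
  obtain t l m0 where t: "\<forall>c. (\<Sum>x\<in>UNIV \<times> Std D. t x * lin_vec d a x c) = 0"
    and l: "m0 \<in> Std D" "t (l, m0) \<noteq> 0" using c unfolding indep_def by auto
  define g where "g i = (\<Sum>m\<in>Std D. const (t (i, m)) * single m 1)" for i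
  have "left_inverse ?h D g"
    unfolding left_inverse_def
  proof (intro conjI allI)
    show "form D (g i)" for i unfolding g_def by (rule form_Std_sum)
    show "\<exists>i. subst ?h (g i) \<notin> P"
    proof (intro exI notI)
      assume "subst ?h (g l) \<in> P"
      then have "(\<Sum>m\<in>Std D. const (t (l, m)) * subst ?h (single m 1)) \<in> P"
        by (simp add: g_def subst_sum subst_mult)
      moreover have "\<forall>t. (\<Sum>m\<in>Std D. const (t m) * subst ?h (single m 1)) \<in> P \<longrightarrow> (\<forall>m\<in>Std D. t m = 0)"
        using c unfolding inj_degree_def indep_pr by blast
      ultimately have "\<forall>m\<in>Std D. t (l, m) = 0" by (elim allE[of _ "\<lambda>m. t (l, m)"] mp)
      then show False using l by blast
    qed
    show "same_map P (\<lambda>i. subst ?h (g i)) var" using t unfolding lin_vec_sum g_def .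
  qed
  then show "birational P d ?h" by (rule left_inverse_birational[OF pres])
qed

theorem Hd_conditions:
  assumes "d > 0"
  shows "\<exists>\<psi> \<phi>. hopen \<psi> \<and> hopen (\<lambda>a. \<not> \<phi> a) \<and>
    (\<forall>a. (\<forall>i. i \<notin> W_index d \<longrightarrow> a i = 0) \<longrightarrow> birational P d (forms_of d a) = (\<psi> a \<and> \<phi> a))"
proof -
  obtain D where D: "\<And>a. (\<forall>i. i \<notin> W_index d \<longrightarrow> a i = 0) \<Longrightarrow> birational P d (forms_of d a) \<Longrightarrow>
    \<exists>g. left_inverse (forms_of d a) D g" using left_inverse_degree_bound[OF assms] by blast
  show ?thesis
  proof (intro exI conjI)
    show "hopen (\<lambda>a. not_all_zero d a \<and> inj_degree d D a)"
      by (intro hopen_conj hopen_not_all_zero hopen_inj_degree)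
    have "hopen (\<lambda>a. \<exists>b. if b then \<not> maps_into d a else indep (lin_vec d a) (UNIV \<times> Std D))"
    proof (rule hopen_ex)
      show "hopen (\<lambda>a. if b then \<not> maps_into d a else indep (lin_vec d a) (UNIV \<times> Std D))" for b
        by (cases b) (simp_all add: hopen_not_maps_into hopen_lin_vec)
    qed
    then show "hopen (\<lambda>a. \<not> (maps_into d a \<and> \<not> indep (lin_vec d a) (UNIV \<times> Std D)))"
      by (rule hopen_cong) (metis (full_types))
    show "\<forall>a. (\<forall>i. i \<notin> W_index d \<longrightarrow> a i = 0) \<longrightarrow> birational P d (forms_of d a) =
      ((not_all_zero d a \<and> inj_degree d D a) \<and> (maps_into d a \<and> \<not> indep (lin_vec d a) (UNIV \<times> Std D)))"
      using birational_conditions D by blast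
  qed
qed

end

section \<open>Ideals of grade at least two\<close>

text \<open>
  A coordinate modulo the subspace \<open>Q\<close> is a polynomial in the parameter of the moment curve, with the
  coordinates of the \<open>h i\<close> as coefficients. It has infinitely many zeros, so it is zero.
\<close>

lemma moment_curve:
  fixes h :: "'a::finite \<Rightarrow> ('v, 'k::field) mpoly" and \<iota> :: "'a \<Rightarrow> nat"
  assumes Q: "0 \<in> Q" "\<And>f g. f \<in> Q \<Longrightarrow> g \<in> Q \<Longrightarrow> f + g \<in> Q" "\<And>c f. f \<in> Q \<Longrightarrow> const c * f \<in> Q"
    and \<iota>: "inj \<iota>" and inf: "infinite \<Lambda>"
    and mem: "\<And>\<xi>. \<xi> \<in> \<Lambda> \<Longrightarrow> (\<Sum>i\<in>UNIV. const (\<xi> ^ \<iota> i) * h i) \<in> Q"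
  shows "h i \<in> Q"
proof -
  obtain pr :: "('v, 'k) mpoly \<Rightarrow> ('v, 'k) mpoly \<Rightarrow> 'k" where
    pr: "\<forall>f g c. pr (f + g) c = pr f c + pr g c" "\<forall>t f c. pr (const t * f) c = t * pr f c"
      "\<forall>f. f \<in> Q \<longleftrightarrow> (\<forall>c. pr f c = 0)"
  proof -
    have "\<exists>pr :: ('v, 'k) mpoly \<Rightarrow> ('v, 'k) mpoly \<Rightarrow> 'k. (\<forall>f g c. pr (f + g) c = pr f c + pr g c) \<and>
        (\<forall>t f c. pr (const t * f) c = t * pr f c) \<and> (\<forall>f. f \<in> Q \<longleftrightarrow> (\<forall>c. pr f c = 0))"
      by (rule ex_coordinates) (fact Q)+
    then show ?thesis by (elim exE conjE) (rule that)
  qed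
  have pr0: "pr 0 c = 0" for c using pr(3) Q(1) by blast
  have pr_sum: "pr (\<Sum>i\<in>A. f i) c = (\<Sum>i\<in>A. pr (f i) c)" for A :: "'a set" and f c
    by (induction A rule: infinite_finite_induct) (simp_all add: pr0 pr(1))
  have "pr (h i) c = 0" for c
  proof -
    define p where "p = (\<Sum>i\<in>UNIV. Polynomial.monom (pr (h i) c) (\<iota> i))"
    have "poly p \<xi> = 0" if "\<xi> \<in> \<Lambda>" for \<xi>
    proof -
      have "poly p \<xi> = pr (\<Sum>i\<in>UNIV. const (\<xi> ^ \<iota> i) * h i) c"
        by (simp add: p_def poly_sum poly_monom pr_sum pr(2) mult.commute[of "pr (h _) c"])
      then show ?thesis using mem[OF that] pr(3) by simp
    qed
    then have "\<Lambda> \<subseteq> {\<xi>. poly p \<xi> = 0}" by blast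
    then have "infinite {\<xi>. poly p \<xi> = 0}" using inf finite_subset by blast
    then have "p = 0" using poly_roots_finite by blast
    then have "Polynomial.coeff p (\<iota> i) = 0" by simp
    moreover have "Polynomial.coeff p (\<iota> i) = (\<Sum>j\<in>UNIV. if j = i then pr (h j) c else 0)"
      by (simp add: p_def Polynomial.coeff_sum inj_eq[OF \<iota>])
    ultimately show ?thesis by simp
  qed
  then show ?thesis using pr(3) by blast
qed

definition ideal_set :: "('v, 'k::field) mpoly set \<Rightarrow> bool" where
  "ideal_set I \<longleftrightarrow> 0 \<in> I \<and> (\<forall>f\<in>I. \<forall>g\<in>I. f + g \<in> I) \<and> (\<forall>f\<in>I. \<forall>g. g * f \<in> I)"

lemma ideal_set_sum: "ideal_set I \<Longrightarrow> (\<And>x. x \<in> A \<Longrightarrow> f x \<in> I) \<Longrightarrow> (\<Sum>x\<in>A. f x) \<in> I"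
  by (induction A rule: infinite_finite_induct) (auto simp: ideal_set_def)

text \<open>
  The ascending chain condition: choosing an element in each step of a chain would contradict
  \<open>hilbert_chain\<close>.
\<close>

lemma wf_ideal_set:
  "wf {(J, I :: ('v::finite, 'k::field) mpoly set). ideal_set I \<and> ideal_set J \<and> I \<subset> J}"
  unfolding wf_iff_no_infinite_down_chain
proof
  assume "\<exists>I. \<forall>n. (I (Suc n), I n) \<in> {(J, I :: ('v, 'k) mpoly set). ideal_set I \<and> ideal_set J \<and> I \<subset> J}"
  then obtain I :: "nat \<Rightarrow> ('v, 'k) mpoly set" where I: "\<And>n. ideal_set (I n)" "\<And>n. I n \<subset> I (Suc n)" by blast
  then have "\<forall>n. \<exists>q. q \<in> I (Suc n) \<and> q \<notin> I n" by blast
  from choice[OF this] obtain q where q: "\<And>n. q n \<in> I (Suc n)" "\<And>n. q n \<notin> I n" by blast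
  have sub: "I n \<subseteq> I (Suc n)" for n using I(2)[of n] by (rule psubset_imp_subset)
  have mono: "I i \<subseteq> I j" if "i \<le> j" for i j using sub that by (rule lift_Suc_mono_le)
  obtain N c where N: "q N = (\<Sum>j<N. c j * q j)"
    using hilbert_chain[of "UNIV :: 'v set" q] by auto
  have "(\<Sum>j<N. c j * q j) \<in> I N"
  proof (rule ideal_set_sum[OF I(1)])
    fix j assume "j \<in> {..<N}"
    then have "q j \<in> I N" using q(1)[of j] mono[of "Suc j" N] by auto
    then show "c j * q j \<in> I N" using I(1)[of N] unfolding ideal_set_def by blast
  qed
  then show False using q(2)[of N] N by simp
qed

text \<open>
  The maximal annihilators modulo \<open>I\<close> are prime, and by the chain condition there are finitely many of
  them. If all points of a moment curve in the span of the \<open>h i\<close> were zero divisors modulo \<open>I\<close>,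
  infinitely many would lie in the same annihilator, and then all \<open>h i\<close> would.
\<close>

lemma ex_nonzerodivisor:
  fixes I :: "('v::finite, 'k::field) mpoly set" and h :: "'a::finite \<Rightarrow> ('v, 'k) mpoly"
  assumes k: "infinite (UNIV :: 'k set)" and I: "ideal_set I"
    and faithful: "\<And>y. (\<And>i. h i * y \<in> I) \<Longrightarrow> y \<in> I"
  shows "\<exists>t. \<forall>y. (\<Sum>i\<in>UNIV. const (t i) * h i) * y \<in> I \<longrightarrow> y \<in> I"
proof (rule ccontr)
  assume contr: "\<not> ?thesis"
  obtain \<iota> :: "'a \<Rightarrow> nat" where \<iota>: "inj \<iota>"
    using finite_imp_inj_to_nat_seg[of "UNIV :: 'a set"] by auto
  define b where "b \<xi> = (\<Sum>i\<in>UNIV. const (\<xi> ^ \<iota> i) * h i)" for \<xi>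
  define ann where "ann y = {f. f * y \<in> I}" for y
  have I0: "0 \<in> I" and Iadd: "\<And>f g. f \<in> I \<Longrightarrow> g \<in> I \<Longrightarrow> f + g \<in> I" and Imult: "\<And>f g. f \<in> I \<Longrightarrow> g * f \<in> I"
    using I unfolding ideal_set_def by auto
  have ann_ideal: "ideal_set (ann y)" for y
    unfolding ideal_set_def ann_def
    by (auto simp: I0 distrib_right mult.assoc intro: Iadd Imult)
  have "\<exists>y. y \<notin> I \<and> b \<xi> \<in> ann y \<and> (\<forall>y'. y' \<notin> I \<longrightarrow> ann y \<subseteq> ann y' \<longrightarrow> ann y' = ann y)" for \<xi>
  proof -
    let ?\<A> = "{J. \<exists>y. J = ann y \<and> y \<notin> I \<and> b \<xi> \<in> ann y}"
    have "\<exists>y. (\<Sum>i\<in>UNIV. const (t i) * h i) * y \<in> I \<and> y \<notin> I" for t using contr by blast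
    from this[of "\<lambda>i. \<xi> ^ \<iota> i"] have "\<exists>y. b \<xi> * y \<in> I \<and> y \<notin> I" unfolding b_def .
    then obtain y0 where "ann y0 \<in> ?\<A>" unfolding ann_def by blast
    from wf_ideal_set[unfolded wf_eq_minimal, rule_format, OF this]
    obtain J where J: "J \<in> ?\<A>" "\<forall>J'. (J', J) \<in> {(J, I). ideal_set I \<and> ideal_set J \<and> I \<subset> J} \<longrightarrow> J' \<notin> ?\<A>"
      by (elim bexE) (rule that)
    then obtain y where y: "J = ann y" "y \<notin> I" "b \<xi> \<in> ann y" by blast
    have "ann y' = ann y" if "y' \<notin> I" "ann y \<subseteq> ann y'" for y'
    proof (rule ccontr)
      assume "ann y' \<noteq> ann y"
      then have "ann y' \<notin> ?\<A>" using J(2) that(2) ann_ideal y(1) by blast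
      then show False using that y(3) by blast
    qed
    then show ?thesis using y by blast
  qed
  then have "\<exists>y. \<forall>\<xi>. y \<xi> \<notin> I \<and> b \<xi> \<in> ann (y \<xi>) \<and> (\<forall>y'. y' \<notin> I \<longrightarrow> ann (y \<xi>) \<subseteq> ann y' \<longrightarrow> ann y' = ann (y \<xi>))"
    by (intro choice allI)
  then obtain y where y: "\<And>\<xi>. y \<xi> \<notin> I" "\<And>\<xi>. b \<xi> \<in> ann (y \<xi>)"
    "\<And>\<xi> y'. y' \<notin> I \<Longrightarrow> ann (y \<xi>) \<subseteq> ann y' \<Longrightarrow> ann y' = ann (y \<xi>)" by blast
  have prime_ann: "f \<in> ann (y \<xi>) \<or> g \<in> ann (y \<xi>)" if "f * g \<in> ann (y \<xi>)" for f g \<xi>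
  proof (rule disjCI)
    assume g: "g \<notin> ann (y \<xi>)"
    have "ann (g * y \<xi>) = ann (y \<xi>)"
    proof (rule y(3))
      show "g * y \<xi> \<notin> I" using g unfolding ann_def by simp
      show "ann (y \<xi>) \<subseteq> ann (g * y \<xi>)"
      proof
        fix x assume "x \<in> ann (y \<xi>)"
        then have "x * y \<xi> \<in> I" unfolding ann_def by simp
        from Imult[OF this, of g] show "x \<in> ann (g * y \<xi>)" unfolding ann_def by (simp add: mult.left_commute)
      qed
    qed
    then show "f \<in> ann (y \<xi>)" using that unfolding ann_def by (auto simp: mult.assoc)
  qed
  have "infinite (range (\<lambda>\<xi>. ann (y \<xi>)))"
  proof
    assume fin: "finite (range (\<lambda>\<xi>. ann (y \<xi>)))"
    obtain \<xi>0 where inf: "infinite {\<xi> \<in> UNIV. ann (y \<xi>) = ann (y \<xi>0)}"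
      using pigeonhole_infinite[OF k fin] by blast
    have "h i \<in> ann (y \<xi>0)" for i
    proof (rule moment_curve[OF _ _ _ \<iota> inf])
      show "0 \<in> ann (y \<xi>0)" "\<And>f g. f \<in> ann (y \<xi>0) \<Longrightarrow> g \<in> ann (y \<xi>0) \<Longrightarrow> f + g \<in> ann (y \<xi>0)"
        "\<And>c f. f \<in> ann (y \<xi>0) \<Longrightarrow> const c * f \<in> ann (y \<xi>0)"
        using ann_ideal[of "y \<xi>0"] unfolding ideal_set_def by auto
      show "(\<Sum>i\<in>UNIV. const (\<xi> ^ \<iota> i) * h i) \<in> ann (y \<xi>0)" if "\<xi> \<in> {\<xi> \<in> UNIV. ann (y \<xi>) = ann (y \<xi>0)}" for \<xi>
        using that y(2)[of \<xi>] unfolding b_def by auto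
    qed
    then show False using faithful[of "y \<xi>0"] y(1) unfolding ann_def by blast
  qed
  then obtain A :: "nat \<Rightarrow> ('v, 'k) mpoly set" where A: "inj A" "range A \<subseteq> range (\<lambda>\<xi>. ann (y \<xi>))"
    using infinite_countable_subset by blast
  then have "\<forall>n. \<exists>\<xi>. A n = ann (y \<xi>)" by blast
  from choice[OF this] obtain \<xi> where \<xi>: "\<And>n. A n = ann (y (\<xi> n))" by blast
  obtain N c where N: "y (\<xi> N) = (\<Sum>j<N. c j * y (\<xi> j))"
    using hilbert_chain[of "UNIV :: 'v set" "\<lambda>n. y (\<xi> n)"] by auto
  have "\<exists>f. f \<in> ann (y (\<xi> j)) \<and> f \<notin> ann (y (\<xi> N))" if "j < N" for j
  proof (rule ccontr)
    assume "\<not> ?thesis"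
    then have "ann (y (\<xi> N)) = ann (y (\<xi> j))" using y(1,3) by blast
    then have "A N = A j" by (simp add: \<xi>)
    then show False using A(1) that by (simp add: inj_eq)
  qed
  then have "\<forall>j. \<exists>f. j < N \<longrightarrow> f \<in> ann (y (\<xi> j)) \<and> f \<notin> ann (y (\<xi> N))" by blast
  from choice[OF this] obtain f where f: "\<And>j. j < N \<Longrightarrow> f j \<in> ann (y (\<xi> j))" "\<And>j. j < N \<Longrightarrow> f j \<notin> ann (y (\<xi> N))"
    by blast
  have one: "1 \<notin> ann (y (\<xi> N))" using y(1) unfolding ann_def by simp
  have "(\<Prod>j\<in>M. f j) \<notin> ann (y (\<xi> N))" if "finite M" "M \<subseteq> {..<N}" for M
    using that
  proof (induction M rule: finite_induct)
    case (insert x M)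
    then have "f x \<notin> ann (y (\<xi> N))" "(\<Prod>j\<in>M. f j) \<notin> ann (y (\<xi> N))" using f(2)[of x] by auto
    then have "f x * (\<Prod>j\<in>M. f j) \<notin> ann (y (\<xi> N))" using prime_ann by blast
    then show ?case using insert.hyps by simp
  qed (simp add: one)
  then have nin: "(\<Prod>j<N. f j) \<notin> ann (y (\<xi> N))" by simp
  have "(\<Prod>j<N. f j) * y (\<xi> j) \<in> I" if j: "j < N" for j
  proof -
    have "(\<Prod>j<N. f j) = (\<Prod>i\<in>{..<N} - {j}. f i) * f j"
      using j by (subst prod.remove[of _ j]) (auto simp: mult.commute)
    moreover have "f j * y (\<xi> j) \<in> I" using f(1)[OF j] unfolding ann_def by simp
    ultimately show ?thesis using Imult by (simp add: mult.assoc)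
  qed
  then have "(\<Sum>j<N. c j * ((\<Prod>j<N. f j) * y (\<xi> j))) \<in> I"
    using Imult by (intro ideal_set_sum[OF I]) simp
  also have "(\<Sum>j<N. c j * ((\<Prod>j<N. f j) * y (\<xi> j))) = (\<Prod>j<N. f j) * y (\<xi> N)"
    unfolding N sum_distrib_left by (simp add: mult.left_commute)
  finally show False using nin unfolding ann_def by simp
qed

lemma eval_0_lookup: "eval_at (\<lambda>_. 0) f = lookup (f :: ('v, 'k::field) mpoly) 0"
proof -
  have z: "(\<Prod>i\<in>keys m. (0::'k) ^ lookup m i) = (if m = 0 then 1 else 0)" for m :: "'v monom"
  proof (cases "m = 0")
    case False
    then obtain i where "i \<in> keys m" by (metis poly_mapping_eqI in_keys_iff lookup_zero)
    then have "(\<Prod>i\<in>keys m. (0::'k) ^ lookup m i) = 0"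
      by (intro prod_zero) (auto simp: in_keys_iff intro!: bexI[of _ i])
    then show ?thesis using False by simp
  qed simp
  show ?thesis unfolding peval_def z by (auto simp: in_keys_iff if_distrib cong: if_cong)
qed

context hprime
begin

text \<open>
  Every tuple of degree \<open>e\<close> that is proportional to \<open>h\<close> is a multiple of \<open>h\<close>. This is the form in which the
  condition on the grade enters all further arguments.
\<close>

definition saturated :: "nat \<Rightarrow> ('v \<Rightarrow> ('v, 'k) mpoly) \<Rightarrow> bool" where
  "saturated e h \<longleftrightarrow> (\<forall>u. (\<forall>i. form e (u i)) \<longrightarrow> same_map P h u \<longrightarrow> (\<exists>c. \<forall>i. u i - c * h i \<in> P))"

lemma P_ideal: "ideal P S_ring"
proof -
  interpret S: cring "S_ring :: ('v, 'k) mpoly ring" by (rule cring_S_ring)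
  have sr: "carrier S_ring = (UNIV :: ('v, 'k) mpoly set)"
    "\<And>a b :: ('v, 'k) mpoly. a \<otimes>\<^bsub>S_ring\<^esub> b = a * b"
    "\<And>a b :: ('v, 'k) mpoly. a \<oplus>\<^bsub>S_ring\<^esub> b = a + b"
    "\<zero>\<^bsub>S_ring\<^esub> = (0 :: ('v, 'k) mpoly)" by (simp_all add: S_ring_def)
  show ?thesis
  proof (rule idealI)
    show "ring (S_ring :: ('v, 'k) mpoly ring)" by (rule S.ring_axioms)
    show "subgroup P (add_monoid S_ring)"
    proof (rule S.add.subgroupI)
      show "P \<subseteq> carrier S_ring" by (simp add: sr)
      show "P \<noteq> {}" using P_zero by blast
      fix a assume a: "a \<in> P"
      have "\<ominus>\<^bsub>S_ring\<^esub> a = - a" by (rule S.minus_equality) (simp_all add: sr)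
      then show "\<ominus>\<^bsub>S_ring\<^esub> a \<in> P" using P_uminus[OF a] by simp
    qed (simp add: sr P_add)
    fix a x assume "a \<in> P"
    then show "x \<otimes>\<^bsub>S_ring\<^esub> a \<in> P" "a \<otimes>\<^bsub>S_ring\<^esub> x \<in> P" by (simp_all add: sr P_mult P_mult_right)
  qed
qed

lemma coord_cring: "cring (coord_ring P)"
  unfolding coord_ring_def by (rule ideal.quotient_is_cring[OF P_ideal cring_S_ring])

lemma cls_def': "cls P f = (\<lambda>p. p + f) ` P"
  unfolding a_r_coset_def r_coset_def S_ring_def by auto

lemma cls_eq: "cls P f = cls P g \<longleftrightarrow> f - g \<in> P"
proof
  assume "cls P f = cls P g"
  then have "f \<in> (\<lambda>p. p + g) ` P" unfolding cls_def' using P_zero by force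
  then show "f - g \<in> P" by auto
next
  assume fg: "f - g \<in> P"
  have "(\<lambda>p. p + f) ` P \<subseteq> (\<lambda>p. p + g) ` P" if "f - g \<in> P" for f g
  proof
    fix x assume "x \<in> (\<lambda>p. p + f) ` P"
    then obtain p where "p \<in> P" "x = p + f" by blast
    then show "x \<in> (\<lambda>p. p + g) ` P" using P_add[OF _ that, of p] by (intro image_eqI[of _ _ "p + (f - g)"]) simp_all
  qed
  then show "cls P f = cls P g" unfolding cls_def' using fg P_sub_sym by blast
qed

lemma coord_carrier: "carrier (coord_ring P) = range (cls P)"
  unfolding coord_ring_def FactRing_def A_RCOSETS_def' by (auto simp: S_ring_def)

lemma coord_mult: "cls P f \<otimes>\<^bsub>coord_ring P\<^esub> cls P g = cls P (f * g)"
  using ideal.rcoset_mult_add[OF P_ideal, of f g] unfolding coord_ring_def FactRing_def by (simp add: S_ring_def)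

lemma coord_add: "cls P f \<oplus>\<^bsub>coord_ring P\<^esub> cls P g = cls P (f + g)"
  using ring_hom_add[OF ideal.rcos_ring_hom[OF P_ideal], of f g] unfolding coord_ring_def by (simp add: S_ring_def)

lemma coord_one: "\<one>\<^bsub>coord_ring P\<^esub> = cls P 1"
  using ring_hom_one[OF ideal.rcos_ring_hom[OF P_ideal]] unfolding coord_ring_def by (simp add: S_ring_def)

lemma coord_zero: "\<zero>\<^bsub>coord_ring P\<^esub> = cls P 0"
proof -
  interpret R: cring "coord_ring P" by (rule coord_cring)
  have "cls P 0 \<oplus>\<^bsub>coord_ring P\<^esub> cls P 0 = cls P 0" by (simp add: coord_add)
  moreover have "cls P 0 \<in> carrier (coord_ring P)" by (simp add: coord_carrier)
  ultimately show ?thesis by (metis R.add.l_cancel_one')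
qed

lemma coord_idealI:
  assumes "ideal_set I" "P \<subseteq> I"
  shows "ideal (cls P ` I) (coord_ring P)"
proof -
  interpret R: cring "coord_ring P" by (rule coord_cring)
  have I: "0 \<in> I" "\<And>f g. f \<in> I \<Longrightarrow> g \<in> I \<Longrightarrow> f + g \<in> I" "\<And>f g. f \<in> I \<Longrightarrow> g * f \<in> I"
    using assms(1) unfolding ideal_set_def by auto
  show ?thesis
  proof (rule idealI)
    show "ring (coord_ring P)" by (rule R.ring_axioms)
    show "subgroup (cls P ` I) (add_monoid (coord_ring P))"
    proof (rule R.add.subgroupI)
      show "cls P ` I \<subseteq> carrier (coord_ring P)" by (auto simp: coord_carrier)
      show "cls P ` I \<noteq> {}" using I(1) by blast
      fix a assume "a \<in> cls P ` I"
      then obtain f where f: "a = cls P f" "f \<in> I" by blast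
      have "\<ominus>\<^bsub>coord_ring P\<^esub> a = cls P (- f)"
        by (rule R.minus_equality) (simp_all add: f(1) coord_add coord_zero coord_carrier)
      then show "\<ominus>\<^bsub>coord_ring P\<^esub> a \<in> cls P ` I" using I(3)[OF f(2), of "-1"] by simp
    next
      fix a b assume "a \<in> cls P ` I" "b \<in> cls P ` I"
      then show "a \<oplus>\<^bsub>coord_ring P\<^esub> b \<in> cls P ` I" using I(2) by (auto simp: coord_add)
    qed
    fix a x assume "a \<in> cls P ` I" "x \<in> carrier (coord_ring P)"
    then show "x \<otimes>\<^bsub>coord_ring P\<^esub> a \<in> cls P ` I" "a \<otimes>\<^bsub>coord_ring P\<^esub> x \<in> cls P ` I"
      using I(3) unfolding coord_carrier by (auto simp: coord_mult mult.commute)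
  qed
qed

text \<open>
  The inverse image in the polynomial ring of the ideal of the coordinate ring generated by the \<open>h i\<close>.
\<close>

definition ext :: "('a::finite \<Rightarrow> ('v, 'k) mpoly) \<Rightarrow> ('v, 'k) mpoly set" where
  "ext h = {f. \<exists>\<alpha>. f - (\<Sum>i\<in>UNIV. \<alpha> i * h i) \<in> P}"

lemma ext_ideal_set: "ideal_set (ext h)"
  unfolding ideal_set_def
proof (intro conjI ballI allI)
  show "0 \<in> ext h" unfolding ext_def by (intro CollectI exI[of _ "\<lambda>_. 0"]) (simp add: P_zero)
  fix f assume "f \<in> ext h"
  then obtain \<alpha> where f: "f - (\<Sum>i\<in>UNIV. \<alpha> i * h i) \<in> P" unfolding ext_def by blast
  show "g * f \<in> ext h" for g
    using P_mult[OF f, of g] unfolding ext_def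
    by (intro CollectI exI[of _ "\<lambda>i. g * \<alpha> i"]) (simp add: right_diff_distrib sum_distrib_left mult.assoc)
  fix g assume "g \<in> ext h"
  then obtain \<beta> where g: "g - (\<Sum>i\<in>UNIV. \<beta> i * h i) \<in> P" unfolding ext_def by blast
  have "f + g - (\<Sum>i\<in>UNIV. (\<alpha> i + \<beta> i) * h i)
      = (f - (\<Sum>i\<in>UNIV. \<alpha> i * h i)) + (g - (\<Sum>i\<in>UNIV. \<beta> i * h i))"
    by (simp add: distrib_right sum.distrib)
  then show "f + g \<in> ext h" using P_add[OF f g] unfolding ext_def
    by (intro CollectI exI[of _ "\<lambda>i. \<alpha> i + \<beta> i"]) (simp only:)
qed

lemma P_ext: "P \<subseteq> ext h"
  unfolding ext_def by (auto intro!: exI[of _ "\<lambda>_. 0"])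

lemma ext_mem: "h i \<in> ext h"
proof -
  have "(\<Sum>j\<in>UNIV. (if j = i then 1 else 0) * h j) = h i"
    by (simp add: if_distrib[of "\<lambda>t. t * _"] cong: if_cong)
  then show ?thesis unfolding ext_def by (intro CollectI exI[of _ "\<lambda>j. if j = i then 1 else 0"]) (simp add: P_zero)
qed

lemma genideal_coord: "Idl\<^bsub>coord_ring P\<^esub> (range (\<lambda>i. cls P (h i))) = cls P ` ext h"
proof
  interpret R: cring "coord_ring P" by (rule coord_cring)
  show "Idl\<^bsub>coord_ring P\<^esub> (range (\<lambda>i. cls P (h i))) \<subseteq> cls P ` ext h"
    by (rule R.genideal_minimal[OF coord_idealI[OF ext_ideal_set P_ext]]) (use ext_mem in blast)
  have sub: "range (\<lambda>i. cls P (h i)) \<subseteq> carrier (coord_ring P)" by (auto simp: coord_carrier)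
  interpret J: ideal "Idl\<^bsub>coord_ring P\<^esub> (range (\<lambda>i. cls P (h i)))" "coord_ring P"
    by (rule R.genideal_ideal[OF sub])
  have mem: "cls P (\<alpha> * h i) \<in> Idl\<^bsub>coord_ring P\<^esub> (range (\<lambda>i. cls P (h i)))" for \<alpha> i
  proof -
    have "cls P (h i) \<in> Idl\<^bsub>coord_ring P\<^esub> (range (\<lambda>i. cls P (h i)))" using R.genideal_self[OF sub] by blast
    from J.I_l_closed[OF this, of "cls P \<alpha>"] show ?thesis by (simp add: coord_mult coord_carrier)
  qed
  have sum: "cls P (\<Sum>i\<in>A. \<alpha> i * h i) \<in> Idl\<^bsub>coord_ring P\<^esub> (range (\<lambda>i. cls P (h i)))" for \<alpha> and A :: "'a set"
  proof (induction A rule: infinite_finite_induct)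
    case (insert x A)
    from J.a_closed[OF mem[of "\<alpha> x" x] insert.IH] show ?case using insert.hyps by (simp add: coord_add)
  qed (use J.zero_closed in \<open>simp_all add: coord_zero\<close>)
  show "cls P ` ext h \<subseteq> Idl\<^bsub>coord_ring P\<^esub> (range (\<lambda>i. cls P (h i)))"
  proof
    fix x assume "x \<in> cls P ` ext h"
    then obtain f \<alpha> where f: "x = cls P f" "f - (\<Sum>i\<in>UNIV. \<alpha> i * h i) \<in> P" unfolding ext_def by blast
    then have "x = cls P (\<Sum>i\<in>UNIV. \<alpha> i * h i)" using cls_eq by blast
    then show "x \<in> Idl\<^bsub>coord_ring P\<^esub> (range (\<lambda>i. cls P (h i)))" using sum by (simp only:)
  qed
qed

lemma cls_mem_ext: "cls P f \<in> cls P ` ext h \<longleftrightarrow> f \<in> ext h"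
proof
  assume "cls P f \<in> cls P ` ext h"
  then obtain g where g: "g \<in> ext h" "f - g \<in> P" using cls_eq by blast
  have "(f - g) + g \<in> ext h" using ext_ideal_set[of h] P_ext g unfolding ideal_set_def by blast
  then show "f \<in> ext h" by simp
qed blast

lemma genideal_empty: "Idl\<^bsub>coord_ring P\<^esub> {} = {cls P 0}"
proof
  interpret R: cring "coord_ring P" by (rule coord_cring)
  show "Idl\<^bsub>coord_ring P\<^esub> {} \<subseteq> {cls P 0}" using R.genideal_minimal[OF R.zeroideal, of "{}"] by (simp add: coord_zero)
  interpret J: ideal "Idl\<^bsub>coord_ring P\<^esub> {}" "coord_ring P" by (rule R.genideal_ideal) simp
  show "{cls P 0} \<subseteq> Idl\<^bsub>coord_ring P\<^esub> {}" using J.zero_closed by (simp add: coord_zero)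
qed

lemma genideal_one: "Idl\<^bsub>coord_ring P\<^esub> {cls P a} = cls P ` ext (\<lambda>_ :: unit. a)"
  using genideal_coord[of "\<lambda>_ :: unit. a"] by simp

lemma ext_unit: "f \<in> ext (\<lambda>_ :: unit. a) \<longleftrightarrow> (\<exists>c. f - c * a \<in> P)"
proof -
  have "f \<in> ext (\<lambda>_ :: unit. a) \<longleftrightarrow> (\<exists>\<alpha>. f - \<alpha> () * a \<in> P)" unfolding ext_def by (simp add: UNIV_unit)
  also have "\<dots> \<longleftrightarrow> (\<exists>c. f - c * a \<in> P)" by (auto intro: exI[of _ "\<lambda>_. _"])
  finally show ?thesis .
qed

text \<open>
  Let \<open>a, b\<close> be a regular sequence in the ideal, and let \<open>u = q h\<close> with \<open>q\<close> in the field of fractions.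
  Then \<open>q a\<close> and \<open>q b\<close> lie in the coordinate ring and \<open>b (q a) = a (q b)\<close>, so \<open>a\<close> divides \<open>q a\<close>.
\<close>

lemma grade_saturated:
  assumes J: "grade (coord_ring P) (Idl\<^bsub>coord_ring P\<^esub> (range (\<lambda>i. cls P (h i)))) \<ge> 2" and hz: "\<exists>i. h i \<notin> P"
  shows "saturated e h"
  unfolding saturated_def
proof (intro allI impI)
  interpret R: cring "coord_ring P" by (rule coord_cring)
  fix u assume u: "\<forall>i. form e (u i)" "same_map P h u"
  let ?J = "Idl\<^bsub>coord_ring P\<^esub> (range (\<lambda>i. cls P (h i)))"
  have "\<exists>rs. regular_sequence (coord_ring P) rs \<and> set rs \<subseteq> ?J \<and> 2 \<le> length rs"
  proof (rule ccontr)
    assume n: "\<not> ?thesis"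
    have "grade (coord_ring P) ?J \<le> 1"
      unfolding grade_def
    proof (rule SUP_least)
      fix rs assume "rs \<in> {rs. regular_sequence (coord_ring P) rs \<and> set rs \<subseteq> ?J}"
      then have "length rs \<le> 1" using n by force
      then show "enat (length rs) \<le> 1" by (simp add: one_enat_def)
    qed
    with J have "(2::enat) \<le> 1" by (rule order_trans)
    then show False by (simp add: one_enat_def numeral_eq_enat)
  qed
  then obtain rs where rs: "regular_sequence (coord_ring P) rs" "set rs \<subseteq> ?J" "2 \<le> length rs" by blast
  have len: "0 < length rs" "1 < length rs" using rs(3) by auto
  have "rs ! 0 \<in> ?J" "rs ! 1 \<in> ?J" using rs(2) len by (auto intro: nth_mem)
  then obtain a b where ab: "a \<in> ext h" "rs ! 0 = cls P a" "b \<in> ext h" "rs ! 1 = cls P b"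
    unfolding genideal_coord by blast
  obtain \<alpha> \<beta> where \<alpha>: "a - (\<Sum>i\<in>UNIV. \<alpha> i * h i) \<in> P" and \<beta>: "b - (\<Sum>i\<in>UNIV. \<beta> i * h i) \<in> P"
    using ab(1,3) unfolding ext_def by blast
  have regD: "\<forall>i < length rs. \<forall>y\<in>carrier (coord_ring P).
      rs ! i \<otimes>\<^bsub>coord_ring P\<^esub> y \<in> Idl\<^bsub>coord_ring P\<^esub> (set (take i rs)) \<longrightarrow> y \<in> Idl\<^bsub>coord_ring P\<^esub> (set (take i rs))"
    using rs(1) unfolding regular_sequence_def by blast
  have take1: "take 1 rs = [rs ! 0]" using len(1) by (cases rs) auto
  have aP: "a \<notin> P"
  proof
    assume "a \<in> P"
    then have "rs ! 0 \<otimes>\<^bsub>coord_ring P\<^esub> cls P 1 = cls P 0" using cls_eq[of a 0] by (simp add: ab(2) coord_mult)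
    moreover have "cls P 1 \<in> carrier (coord_ring P)" by (simp add: coord_carrier)
    ultimately have "cls P 1 \<in> {cls P 0}"
      using regD[rule_format, OF len(1), of "cls P 1"] genideal_empty by simp
    then show False using cls_eq[of 1 0] P_one by simp
  qed
  have reg: "y \<in> ext (\<lambda>_ :: unit. a)" if "b * y \<in> ext (\<lambda>_ :: unit. a)" for y
  proof -
    have "Idl\<^bsub>coord_ring P\<^esub> (set (take 1 rs)) = cls P ` ext (\<lambda>_ :: unit. a)"
      unfolding take1 ab(2) using genideal_one by simp
    moreover have "rs ! 1 \<otimes>\<^bsub>coord_ring P\<^esub> cls P y = cls P (b * y)" unfolding ab(4) by (rule coord_mult)
    moreover have "cls P y \<in> carrier (coord_ring P)" by (simp add: coord_carrier)
    ultimately have "cls P y \<in> cls P ` ext (\<lambda>_ :: unit. a)"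
      using regD[rule_format, OF len(2), of "cls P y"] that by simp
    then show ?thesis by (simp add: cls_mem_ext)
  qed
  define a' b' where "a' = (\<Sum>i\<in>UNIV. \<alpha> i * u i)" and "b' = (\<Sum>i\<in>UNIV. \<beta> i * u i)"
  have key: "h j * (\<Sum>i\<in>UNIV. \<gamma> i * u i) - f * u j \<in> P" if "f - (\<Sum>i\<in>UNIV. \<gamma> i * h i) \<in> P" for f \<gamma> j
  proof -
    have "h j * (\<Sum>i\<in>UNIV. \<gamma> i * u i) - f * u j
        = (\<Sum>i\<in>UNIV. \<gamma> i * (h j * u i - h i * u j)) - u j * (f - (\<Sum>i\<in>UNIV. \<gamma> i * h i))"
      by (simp add: sum_distrib_left sum_distrib_right sum_subtractf right_diff_distrib mult_ac)
    also have "\<dots> \<in> P" by (rule P_diff[OF P_sum[OF P_mult[OF same_mapD[OF u(2)]]] P_mult[OF that]])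
    finally show ?thesis .
  qed
  have ka: "h j * a' - a * u j \<in> P" and kb: "h j * b' - b * u j \<in> P" for j
    unfolding a'_def b'_def using key[OF \<alpha>] key[OF \<beta>] by auto
  obtain j where j: "h j \<notin> P" using hz by blast
  have "h j * (b * a' - b' * a) = b * (h j * a' - a * u j) - a * (h j * b' - b * u j)"
    by (simp add: algebra_simps)
  also have "\<dots> \<in> P" by (rule P_diff[OF P_mult[OF ka] P_mult[OF kb]])
  finally have "b * a' - b' * a \<in> P" using P_cancel j by blast
  then have "b * a' \<in> ext (\<lambda>_ :: unit. a)" unfolding ext_unit by blast
  then obtain c where c: "a' - c * a \<in> P" using reg unfolding ext_unit by blast
  have "u i - c * h i \<in> P" for i
  proof -
    have "a * (u i - c * h i) = h i * (a' - c * a) - (h i * a' - a * u i)" by (simp add: algebra_simps)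
    also have "\<dots> \<in> P" by (rule P_diff[OF P_mult[OF c] ka])
    finally show ?thesis using P_cancel aP by blast
  qed
  then show "\<exists>c. \<forall>i. u i - c * h i \<in> P" by blast
qed

lemma P_no_constant:
  assumes "f \<in> P"
  shows "lookup f 0 = 0"
proof -
  have "hcomp 0 f \<in> P" using assms by (rule P_hcomp)
  moreover have "hcomp 0 f = const (lookup f 0)"
  proof (rule poly_mapping_eqI)
    fix m :: "'v monom"
    show "lookup (hcomp 0 f) m = lookup (const (lookup f 0)) m"
      by (cases "m = 0") (simp_all add: lookup_hcomp const_def lookup_single_not_eq mdeg_eq_0)
  qed
  ultimately have "const (lookup f 0) \<in> P" by metis
  then show ?thesis unfolding const_in_P .
qed

text \<open>
  Let \<open>a\<close> be a component of \<open>h\<close> outside \<open>P\<close>. If all \<open>h i\<close> multiply a form \<open>y\<close> into the ideal of \<open>a\<close>, then \<open>(y / a) h\<close>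
  is a tuple of forms proportional to \<open>h\<close>, so \<open>y / a\<close> lies in the coordinate ring. Hence some combination
  of the \<open>h i\<close> is not a zero divisor modulo \<open>a\<close>.
\<close>

lemma saturated_grade:
  assumes k: "infinite (UNIV :: 'k set)" and d: "d > 0" and hf: "\<And>i. form d (h i)"
    and hz: "\<exists>i. h i \<notin> P" and sat: "\<And>e. saturated e h"
  shows "grade (coord_ring P) (Idl\<^bsub>coord_ring P\<^esub> (range (\<lambda>i. cls P (h i)))) \<ge> 2"
proof -
  interpret R: cring "coord_ring P" by (rule coord_cring)
  obtain j where j: "h j \<notin> P" using hz by blast
  define a where "a = h j"
  define I where "I = ext (\<lambda>_ :: unit. a)"
  have I: "ideal_set I" unfolding I_def by (rule ext_ideal_set)
  have faithful_form: "y \<in> I" if y: "form e y" "\<And>i. h i * y \<in> I" for y e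
  proof -
    have "\<exists>w. form e w \<and> h i * y - w * a \<in> P" for i
    proof -
      obtain c where c: "h i * y - c * a \<in> P" using y(2)[of i] unfolding I_def ext_unit by blast
      have "hcomp (d + e) (h i * y - a * c) \<in> P" using P_hcomp[OF c] by (simp add: mult.commute)
      moreover have "hcomp (d + e) (h i * y - a * c) = h i * y - a * hcomp e c"
        unfolding hcomp_diff hcomp_mult[OF hf[of j], folded a_def] hcomp_form[OF form_mult[OF hf y(1)]] by simp
      ultimately show ?thesis using form_hcomp[of e c] by (intro exI[of _ "hcomp e c"]) (simp add: mult.commute)
    qed
    then have "\<exists>w. \<forall>i. form e (w i) \<and> h i * y - w i * a \<in> P" by (intro choice allI)
    then obtain w where w: "\<And>i. form e (w i)" "\<And>i. h i * y - w i * a \<in> P" by blast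
    have "same_map P h w" unfolding same_map_def
    proof (intro allI)
      fix i i'
      have "a * (h i * w i' - h i' * w i) = h i' * (h i * y - w i * a) - h i * (h i' * y - w i' * a)"
        by (simp add: algebra_simps)
      also have "\<dots> \<in> P" by (rule P_diff[OF P_mult[OF w(2)] P_mult[OF w(2)]])
      finally show "h i * w i' - h i' * w i \<in> P" using P_cancel j unfolding a_def by blast
    qed
    then obtain c where c: "\<And>i. w i - c * h i \<in> P" using sat[of e] w(1) unfolding saturated_def by blast
    have "h j * (y - c * a) = (h j * y - w j * a) + a * (w j - c * h j)" by (simp add: algebra_simps)
    also have "\<dots> \<in> P" by (rule P_add[OF w(2) P_mult[OF c]])
    finally have "y - c * a \<in> P" using P_cancel j by blast
    then show ?thesis unfolding I_def ext_unit by blast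
  qed
  have faithful: "y \<in> I" if y: "\<And>i. h i * y \<in> I" for y
  proof -
    have "hcomp e y \<in> I" for e
    proof (rule faithful_form[OF form_hcomp])
      fix i
      obtain c where c: "h i * y - c * a \<in> P" using y[of i] unfolding I_def ext_unit by blast
      have "hcomp (d + e) (h i * y - a * c) \<in> P" using P_hcomp[OF c] by (simp add: mult.commute)
      moreover have "hcomp (d + e) (h i * y - a * c) = h i * hcomp e y - a * hcomp e c"
        unfolding hcomp_diff hcomp_mult[OF hf[of j], folded a_def] hcomp_mult[OF hf[of i]] by simp
      ultimately show "h i * hcomp e y \<in> I" unfolding I_def ext_unit
        by (intro exI[of _ "hcomp e c"]) (simp add: mult.commute)
    qed
    then have "(\<Sum>e\<in>mdeg ` keys y. hcomp e y) \<in> I" by (intro ideal_set_sum[OF I])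
    then show ?thesis using sum_hcomp[of y] by simp
  qed
  obtain t where t: "\<And>y. (\<Sum>i\<in>UNIV. const (t i) * h i) * y \<in> I \<Longrightarrow> y \<in> I"
    using ex_nonzerodivisor[OF k I faithful] by blast
  define b where "b = (\<Sum>i\<in>UNIV. const (t i) * h i)"
  have bf: "form d b" unfolding b_def by (intro form_sum form_const_mult hf)
  let ?rs = "[cls P a, cls P b]"
  have "regular_sequence (coord_ring P) ?rs"
    unfolding regular_sequence_def
  proof (intro conjI allI impI ballI)
    show "set ?rs \<subseteq> carrier (coord_ring P)" by (simp add: coord_carrier)
    fix i y
    assume i: "i < length ?rs" and y: "y \<in> carrier (coord_ring P)"
      and yI: "?rs ! i \<otimes>\<^bsub>coord_ring P\<^esub> y \<in> Idl\<^bsub>coord_ring P\<^esub> (set (take i ?rs))"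
    obtain f where f: "y = cls P f" using y unfolding coord_carrier by blast
    consider "i = 0" | "i = 1" using i by force
    then show "y \<in> Idl\<^bsub>coord_ring P\<^esub> (set (take i ?rs))"
    proof cases
      case 1
      then have "a * f \<in> P" using yI f genideal_empty cls_eq[of "a * f" 0] by (simp add: coord_mult)
      then have "f \<in> P" using P_cancel j unfolding a_def by blast
      then show ?thesis using 1 f genideal_empty cls_eq[of f 0] by simp
    next
      case 2
      then have "cls P (b * f) \<in> cls P ` I" using yI f genideal_one[of a] by (simp add: coord_mult I_def)
      then have "b * f \<in> I" unfolding I_def by (simp add: cls_mem_ext)
      then have "f \<in> I" using t unfolding b_def by blast
      then show ?thesis using 2 f genideal_one[of a] by (simp add: I_def)
    qed
  next
    define M where "M = {f :: ('v, 'k) mpoly. lookup f 0 = 0}"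
    have M: "ideal_set M" unfolding ideal_set_def M_def
      by (auto simp: eval_0_lookup[symmetric] eval_at_mult eval_at_add)
    have PM: "P \<subseteq> M" using P_no_constant unfolding M_def by blast
    have "set ?rs \<subseteq> cls P ` M"
      using lookup_0_form[OF bf d] lookup_0_form[OF hf[of j] d] unfolding M_def a_def by auto
    then have "Idl\<^bsub>coord_ring P\<^esub> (set ?rs) \<subseteq> cls P ` M"
      by (rule R.genideal_minimal[OF coord_idealI[OF M PM]])
    moreover have "cls P 1 \<notin> cls P ` M"
    proof
      assume "cls P 1 \<in> cls P ` M"
      then obtain g where "g \<in> M" "1 - g \<in> P" using cls_eq by blast
      then show False using P_no_constant[of "1 - g"] unfolding M_def by (simp add: lookup_minus lookup_one)
    qed
    ultimately show "Idl\<^bsub>coord_ring P\<^esub> (set ?rs) \<noteq> carrier (coord_ring P)" unfolding coord_carrier by blast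
  qed
  moreover have "set ?rs \<subseteq> Idl\<^bsub>coord_ring P\<^esub> (range (\<lambda>i. cls P (h i)))"
  proof -
    have "a \<in> ext h" unfolding a_def by (rule ext_mem)
    moreover have "b \<in> ext h" unfolding ext_def b_def
      by (intro CollectI exI[of _ "\<lambda>i. const (t i)"]) (simp add: P_zero)
    ultimately show ?thesis unfolding genideal_coord by simp
  qed
  ultimately have "enat (length ?rs) \<le> grade (coord_ring P) (Idl\<^bsub>coord_ring P\<^esub> (range (\<lambda>i. cls P (h i))))"
    unfolding grade_def by (intro SUP_upper) blast
  then show ?thesis by (simp add: numeral_eq_enat eval_nat_numeral)
qed

end

section \<open>Saturation as a rank condition\<close>

text \<open>
  In a space of dimension at most \<open>card C\<close>, that many independent vectors span.
\<close>

lemma indep_spans: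
  fixes v :: "'x \<Rightarrow> 'c \<Rightarrow> 'k::field"
  assumes A: "finite A" "indep v A" "\<And>x c. x \<in> A \<Longrightarrow> c \<notin> C \<Longrightarrow> v x c = 0"
    and C: "finite C" "card C \<le> card A" and y: "\<And>c. c \<notin> C \<Longrightarrow> y c = 0"
  shows "inspan v A y"
proof -
  define u where "u = case_option y v"
  have u: "(\<Sum>x\<in>Some ` A. t x * u x c) = (\<Sum>x\<in>A. t (Some x) * v x c)" for t c
    by (simp add: sum.reindex u_def)
  have ind: "indep u (Some ` A)" unfolding indep_def u
  proof (intro allI impI ballI)
    fix t x assume t: "\<forall>c. (\<Sum>x\<in>A. t (Some x) * v x c) = 0" and "x \<in> Some ` A"
    then obtain a where a: "x = Some a" "a \<in> A" by blast
    show "t x = 0" using indepD[OF A(2), of "\<lambda>x. t (Some x)"] t a by blast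
  qed
  have "inspan u (Some ` A) (u None)"
  proof (rule ccontr)
    assume "\<not> ?thesis"
    then have ind: "indep u (insert None (Some ` A))" using A(1) ind by (subst indep_insert) auto
    have "card (insert None (Some ` A)) \<le> card C"
    proof (rule indep_card_le[OF ind, where w = "\<lambda>x y. if y = x then 1 else 0"])
      fix x assume "x \<in> insert None (Some ` A)"
      then have "c \<notin> C \<Longrightarrow> u x c = 0" for c using A(3) y by (auto simp: u_def)
      then show "inspan (\<lambda>x y. if y = x then 1 else 0) C (u x)"
        unfolding inspan_def using C(1)
        by (intro exI[of _ "u x"] allI) (auto simp: if_distrib[of "(*) _"] cong: if_cong)
    qed (use A(1) C(1) in auto)
    moreover have "card (insert None (Some ` A)) = Suc (card A)" using A(1) by (simp add: card_image)
    ultimately show False using C(2) by simp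
  qed
  then show ?thesis unfolding inspan_def u by (auto simp: u_def)
qed

text \<open>
  Rank and nullity: with \<open>T\<close> a basis of the span of the vectors \<open>w x\<close>, the relations between them are
  determined by their coordinates outside \<open>T\<close>, which can be prescribed. So independent relations \<open>z b\<close>
  generate all relations if and only if there are as many of them as elements outside \<open>T\<close>.
\<close>

lemma relations_spanned_iff:
  fixes w :: "'x \<Rightarrow> 'c \<Rightarrow> 'k::field" and z :: "'b \<Rightarrow> 'x \<Rightarrow> 'k"
  assumes A: "finite A" and T: "T \<subseteq> A" "indep w T" "\<And>x. x \<in> A \<Longrightarrow> inspan w T (w x)"
    and B: "finite B" "indep z B" and zA: "\<And>b x. b \<in> B \<Longrightarrow> x \<notin> A \<Longrightarrow> z b x = 0"
    and z: "\<And>b c. b \<in> B \<Longrightarrow> (\<Sum>x\<in>A. z b x * w x c) = 0"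
  shows "card A \<le> card T + card B \<longleftrightarrow>
    (\<forall>t. (\<forall>x. x \<notin> A \<longrightarrow> t x = 0) \<longrightarrow> (\<forall>c. (\<Sum>x\<in>A. t x * w x c) = 0) \<longrightarrow> inspan z B t)"
proof -
  have finT: "finite T" using A T(1) finite_subset by blast
  have card: "card A = card T + card (A - T)"
    using A T(1) finT by (simp add: card_Diff_subset card_mono)
  have determined: "t x = 0" if t: "\<forall>x. x \<notin> A \<longrightarrow> t x = 0" "\<forall>c. (\<Sum>x\<in>A. t x * w x c) = 0" "\<forall>x\<in>A - T. t x = 0" for t x
  proof -
    have "(\<Sum>x\<in>T. t x * w x c) = 0" for c
      using t(2,3) A T(1) by (subst sum.mono_neutral_left[of A T]) auto
    then have "t x = 0" if "x \<in> T" for x using indepD[OF T(2) _ that] by blast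
    then show ?thesis using t(1,3) by blast
  qed
  have comb: "(\<Sum>x\<in>A. (\<Sum>b\<in>B. s b * z b x) * w x c) = (\<Sum>b\<in>B. s b * (\<Sum>x\<in>A. z b x * w x c))" for s c
    by (simp add: sum_distrib_right sum_distrib_left mult.assoc) (rule sum.swap)
  show ?thesis
  proof
    assume le: "card A \<le> card T + card B"
    show "\<forall>t. (\<forall>x. x \<notin> A \<longrightarrow> t x = 0) \<longrightarrow> (\<forall>c. (\<Sum>x\<in>A. t x * w x c) = 0) \<longrightarrow> inspan z B t"
    proof (intro allI impI)
      fix t assume t: "\<forall>x. x \<notin> A \<longrightarrow> t x = 0" "\<forall>c. (\<Sum>x\<in>A. t x * w x c) = 0"
      define v where "v b = (\<lambda>x. if x \<in> A - T then z b x else 0)" for b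
      have "inspan v B (\<lambda>x. if x \<in> A - T then t x else 0)"
      proof (rule indep_spans[where C = "A - T"])
        show "indep v B" unfolding indep_def
        proof (intro allI impI ballI)
          fix s b assume s: "\<forall>x. (\<Sum>b\<in>B. s b * v b x) = 0" and b: "b \<in> B"
          have s': "(\<Sum>b\<in>B. s b * z b x) = 0" if "x \<in> A - T" for x
            using s[rule_format, of x] that by (simp add: v_def)
          have "(\<Sum>b\<in>B. s b * z b x) = 0" for x
          proof (rule determined)
            show "\<forall>x. x \<notin> A \<longrightarrow> (\<Sum>b\<in>B. s b * z b x) = 0" using zA by simp
            show "\<forall>c. (\<Sum>x\<in>A. (\<Sum>b\<in>B. s b * z b x) * w x c) = 0" using z by (simp add: comb)
          qed (use s' in blast)
          from indepD[OF B(2) this b] show "s b = 0" .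
        qed
        show "card (A - T) \<le> card B" using le card by simp
      qed (use A B(1) in \<open>auto simp: v_def\<close>)
      then obtain s where s: "\<And>x. (if x \<in> A - T then t x else 0) = (\<Sum>b\<in>B. s b * v b x)" unfolding inspan_def by blast
      have "t x - (\<Sum>b\<in>B. s b * z b x) = 0" for x
      proof (rule determined)
        show "\<forall>x. x \<notin> A \<longrightarrow> t x - (\<Sum>b\<in>B. s b * z b x) = 0" using t(1) zA by simp
        show "\<forall>x\<in>A - T. t x - (\<Sum>b\<in>B. s b * z b x) = 0"
        proof
          fix x assume "x \<in> A - T"
          then show "t x - (\<Sum>b\<in>B. s b * z b x) = 0" using s[of x] by (simp add: v_def)
        qed
        show "\<forall>c. (\<Sum>x\<in>A. (t x - (\<Sum>b\<in>B. s b * z b x)) * w x c) = 0"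
        proof
          fix c
          show "(\<Sum>x\<in>A. (t x - (\<Sum>b\<in>B. s b * z b x)) * w x c) = 0"
            using z t(2) by (simp add: left_diff_distrib sum_subtractf comb)
        qed
      qed
      then show "inspan z B t" unfolding inspan_def by (intro exI[of _ s]) simp
    qed
  next
    assume span: "\<forall>t. (\<forall>x. x \<notin> A \<longrightarrow> t x = 0) \<longrightarrow> (\<forall>c. (\<Sum>x\<in>A. t x * w x c) = 0) \<longrightarrow> inspan z B t"
    have "\<forall>x. \<exists>s. x \<in> A \<longrightarrow> (\<forall>c. w x c = (\<Sum>y\<in>T. s y * w y c))" using T(3) unfolding inspan_def by blast
    from choice[OF this] obtain s where s: "\<And>x c. x \<in> A \<Longrightarrow> w x c = (\<Sum>y\<in>T. s x y * w y c)" by blast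
    define k where "k x = (\<lambda>y. if y = x then 1 else if y \<in> T then - s x y else 0)" for x
    have "card (A - T) \<le> card B"
    proof (rule indep_card_le)
      show "indep k (A - T)" unfolding indep_def
      proof (intro allI impI ballI)
        fix t x assume t: "\<forall>c. (\<Sum>x\<in>A - T. t x * k x c) = 0" and x: "x \<in> A - T"
        have "(\<Sum>x'\<in>A - T. t x' * k x' x) = (\<Sum>x'\<in>A - T. if x' = x then t x else 0)"
          using x by (intro sum.cong) (auto simp: k_def)
        also have "\<dots> = t x" using x A by simp
        finally show "t x = 0" using t by simp
      qed
      fix x assume x: "x \<in> A - T"
      have "(\<Sum>y\<in>A. k x y * w y c) = 0" for c
      proof -
        have "(\<Sum>y\<in>A. k x y * w y c) = (\<Sum>y\<in>insert x T. k x y * w y c)"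
          using A x T(1) by (intro sum.mono_neutral_right) (auto simp: k_def)
        also have "\<dots> = w x c - (\<Sum>y\<in>T. s x y * w y c)"
        proof -
          have "(\<Sum>y\<in>T. k x y * w y c) = (\<Sum>y\<in>T. - (s x y * w y c))"
            using x by (intro sum.cong) (auto simp: k_def)
          then show ?thesis using finT x by (simp add: k_def sum_negf)
        qed
        also have "\<dots> = 0" using s[of x c] x by simp
        finally show ?thesis .
      qed
      moreover have "\<forall>y. y \<notin> A \<longrightarrow> k x y = 0" using x T(1) by (auto simp: k_def)
      ultimately show "inspan z B (k x)" using span by blast
    qed (use A B(1) in auto)
    then show "card A \<le> card T + card B" using card by simp
  qed
qed

lemma const_diff: "const (a - b) = const a - const (b :: 'k::field)"
  using const_add[of a "- b"] by (simp add: const_uminus)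

lemma const_sum: "const (\<Sum>x\<in>A. f x) = (\<Sum>x\<in>A. const (f x :: 'k::field))"
  by (induction A rule: infinite_finite_induct) (simp_all add: const_add)

context hprime
begin

text \<open>
  With \<open>u = (u\<^sub>k)\<close> a tuple of forms, the combination of these vectors with the coefficients of \<open>u\<close> is
  the tuple of all \<open>h\<^sub>i u\<^sub>j - h\<^sub>j u\<^sub>i\<close> modulo \<open>P\<close>. So the relations are the tuples proportional to \<open>h\<close>.
\<close>

definition kvec :: "('v \<Rightarrow> ('v, 'k) mpoly) \<Rightarrow> 'v \<times> 'v monom \<Rightarrow> ('v \<times> 'v) \<times> ('v, 'k) mpoly \<Rightarrow> 'k" where
  "kvec h = (\<lambda>(k, m) ((i, j), c). pr (single m 1 * ((if k = j then h i else 0) - (if k = i then h j else 0))) c)"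

lemma same_map_right_cong:
  assumes "same_map P h u" "\<And>k. u k - u' k \<in> P"
  shows "same_map P h u'"
  unfolding same_map_def
proof (intro allI)
  fix i j
  have "h i * u' j - h j * u' i = (h i * u j - h j * u i) - (h i * (u j - u' j) - h j * (u i - u' i))"
    by (simp add: algebra_simps)
  also have "\<dots> \<in> P" by (intro P_diff same_mapD[OF assms(1)] P_mult assms(2))
  finally show "h i * u' j - h j * u' i \<in> P" .
qed

text \<open>
  A basis of the forms by which a tuple of degree \<open>d\<close> can be multiplied to obtain one of degree \<open>e\<close>.
\<close>

definition multiples :: "nat \<Rightarrow> nat \<Rightarrow> 'v monom set" where
  "multiples d e = (if d \<le> e then Std (e - d) else {})"

lemma finite_multiples: "finite (multiples d e)"
  by (simp add: multiples_def finite_Std)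

lemma kvec_sum:
  "(\<forall>c. (\<Sum>x\<in>UNIV \<times> Std e. t x * kvec h x c) = 0) \<longleftrightarrow>
    same_map P h (\<lambda>k. \<Sum>m\<in>Std e. const (t (k, m)) * single m 1)"
proof -
  let ?u = "\<lambda>k. \<Sum>m\<in>Std e. const (t (k, m)) * single m (1 :: 'k)"
  have *: "(\<Sum>l\<in>UNIV. \<Sum>m\<in>Std e. const (t (l, m)) * (single m 1 * (if l = i then y else 0))) = y * ?u i" for i y
  proof -
    have "(\<Sum>l\<in>UNIV. \<Sum>m\<in>Std e. const (t (l, m)) * (single m 1 * (if l = i then y else 0)))
        = (\<Sum>l\<in>UNIV. if l = i then \<Sum>m\<in>Std e. const (t (l, m)) * (single m 1 * y) else 0)"
      by (intro sum.cong) auto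
    then show ?thesis by (simp add: sum_distrib_left mult_ac)
  qed
  have sum: "(\<Sum>x\<in>UNIV \<times> Std e. const (t x) * (single (snd x) 1 * ((if fst x = j then h i else 0) - (if fst x = i then h j else 0))))
      = h i * ?u j - h j * ?u i" for i j
  proof -
    have "(\<Sum>x\<in>UNIV \<times> Std e. const (t x) * (single (snd x) 1 * ((if fst x = j then h i else 0) - (if fst x = i then h j else 0))))
      = (\<Sum>l\<in>UNIV. \<Sum>m\<in>Std e. const (t (l, m)) * (single m 1 * ((if l = j then h i else 0) - (if l = i then h j else 0))))"
      by (simp add: sum.cartesian_product case_prod_unfold)
    then show ?thesis by (simp only: right_diff_distrib sum_subtractf *)
  qed
  have "(\<Sum>x\<in>UNIV \<times> Std e. t x * kvec h x ((i, j), c)) = pr (h i * ?u j - h j * ?u i) c" for i j c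
    unfolding sum[symmetric] pr_lincomb kvec_def case_prod_unfold fst_conv snd_conv ..
  then show ?thesis unfolding same_map_def pr_P split_paired_All by simp
qed

lemma multiples_span:
  assumes h: "\<And>i. form d (h i)" and u: "\<And>i. form e (u i)" "\<And>i. u i - c * h i \<in> P"
  shows "\<exists>s. \<forall>i. u i - (\<Sum>b\<in>multiples d e. const (s b) * single b 1) * h i \<in> P"
proof (cases "d \<le> e")
  case True
  define c' where "c' = hcomp (e - d) c"
  have c': "u i - c' * h i \<in> P" for i
  proof -
    have "hcomp e (u i - h i * c) = u i - h i * c'"
      using True by (simp add: hcomp_diff hcomp_form[OF u(1)] hcomp_mult[OF h] c'_def)
    then have "hcomp e (u i - c * h i) = u i - c' * h i" by (simp only: mult.commute)
    then show ?thesis using P_hcomp[OF u(2), of e i] by simp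
  qed
  have "form (e - d) c'" unfolding c'_def by (rule form_hcomp)
  then obtain s where s: "c' - (\<Sum>b\<in>Std (e - d). const (s b) * single b 1) \<in> P"
    using Std_span[of "e - d" c'] unfolding inspan_pr by blast
  have "u i - (\<Sum>b\<in>Std (e - d). const (s b) * single b 1) * h i \<in> P" for i
    using P_add[OF c'[of i] P_mult_right[OF s, of "h i"]] by (simp add: algebra_simps)
  then show ?thesis using True by (auto simp: multiples_def)
next
  case False
  have "u i \<in> P" for i
  proof -
    have "hcomp e (u i - h i * c) = u i" using False by (simp add: hcomp_diff hcomp_form[OF u(1)] hcomp_mult[OF h])
    then have "hcomp e (u i - c * h i) = u i" by (simp only: mult.commute)
    then show ?thesis using P_hcomp[OF u(2), of e i] by simp
  qed
  then show ?thesis using False by (simp add: multiples_def)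
qed

text \<open>
  The rank of the vectors \<open>kvec h\<close> has the largest value that the multiples of \<open>h\<close> permit. Stating it
  by the existence of an independent set makes it an open condition.
\<close>

definition full_rank :: "nat \<Rightarrow> nat \<Rightarrow> ('v \<Rightarrow> ('v, 'k) mpoly) \<Rightarrow> bool" where
  "full_rank d e h \<longleftrightarrow> (\<exists>T. T \<subseteq> UNIV \<times> Std e \<and> card (UNIV \<times> Std e :: ('v \<times> 'v monom) set) \<le> card T + card (multiples d e) \<and>
     indep (kvec h) T)"

lemma full_rank_iff:
  assumes "T \<subseteq> UNIV \<times> Std e" "indep (kvec h) T" "\<And>x. x \<in> UNIV \<times> Std e \<Longrightarrow> inspan (kvec h) T (kvec h x)"
  shows "full_rank d e h \<longleftrightarrow> card (UNIV \<times> Std e :: ('v \<times> 'v monom) set) \<le> card T + card (multiples d e)"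
proof
  have fin: "finite (UNIV \<times> Std e :: ('v \<times> 'v monom) set)" by (intro finite_cartesian_product finite_Std) simp
  assume "full_rank d e h"
  then obtain T' where T': "T' \<subseteq> UNIV \<times> Std e" "indep (kvec h) T'"
    "card (UNIV \<times> Std e :: ('v \<times> 'v monom) set) \<le> card T' + card (multiples d e)"
    unfolding full_rank_def by blast
  have "card T' \<le> card T"
    by (rule indep_card_le[OF T'(2)]) (use T'(1) assms(1,3) fin finite_subset in blast)+
  then show "card (UNIV \<times> Std e :: ('v \<times> 'v monom) set) \<le> card T + card (multiples d e)" using T'(3) by simp
qed (use assms in \<open>auto simp: full_rank_def\<close>)

text \<open>
  In degree \<open>e\<close>, the tuples proportional to \<open>h\<close> are the relations of the vectors \<open>kvec h\<close>, and the
  multiples of \<open>h\<close> form a subspace of them of known dimension.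
\<close>

lemma saturated_full_rank:
  assumes h: "\<And>i. form d (h i)" and hz: "\<exists>i. h i \<notin> P"
  shows "saturated e h \<longleftrightarrow> full_rank d e h"
proof -
  let ?A = "UNIV \<times> Std e :: ('v \<times> 'v monom) set" and ?B = "multiples d e"
  let ?u = "\<lambda>t k. \<Sum>m\<in>Std e. const (t (k, m)) * single m (1 :: 'k)"
  let ?c = "\<lambda>s. \<Sum>b\<in>?B. const (s b) * single b (1 :: 'k)"
  have fin: "finite ?A" by (intro finite_cartesian_product finite_Std) simp
  obtain T where T: "T \<subseteq> ?A" "indep (kvec h) T" "\<forall>x\<in>?A. inspan (kvec h) T (kvec h x)"
    using maximal_indep[OF fin] by blast
  have coeffs: "\<exists>t. (\<forall>x. x \<notin> ?A \<longrightarrow> t x = 0) \<and> (\<forall>k. u k - ?u t k \<in> P)" if u: "\<And>k. form e (u k)" for u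
  proof -
    have "\<forall>k. \<exists>s. u k - (\<Sum>m\<in>Std e. const (s m) * single m 1) \<in> P"
      using Std_span[OF u] unfolding inspan_pr by blast
    from choice[OF this] obtain s where s: "\<And>k. u k - (\<Sum>m\<in>Std e. const (s k m) * single m 1) \<in> P" by blast
    show ?thesis
    proof (intro exI[of _ "\<lambda>x. if x \<in> ?A then s (fst x) (snd x) else 0"] conjI allI)
      fix k
      have "?u (\<lambda>x. if x \<in> ?A then s (fst x) (snd x) else 0) k = (\<Sum>m\<in>Std e. const (s k m) * single m 1)"
        by (intro sum.cong) auto
      then show "u k - ?u (\<lambda>x. if x \<in> ?A then s (fst x) (snd x) else 0) k \<in> P" using s by simp
    qed simp
  qed
  have form_mult_h: "form e (single b 1 * h k)" if "b \<in> ?B" for b k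
  proof -
    have "d \<le> e" "b \<in> Std (e - d)" using that by (auto simp: multiples_def split: if_splits)
    then show ?thesis using form_mult[OF form_single[OF Std_monoms, of b "e - d" 1] h[of k]] by simp
  qed
  have "\<forall>b. \<exists>t. b \<in> ?B \<longrightarrow> (\<forall>x. x \<notin> ?A \<longrightarrow> t x = 0) \<and> (\<forall>k. single b 1 * h k - ?u t k \<in> P)"
  proof
    fix b show "\<exists>t. b \<in> ?B \<longrightarrow> (\<forall>x. x \<notin> ?A \<longrightarrow> t x = 0) \<and> (\<forall>k. single b 1 * h k - ?u t k \<in> P)"
      using coeffs[of "\<lambda>k. single b 1 * h k"] form_mult_h[of b] by blast
  qed
  from choice[OF this] obtain z where zA: "\<And>b x. b \<in> ?B \<Longrightarrow> x \<notin> ?A \<Longrightarrow> z b x = 0"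
    and z: "\<And>b k. b \<in> ?B \<Longrightarrow> single b 1 * h k - ?u (z b) k \<in> P" by blast
  have zsum: "?c s * h k - ?u (\<lambda>x. \<Sum>b\<in>?B. s b * z b x) k \<in> P" for s k
  proof -
    have "?u (\<lambda>x. \<Sum>b\<in>?B. s b * z b x) k = (\<Sum>b\<in>?B. const (s b) * ?u (z b) k)"
    proof -
      have "?u (\<lambda>x. \<Sum>b\<in>?B. s b * z b x) k = (\<Sum>m\<in>Std e. \<Sum>b\<in>?B. const (s b) * (const (z b (k, m)) * single m 1))"
        by (intro sum.cong refl) (simp add: const_sum const_mult sum_distrib_right mult.assoc)
      then show ?thesis by (subst (asm) sum.swap) (simp add: sum_distrib_left)
    qed
    then have "?c s * h k - ?u (\<lambda>x. \<Sum>b\<in>?B. s b * z b x) k = (\<Sum>b\<in>?B. const (s b) * (single b 1 * h k - ?u (z b) k))"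
      by (simp add: sum_distrib_right right_diff_distrib sum_subtractf mult.assoc)
    also have "\<dots> \<in> P" by (intro P_sum P_mult z)
    finally show ?thesis .
  qed
  have unique: "t x = 0" if "\<And>k. ?u t k \<in> P" "\<forall>x. x \<notin> ?A \<longrightarrow> t x = 0" for t x
  proof (cases "x \<in> ?A")
    case True
    then show ?thesis using Std_zero[OF that(1)[of "fst x"], of "snd x"] by auto
  qed (use that(2) in blast)
  have indz: "indep z ?B" unfolding indep_def
  proof (intro allI impI)
    fix s assume s: "\<forall>c. (\<Sum>b\<in>?B. s b * z b c) = 0"
    obtain k where k: "h k \<notin> P" using hz by blast
    have "?c s * h k \<in> P" using zsum[of s k] s by simp
    then have "?c s \<in> P" using P_prime k by blast
    then show "\<forall>b\<in>?B. s b = 0" using Std_zero[where t = "e - d" and s = s]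
      by (auto simp: multiples_def split: if_splits)
  qed
  have ker: "(\<Sum>x\<in>?A. z b x * kvec h x c) = 0" if "b \<in> ?B" for b c
  proof -
    have "same_map P h (\<lambda>k. single b 1 * h k)" unfolding same_map_def by (simp add: mult_ac P_zero)
    then have "same_map P h (?u (z b))" using z[OF that] by (rule same_map_right_cong)
    then show ?thesis using kvec_sum[where t = "z b" and h = h and e = e] by blast
  qed
  have "full_rank d e h \<longleftrightarrow> (\<forall>t. (\<forall>x. x \<notin> ?A \<longrightarrow> t x = 0) \<longrightarrow> (\<forall>c. (\<Sum>x\<in>?A. t x * kvec h x c) = 0) \<longrightarrow> inspan z ?B t)"
    using relations_spanned_iff[where w = "kvec h" and A = ?A and T = T and B = ?B and z = z, OF fin T(1,2) _ finite_multiples indz zA ker]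
      full_rank_iff[OF T(1,2)] T(3) by blast
  also have "\<dots> \<longleftrightarrow> saturated e h"
  proof
    assume span: "\<forall>t. (\<forall>x. x \<notin> ?A \<longrightarrow> t x = 0) \<longrightarrow> (\<forall>c. (\<Sum>x\<in>?A. t x * kvec h x c) = 0) \<longrightarrow> inspan z ?B t"
    show "saturated e h" unfolding saturated_def
    proof (intro allI impI)
      fix u assume u: "\<forall>i. form e (u i)" "same_map P h u"
      obtain t where t: "\<forall>x. x \<notin> ?A \<longrightarrow> t x = 0" "\<And>k. u k - ?u t k \<in> P" using coeffs[of u] u(1) by blast
      have "same_map P h (?u t)" using u(2) t(2) by (rule same_map_right_cong)
      then have "inspan z ?B t" using span t(1) unfolding kvec_sum by blast
      then obtain s where s: "\<And>x. t x = (\<Sum>b\<in>?B. s b * z b x)" unfolding inspan_def by blast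
      have "u i - ?c s * h i \<in> P" for i
        using P_diff[OF t(2)[of i] zsum[of s i]] s by simp
      then show "\<exists>c. \<forall>i. u i - c * h i \<in> P" by (intro exI allI)
    qed
  next
    assume sat: "saturated e h"
    show "\<forall>t. (\<forall>x. x \<notin> ?A \<longrightarrow> t x = 0) \<longrightarrow> (\<forall>c. (\<Sum>x\<in>?A. t x * kvec h x c) = 0) \<longrightarrow> inspan z ?B t"
    proof (intro allI impI)
      fix t assume t: "\<forall>x. x \<notin> ?A \<longrightarrow> t x = 0" "\<forall>c. (\<Sum>x\<in>?A. t x * kvec h x c) = 0"
      have "same_map P h (?u t)" using t(2) unfolding kvec_sum .
      moreover have uf: "form e (?u t i)" for i by (rule form_Std_sum)
      ultimately have "\<exists>c. \<forall>i. ?u t i - c * h i \<in> P"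
        using sat[unfolded saturated_def, rule_format, of "?u t"] by blast
      then obtain c where c: "\<And>i. ?u t i - c * h i \<in> P" by blast
      obtain s where s: "\<And>i. ?u t i - ?c s * h i \<in> P"
        using multiples_span[where u = "?u t", OF h uf c] by blast
      have "t x - (\<Sum>b\<in>?B. s b * z b x) = 0" for x
      proof (rule unique)
        fix k
        have "?u (\<lambda>x. t x - (\<Sum>b\<in>?B. s b * z b x)) k = (?u t k - ?c s * h k) + (?c s * h k - ?u (\<lambda>x. \<Sum>b\<in>?B. s b * z b x) k)"
          by (simp add: const_diff left_diff_distrib sum_subtractf)
        also have "\<dots> \<in> P" by (rule P_add[OF s zsum])
        finally show "?u (\<lambda>x. t x - (\<Sum>b\<in>?B. s b * z b x)) k \<in> P" .
      qed (use t(1) zA in simp)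
      then show "inspan z ?B t" unfolding inspan_def by (intro exI[of _ s]) simp
    qed
  qed
  finally show ?thesis by simp
qed

lemma hopen_full_rank: "hopen (\<lambda>a. full_rank d e (forms_of d a))"
  unfolding full_rank_def
proof (rule hopen_ex)
  fix T :: "('v \<times> 'v monom) set"
  have fin: "finite (UNIV \<times> Std e :: ('v \<times> 'v monom) set)" by (intro finite_cartesian_product finite_Std) simp
  have choice_fam: "pfam 1 (\<lambda>a. if b then forms_of d a i else 0 :: ('v, 'k) mpoly)" for b i
    using pfam_forms_of[of d i] pfam_zero by (cases b) simp_all
  show "hopen (\<lambda>a. T \<subseteq> UNIV \<times> Std e \<and> card (UNIV \<times> Std e :: ('v \<times> 'v monom) set) \<le> card T + card (multiples d e) \<and>
      indep (kvec (forms_of d a)) T)"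
  proof (cases "T \<subseteq> UNIV \<times> Std e")
    case True
    then have "finite T" using fin finite_subset by blast
    then have "hopen (\<lambda>a. indep (kvec (forms_of d a)) T)"
    proof (rule hopen_indep)
      show "hfun 1 (\<lambda>a. kvec (forms_of d a) x c)" for x c
        unfolding kvec_def case_prod_unfold by (intro pr_hfun pfam_mult_fixed pfam_diff choice_fam)
    qed
    then show ?thesis using True by (intro hopen_conj hopen_const)
  qed (simp add: hopen_const)
qed

end

section \<open>Saturation is an open condition\<close>

text \<open>
  Besides the variables \<open>Inl v\<close> of the coordinate ring there is a variable \<open>Inr (Inl k)\<close> for each of the
  vectors \<open>kvec\<close> and a variable \<open>Inr (Inr p)\<close> for each unit vector. In the pieces that are linear in these
  additional variables, a monomial stands for a multiple of a vector.
\<close>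

type_synonym 'v sat_var = "'v + ('v + 'v \<times> 'v)"

lemma sum_sat_var: "(\<Sum>w\<in>UNIV. f w) = (\<Sum>v\<in>UNIV. f (Inl v)) + (\<Sum>w\<in>UNIV. f (Inr w))"
  for f :: "'v::finite + 'b::finite \<Rightarrow> 'c::comm_monoid_add"
  by (simp add: UNIV_Plus_UNIV[symmetric] sum.Plus del: UNIV_Plus_UNIV)

definition vmon :: "'v::finite monom \<Rightarrow> 'b::finite \<Rightarrow> ('v + 'b) monom" where
  "vmon \<alpha> w = emb Inl \<alpha> + single (Inr w) 1"

lemma lookup_vmon: "lookup (vmon \<alpha> w) (Inl v) = lookup \<alpha> v"
  "lookup (vmon \<alpha> w) (Inr w') = (if w' = w then 1 else 0)"
proof -
  have "lookup (emb Inl \<alpha>) (Inr w') = 0" by (rule lookup_emb_other) blast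
  then show "lookup (vmon \<alpha> w) (Inr w') = (if w' = w then 1 else 0)"
    by (auto simp: vmon_def lookup_add lookup_single when_def)
qed (simp add: vmon_def lookup_add lookup_single lookup_emb)

lemma vmon_inj: "vmon \<alpha> w = vmon \<beta> w' \<longleftrightarrow> \<alpha> = \<beta> \<and> w = w'"
proof
  assume eq: "vmon \<alpha> w = vmon \<beta> w'"
  have "lookup \<alpha> v = lookup \<beta> v" for v using lookup_vmon(1)[of \<alpha> w v] lookup_vmon(1)[of \<beta> w' v] eq by simp
  then have "\<alpha> = \<beta>" by (intro poly_mapping_eqI)
  moreover have "w = w'"
  proof (rule ccontr)
    assume "w \<noteq> w'"
    then show False using lookup_vmon(2)[of \<alpha> w w] lookup_vmon(2)[of \<beta> w' w] unfolding eq by simp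
  qed
  ultimately show "\<alpha> = \<beta> \<and> w = w'" ..
qed simp

lemma vmon_cases:
  fixes m :: "('v::finite + 'b::finite) monom"
  assumes "(\<Sum>w\<in>UNIV. lookup m (Inr w)) = 1"
  obtains \<alpha> w where "m = vmon \<alpha> w"
proof -
  obtain w where w: "lookup m (Inr w) \<noteq> 0" using assms by fastforce
  have "(\<Sum>w\<in>UNIV. lookup m (Inr w)) = lookup m (Inr w) + (\<Sum>w\<in>UNIV - {w}. lookup m (Inr w))"
    by (rule sum.remove) simp_all
  then have "lookup m (Inr w) = 1" "(\<Sum>w\<in>UNIV - {w}. lookup m (Inr w)) = 0" using assms w by linarith+
  then have lk: "lookup m (Inr w') = (if w' = w then 1 else 0)" for w' by auto
  define \<alpha> where "\<alpha> = (\<Sum>v\<in>UNIV. single v (lookup m (Inl v)))"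
  have "m = vmon \<alpha> w"
  proof (rule poly_mapping_eqI)
    fix x show "lookup m x = lookup (vmon \<alpha> w) x"
    proof (cases x)
      case (Inl v)
      have "lookup \<alpha> v = (\<Sum>v'\<in>UNIV. if v' = v then lookup m (Inl v') else 0)"
        unfolding \<alpha>_def lookup_sum lookup_single when_def ..
      then show ?thesis using Inl by (simp add: lookup_vmon)
    qed (simp add: lk lookup_vmon)
  qed
  then show thesis by (rule that)
qed

lemma mdeg_vmon: "mdeg (vmon \<alpha> w) = mdeg \<alpha> + 1"
  by (simp add: mdeg_superset[of UNIV "vmon \<alpha> w"] mdeg_superset[of UNIV \<alpha>] sum_sat_var lookup_vmon)

lemma subst_vmon: "subst x (single (vmon \<alpha> w) (1 :: 'k::field)) = subst (\<lambda>v. x (Inl v)) (single \<alpha> 1) * x (Inr w)"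
proof -
  have "subst x (single (vmon \<alpha> w) (1 :: 'k)) = subst x (single (emb Inl \<alpha>) 1) * subst x (single (single (Inr w) 1) 1)"
    unfolding subst_mult[symmetric] by (simp add: mult_single vmon_def)
  moreover have "subst x (single (single (Inr w) 1) 1) = x (Inr w)" unfolding subst_single by simp
  ultimately show ?thesis by (simp only: subst_emb[OF inj_Inl])
qed

definition sat_wt :: "nat \<Rightarrow> 'v sat_var \<Rightarrow> nat" where
  "sat_wt d w = (case w of Inl _ \<Rightarrow> 1 | Inr (Inl _) \<Rightarrow> d | Inr (Inr _) \<Rightarrow> 0)"

definition sat_lin :: "'v sat_var \<Rightarrow> nat" where
  "sat_lin w = (case w of Inl _ \<Rightarrow> 0 | Inr _ \<Rightarrow> 1)"

lemma wdeg_sat_lin: "wdeg sat_lin m = (\<Sum>w\<in>UNIV. lookup m (Inr w))"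
  unfolding wdeg_def sum_sat_var by (simp add: sat_lin_def)

lemma wdeg_vmon: "wdeg (sat_wt d) (vmon \<alpha> w) = mdeg \<alpha> + sat_wt d (Inr w)" "wdeg sat_lin (vmon \<alpha> w) = 1"
proof -
  have "(\<Sum>w'\<in>UNIV. (if w' = w then 1 else 0) * sat_wt d (Inr w')) = sat_wt d (Inr w)"
    by (simp add: if_distrib[of "\<lambda>t. t * _"] cong: if_cong)
  then show "wdeg (sat_wt d) (vmon \<alpha> w) = mdeg \<alpha> + sat_wt d (Inr w)"
    unfolding wdeg_def sum_sat_var by (simp add: lookup_vmon mdeg_superset[of UNIV \<alpha>] sat_wt_def)
  show "wdeg sat_lin (vmon \<alpha> w) = 1" unfolding wdeg_sat_lin by (simp add: lookup_vmon)
qed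

context hprime
begin

definition sat_val :: "('v \<Rightarrow> ('v, 'k) mpoly) \<Rightarrow> 'v \<times> 'v \<Rightarrow> 'v sat_var \<Rightarrow> ('v, 'k) mpoly" where
  "sat_val h p w = (case w of Inl v \<Rightarrow> var v
     | Inr (Inl k) \<Rightarrow> (if k = snd p then h (fst p) else 0) - (if k = fst p then h (snd p) else 0)
     | Inr (Inr p') \<Rightarrow> if p' = p then 1 else 0)"

lemma sat_val_vmon: "subst (sat_val h p) (single (vmon \<alpha> w) 1) = single \<alpha> 1 * sat_val h p (Inr w)"
  by (simp add: subst_vmon) (simp add: sat_val_def)

lemma svec_sat_val: "svec (sat_val h) (vmon \<alpha> (Inl k)) = kvec h (k, \<alpha>)"
  unfolding svec_def kvec_def sat_val_vmon by (auto simp: sat_val_def fun_eq_iff)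

lemma saturation_family:
  assumes r: "inj (r :: 'v sat_var \<Rightarrow> nat)" and d: "d > 0"
  shows "monomial_family r (\<lambda>m. (wdeg (sat_wt d) m, wdeg sat_lin m)) (UNIV \<times> {1})
    (\<lambda>a. svec (sat_val (forms_of d a)))"
proof (rule monomial_family_svec[where \<delta> = "\<lambda>w. case w of Inr (Inl _) \<Rightarrow> 1 | _ \<Rightarrow> 0", OF r])
  show "1 \<le> sat_wt d w + sat_lin w" for w :: "'v sat_var"
    by (auto simp: sat_wt_def sat_lin_def split: sum.splits)
  have choice_fam: "pfam 1 (\<lambda>a. if b then forms_of d a i else 0 :: ('v, 'k) mpoly)" for b i
    using pfam_forms_of[of d i] pfam_zero by (cases b) simp_all
  show "pfam (case w of Inr (Inl _) \<Rightarrow> 1 | _ \<Rightarrow> 0) (\<lambda>a. sat_val (forms_of d a) q w)" for q w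
    unfolding sat_val_def using choice_fam by (auto split: sum.splits intro!: pfam_diff pfam_fixed)
  fix e :: "nat \<times> nat"
  assume "e \<in> UNIV \<times> {1}"
  then obtain s where e: "e = (s, 1)" by auto
  let ?dg = "\<lambda>m :: 'v sat_var monom. (wdeg (sat_wt d) m, wdeg sat_lin m)"
  let ?I = "(monoms s :: 'v monom set) \<times> (UNIV :: ('v \<times> 'v) set)"
  define \<mu> where "\<mu> x = vmon (fst x) (Inr (snd x) :: 'v + 'v \<times> 'v)" for x :: "'v monom \<times> 'v \<times> 'v"
  have \<mu>_inj: "inj \<mu>" by (auto simp: inj_def \<mu>_def vmon_inj)
  have finI: "finite ?I" by (simp add: finite_monoms)
  show "\<exists>B\<subseteq>{m. ?dg m = e}. \<forall>a a'.
      (\<forall>m\<in>B. \<forall>q. subst (sat_val (forms_of d a) q) (single m 1) = subst (sat_val (forms_of d a') q) (single m 1)) \<and>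
      (\<forall>m. ?dg m = e \<longrightarrow> inspan (svec (sat_val (forms_of d a))) B (svec (sat_val (forms_of d a)) m))"
  proof (intro exI[of _ "\<mu> ` ?I"] conjI allI ballI impI)
    show "\<mu> ` ?I \<subseteq> {m. ?dg m = e}"
      by (auto simp: \<mu>_def wdeg_vmon sat_wt_def e monoms_def)
    show "subst (sat_val (forms_of d a) q) (single m 1) = subst (sat_val (forms_of d a') q) (single m 1)"
      if "m \<in> \<mu> ` ?I" for a a' m q
      using that by (auto simp: \<mu>_def sat_val_vmon) (auto simp: sat_val_def)
    fix a and m :: "'v sat_var monom" assume m: "?dg m = e"
    then have "(\<Sum>w\<in>UNIV. lookup m (Inr w)) = 1" by (simp add: e wdeg_sat_lin)
    then obtain \<alpha> w where mw: "m = vmon \<alpha> w" by (rule vmon_cases)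
    let ?v = "sat_val (forms_of d a)"
    define f where "f p = subst (?v p) (single m 1)" for p
    have "form s (f p)" for p
    proof -
      have "mdeg \<alpha> + sat_wt d (Inr w) = s" using m by (simp add: mw wdeg_vmon e)
      moreover have "form (sat_wt d (Inr w)) (?v p (Inr w))"
        by (cases w) (auto simp: sat_wt_def sat_val_def form_forms_of form_one form_zero intro: form_diff form_uminus)
      ultimately show ?thesis
        unfolding f_def mw sat_val_vmon using form_mult[OF form_single[OF refl, of \<alpha> 1]] by blast
    qed
    then have f_sum: "f p = (\<Sum>\<beta>\<in>monoms s. single \<beta> (lookup (f p) \<beta>))" for p
      using mpoly_sum_single[of "f p"] finite_monoms
      by (subst sum.mono_neutral_right[of "monoms s" "keys (f p)"]) (auto simp: form_def in_keys_iff)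
    define t where "t x = lookup (f (snd x)) (fst x)" for x :: "'v monom \<times> 'v \<times> 'v"
    have "f p = (\<Sum>x\<in>\<mu> ` ?I. const (t (inv_into UNIV \<mu> x)) * subst (?v p) (single x 1))" for p
    proof -
      have "(\<Sum>x\<in>\<mu> ` ?I. const (t (inv_into UNIV \<mu> x)) * subst (?v p) (single x 1))
          = (\<Sum>x\<in>?I. const (t x) * subst (?v p) (single (\<mu> x) 1))"
        by (subst sum.reindex) (simp_all add: \<mu>_inj inj_on_subset[OF \<mu>_inj])
      also have "\<dots> = (\<Sum>x\<in>?I. if snd x = p then single (fst x) (lookup (f p) (fst x)) else 0)"
        by (intro sum.cong refl) (simp add: \<mu>_def sat_val_vmon t_def const_mult_single, simp add: sat_val_def const_mult_single)
      also have "\<dots> = (\<Sum>\<beta>\<in>monoms s. \<Sum>p'\<in>UNIV. if p' = p then single \<beta> (lookup (f p) \<beta>) else 0)"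
        unfolding sum.cartesian_product case_prod_unfold ..
      finally show ?thesis using f_sum[of p] by simp
    qed
    then show "inspan (svec ?v) (\<mu> ` ?I) (svec ?v m)"
      unfolding inspan_svec
      by (intro exI[of _ "\<lambda>x. t (inv_into UNIV \<mu> x)"] allI)
         (simp add: subst_diff subst_sum subst_mult f_def[symmetric] P_zero)
  qed
qed

lemma kvec_span_Std:
  assumes "mdeg m = e"
  shows "inspan (kvec h) (UNIV \<times> Std e) (kvec h (k, m))"
proof -
  obtain s where s: "single m 1 - (\<Sum>m'\<in>Std e. const (s m') * single m' 1) \<in> P"
    using Std_span[OF form_single[OF assms, of 1]] unfolding inspan_pr by blast
  have expand: "pr (single m 1 * y) c = (\<Sum>m'\<in>Std e. s m' * pr (single m' 1 * y) c)" for y c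
  proof -
    have "(single m 1 - (\<Sum>m'\<in>Std e. const (s m') * single m' 1)) * y \<in> P" by (rule P_mult_right[OF s])
    then have "single m 1 * y - (\<Sum>m'\<in>Std e. const (s m') * (single m' 1 * y)) \<in> P"
      by (simp add: left_diff_distrib sum_distrib_right mult.assoc)
    then have "pr (single m 1 * y) c - pr (\<Sum>m'\<in>Std e. const (s m') * (single m' 1 * y)) c = 0"
      unfolding pr_P pr_diff by blast
    then show ?thesis by (simp add: pr_lincomb)
  qed
  show ?thesis unfolding inspan_def
  proof (intro exI[of _ "\<lambda>x. if fst x = k then s (snd x) else 0"] allI)
    fix c
    have "(\<Sum>x\<in>UNIV \<times> Std e. (if fst x = k then s (snd x) else 0) * kvec h x c)
        = (\<Sum>l\<in>UNIV. \<Sum>m'\<in>Std e. if l = k then s m' * kvec h (l, m') c else 0)"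
      unfolding sum.cartesian_product
    proof (intro sum.cong refl)
      fix x :: "'v \<times> 'v monom"
      show "(if fst x = k then s (snd x) else 0) * kvec h x c = (case x of (l, m') \<Rightarrow> if l = k then s m' * kvec h (l, m') c else 0)"
        by (cases x) simp
    qed
    also have "\<dots> = (\<Sum>l\<in>UNIV. if l = k then \<Sum>m'\<in>Std e. s m' * kvec h (l, m') c else 0)"
      by (intro sum.cong) auto
    also have "\<dots> = kvec h (k, m) c" using expand by (simp add: kvec_def case_prod_unfold)
    finally show "kvec h (k, m) c = (\<Sum>x\<in>UNIV \<times> Std e. (if fst x = k then s (snd x) else 0) * kvec h x c)" by simp
  qed
qed

text \<open>
  The monomials for multiples of the vectors \<open>kvec\<close> precede those for unit vectors. So the standard ones
  among them form a basis of the span of these vectors, and the rank in each degree is the same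
  wherever the leading monomials are generic.
\<close>

lemma saturation_bound_generic:
  assumes d: "d > 0" and Z: "irred (Z :: ('v \<times> 'v monom \<Rightarrow> 'k) set)"
  shows "\<exists>e q. hfun e q \<and> (\<exists>a\<in>Z. q a \<noteq> 0) \<and>
    (\<forall>a\<in>Z. q a \<noteq> 0 \<longrightarrow> (\<forall>a'\<in>Z. q a' \<noteq> 0 \<longrightarrow> (\<forall>e. full_rank d e (forms_of d a) \<longrightarrow> full_rank d e (forms_of d a'))))"
proof -
  obtain r :: "'v sat_var \<Rightarrow> nat" where r: "inj r"
    using finite_imp_inj_to_nat_seg[of "UNIV :: 'v sat_var set"] by auto
  let ?dg = "\<lambda>m :: 'v sat_var monom. (wdeg (sat_wt d) m, wdeg sat_lin m)"
  interpret fam: monomial_family r ?dg "UNIV \<times> {1}" "\<lambda>a. svec (sat_val (forms_of d a))"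
    by (rule saturation_family[OF r d])
  obtain e0 q T F where q: "hfun e0 q" "\<exists>a\<in>Z. q a \<noteq> 0"
    and T: "\<forall>a\<in>Z. q a \<noteq> 0 \<longrightarrow> {m. ?dg m \<in> UNIV \<times> {1} \<and> fam.lead a m} = T"
    using fam.generic_leading_monomials[OF Z] by (elim exE conjE) (rule that)
  have "full_rank d e (forms_of d a')"
    if a: "a \<in> Z" "q a \<noteq> 0" "a' \<in> Z" "q a' \<noteq> 0" and full: "full_rank d e (forms_of d a)" for a a' e
  proof -
    let ?e = "(e + d, 1)"
    let ?\<mu> = "\<lambda>x :: 'v \<times> 'v monom. vmon (snd x) (Inl (fst x) :: 'v + 'v \<times> 'v)"
    let ?A = "UNIV \<times> Std e :: ('v \<times> 'v monom) set"
    have \<mu>_inj: "inj_on ?\<mu> M" for M by (auto simp: inj_on_def vmon_inj)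
    have sv: "svec (sat_val (forms_of d a)) (?\<mu> x) = kvec (forms_of d a) x" for a x
      using svec_sat_val[of "forms_of d a" "snd x" "fst x"] by simp
    have fin: "finite ?A" by (intro finite_cartesian_product finite_Std) simp
    define S where "S = {x \<in> UNIV \<times> monoms e. ?\<mu> x \<in> fam.std a ?e}"
    have finS: "finite S" unfolding S_def by (simp add: finite_monoms)
    have std: "fam.std a ?e = fam.std a' ?e"
    proof -
      have "fam.lead a m \<longleftrightarrow> fam.lead a' m" if "?dg m = ?e" for m
      proof -
        have "fam.lead a m \<longleftrightarrow> m \<in> T" using T[rule_format, OF a(1,2)] that by auto
        moreover have "fam.lead a' m \<longleftrightarrow> m \<in> T" using T[rule_format, OF a(3,4)] that by auto
        ultimately show ?thesis by simp
      qed
      then show ?thesis unfolding fam.std_def by auto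
    qed
    have span: "inspan (kvec (forms_of d a)) S (kvec (forms_of d a) x)" if x: "snd x \<in> monoms e" for x
    proof -
      have dgx: "?dg (?\<mu> x) = ?e" using x by (simp add: wdeg_vmon sat_wt_def monoms_def)
      let ?M = "{m' \<in> fam.std a ?e. m' = ?\<mu> x \<or> mless r m' (?\<mu> x)}"
      have "?M \<subseteq> ?\<mu> ` S"
      proof
        fix m' assume m': "m' \<in> ?M"
        then have dg: "?dg m' = ?e" by (auto simp: fam.std_def)
        then have "(\<Sum>w\<in>UNIV. lookup m' (Inr w)) = 1" by (simp add: wdeg_sat_lin)
        then obtain \<alpha> w where w: "m' = vmon \<alpha> w" by (rule vmon_cases)
        have "mdeg m' \<le> mdeg (?\<mu> x)" using m' by (auto simp: mless_def)
        then have le: "mdeg \<alpha> \<le> e" using x by (simp add: w mdeg_vmon monoms_def)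
        have deg: "mdeg \<alpha> + sat_wt d (Inr w) = e + d" using dg by (simp add: w wdeg_vmon)
        then obtain k where "w = Inl k" using le d by (cases w) (auto simp: sat_wt_def)
        then have "m' = ?\<mu> (k, \<alpha>)" "\<alpha> \<in> monoms e" using w deg by (simp_all add: sat_wt_def monoms_def)
        then show "m' \<in> ?\<mu> ` S" using m' unfolding S_def by (intro image_eqI[of _ _ "(k, \<alpha>)"]) auto
      qed
      moreover have "inspan (svec (sat_val (forms_of d a))) ?M (svec (sat_val (forms_of d a)) (?\<mu> x))"
        using fam.std_spans[of "?\<mu> x" a] unfolding dgx by simp
      ultimately have "inspan (svec (sat_val (forms_of d a))) (?\<mu> ` S) (svec (sat_val (forms_of d a)) (?\<mu> x))"
        using finS by (intro inspan_mono[of "?\<mu> ` S" ?M]) auto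
      then obtain t where "\<And>c. kvec (forms_of d a) x c = (\<Sum>y\<in>S. t (?\<mu> y) * kvec (forms_of d a) y c)"
        unfolding inspan_def sum.reindex[OF \<mu>_inj] o_def sv by blast
      then show ?thesis unfolding inspan_def by (intro exI[of _ "\<lambda>y. t (?\<mu> y)"] allI)
    qed
    have ind: "indep (kvec (forms_of d a')) S"
    proof -
      have "?\<mu> ` S \<subseteq> fam.std a' ?e" unfolding std[symmetric] S_def by blast
      then have *: "indep (svec (sat_val (forms_of d a'))) (?\<mu> ` S)" by (rule fam.indep_std[rotated]) simp
      show ?thesis unfolding indep_def
      proof (intro allI impI ballI)
        fix t x assume t: "\<forall>c. (\<Sum>x\<in>S. t x * kvec (forms_of d a') x c) = 0" and x: "x \<in> S"
        have "(\<Sum>m\<in>?\<mu> ` S. t (inv_into S ?\<mu> m) * svec (sat_val (forms_of d a')) m c) = 0" for c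
        proof -
          have "(\<Sum>m\<in>?\<mu> ` S. t (inv_into S ?\<mu> m) * svec (sat_val (forms_of d a')) m c)
              = (\<Sum>x\<in>S. t x * kvec (forms_of d a') x c)"
            unfolding sum.reindex[OF \<mu>_inj] o_def sv by (intro sum.cong) (simp_all add: inv_into_f_f[OF \<mu>_inj])
          then show ?thesis using t by (simp only:)
        qed
        from indepD[OF * this, of "?\<mu> x"] show "t x = 0" using x by (simp add: inv_into_f_f[OF \<mu>_inj])
      qed
    qed
    obtain T0 where T0: "T0 \<subseteq> ?A" "indep (kvec (forms_of d a)) T0"
      "card ?A \<le> card T0 + card (multiples d e)" using full unfolding full_rank_def by blast
    have "card T0 \<le> card S"
    proof (rule indep_card_le[OF T0(2)])
      show "finite T0" using T0(1) fin finite_subset by blast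
      fix x assume "x \<in> T0"
      then have "snd x \<in> Std e" using T0(1) by auto
      then have "snd x \<in> monoms e" using Std_monoms by (simp add: monoms_def)
      then show "inspan (kvec (forms_of d a)) S (kvec (forms_of d a) x)" by (rule span)
    qed (rule finS)
    obtain T1 where T1: "T1 \<subseteq> ?A" "indep (kvec (forms_of d a')) T1"
      "\<forall>x\<in>?A. inspan (kvec (forms_of d a')) T1 (kvec (forms_of d a') x)"
      using maximal_indep[OF fin] by blast
    have "card S \<le> card T1"
    proof (rule indep_card_le[OF ind finS])
      show "finite T1" using T1(1) fin finite_subset by blast
      fix x assume "x \<in> S"
      then have "mdeg (snd x) = e" by (auto simp: S_def monoms_def)
      show "inspan (kvec (forms_of d a')) T1 (kvec (forms_of d a') x)"
      proof (rule inspan_trans[of ?A])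
        show "inspan (kvec (forms_of d a')) ?A (kvec (forms_of d a') x)"
          using kvec_span_Std[of "snd x" e "forms_of d a'" "fst x"] \<open>mdeg (snd x) = e\<close> by simp
      qed (use T1(3) in blast)
    qed
    with \<open>card T0 \<le> card S\<close> T0(3) T1(1,2) show ?thesis
      unfolding full_rank_def by (intro exI[of _ T1]) auto
  qed
  then show ?thesis using q by blast
qed

text \<open>
  Where the ranks are generic, either they are full in all degrees, or a single degree exhibits the failure
  everywhere.
\<close>

theorem saturation_bound:
  assumes d: "d > 0"
  shows "\<exists>E. \<forall>a. (\<forall>i. i \<notin> W_index d \<longrightarrow> a i = 0) \<longrightarrow> (\<forall>e\<le>E. full_rank d e (forms_of d a)) \<longrightarrow>
    (\<forall>e. full_rank d e (forms_of d a))"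
proof -
  define Q where "Q A \<longleftrightarrow> (\<exists>E. \<forall>a\<in>A. (\<forall>e\<le>E. full_rank d e (forms_of d a)) \<longrightarrow> (\<forall>e. full_rank d e (forms_of d a)))" for A
  have "Q {a. \<forall>i. i \<notin> W_index d \<longrightarrow> a i = 0}"
  proof (rule noetherian_induct[OF finite_W_index hclosed_space])
    show "Q {}" by (simp add: Q_def)
    fix A B assume "Q A" "Q B"
    then obtain E E' where E: "\<And>a e. a \<in> A \<Longrightarrow> (\<forall>e\<le>E. full_rank d e (forms_of d a)) \<Longrightarrow> full_rank d e (forms_of d a)"
      "\<And>a e. a \<in> B \<Longrightarrow> (\<forall>e\<le>E'. full_rank d e (forms_of d a)) \<Longrightarrow> full_rank d e (forms_of d a)"
      unfolding Q_def by blast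
    show "Q (A \<union> B)" unfolding Q_def
    proof (intro exI[of _ "max E E'"] ballI impI allI)
      fix a e assume "a \<in> A \<union> B" "\<forall>e\<le>max E E'. full_rank d e (forms_of d a)"
      then show "full_rank d e (forms_of d a)" using E[of a e] by auto
    qed
  next
    fix Z :: "('v \<times> 'v monom \<Rightarrow> 'k) set" assume "irred Z"
    from saturation_bound_generic[OF d this] obtain e q where q: "hfun e q" "\<exists>a\<in>Z. q a \<noteq> 0"
      and same: "\<forall>a\<in>Z. q a \<noteq> 0 \<longrightarrow> (\<forall>a'\<in>Z. q a' \<noteq> 0 \<longrightarrow>
        (\<forall>e. full_rank d e (forms_of d a) \<longrightarrow> full_rank d e (forms_of d a')))" by (elim exE conjE) (rule that)
    have "Q {a \<in> Z. q a \<noteq> 0}"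
    proof (cases "\<exists>a\<in>Z. q a \<noteq> 0 \<and> (\<exists>e. \<not> full_rank d e (forms_of d a))")
      case True
      then obtain a E where a: "a \<in> Z" "q a \<noteq> 0" "\<not> full_rank d E (forms_of d a)" by blast
      have "\<not> full_rank d E (forms_of d a')" if "a' \<in> Z" "q a' \<noteq> 0" for a' using same that a by blast
      then show ?thesis unfolding Q_def by (intro exI[of _ E]) auto
    qed (auto simp: Q_def)
    then show "\<exists>e q. hfun e q \<and> (\<exists>a\<in>Z. q a \<noteq> 0) \<and> Q {a \<in> Z. q a \<noteq> 0}" using q by blast
  qed
  then show ?thesis unfolding Q_def by simp
qed

end

section \<open>The locus of birational maps of clear degree\<close>

lemma hfun_prod: "(\<And>x. x \<in> A \<Longrightarrow> hfun (e x) (f x)) \<Longrightarrow> hfun (\<Sum>x\<in>A. e x) (\<lambda>a. \<Prod>x\<in>A. f x a)"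
proof (induction A rule: infinite_finite_induct)
  case (insert x A)
  then have "hfun (e x + (\<Sum>x\<in>A. e x)) (\<lambda>a. f x a * (\<Prod>x\<in>A. f x a))" by (intro hfun_mult) simp_all
  then show ?case using insert.hyps by simp
qed (simp_all add: hfun_const)

lemma hfun_linear_comp:
  assumes "hfun e f" "\<And>i. hfun 1 (\<lambda>a. \<sigma> a i)"
  shows "hfun e (\<lambda>a. f (\<sigma> a))"
proof -
  obtain p where p: "form e p" "f = (\<lambda>a. eval_at a p)" using assms(1) unfolding hfun_def by blast
  have "hfun e (\<lambda>a. \<Sum>m\<in>keys p. lookup p m * (\<Prod>i\<in>keys m. \<sigma> a i ^ lookup m i))"
  proof (intro hfun_sum hfun_cmult)
    fix m assume m: "m \<in> keys p"
    have pow: "hfun n (\<lambda>a. \<sigma> a i ^ n)" for n i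
    proof (induction n)
      case (Suc n)
      from hfun_mult[OF assms(2)[of i] Suc] show ?case by simp
    qed (simp add: hfun_const)
    have "hfun (\<Sum>i\<in>keys m. lookup m i) (\<lambda>a. \<Prod>i\<in>keys m. \<sigma> a i ^ lookup m i)" by (intro hfun_prod pow)
    moreover have "(\<Sum>i\<in>keys m. lookup m i) = e" using m p(1) by (auto simp: form_def monoms_def mdeg_def)
    ultimately show "hfun e (\<lambda>a. \<Prod>i\<in>keys m. \<sigma> a i ^ lookup m i)" by simp
  qed
  then show ?thesis unfolding p(2) peval_def .
qed

lemma hopen_linear_comp:
  assumes "hopen \<psi>" "\<And>i. hfun 1 (\<lambda>a. \<sigma> a i)"
  shows "hopen (\<lambda>a. \<psi> (\<sigma> a))"
proof -
  obtain \<F> where F: "\<forall>f\<in>\<F>. \<exists>e. hfun e f" "\<forall>a. \<psi> a \<longleftrightarrow> (\<exists>f\<in>\<F>. f a \<noteq> 0)"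
    using assms(1) unfolding hopen_def by (elim exE conjE) (rule that)
  have "\<exists>e. hfun e (\<lambda>a. f (\<sigma> a))" if "f \<in> \<F>" for f
    using F(1) that hfun_linear_comp[of _ f \<sigma>] assms(2) by blast
  then show ?thesis unfolding hopen_def using F(2)
    by (intro exI[of _ "(\<lambda>f a. f (\<sigma> a)) ` \<F>"]) auto
qed

lemma forms_of_scale:
  fixes a :: "'v::finite \<times> 'v monom \<Rightarrow> 'k::field"
  shows "forms_of d (\<lambda>x. c * a x) i = const c * forms_of d a i"
  by (simp add: forms_of_def sum_distrib_left const_mult_single)

lemma forms_of_coeffs:
  fixes h :: "'v::finite \<Rightarrow> ('v, 'k::field) mpoly"
  assumes "\<And>i. form d (h i)"
  shows "forms_of d (\<lambda>(i, m). lookup (h i) m) = h"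
proof
  fix i show "forms_of d (\<lambda>(i, m). lookup (h i) m) i = h i"
    by (rule poly_mapping_eqI) (use assms[of i] in \<open>auto simp: lookup_forms_of form_def monoms_def in_keys_iff\<close>)
qed

lemma pt_in_proj_space: "a \<noteq> (\<lambda>_. 0) \<Longrightarrow> (\<And>i. i \<notin> I \<Longrightarrow> a i = 0) \<Longrightarrow> pt a \<in> proj_space I"
  unfolding proj_space_def vecs_def by blast

lemma proj_space_pt: "w \<in> proj_space I \<Longrightarrow> a \<in> w \<Longrightarrow> w = pt a"
proof -
  assume "w \<in> proj_space I" "a \<in> w"
  then obtain v c where v: "w = pt v" "a = (\<lambda>i. c * v i)" "c \<noteq> 0" unfolding proj_space_def pt_def by blast
  show "w = pt a"
  proof (intro equalityI subsetI)
    fix b assume "b \<in> w"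
    then obtain t where "b = (\<lambda>i. t * v i)" "t \<noteq> 0" unfolding v(1) pt_def by blast
    then show "b \<in> pt a" unfolding pt_def v(2) using v(3) by (intro CollectI exI[of _ "t / c"]) simp
  next
    fix b assume "b \<in> pt a"
    then obtain t where "b = (\<lambda>i. t * a i)" "t \<noteq> 0" unfolding pt_def by blast
    then show "b \<in> w" unfolding pt_def v(1,2) using v(3) by (intro CollectI exI[of _ "t * c"]) (simp add: mult.assoc)
  qed
qed

lemma proj_space_nonempty: "w \<in> proj_space I \<Longrightarrow> \<exists>a. a \<in> w"
  unfolding proj_space_def using pt_self by blast

context hprime
begin

text \<open>
  The factor between two tuples of the same degree has degree zero. So a tuple of clear degree is unique up
  to a scalar.
\<close>

lemma proportional_of_saturated:
  assumes h: "\<And>i. form d (h i)" "\<And>i. form d (h' i)" and sat: "saturated d h'" and same: "same_map P h' h"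
    and nz: "\<exists>i. h i \<notin> P"
  shows "\<exists>t. t \<noteq> 0 \<and> (\<forall>i. h i - const t * h' i \<in> P)"
proof -
  obtain c where c: "\<And>i. h i - c * h' i \<in> P" using sat h(1) same unfolding saturated_def by blast
  obtain s where s: "\<And>i. h i - (\<Sum>b\<in>multiples d d. const (s b) * single b 1) * h' i \<in> P"
    using multiples_span[where u = h and h = h', OF h(2) h(1) c] by blast
  have "Std 0 \<subseteq> {0}" using Std_monoms[of _ 0] mdeg_eq_0 by blast
  then have "\<exists>t. (\<Sum>b\<in>multiples d d. const (s b) * single b 1) = const t"
  proof (cases "Std 0 = {}")
    case True
    then show ?thesis by (intro exI[of _ 0]) (simp add: multiples_def)
  next
    case False
    then have "Std 0 = {0}" using \<open>Std 0 \<subseteq> {0}\<close> by blast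
    then show ?thesis by (intro exI[of _ "s 0"]) (simp add: multiples_def)
  qed
  then obtain t where "(\<Sum>b\<in>multiples d d. const (s b) * single b 1) = const t" by blast
  then have t: "h i - const t * h' i \<in> P" for i using s[of i] by simp
  obtain i where i: "h i \<notin> P" using nz by blast
  have "t \<noteq> 0" using t[of i] i by auto
  then show ?thesis using t by blast
qed

lemma saturated_proportional:
  assumes sat: "saturated e h'" and t: "t \<noteq> 0" "\<And>i. h i - const t * h' i \<in> P" and nz: "\<exists>i. h i \<notin> P"
  shows "saturated e h"
  unfolding saturated_def
proof (intro allI impI)
  fix u assume u: "\<forall>i. form e (u i)" "same_map P h u"
  obtain k where k: "h k \<notin> P" using nz by blast
  have th: "same_map P (\<lambda>i. const t * h' i) h" by (rule same_map_sym, rule same_map_cong, rule t(2))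
  have hth: "same_map P h' (\<lambda>i. const t * h' i)" unfolding same_map_def by (simp add: mult_ac P_zero)
  have "const t * h' k \<notin> P" using P_sub_mem[OF t(2)[of k]] k by blast
  then have "same_map P h' h" by (rule same_map_trans[OF hth th])
  then have "same_map P h' u" using u(2) k by (rule same_map_trans)
  then obtain c where c: "\<And>i. u i - c * h' i \<in> P" using sat u(1) unfolding saturated_def by blast
  have "u i - (c * const (1 / t)) * h i \<in> P" for i
  proof -
    have "const (1 / t) * const t = (1 :: ('v, 'k) mpoly)" using t(1) by (simp add: const_mult[symmetric])
    then have "u i - (c * const (1 / t)) * h i = (u i - c * h' i) - (c * const (1 / t)) * (h i - const t * h' i)"
      by (simp add: right_diff_distrib mult.assoc) (simp add: mult.assoc[symmetric])
    also have "\<dots> \<in> P" by (rule P_diff[OF c P_mult[OF t(2)]])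
    finally show ?thesis .
  qed
  then show "\<exists>c. \<forall>i. u i - c * h i \<in> P" by (intro exI allI)
qed

text \<open>
  By uniqueness up to scalars it does not matter which presentation of degree \<open>d\<close> is tested.
\<close>

lemma clear_degree_iff:
  assumes k: "infinite (UNIV :: 'k set)" and d: "d > 0" and pres: "presentation P d h"
  shows "clear_degree P d (rat_map P h) \<longleftrightarrow> (\<forall>e. saturated e h)"
proof
  have h: "\<And>i. form d (h i)" "\<exists>i. h i \<notin> P" using pres unfolding presentation_def by auto
  {
    assume "clear_degree P d (rat_map P h)"
    then obtain h' where h': "h' \<in> rat_map P h" "\<And>i. form d (h' i)"
      "grade (coord_ring P) (Idl\<^bsub>coord_ring P\<^esub> (range (\<lambda>i. cls P (h' i)))) \<ge> 2" unfolding clear_degree_def by blast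
    then have nz: "\<exists>i. h' i \<notin> P" and same: "same_map P h h'" unfolding rat_map_def presentation_def by auto
    have sat: "saturated e h'" for e by (rule grade_saturated[OF h'(3) nz])
    obtain t where "t \<noteq> 0" "\<And>i. h i - const t * h' i \<in> P"
      using proportional_of_saturated[OF h(1) h'(2) sat same_map_sym[OF same] h(2)] by blast
    then show "\<forall>e. saturated e h" using saturated_proportional[OF sat] h(2) by blast
  }
  assume "\<forall>e. saturated e h"
  then have "grade (coord_ring P) (Idl\<^bsub>coord_ring P\<^esub> (range (\<lambda>i. cls P (h i)))) \<ge> 2"
    using saturated_grade[OF k d h(1,2)] by blast
  moreover have "h \<in> rat_map P h" unfolding rat_map_def using pres same_map_refl by blast
  ultimately show "clear_degree P d (rat_map P h)" unfolding clear_degree_def using h(1) by blast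
qed

definition clear_bir :: "nat \<Rightarrow> ('v \<Rightarrow> ('v, 'k) mpoly) \<Rightarrow> bool" where
  "clear_bir d h \<longleftrightarrow> birational P d h \<and> clear_degree P d (rat_map P h)"

theorem clear_bir_conditions:
  assumes k: "infinite (UNIV :: 'k set)" and d: "d > 0"
  shows "\<exists>\<psi> \<phi>. hopen \<psi> \<and> hopen (\<lambda>a. \<not> \<phi> a) \<and>
    (\<forall>a. (\<forall>i. i \<notin> W_index d \<longrightarrow> a i = 0) \<longrightarrow> clear_bir d (forms_of d a) = (\<psi> a \<and> \<phi> a))"
proof -
  obtain \<psi> \<phi> where bir: "hopen \<psi>" "hopen (\<lambda>a. \<not> \<phi> a)"
    "\<forall>a. (\<forall>i. i \<notin> W_index d \<longrightarrow> a i = 0) \<longrightarrow> birational P d (forms_of d a) = (\<psi> a \<and> \<phi> a)"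
    using Hd_conditions[OF d] by (elim exE conjE) (rule that)
  obtain E where E: "\<forall>a. (\<forall>i. i \<notin> W_index d \<longrightarrow> a i = 0) \<longrightarrow> (\<forall>e\<le>E. full_rank d e (forms_of d a)) \<longrightarrow>
    (\<forall>e. full_rank d e (forms_of d a))" using saturation_bound[OF d] by (elim exE) (rule that)
  show ?thesis
  proof (intro exI conjI allI impI)
    show "hopen (\<lambda>a. \<psi> a \<and> (\<forall>e\<le>E. full_rank d e (forms_of d a)))"
      by (intro hopen_conj bir(1) hopen_all_le hopen_full_rank)
    show "hopen (\<lambda>a. \<not> \<phi> a)" by (rule bir(2))
    fix a :: "'v \<times> 'v monom \<Rightarrow> 'k" assume a: "\<forall>i. i \<notin> W_index d \<longrightarrow> a i = 0"
    have "clear_degree P d (rat_map P (forms_of d a)) \<longleftrightarrow> (\<forall>e\<le>E. full_rank d e (forms_of d a))"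
      if "birational P d (forms_of d a)"
    proof -
      have pres: "presentation P d (forms_of d a)" using that unfolding birational_def by blast
      then have nz: "\<exists>i. forms_of d a i \<notin> P" unfolding presentation_def by blast
      show ?thesis unfolding clear_degree_iff[OF k d pres] saturated_full_rank[OF form_forms_of nz]
        using E a by blast
    qed
    then show "clear_bir d (forms_of d a) = ((\<psi> a \<and> (\<forall>e\<le>E. full_rank d e (forms_of d a))) \<and> \<phi> a)"
      using bir(3) a unfolding clear_bir_def by blast
  qed
qed

lemma psi_eq:
  assumes w: "w \<in> proj_space (W_index d)" "a \<in> w" and pres: "presentation P d (forms_of d a)"
  shows "psi P d w = rat_map P (forms_of d a)"
proof -
  have "rat_map P (forms_of d b) = rat_map P (forms_of d a)" if "b \<in> w" for b
  proof -
    have "b \<in> pt a" using proj_space_pt[OF w] that by simp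
    then obtain c where c: "c \<noteq> 0" "b = (\<lambda>i. c * a i)" unfolding pt_def by blast
    have b: "forms_of d b = (\<lambda>i. const c * forms_of d a i)" unfolding c(2) using forms_of_scale by blast
    have "same_map P h' (\<lambda>i. const c * f i) \<longleftrightarrow> same_map P h' f" for f :: "'v \<Rightarrow> ('v, 'k) mpoly" and h'
    proof -
      have cP: "const c \<notin> P" using c(1) by (simp add: const_in_P)
      have "h' i * (const c * f j) - h' j * (const c * f i) = const c * (h' i * f j - h' j * f i)" for i j
        by (simp add: algebra_simps)
      then show ?thesis unfolding same_map_def using P_cancel[OF _ cP] P_mult by metis
    qed
    then have "same_map P (forms_of d b) h' \<longleftrightarrow> same_map P (forms_of d a) h'" for h'
      unfolding b using same_map_sym by blast
    then show ?thesis unfolding rat_map_def by simp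
  qed
  then have "(\<lambda>a. rat_map P (forms_of d a)) ` w \<subseteq> {rat_map P (forms_of d a)}" by blast
  then have "(\<lambda>a. rat_map P (forms_of d a)) ` w = {rat_map P (forms_of d a)}" using w(2) by blast
  then show ?thesis unfolding psi_def by simp
qed

lemma Hd_clear_eq: "Hd_clear P d = {w \<in> proj_space (W_index d). \<forall>a\<in>w. clear_bir d (forms_of d a)}"
proof -
  have "clear_degree P d (psi P d w) \<longleftrightarrow> (\<forall>a\<in>w. clear_degree P d (rat_map P (forms_of d a)))"
    if w: "w \<in> proj_space (W_index d)" "\<forall>a\<in>w. birational P d (forms_of d a)" for w
  proof -
    have "psi P d w = rat_map P (forms_of d a)" if "a \<in> w" for a
      using psi_eq[OF w(1) that] w(2) that unfolding birational_def by blast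
    moreover obtain a0 where "a0 \<in> w" using proj_space_nonempty[OF w(1)] by blast
    ultimately show ?thesis by metis
  qed
  then show ?thesis unfolding Hd_clear_def Hd_def clear_bir_def by auto
qed

theorem locally_closed_Hd:
  assumes d: "d > 0"
  shows "locally_closed_in (zariski (W_index d)) (Hd P d)"
proof -
  obtain \<psi> \<phi> where c: "hopen \<psi>" "hopen (\<lambda>a. \<not> \<phi> a)"
    "\<forall>a. (\<forall>i. i \<notin> W_index d \<longrightarrow> a i = 0) \<longrightarrow> birational P d (forms_of d a) = (\<psi> a \<and> \<phi> a)"
    using Hd_conditions[OF d] by (elim exE conjE) (rule that)
  have "Hd P d = {w \<in> proj_space (W_index d). \<forall>a\<in>w. \<psi> a \<and> \<phi> a}"
    unfolding Hd_def using c(3) proj_space_support[of _ "W_index d"] by (intro Collect_cong conj_cong refl ball_cong) blast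
  then show ?thesis using locally_closed_hopen[OF c(1,2)] by simp
qed

theorem locally_closed_Hd_clear:
  assumes k: "infinite (UNIV :: 'k set)" and d: "d > 0"
  shows "locally_closed_in (zariski (W_index d)) (Hd_clear P d)"
proof -
  obtain \<psi> \<phi> where c: "hopen \<psi>" "hopen (\<lambda>a. \<not> \<phi> a)"
    "\<forall>a. (\<forall>i. i \<notin> W_index d \<longrightarrow> a i = 0) \<longrightarrow> clear_bir d (forms_of d a) = (\<psi> a \<and> \<phi> a)"
    using clear_bir_conditions[OF k d] by (elim exE conjE) (rule that)
  have "Hd_clear P d = {w \<in> proj_space (W_index d). \<forall>a\<in>w. \<psi> a \<and> \<phi> a}"
    unfolding Hd_clear_eq using c(3) proj_space_support[of _ "W_index d"] by (intro Collect_cong conj_cong refl ball_cong) blast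
  then show ?thesis using locally_closed_hopen[OF c(1,2)] by simp
qed

end

section \<open>The constructible structure\<close>

text \<open>
  Independence of the rows means that the columns span.
\<close>

lemma dual_vectors:
  fixes l :: "nat \<Rightarrow> 'm \<Rightarrow> 'k::field"
  assumes M: "finite M" and l: "\<And>c. (\<forall>m\<in>M. (\<Sum>j<s. c j * l j m) = 0) \<Longrightarrow> \<forall>j<s. c j = 0"
  shows "\<exists>f. \<forall>i<s. \<forall>j<s. (\<Sum>m\<in>M. l i m * f j m) = (if i = j then 1 else 0)"
proof -
  define v where "v m = (\<lambda>j. if j < s then l j m else 0)" for m
  obtain T where T: "T \<subseteq> M" "indep v T" "\<forall>m\<in>M. inspan v T (v m)" using maximal_indep[OF M] by blast
  have finT: "finite T" using T(1) M finite_subset by blast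
  have "s \<le> card T"
  proof (rule ccontr)
    assume "\<not> s \<le> card T"
    then obtain t where t: "\<exists>j\<in>{..<s}. t j \<noteq> 0" "\<forall>m\<in>T. (\<Sum>j<s. t j * l j m) = 0"
      using homogeneous_system[OF finT, of "{..<s}" l] by auto
    have "(\<Sum>j<s. t j * l j m) = 0" if "m \<in> M" for m
    proof -
      have "inspan v T (v m)" using T(3) that by blast
      then obtain c where c: "\<And>j. v m j = (\<Sum>x\<in>T. c x * v x j)" unfolding inspan_def by blast
      have "(\<Sum>j<s. t j * l j m) = (\<Sum>j<s. \<Sum>x\<in>T. c x * (t j * l j x))"
      proof (intro sum.cong refl)
        fix j assume "j \<in> {..<s}"
        then show "t j * l j m = (\<Sum>x\<in>T. c x * (t j * l j x))"
          using c[of j] by (simp add: v_def sum_distrib_left mult_ac)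
      qed
      also have "\<dots> = (\<Sum>x\<in>T. c x * (\<Sum>j<s. t j * l j x))" by (subst sum.swap) (simp add: sum_distrib_left)
      finally show ?thesis using t(2) by simp
    qed
    then show False using l[of t] t(1) by auto
  qed
  then have "inspan v T (\<lambda>i. if i = j then 1 else 0)" if "j < s" for j
    using that by (intro indep_spans[OF finT T(2), of "{..<s}"]) (auto simp: v_def)
  then have "\<forall>j. \<exists>g. j < s \<longrightarrow> (\<forall>i. (if i = j then 1 else 0) = (\<Sum>m\<in>T. g m * v m i))"
    unfolding inspan_def by blast
  from choice[OF this] obtain g where g: "\<And>i j. j < s \<Longrightarrow> (if i = j then 1 else 0) = (\<Sum>m\<in>T. g j m * v m i)" by blast
  show ?thesis
  proof (intro exI[of _ "\<lambda>j m. if m \<in> T then g j m else 0"] allI impI)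
    fix i j assume ij: "i < s" "j < s"
    have "(\<Sum>m\<in>M. l i m * (if m \<in> T then g j m else 0)) = (\<Sum>m\<in>T. g j m * v m i)"
      using T(1) M ij by (intro sum.mono_neutral_cong_right) (auto simp: v_def)
    then show "(\<Sum>m\<in>M. l i m * (if m \<in> T then g j m else 0)) = (if i = j then 1 else 0)" using g[OF ij(2), of i] by simp
  qed
qed

lemma induced_bijection:
  assumes "\<And>x y. x \<in> A \<Longrightarrow> y \<in> A \<Longrightarrow> f x = f y \<longleftrightarrow> g x = g y"
  shows "\<exists>\<Phi>. bij_betw \<Phi> (f ` A) (g ` A) \<and> (\<forall>x\<in>A. \<Phi> (f x) = g x)"
proof -
  define \<Phi> where "\<Phi> y = g (inv_into A f y)" for y
  have \<Phi>: "\<Phi> (f x) = g x" if "x \<in> A" for x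
  proof -
    have "f (inv_into A f (f x)) = f x" "inv_into A f (f x) \<in> A"
      using that by (simp_all add: f_inv_into_f inv_into_into)
    then show ?thesis unfolding \<Phi>_def using assms that by blast
  qed
  have "bij_betw \<Phi> (f ` A) (g ` A)" unfolding bij_betw_def
  proof
    show "inj_on \<Phi> (f ` A)" using \<Phi> assms by (auto simp: inj_on_def)
    show "\<Phi> ` f ` A = g ` A" using \<Phi> by (auto simp: image_image)
  qed
  then show ?thesis using \<Phi> by blast
qed

locale linear_system = hprime P for P :: "('v::finite, 'k::field) mpoly set" +
  fixes d :: nat and l :: "nat \<Rightarrow> 'v monom \<Rightarrow> 'k"
  assumes defining: "defining_forms P d l"
begin

abbreviation "s \<equiv> s_dim P d"

definition dv :: "('v \<times> 'v monom \<Rightarrow> 'k) \<Rightarrow> 'v \<times> nat \<Rightarrow> 'k" where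
  "dv a = (\<lambda>(i, j). if j < s then lin d (l j) (\<lambda>m. a (i, m)) else 0)"

lemma D'_dv: "D' P d l w = dv ` w"
  unfolding D'_def dv_def ..

lemma dv_scale: "dv (\<lambda>x. c * a x) = (\<lambda>x. c * dv a x)"
  by (auto simp: dv_def lin_def sum_distrib_left mult_ac fun_eq_iff)

lemma dv_support: "x \<notin> D_index P d \<Longrightarrow> dv a x = 0"
  by (cases x) (simp add: dv_def D_index_def)

lemma dv_iff: "(\<forall>x. dv a x = t * dv b x) \<longleftrightarrow> (\<forall>i. forms_of d a i - const t * forms_of d b i \<in> P)"
proof -
  have "(\<forall>j<s. lin d (l j) (\<lambda>m. a (i, m)) = t * lin d (l j) (\<lambda>m. b (i, m))) \<longleftrightarrow>
      forms_of d a i - const t * forms_of d b i \<in> P" for i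
  proof -
    have diff: "lin d (l j) (\<lambda>m. a (i, m)) - t * lin d (l j) (\<lambda>m. b (i, m)) = lin d (l j) (\<lambda>m. a (i, m) - t * b (i, m))" for j
      by (simp add: lin_def sum_distrib_left right_diff_distrib sum_subtractf mult_ac)
    have "lin d (l j) (\<lambda>m. a (i, m)) = t * lin d (l j) (\<lambda>m. b (i, m)) \<longleftrightarrow> lin d (l j) (\<lambda>m. a (i, m) - t * b (i, m)) = 0" for j
      unfolding eq_iff_diff_eq_0[of "lin d (l j) (\<lambda>m. a (i, m))"] diff ..
    moreover have "forms_of d a i - const t * forms_of d b i = (\<Sum>m\<in>monoms d. single m (a (i, m) - t * b (i, m)))"
      by (simp add: forms_of_def sum_distrib_left const_mult_single single_diff sum_subtractf)
    ultimately show ?thesis using defining unfolding defining_forms_def by simp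
  qed
  then show ?thesis by (auto simp: dv_def)
qed

definition dual :: "nat \<Rightarrow> 'v monom \<Rightarrow> 'k" where
  "dual = (SOME f. \<forall>i<s. \<forall>j<s. (\<Sum>m\<in>monoms d. l i m * f j m) = (if i = j then 1 else 0))"

lemma dual: "i < s \<Longrightarrow> j < s \<Longrightarrow> (\<Sum>m\<in>monoms d. l i m * dual j m) = (if i = j then 1 else 0)"
proof -
  have "\<exists>f. \<forall>i<s. \<forall>j<s. (\<Sum>m\<in>monoms d. l i m * f j m) = (if i = j then 1 else 0)"
    by (rule dual_vectors[OF finite_monoms]) (use defining in \<open>simp add: defining_forms_def\<close>)
  from someI_ex[OF this] show "i < s \<Longrightarrow> j < s \<Longrightarrow> ?thesis" unfolding dual_def by blast
qed

text \<open>
  A linear section of the projection modulo \<open>P\<close>. Pulling conditions back along it turns conditions on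
  tuples of forms that only depend on their classes into conditions on the coordinates of the classes.
\<close>

definition sec :: "('v \<times> nat \<Rightarrow> 'k) \<Rightarrow> 'v \<times> 'v monom \<Rightarrow> 'k" where
  "sec b = (\<lambda>(i, m). if m \<in> monoms d then \<Sum>j<s. b (i, j) * dual j m else 0)"

lemma lin_dual: "i < s \<Longrightarrow> lin d (l i) (\<lambda>m. \<Sum>j<s. c j * dual j m) = c i"
proof -
  assume i: "i < s"
  have "lin d (l i) (\<lambda>m. \<Sum>j<s. c j * dual j m) = (\<Sum>j<s. c j * (\<Sum>m\<in>monoms d. l i m * dual j m))"
    unfolding lin_def sum_distrib_left by (subst sum.swap) (simp add: mult_ac)
  also have "\<dots> = (\<Sum>j<s. if i = j then c j else 0)" using dual[OF i] by (intro sum.cong) auto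
  finally show ?thesis using i by simp
qed

lemma dv_sec:
  assumes "\<And>x. x \<notin> D_index P d \<Longrightarrow> b x = 0"
  shows "dv (sec b) = b"
proof
  fix x :: "'v \<times> nat"
  obtain i j where x: "x = (i, j)" by force
  have "lin d (l j) (\<lambda>m. sec b (i, m)) = lin d (l j) (\<lambda>m. \<Sum>j<s. b (i, j) * dual j m)"
    unfolding lin_def sec_def by (intro sum.cong) auto
  then show "dv (sec b) x = b x" using assms[of x] by (auto simp: x dv_def lin_dual D_index_def)
qed

lemma sec_support: "x \<notin> W_index d \<Longrightarrow> sec b x = 0"
  by (cases x) (simp add: sec_def W_index_def)

lemma sec_scale: "sec (\<lambda>x. c * b x) = (\<lambda>x. c * sec b x)"
  by (auto simp: sec_def sum_distrib_left mult.assoc fun_eq_iff)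

lemma sec_linear: "hfun 1 (\<lambda>b. sec b x)"
proof -
  have "hfun 1 (\<lambda>b. \<Sum>j<s. dual j (snd x) * b (fst x, j))" by (intro hfun_sum hfun_cmult hfun_coord)
  then have *: "hfun 1 (\<lambda>b. \<Sum>j<s. b (fst x, j) * dual j (snd x))" by (simp only: mult.commute)
  show ?thesis
  proof (cases "snd x \<in> monoms d")
    case True
    then show ?thesis using * by (simp add: sec_def case_prod_unfold)
  next
    case False
    then show ?thesis using hfun_zero by (simp add: sec_def case_prod_unfold)
  qed
qed

lemma clear_bir_cong:
  assumes "clear_bir d h" "\<And>i. form d (h' i)" "\<And>i. h i - h' i \<in> P"
  shows "clear_bir d h'" "rat_map P h' = rat_map P h"
proof -
  have h: "birational P d h" "presentation P d h" "clear_degree P d (rat_map P h)"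
    using assms(1) unfolding clear_bir_def birational_def by auto
  have pres: "presentation P d h'" by (rule presentation_cong[OF h(2) assms(2,3)])
  have same: "same_map P h h'" by (rule same_map_cong) (rule assms(3))
  show eq: "rat_map P h' = rat_map P h" using rat_map_eq[OF h(2) pres same] by simp
  show "clear_bir d h'" unfolding clear_bir_def eq using birational_same_map[OF h(1) pres same] h(3) by blast
qed

lemma dv_pt: "dv ` pt a = pt (dv a)"
proof (intro equalityI subsetI)
  fix b assume "b \<in> dv ` pt a"
  then obtain c where c: "b = dv (\<lambda>x. c * a x)" "c \<noteq> 0" unfolding pt_def by blast
  show "b \<in> pt (dv a)" unfolding c(1) dv_scale pt_def using c(2) by (intro CollectI exI[of _ c] conjI refl)
next
  fix b assume "b \<in> pt (dv a)"
  then obtain c where c: "b = (\<lambda>x. c * dv a x)" "c \<noteq> 0" unfolding pt_def by blast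
  show "b \<in> dv ` pt a" unfolding c(1) dv_scale[symmetric] pt_def using c(2)
    by (intro imageI CollectI exI[of _ c] conjI refl)
qed

lemma clear_bir_sec:
  assumes "clear_bir d (forms_of d a)"
  shows "clear_bir d (forms_of d (sec (dv a)))"
proof (rule clear_bir_cong(1)[OF assms form_forms_of])
  have "dv (sec (dv a)) = dv a" by (rule dv_sec) (rule dv_support)
  then have "\<forall>i. forms_of d a i - const 1 * forms_of d (sec (dv a)) i \<in> P"
    unfolding dv_iff[symmetric] by simp
  then show "forms_of d a i - forms_of d (sec (dv a)) i \<in> P" for i by simp
qed

text \<open>
  Membership of a tuple only depends on its class modulo \<open>P\<close>, so it can be tested on the section.
\<close>

lemma image_D':
  "D' P d l ` Hd_clear P d = {v \<in> proj_space (D_index P d). \<forall>b\<in>v. clear_bir d (forms_of d (sec b))}"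
proof (intro equalityI subsetI)
  fix v assume "v \<in> D' P d l ` Hd_clear P d"
  then obtain w where w: "w \<in> proj_space (W_index d)" "\<forall>a\<in>w. clear_bir d (forms_of d a)" "v = dv ` w"
    unfolding Hd_clear_eq D'_dv by blast
  obtain a where a: "a \<in> w" using proj_space_nonempty[OF w(1)] by blast
  have v: "v = pt (dv a)" unfolding w(3) proj_space_pt[OF w(1) a] by (rule dv_pt)
  have "dv a \<noteq> (\<lambda>_. 0)"
  proof
    assume "dv a = (\<lambda>_. 0)"
    then have "\<forall>i. forms_of d a i - const 0 * forms_of d a i \<in> P" unfolding dv_iff[symmetric] by simp
    then show False using w(2) a unfolding clear_bir_def birational_def presentation_def by auto
  qed
  then have "v \<in> proj_space (D_index P d)" unfolding v using dv_support by (rule pt_in_proj_space)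
  moreover have "\<forall>b\<in>v. clear_bir d (forms_of d (sec b))" unfolding w(3) using w(2) clear_bir_sec by blast
  ultimately show "v \<in> {v \<in> proj_space (D_index P d). \<forall>b\<in>v. clear_bir d (forms_of d (sec b))}" by blast
next
  fix v assume "v \<in> {v \<in> proj_space (D_index P d). \<forall>b\<in>v. clear_bir d (forms_of d (sec b))}"
  then have v: "v \<in> proj_space (D_index P d)" "\<forall>b\<in>v. clear_bir d (forms_of d (sec b))" by auto
  obtain b where b: "b \<in> v" using proj_space_nonempty[OF v(1)] by blast
  have vb: "v = pt b" by (rule proj_space_pt[OF v(1) b])
  have dvb: "dv (sec b) = b" by (rule dv_sec) (rule proj_space_support[OF v(1) b])
  have "sec b \<noteq> (\<lambda>_. 0)"
  proof
    assume z: "sec b = (\<lambda>_. 0)"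
    have "forms_of d (sec b) i = 0" for i unfolding z by (simp add: forms_of_def)
    moreover have "\<exists>i. forms_of d (sec b) i \<notin> P"
      using v(2) b unfolding clear_bir_def birational_def presentation_def by blast
    ultimately show False using P_zero by simp
  qed
  then have w: "pt (sec b) \<in> proj_space (W_index d)" using sec_support by (rule pt_in_proj_space)
  have "clear_bir d (forms_of d a)" if a: "a \<in> pt (sec b)" for a
  proof -
    obtain c where c: "a = (\<lambda>x. c * sec b x)" "c \<noteq> 0"
      using a unfolding pt_def by (elim CollectE exE conjE) (rule that)
    have "a = sec (\<lambda>x. c * b x)" unfolding c(1) sec_scale ..
    moreover have "(\<lambda>x. c * b x) \<in> v" unfolding vb pt_def using c(2) by (intro CollectI exI[of _ c] conjI refl)
    ultimately show ?thesis using v(2) by blast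
  qed
  then have "pt (sec b) \<in> Hd_clear P d" unfolding Hd_clear_eq using w by blast
  moreover have "D' P d l (pt (sec b)) = v" unfolding D'_dv dv_pt dvb vb ..
  ultimately show "v \<in> D' P d l ` Hd_clear P d" by blast
qed

theorem constructible_image:
  assumes k: "infinite (UNIV :: 'k set)" and d: "d > 0"
  shows "constructible_in (zariski (D_index P d)) (D' P d l ` Hd_clear P d)"
proof -
  obtain \<psi> \<phi> where c: "hopen \<psi>" "hopen (\<lambda>a. \<not> \<phi> a)"
    "\<forall>a. (\<forall>i. i \<notin> W_index d \<longrightarrow> a i = 0) \<longrightarrow> clear_bir d (forms_of d a) = (\<psi> a \<and> \<phi> a)"
    using clear_bir_conditions[OF k d] by (elim exE conjE) (rule that)
  have "clear_bir d (forms_of d (sec b)) = (\<psi> (sec b) \<and> \<phi> (sec b))" for b using c(3) sec_support by blast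
  then have "D' P d l ` Hd_clear P d = {v \<in> proj_space (D_index P d). \<forall>b\<in>v. \<psi> (sec b) \<and> \<phi> (sec b)}"
    unfolding image_D' by simp
  moreover have "locally_closed_in (zariski (D_index P d)) {v \<in> proj_space (D_index P d). \<forall>b\<in>v. \<psi> (sec b) \<and> \<phi> (sec b)}"
    by (rule locally_closed_hopen[OF hopen_linear_comp[OF c(1) sec_linear] hopen_linear_comp[OF c(2) sec_linear]])
  ultimately show ?thesis unfolding constructible_in_def
    by (intro exI[of _ "{D' P d l ` Hd_clear P d}"]) simp
qed

lemma psi_clear: "w \<in> Hd_clear P d \<Longrightarrow> a \<in> w \<Longrightarrow> psi P d w = rat_map P (forms_of d a)"
  unfolding Hd_clear_eq using psi_eq unfolding clear_bir_def birational_def by blast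

text \<open>
  Two points have the same image if and only if their tuples agree modulo \<open>P\<close> up to a scalar, and for tuples
  of clear degree this means that they present the same rational map.
\<close>

lemma D'_eq_iff:
  assumes k: "infinite (UNIV :: 'k set)" and d: "d > 0" and w: "w \<in> Hd_clear P d" "w' \<in> Hd_clear P d"
  shows "D' P d l w = D' P d l w' \<longleftrightarrow> psi P d w = psi P d w'"
proof
  have W: "w \<in> proj_space (W_index d)" "w' \<in> proj_space (W_index d)" using w unfolding Hd_clear_eq by auto
  have cb: "a \<in> w \<Longrightarrow> clear_bir d (forms_of d a)" "a \<in> w' \<Longrightarrow> clear_bir d (forms_of d a)" for a
    using w unfolding Hd_clear_eq by auto
  obtain a where a: "a \<in> w" using proj_space_nonempty[OF W(1)] by blast
  {
    assume "D' P d l w = D' P d l w'"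
    then have "dv a \<in> dv ` w'" using a unfolding D'_dv by blast
    then obtain a' where a': "a' \<in> w'" "dv a = dv a'" by blast
    then have "\<forall>i. forms_of d a i - const 1 * forms_of d a' i \<in> P" unfolding dv_iff[symmetric] by simp
    then have "rat_map P (forms_of d a') = rat_map P (forms_of d a)"
      using clear_bir_cong(2)[where h' = "forms_of d a'", OF cb(1)[OF a] form_forms_of] by simp
    then show "psi P d w = psi P d w'" using psi_clear w a a'(1) by simp
  }
  assume eq: "psi P d w = psi P d w'"
  obtain a' where a': "a' \<in> w'" using proj_space_nonempty[OF W(2)] by blast
  have pres: "presentation P d (forms_of d a)" "presentation P d (forms_of d a')"
    using cb(1)[OF a] cb(2)[OF a'] unfolding clear_bir_def birational_def by auto
  have "rat_map P (forms_of d a') = rat_map P (forms_of d a)" using eq psi_clear w a a' by simp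
  moreover have "forms_of d a \<in> rat_map P (forms_of d a)" unfolding rat_map_def using pres(1) same_map_refl by blast
  ultimately have same: "same_map P (forms_of d a') (forms_of d a)" unfolding rat_map_def by blast
  have sat: "saturated d (forms_of d a')"
    using cb(2)[OF a'] clear_degree_iff[OF k d pres(2)] unfolding clear_bir_def by blast
  have nz: "\<exists>i. forms_of d a i \<notin> P" using pres(1) unfolding presentation_def by blast
  obtain t where t: "t \<noteq> 0" "\<forall>i. forms_of d a i - const t * forms_of d a' i \<in> P"
    using proportional_of_saturated[OF form_forms_of form_forms_of sat same nz] by blast
  have dva: "dv a = (\<lambda>x. t * dv a' x)" using t(2) unfolding dv_iff[symmetric] by blast
  have "pt (dv a) = pt (dv a')" unfolding dva
  proof (intro equalityI subsetI)
    fix b assume "b \<in> pt (\<lambda>x. t * dv a' x)"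
    then obtain c where "c \<noteq> 0" "b = (\<lambda>x. c * (t * dv a' x))" unfolding pt_def by blast
    then show "b \<in> pt (dv a')" unfolding pt_def using t(1) by (intro CollectI exI[of _ "c * t"]) (simp add: mult.assoc)
  next
    fix b assume "b \<in> pt (dv a')"
    then obtain c where "c \<noteq> 0" "b = (\<lambda>x. c * dv a' x)" unfolding pt_def by blast
    then show "b \<in> pt (\<lambda>x. t * dv a' x)" unfolding pt_def using t(1) by (intro CollectI exI[of _ "c / t"]) simp
  qed
  then show "D' P d l w = D' P d l w'"
    unfolding D'_dv proj_space_pt[OF W(1) a] proj_space_pt[OF W(2) a'] dv_pt .
qed

end

context hprime
begin

text \<open>
  A map of clear degree \<open>d\<close> has a presentation of degree \<open>d\<close>, whose coefficients are a point of
  the parameter space.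
\<close>

lemma psi_image: "psi P d ` Hd_clear P d = Bir P d"
proof (intro equalityI subsetI)
  fix \<Psi> assume "\<Psi> \<in> psi P d ` Hd_clear P d"
  then obtain w where w: "w \<in> proj_space (W_index d)" "\<forall>a\<in>w. clear_bir d (forms_of d a)" "\<Psi> = psi P d w"
    unfolding Hd_clear_eq by blast
  obtain a where a: "a \<in> w" using proj_space_nonempty[OF w(1)] by blast
  then have cb: "birational P d (forms_of d a)" "clear_degree P d (rat_map P (forms_of d a))"
    using w(2) unfolding clear_bir_def by auto
  have "\<Psi> = rat_map P (forms_of d a)"
    unfolding w(3) using psi_eq[OF w(1) a] cb(1) unfolding birational_def by blast
  then show "\<Psi> \<in> Bir P d" unfolding Bir_def using cb by blast
next
  fix \<Psi> assume "\<Psi> \<in> Bir P d"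
  then obtain h e where h: "\<Psi> = rat_map P h" "birational P e h" "clear_degree P d \<Psi>" unfolding Bir_def by blast
  obtain h' where h': "h' \<in> \<Psi>" "\<And>i. form d (h' i)" using h(3) unfolding clear_degree_def by blast
  have same: "same_map P h h'" and "\<exists>e. presentation P e h'" using h'(1) unfolding h(1) rat_map_def by auto
  then have pres': "presentation P d h'" using h'(2) unfolding presentation_def by blast
  have pres: "presentation P e h" using h(2) unfolding birational_def by blast
  have bir: "birational P d h'" by (rule birational_same_map[OF h(2) pres' same])
  have \<Psi>: "\<Psi> = rat_map P h'" unfolding h(1) by (rule rat_map_eq[OF pres pres' same])
  define a where "a = (\<lambda>(i, m). lookup (h' i) m)"
  have ah: "forms_of d a = h'" unfolding a_def by (rule forms_of_coeffs) (rule h'(2))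
  have supp: "a x = 0" if "x \<notin> W_index d" for x
    using that h'(2)[of "fst x"] by (cases x) (auto simp: a_def W_index_def form_def in_keys_iff)
  have "a \<noteq> (\<lambda>_. 0)"
  proof
    assume "a = (\<lambda>_. 0)"
    then have "h' i = 0" for i unfolding ah[symmetric] by (simp add: forms_of_def)
    then show False using pres' unfolding presentation_def by (simp add: P_zero)
  qed
  then have w: "pt a \<in> proj_space (W_index d)" using supp by (rule pt_in_proj_space)
  have "clear_bir d (forms_of d b)" if b: "b \<in> pt a" for b
  proof -
    obtain c where c: "c \<noteq> 0" "b = (\<lambda>x. c * a x)" using b unfolding pt_def by blast
    have fb: "forms_of d b i = const c * h' i" for i unfolding c(2) forms_of_scale ah ..
    have "presentation P d (forms_of d b)" unfolding presentation_def
    proof (intro conjI allI ballI)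
      obtain i where "h' i \<notin> P" using pres' unfolding presentation_def by blast
      then have "forms_of d b i \<notin> P" using P_cancel[of "const c" "h' i"] c(1) by (auto simp: fb const_in_P)
      then show "\<exists>i. forms_of d b i \<notin> P" by blast
      show "form d (forms_of d b i)" for i by (rule form_forms_of)
      fix g assume g: "g \<in> P"
      have "subst (forms_of d b) (hcomp e g) \<in> P" for e
      proof -
        have "subst h' (hcomp e g) \<in> P" using pres' P_hcomp[OF g] unfolding presentation_def by blast
        moreover have "subst (forms_of d b) (hcomp e g) = const c ^ e * subst h' (hcomp e g)"
          unfolding fb using subst_scale[OF form_hcomp] by blast
        ultimately show ?thesis using P_mult by simp
      qed
      then have "(\<Sum>e\<in>mdeg ` keys g. subst (forms_of d b) (hcomp e g)) \<in> P" by (intro P_sum)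
      then show "subst (forms_of d b) g \<in> P" unfolding subst_sum[symmetric] using sum_hcomp[of g] by simp
    qed
    moreover have "same_map P h' (forms_of d b)" unfolding same_map_def by (simp add: fb mult_ac P_zero)
    ultimately have "birational P d (forms_of d b)" "rat_map P (forms_of d b) = \<Psi>"
      using birational_same_map[OF bir] rat_map_eq[OF pres'] \<Psi> by auto
    then show ?thesis unfolding clear_bir_def using h(3) by simp
  qed
  then have "pt a \<in> Hd_clear P d" unfolding Hd_clear_eq using w by blast
  moreover have "psi P d (pt a) = \<Psi>" unfolding \<Psi> using psi_eq[OF w pt_self] pres' unfolding ah by simp
  ultimately show "\<Psi> \<in> psi P d ` Hd_clear P d" by blast
qed

end

section \<open>The embedding dimension\<close>

lemma closedin_condition:
  assumes "closedin (zariski I) C"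
  shows "\<exists>\<phi>. hopen (\<lambda>a :: 'i \<Rightarrow> 'k::field. \<not> \<phi> a) \<and> C = {w \<in> proj_space I. \<forall>a\<in>w. \<phi> a}"
proof -
  obtain F where F: "\<forall>q\<in>F. \<exists>e. form e q" "C = zero_locus I F" using assms unfolding closedin_zariski by blast
  have "hopen (\<lambda>a :: 'i \<Rightarrow> 'k. \<not> (\<forall>q\<in>F. eval_at a q = 0))"
    unfolding hopen_def
  proof (intro exI[of _ "(\<lambda>q a. eval_at a q) ` F"] conjI ballI allI)
    fix f assume "f \<in> (\<lambda>q a. eval_at a q) ` F"
    then obtain q where "q \<in> F" "f = (\<lambda>a. eval_at a q)" by blast
    then show "\<exists>e. hfun e f" using F(1) unfolding hfun_def by blast
  qed auto
  moreover have "C = {w \<in> proj_space I. \<forall>a\<in>w. \<forall>q\<in>F. eval_at a q = 0}"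
    unfolding F(2) zero_locus_def by blast
  ultimately show ?thesis by (intro exI[of _ "\<lambda>a. \<forall>q\<in>F. eval_at a q = 0"] conjI)
qed

lemma eval_at_var: "eval_at v (var i :: ('i, 'k::field) mpoly) = v i"
  by (simp add: var_def peval_single)

lemma pt_image:
  assumes "\<And>c v. T (\<lambda>i. c * v i) = (\<lambda>j. c * T v j)"
  shows "T ` pt v = pt (T v)"
proof (intro equalityI subsetI)
  fix b assume "b \<in> T ` pt v"
  then obtain c where c: "b = T (\<lambda>i. c * v i)" "c \<noteq> 0" unfolding pt_def by blast
  show "b \<in> pt (T v)" unfolding c(1) assms pt_def using c(2) by (intro CollectI exI[of _ c] conjI refl)
next
  fix b assume "b \<in> pt (T v)"
  then obtain c where c: "b = (\<lambda>j. c * T v j)" "c \<noteq> 0" unfolding pt_def by blast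
  show "b \<in> T ` pt v" unfolding c(1) assms[symmetric] pt_def using c(2) by (intro imageI CollectI exI[of _ c] conjI refl)
qed

text \<open>
  Renaming the coordinates is a regular isomorphism of projective spaces; restricted to the closure it is
  a closed embedding.
\<close>

lemma edim_le:
  fixes C :: "('i \<Rightarrow> 'k::field) set set"
  assumes fin: "finite I" and card: "card I = Suc m"
  shows "edim I C \<le> enat m"
proof -
  obtain \<beta> where \<beta>: "bij_betw \<beta> I {..m}"
    using finite_same_card_bij[OF fin, of "{..m}"] card by auto
  define \<gamma> where "\<gamma> = inv_into I \<beta>"
  have \<gamma>\<beta>: "\<gamma> (\<beta> i) = i" "\<beta> i \<le> m" if "i \<in> I" for i
    using that \<beta> by (auto simp: \<gamma>_def bij_betw_def inv_into_f_f)
  have \<beta>\<gamma>: "\<beta> (\<gamma> j) = j" "\<gamma> j \<in> I" if "j \<le> m" for j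
    using that \<beta> by (auto simp: \<gamma>_def bij_betw_def f_inv_into_f inv_into_into)
  define R where "R v = (\<lambda>j. if j \<le> m then v (\<gamma> j) else 0)" for v :: "'i \<Rightarrow> 'k"
  define B where "B u = (\<lambda>i. if i \<in> I then u (\<beta> i) else 0)" for u :: "nat \<Rightarrow> 'k"
  have BR: "B (R v) = v" if "\<And>i. i \<notin> I \<Longrightarrow> v i = 0" for v using that \<gamma>\<beta> by (auto simp: B_def R_def fun_eq_iff)
  have RB: "R (B u) = u" if "\<And>j. j \<notin> {..m} \<Longrightarrow> u j = 0" for u using that \<beta>\<gamma> by (auto simp: B_def R_def fun_eq_iff)
  have Rv: "R v \<in> vecs {..m}" if v: "v \<in> vecs I" for v
  proof -
    have "R v \<noteq> (\<lambda>_. 0)"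
    proof
      assume "R v = (\<lambda>_. 0)"
      then have "B (R v) = (\<lambda>_. 0)" by (simp add: B_def)
      then show False using BR[of v] v unfolding vecs_def by auto
    qed
    then show ?thesis unfolding vecs_def by (simp add: R_def)
  qed
  have Bu: "B u \<in> vecs I" if u: "u \<in> vecs {..m}" for u
  proof -
    have "B u \<noteq> (\<lambda>_. 0)"
    proof
      assume "B u = (\<lambda>_. 0)"
      then have "R (B u) = (\<lambda>_. 0)" by (simp add: R_def)
      then show False using RB[of u] u unfolding vecs_def by auto
    qed
    then show ?thesis unfolding vecs_def by (simp add: B_def)
  qed
  have R_pt: "R ` pt v = pt (R v)" for v by (rule pt_image) (auto simp: R_def)
  have B_pt: "B ` pt u = pt (B u)" for u by (rule pt_image) (auto simp: B_def)
  define A where "A = Abstract_Topology.closure_of (zariski I) C"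
  have closed: "closedin (zariski I) A" unfolding A_def by (rule closedin_closure_of)
  have A: "w \<in> proj_space I" if "w \<in> A" for w using closedin_subset[OF closed] that unfolding topspace_zariski by blast
  have BRw: "B ` R ` w = w" if w: "w \<in> A" for w
    using BR[OF proj_space_support[OF A[OF w]]] by (force simp: image_image)
  have RA: "R ` w \<in> proj_space {..m}" if "w \<in> A" for w
    using A[OF that] Rv unfolding proj_space_def by (auto simp: R_pt)
  have inj: "inj_on ((`) R) A" by (rule inj_on_inverseI[of A "(`) B"]) (rule BRw)
  have "closed_embedding I A {..m} ((`) R)"
    unfolding closed_embedding_def
  proof (intro conjI)
    show "inj_on ((`) R) A" by (rule inj)
    show "regular_map_on I A {..m} ((`) R)" unfolding regular_map_on_def
    proof (intro conjI ballI)
      fix x assume "x \<in> A"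
      show "\<exists>U e q. openin (zariski I) U \<and> x \<in> U \<and> (\<forall>j. form e (q j)) \<and>
          (\<forall>y\<in>A \<inter> U. \<forall>v\<in>y. (\<lambda>j. eval_at v (q j)) \<in> vecs {..m} \<and> R ` y = pt (\<lambda>j. eval_at v (q j)))"
      proof (intro exI[of _ "proj_space I"] exI[of _ 1] exI[of _ "\<lambda>j. if j \<le> m then var (\<gamma> j) else 0"] conjI allI ballI)
        show "openin (zariski I) (proj_space I :: ('i \<Rightarrow> 'k) set set)"
          using openin_topspace[of "zariski I"] unfolding topspace_zariski .
        show "x \<in> proj_space I" using A \<open>x \<in> A\<close> .
        show "form 1 (if j \<le> m then var (\<gamma> j) else 0 :: ('i, 'k) mpoly)" for j using form_var form_zero by auto
        fix y v assume y: "y \<in> A \<inter> proj_space I" and v: "v \<in> y"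
        have ev: "(\<lambda>j. eval_at v (if j \<le> m then var (\<gamma> j) else 0)) = R v"
          by (auto simp: R_def eval_at_var)
        show "(\<lambda>j. eval_at v (if j \<le> m then var (\<gamma> j) else 0)) \<in> vecs {..m}"
          unfolding ev using Rv[OF proj_space_vecs[of y I v]] y v by blast
        show "R ` y = pt (\<lambda>j. eval_at v (if j \<le> m then var (\<gamma> j) else 0))"
          unfolding ev using proj_space_pt[of y I v] y v R_pt by auto
      qed
    qed (use A in blast)
    show "regular_map_on {..m} ((`) R ` A) I (inv_into A ((`) R))" unfolding regular_map_on_def
    proof (intro conjI ballI)
      fix x assume x: "x \<in> (`) R ` A"
      show "\<exists>U e q. openin (zariski {..m}) U \<and> x \<in> U \<and> (\<forall>j. form e (q j)) \<and>
          (\<forall>y\<in>(`) R ` A \<inter> U. \<forall>v\<in>y. (\<lambda>j. eval_at v (q j)) \<in> vecs I \<and> inv_into A ((`) R) y = pt (\<lambda>j. eval_at v (q j)))"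
      proof (intro exI[of _ "proj_space {..m}"] exI[of _ 1] exI[of _ "\<lambda>i. if i \<in> I then var (\<beta> i) else 0"] conjI allI ballI)
        show "openin (zariski {..m}) (proj_space {..m} :: (nat \<Rightarrow> 'k) set set)"
          using openin_topspace[of "zariski {..m}"] unfolding topspace_zariski .
        show "x \<in> proj_space {..m}" using x RA by blast
        show "form 1 (if i \<in> I then var (\<beta> i) else 0 :: (nat, 'k) mpoly)" for i using form_var form_zero by auto
        fix y v assume y: "y \<in> (`) R ` A \<inter> proj_space {..m}" and v: "v \<in> y"
        have ev: "(\<lambda>i. eval_at v (if i \<in> I then var (\<beta> i) else 0)) = B v"
          by (auto simp: B_def eval_at_var)
        show "(\<lambda>i. eval_at v (if i \<in> I then var (\<beta> i) else 0)) \<in> vecs I"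
          unfolding ev using Bu[OF proj_space_vecs[of y "{..m}" v]] y v by blast
        obtain w where w: "w \<in> A" "y = R ` w" using y by blast
        have "inv_into A ((`) R) y = B ` y" unfolding w(2) inv_into_f_f[OF inj w(1)] BRw[OF w(1)] ..
        also have "\<dots> = pt (B v)" using proj_space_pt[of y "{..m}" v] y v B_pt by auto
        finally show "inv_into A ((`) R) y = pt (\<lambda>i. eval_at v (if i \<in> I then var (\<beta> i) else 0))" unfolding ev .
      qed
    qed (use RA in blast)
    obtain \<phi> where \<phi>: "hopen (\<lambda>a :: 'i \<Rightarrow> 'k. \<not> \<phi> a)" "A = {w \<in> proj_space I. \<forall>a\<in>w. \<phi> a}"
      using closedin_condition[OF closed] by blast
    have "(`) R ` A = {x \<in> proj_space {..m}. \<forall>u\<in>x. \<phi> (B u)}"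
    proof (intro equalityI subsetI)
      fix x assume "x \<in> (`) R ` A"
      then obtain w where w: "w \<in> A" "x = R ` w" by blast
      have "\<phi> (B u)" if "u \<in> x" for u
      proof -
        have "B u \<in> B ` R ` w" using that unfolding w(2) by blast
        then have "B u \<in> w" unfolding BRw[OF w(1)] .
        then show ?thesis using w(1) unfolding \<phi>(2) by blast
      qed
      then show "x \<in> {x \<in> proj_space {..m}. \<forall>u\<in>x. \<phi> (B u)}" using RA[OF w(1)] w(2) by blast
    next
      fix x assume "x \<in> {x \<in> proj_space {..m}. \<forall>u\<in>x. \<phi> (B u)}"
      then have x: "x \<in> proj_space {..m}" "\<forall>u\<in>x. \<phi> (B u)" by auto
      obtain u where u: "u \<in> x" using proj_space_nonempty[OF x(1)] by blast
      have xp: "x = pt u" by (rule proj_space_pt[OF x(1) u])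
      have "B ` x \<in> proj_space I" unfolding xp B_pt proj_space_def using Bu[OF proj_space_vecs[OF x(1) u]] by blast
      then have "B ` x \<in> A" unfolding \<phi>(2) using x(2) by blast
      moreover have "R ` B ` x = x" unfolding xp B_pt R_pt using RB[of u] proj_space_support[OF x(1) u] by simp
      ultimately show "x \<in> (`) R ` A" by (metis image_eqI)
    qed
    moreover have "closedin (zariski {..m}) {x \<in> proj_space {..m}. \<forall>u\<in>x. \<phi> (B u)}"
    proof (rule closedin_hopen, rule hopen_linear_comp[OF \<phi>(1)])
      show "hfun 1 (\<lambda>u. B u i)" for i unfolding B_def using hfun_coord[of "\<beta> i"] hfun_zero[of 1] by (cases "i \<in> I") simp_all
    qed
    ultimately show "closedin (zariski {..m}) ((`) R ` A)" by simp
  qed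
  then show ?thesis unfolding edim_def A_def by (intro INF_lower) blast
qed

lemma single_sum: "single m (\<Sum>x\<in>A. f x) = (\<Sum>x\<in>A. single m (f x))"
  by (induction A rule: infinite_finite_induct) (simp_all add: single_add)

context linear_system
begin

text \<open>
  A power of a variable outside \<open>P\<close> is a form of degree \<open>d\<close> outside \<open>P\<close>.
\<close>

lemma s_pos: "s \<ge> 1"
proof (rule ccontr)
  assume "\<not> s \<ge> 1"
  then have s0: "s = 0" by simp
  obtain k where k: "var k \<notin> P" using P_var by blast
  define m where "m = single k d"
  have vm: "single m (1 :: 'k) = var k ^ d"
  proof -
    have "single (single k n) (1 :: 'k) = var k ^ n" for n
    proof (induction n)
      case (Suc n)
      have "single (single k (Suc n)) (1 :: 'k) = single (single k 1) 1 * single (single k n) 1"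
        by (simp add: mult_single single_add[symmetric])
      then show ?case unfolding Suc by (simp add: var_def)
    qed simp
    then show ?thesis by (simp add: m_def)
  qed
  have "mdeg m = d" by (simp add: m_def mdeg_def)
  then have "(\<Sum>m'\<in>monoms d. single m' (if m' = m then 1 else 0 :: 'k)) = single m 1"
    using finite_monoms by (simp add: monoms_def if_distrib[of "single _"] cong: if_cong)
  moreover have "(\<Sum>m'\<in>monoms d. single m' (if m' = m then 1 else 0 :: 'k)) \<in> P"
  proof -
    have "(\<forall>j<s. lin d (l j) a = 0) \<longleftrightarrow> (\<Sum>m'\<in>monoms d. single m' (a m')) \<in> P" for a
      using defining unfolding defining_forms_def by blast
    then show ?thesis using s0 by simp
  qed
  ultimately show False using vm P_power k by auto
qed

text \<open>
  The classes of the forms dual to the defining linear forms are a basis of the degree \<open>d\<close> part of the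
  coordinate ring.
\<close>

lemma HF_eq: "HF P d = s"
proof -
  interpret R: cring "coord_ring P" by (rule coord_cring)
  let ?K = "cls P ` range const" and ?E = "cls P ` {f. form d f}"
  define p where "p j = (\<Sum>m\<in>monoms d. single m (dual j m))" for j
  have single_lin: "(\<Sum>j<s. const (c j) * p j) = (\<Sum>m\<in>monoms d. single m (\<Sum>j<s. c j * dual j m))" for c
  proof -
    have "(\<Sum>j<s. const (c j) * p j) = (\<Sum>j<s. \<Sum>m\<in>monoms d. single m (c j * dual j m))"
      by (simp add: p_def sum_distrib_left const_mult_single)
    also have "\<dots> = (\<Sum>m\<in>monoms d. single m (\<Sum>j<s. c j * dual j m))"
      by (subst sum.swap) (simp add: single_sum)
    finally show ?thesis .
  qed
  have mem: "(\<Sum>m\<in>monoms d. single m (a m)) \<in> P \<longleftrightarrow> (\<forall>j<s. lin d (l j) a = 0)" for a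
    using defining unfolding defining_forms_def by blast
  have zero: "c i = 0" if "(\<Sum>j<s. const (c j) * p j) \<in> P" "i < s" for c i
    using that(1) lin_dual[OF that(2), of c] that(2) unfolding single_lin mem by simp
  have pc: "cls P f \<in> carrier (coord_ring P)" for f by (simp add: coord_carrier)
  have K: "subfield ?K (coord_ring P)"
  proof (rule R.subfieldI)
    have minus: "\<ominus>\<^bsub>coord_ring P\<^esub> cls P (const t) = cls P (const (- t))" for t
      by (rule R.minus_equality) (simp_all add: coord_add coord_zero pc const_add[symmetric])
    show sub: "subcring ?K (coord_ring P)"
    proof (rule R.subcringI)
      show "subring ?K (coord_ring P)"
      proof (rule R.subringI)
        show "\<one>\<^bsub>coord_ring P\<^esub> \<in> ?K" unfolding coord_one const_1[symmetric] by blast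
      qed (auto simp: coord_carrier coord_mult coord_add minus const_add[symmetric] const_mult[symmetric])
      show "h1 \<otimes>\<^bsub>coord_ring P\<^esub> h2 = h2 \<otimes>\<^bsub>coord_ring P\<^esub> h1" if "h1 \<in> ?K" "h2 \<in> ?K" for h1 h2
        using that by (auto simp: coord_mult mult.commute)
    qed
    have K0: "cls P (const t) = \<zero>\<^bsub>coord_ring P\<^esub> \<longleftrightarrow> t = 0" for t
      unfolding coord_zero cls_eq by (simp add: const_in_P)
    have nz: "cls P (const t) \<in> Units (coord_ring P\<lparr>carrier := ?K\<rparr>)" if "t \<noteq> 0" for t
      unfolding Units_def
    proof (intro CollectI conjI bexI)
      show "cls P (const (1 / t)) \<otimes>\<^bsub>coord_ring P\<lparr>carrier := ?K\<rparr>\<^esub> cls P (const t) = \<one>\<^bsub>coord_ring P\<lparr>carrier := ?K\<rparr>\<^esub>"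
        "cls P (const t) \<otimes>\<^bsub>coord_ring P\<lparr>carrier := ?K\<rparr>\<^esub> cls P (const (1 / t)) = \<one>\<^bsub>coord_ring P\<lparr>carrier := ?K\<rparr>\<^esub>"
        using that by (simp_all add: coord_mult coord_one const_mult[symmetric])
    qed auto
    have nonzero: "t \<noteq> 0" if t: "cls P (const t) \<in> Units (coord_ring P\<lparr>carrier := ?K\<rparr>)" for t
    proof
      assume "t = 0"
      obtain r where "cls P (const r) \<otimes>\<^bsub>coord_ring P\<^esub> cls P (const t) = \<one>\<^bsub>coord_ring P\<^esub>"
        using t unfolding Units_def by auto
      then have "const r * const t - 1 \<in> P" unfolding coord_mult coord_one cls_eq .
      then show False using P_uminus[of "- 1"] P_one \<open>t = 0\<close> by simp
    qed
    show "Units (coord_ring P\<lparr>carrier := ?K\<rparr>) = ?K - {\<zero>\<^bsub>coord_ring P\<^esub>}"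
    proof (intro equalityI subsetI)
      fix x assume x: "x \<in> Units (coord_ring P\<lparr>carrier := ?K\<rparr>)"
      then have "x \<in> ?K" unfolding Units_def by simp
      then obtain t where t: "x = cls P (const t)" by blast
      have "t \<noteq> 0" using nonzero[of t] x unfolding t .
      then show "x \<in> ?K - {\<zero>\<^bsub>coord_ring P\<^esub>}" using \<open>x \<in> ?K\<close> K0[of t] unfolding t by simp
    next
      fix x assume x: "x \<in> ?K - {\<zero>\<^bsub>coord_ring P\<^esub>}"
      then obtain t where t: "x = cls P (const t)" by blast
      have "t \<noteq> 0" using x K0[of t] unfolding t by simp
      then show "x \<in> Units (coord_ring P\<lparr>carrier := ?K\<rparr>)" unfolding t by (rule nz)
    qed
  qed
  have span: "R.Span ?K (map (\<lambda>j. cls P (p j)) js) = {cls P (\<Sum>j\<in>set js. const (c j) * p j) | c. True}"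
    if "distinct js" for js
    using that
  proof (induction js)
    case Nil
    have "R.Span ?K [] = {\<zero>\<^bsub>coord_ring P\<^esub>}" by simp
    then show ?case unfolding coord_zero by auto
  next
    case (Cons j js)
    let ?S = "\<lambda>c js. \<Sum>j\<in>set js. const (c j) * p j"
    have IH: "R.Span ?K (map (\<lambda>j. cls P (p j)) js) = {cls P (?S c js) | c. True}" using Cons by simp
    have ext: "x \<in> R.line_extension ?K (cls P (p j)) {cls P (?S c js) | c. True} \<longleftrightarrow> (\<exists>c. x = cls P (?S c (j # js)))" for x
    proof
      assume "x \<in> R.line_extension ?K (cls P (p j)) {cls P (?S c js) | c. True}"
      then obtain t c where x: "x = cls P (const t) \<otimes>\<^bsub>coord_ring P\<^esub> cls P (p j) \<oplus>\<^bsub>coord_ring P\<^esub> cls P (?S c js)"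
        unfolding R.line_extension_mem_iff by blast
      have "?S (c(j := t)) js = ?S c js" using Cons.prems by (intro sum.cong) auto
      then have "x = cls P (?S (c(j := t)) (j # js))" using Cons.prems by (simp add: x coord_mult coord_add)
      then show "\<exists>c. x = cls P (?S c (j # js))" by (rule exI[of _ "c(j := t)"])
    next
      assume "\<exists>c. x = cls P (?S c (j # js))"
      then obtain c where "x = cls P (?S c (j # js))" by blast
      then have "x = cls P (const (c j)) \<otimes>\<^bsub>coord_ring P\<^esub> cls P (p j) \<oplus>\<^bsub>coord_ring P\<^esub> cls P (?S c js)"
        using Cons.prems by (simp add: coord_mult coord_add)
      then show "x \<in> R.line_extension ?K (cls P (p j)) {cls P (?S c js) | c. True}"
        unfolding R.line_extension_mem_iff by blast
    qed
    have "R.Span ?K (map (\<lambda>j. cls P (p j)) (j # js))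
        = R.line_extension ?K (cls P (p j)) (R.Span ?K (map (\<lambda>j. cls P (p j)) js))" by simp
    also have "\<dots> = {cls P (?S c (j # js)) | c. True}" unfolding IH using ext by blast
    finally show ?case .
  qed
  have ind: "R.independent ?K (map (\<lambda>j. cls P (p j)) js)" if "distinct js" "set js \<subseteq> {..<s}" for js
    using that
  proof (induction js)
    case (Cons j js)
    have "cls P (p j) \<notin> R.Span ?K (map (\<lambda>j. cls P (p j)) js)"
    proof
      assume "cls P (p j) \<in> R.Span ?K (map (\<lambda>j. cls P (p j)) js)"
      then obtain c where c: "cls P (p j) = cls P (\<Sum>i\<in>set js. const (c i) * p i)" using span Cons.prems(1) by auto
      define c' where "c' i = (if i = j then 1 else if i \<in> set js then - c i else 0)" for i
      have "(\<Sum>i<s. const (c' i) * p i) = (\<Sum>i\<in>insert j (set js). const (c' i) * p i)"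
        using Cons.prems by (intro sum.mono_neutral_right) (auto simp: c'_def)
      also have "\<dots> = p j + (\<Sum>i\<in>set js. - (const (c i) * p i))"
      proof -
        have "(\<Sum>i\<in>set js. const (c' i) * p i) = (\<Sum>i\<in>set js. - (const (c i) * p i))"
          using Cons.prems(1) by (intro sum.cong) (auto simp: c'_def const_uminus)
        then show ?thesis using Cons.prems(1) by (simp add: c'_def)
      qed
      finally have "(\<Sum>i<s. const (c' i) * p i) \<in> P" using c unfolding cls_eq by (simp add: sum_negf)
      from zero[OF this, of j] show False using Cons.prems(2) by (simp add: c'_def)
    qed
    moreover have "R.independent ?K (map (\<lambda>j. cls P (p j)) js)" using Cons by simp
    ultimately show ?case using pc by (simp add: R.independent.li_Cons)
  qed simp
  have "R.Span ?K (map (\<lambda>j. cls P (p j)) [0..<s]) = ?E"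
  proof (intro equalityI subsetI)
    fix x assume "x \<in> R.Span ?K (map (\<lambda>j. cls P (p j)) [0..<s])"
    then obtain c where "x = cls P (\<Sum>j\<in>set [0..<s]. const (c j) * p j)" using span[of "[0..<s]"] by auto
    moreover have "form d (\<Sum>j\<in>set [0..<s]. const (c j) * p j)" unfolding p_def
      by (intro form_sum form_const_mult form_single) (simp add: monoms_def)
    ultimately show "x \<in> ?E" by blast
  next
    fix x assume "x \<in> ?E"
    then obtain f where f: "x = cls P f" "form d f" by blast
    define a where "a m = lookup f m" for m
    have "f = (\<Sum>m\<in>monoms d. single m (a m))"
      using mpoly_sum_single[of f] finite_monoms f(2) unfolding a_def
      by (subst sum.mono_neutral_right[of "monoms d" "keys f"]) (auto simp: form_def in_keys_iff)
    then have "f - (\<Sum>j<s. const (lin d (l j) a) * p j) = (\<Sum>m\<in>monoms d. single m (a m - (\<Sum>j<s. lin d (l j) a * dual j m)))"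
      unfolding single_lin by (simp add: single_diff sum_subtractf)
    moreover have "lin d (l i) (\<lambda>m. a m - (\<Sum>j<s. lin d (l j) a * dual j m)) = 0" if "i < s" for i
    proof -
      have "lin d (l i) (\<lambda>m. a m - (\<Sum>j<s. lin d (l j) a * dual j m))
          = lin d (l i) a - lin d (l i) (\<lambda>m. \<Sum>j<s. lin d (l j) a * dual j m)"
        by (simp add: lin_def[of d "l i"] right_diff_distrib sum_subtractf)
      then show ?thesis using lin_dual[OF that, of "\<lambda>j. lin d (l j) a"] by simp
    qed
    ultimately have "f - (\<Sum>j<s. const (lin d (l j) a) * p j) \<in> P" using mem by simp
    then have "x = cls P (\<Sum>j\<in>set [0..<s]. const (lin d (l j) a) * p j)"
      unfolding f(1) cls_eq by (simp add: atLeast0LessThan)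
    then show "x \<in> R.Span ?K (map (\<lambda>j. cls P (p j)) [0..<s])" unfolding span[OF distinct_upt]
      by (intro CollectI exI[of _ "\<lambda>j. lin d (l j) a"] conjI TrueI)
  qed
  moreover have "R.independent ?K (map (\<lambda>j. cls P (p j)) [0..<s])" by (rule ind) auto
  ultimately have "R.dimension (length (map (\<lambda>j. cls P (p j)) [0..<s])) ?K ?E" by (intro R.dimensionI[OF K])
  then show ?thesis using R.dimI[OF K, of s ?E] unfolding HF_def over_def by simp
qed

end

section \<open>The space of birational maps of clear degree\<close>

theorem theorem3p10:
  fixes P :: "('v::finite, 'k::field) mpoly set" and n d :: nat
  assumes "infinite (UNIV :: 'k set)"
    and "card (UNIV :: 'v set) = n + 1"
    and "d > 0"
    and "projective_variety P"
    and "in_no_hyperplane P"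
  shows "(locally_closed_in (zariski (W_index d)) (Hd P d) \<and>
          locally_closed_in (zariski (W_index d)) (Hd_clear P d)) \<and>
         (\<forall>l. defining_forms P d l \<longrightarrow>
            (constructible_in (zariski (D_index P d)) (D' P d l ` Hd_clear P d) \<and>
             (\<exists>\<Phi>. bij_betw \<Phi> (D' P d l ` Hd_clear P d) (Bir P d) \<and>
                  (\<forall>w\<in>Hd_clear P d. \<Phi> (D' P d l w) = psi P d w))) \<and>
            edim (D_index P d) (D' P d l ` Hd_clear P d) \<le> enat ((n + 1) * HF P d - 1))"
proof -
  interpret hprime P by (rule projective_variety_hprime[OF assms(4)])
  note k = assms(1) and d = assms(3)
  have "constructible_in (zariski (D_index P d)) (D' P d l ` Hd_clear P d) \<and>
      (\<exists>\<Phi>. bij_betw \<Phi> (D' P d l ` Hd_clear P d) (Bir P d) \<and> (\<forall>w\<in>Hd_clear P d. \<Phi> (D' P d l w) = psi P d w)) \<and>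
      edim (D_index P d) (D' P d l ` Hd_clear P d) \<le> enat ((n + 1) * HF P d - 1)"
    if l: "defining_forms P d l" for l
  proof (intro conjI)
    interpret linear_system P d l by unfold_locales (rule l)
    show "constructible_in (zariski (D_index P d)) (D' P d l ` Hd_clear P d)" by (rule constructible_image[OF k d])
    show "\<exists>\<Phi>. bij_betw \<Phi> (D' P d l ` Hd_clear P d) (Bir P d) \<and> (\<forall>w\<in>Hd_clear P d. \<Phi> (D' P d l w) = psi P d w)"
      using induced_bijection[of "Hd_clear P d" "D' P d l" "psi P d", OF D'_eq_iff[OF k d]] unfolding psi_image .
    show "edim (D_index P d) (D' P d l ` Hd_clear P d) \<le> enat ((n + 1) * HF P d - 1)"
    proof (rule edim_le)
      show "finite (D_index P d :: ('v \<times> nat) set)" by (simp add: D_index_def)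
      show "card (D_index P d :: ('v \<times> nat) set) = Suc ((n + 1) * HF P d - 1)"
        using s_pos by (simp add: D_index_def card_cartesian_product assms(2) HF_eq)
    qed
  qed
  then show ?thesis using locally_closed_Hd[OF d] locally_closed_Hd_clear[OF k d] by blast
qed

end
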